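(* Let $n\ge 1$, let $\varphi:\mathbb{C}^n\to\mathbb{R}^+$ be a plurisubharmonic $\mathcal{C}^2$ weight function with Levi matrix $M_\varphi=\left(\frac{\partial^2\varphi}{\partial z_j\partial\overline z_k}\right)_{jk}$, and let $1\le q\le n$. For $z\in\mathbb{C}^n$ let $s_q(z)$ denote the sum of the $q$ smallest eigenvalues (counted with multiplicity) of the Hermitian matrix $M_\varphi(z)$. Suppose that $$\lim_{|z|\to\infty}s_q(z)=\infty.$$ Then the weighted $\overline\partial$-Neumann operator $$N_{\varphi,q}:L^2_{(0,q)}(\mathbb{C}^n,\varphi)\longrightarrow L^2_{(0,q)}(\mathbb{C}^n,\varphi)$$ is compact.
   Context: $L^2(\mathbb{C}^n,\varphi)$ is the space of measurable $f:\mathbb{C}^n\to\mathbb{C}$ with $\int_{\mathbb{C}^n}|f|^2e^{-\varphi}\,d\lambda<\infty$ ($\lambda$ is Lebesgue measure), with inner product $(f,g)_\varphi=\int_{\mathbb{C}^n}f\,\overline g\,e^{-\varphi}\,d\lambda$ and norm $\|f\|_\varphi$. $L^2_{(0,q)}(\mathbb{C}^n,\varphi)$ is the space of $(0,q)$-forms $u=\sum'_{|J|=q}u_J\,d\overline z_J$ with coefficients $u_J\in L^2(\mathbb{C}^n,\varphi)$, with the inner product obtained by summing over the coefficients; the prime means summation over strictly increasing multi-indices. The weighted $\overline\partial$-complex is formed by the operators $\overline\partial:L^2_{(0,q)}(\mathbb{C}^n,\varphi)\to L^2_{(0,q+1)}(\mathbb{C}^n,\varphi)$, given on forms with $\mathcal{C}_0^\infty$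 coefficients by $\overline\partial u=\sum'_{|J|=q}\sum_{j=1}^n\frac{\partial u_J}{\partial\overline z_j}\,d\overline z_j\wedge d\overline z_J$ and in general taken in the sense of distributions on the domain of those $u\in L^2_{(0,q)}(\mathbb{C}^n,\varphi)$ with $\overline\partial u\in L^2_{(0,q+1)}(\mathbb{C}^n,\varphi)$, and by their Hilbert space adjoints $\overline\partial_\varphi^*$ with respect to $(\cdot,\cdot)_\varphi$. On forms with $\mathcal{C}_0^\infty$ coefficients, $\overline\partial_\varphi^*u=-\sum'_{|K|=q-1}\sum_{k=1}^n\delta_k u_{kK}\,d\overline z_K$ with $\delta_k=\frac{\partial}{\partial z_k}-\frac{\partial\varphi}{\partial z_k}$, where $u_{kK}$ is extended antisymmetrically in its indices. The complex Laplacian on $(0,q)$-forms is $\square_\varphi=\overline\partial\,\overline\partial_\varphi^*+\overline\partial_\varphi^*\,\overline\partial$, understood as the maximal closure of the operator initially defined on forms with $\mathcal{C}_0^\infty$ coefficients. It is a positive selfadjoint operator on $L^2_{(0,q)}(\mathbb{C}^n,\varphi)$ whose associated Dirichlet form is $Q_\varphi(f,g)=(\overline\partial f,\overline\partial g)_\varphi+(\overline\partial_\varphi^*f,\overline\partial_\varphi^*g)_\varphi$ for $f,g\in\mathrm{dom}(\overline\partial)\cap\mathrm{dom}(\overline\partial_\varphi^* )$. The weighted $\overline\partial$-Neumann operator $N_{\varphi,q}$ is, if it exists, the bounded inverse of $\square_\varphi$ on $(0,q)$-forms, i.e. the uniquely determined bounded linear operator on $L^2_{(0,q)}(\mathbb{C}^n,\varphi)$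 with $\square_\varphi\circ N_{\varphi,q}\,u=u$ for every $u\in L^2_{(0,q)}(\mathbb{C}^n,\varphi)$. It exists whenever $\liminf_{|z|\to\infty}s_q(z)>0$, in particular under the hypothesis of the claim. *)

theory Defs
  imports
    "HOL-Analysis.Analysis"
    "HOL-Computational_Algebra.Polynomial"
    "HOL-Library.Multiset"
begin

section \<open>Differentiability classes and Wirtinger derivatives\<close>

text \<open>\<open>C_k k f\<close>: the function \<open>f\<close> is of class \<open>C\<^sup>k\<close> in the real sense, i.e. all iterated partial
  derivatives along the real basis vectors up to order \<open>k\<close> exist and are continuous.\<close>

primrec C_k :: "nat \<Rightarrow> ('a::euclidean_space \<Rightarrow> 'b::real_normed_vector) \<Rightarrow> bool" where
  "C_k 0 f \<longleftrightarrow> continuous_on UNIV f"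
| "C_k (Suc k) f \<longleftrightarrow> (\<forall>x. f differentiable at x) \<and>
     (\<forall>b\<in>Basis. C_k k (\<lambda>x. frechet_derivative f (at x) b))"

definition test_function :: "('a::euclidean_space \<Rightarrow> complex) \<Rightarrow> bool" where
  "test_function \<eta> \<longleftrightarrow> (\<forall>k. C_k k \<eta>) \<and> compact (closure {x. \<eta> x \<noteq> 0})"

definition d_z :: "'n::finite \<Rightarrow> (complex ^ 'n \<Rightarrow> complex) \<Rightarrow> complex ^ 'n \<Rightarrow> complex" where
  "d_z j f z = (frechet_derivative f (at z) (axis j 1)
                 - \<i> * frechet_derivative f (at z) (axis j \<i>)) / 2"

definition d_zbar :: "'n::finite \<Rightarrow> (complex ^ 'n \<Rightarrow> complex) \<Rightarrow> complex ^ 'n \<Rightarrow> complex" where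
  "d_zbar j f z = (frechet_derivative f (at z) (axis j 1)
                    + \<i> * frechet_derivative f (at z) (axis j \<i>)) / 2"


section \<open>Plurisubharmonicity, Levi matrix, and sums of eigenvalues\<close>

text \<open>Upper semicontinuity together with the submean value property on all circles in all complex
  lines. For a real-valued function this property forces integrability over these
  circles; it is required explicitly because a divergent Bochner integral is \<open>0\<close> by convention.\<close>

definition plurisubharmonic :: "(complex ^ 'n::finite \<Rightarrow> real) \<Rightarrow> bool" where
  "plurisubharmonic \<phi> \<longleftrightarrow>
     (\<forall>z c. \<phi> z < c \<longrightarrow> (\<forall>\<^sub>F w in nhds z. \<phi> w < c)) \<and>
     (\<forall>z w. set_integrable lborel {0..2 * pi} (\<lambda>t. \<phi> (z + cis t *s w)) \<and>
            \<phi> z \<le> (LINT t:{0..2 * pi}|lborel. \<phi> (z + cis t *s w)) / (2 * pi))"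

definition levi_matrix :: "(complex ^ 'n::finite \<Rightarrow> real) \<Rightarrow> complex ^ 'n \<Rightarrow> complex ^ 'n ^ 'n" where
  "levi_matrix \<phi> z = (\<chi> j k. d_z j (d_zbar k (\<lambda>w. complex_of_real (\<phi> w))) z)"

definition charpoly :: "complex ^ 'n ^ 'n::finite \<Rightarrow> complex poly" where
  "charpoly A = det (\<chi> i j. (if i = j then [:0, 1:] else 0) - [:A $ i $ j:])"

text \<open>The sum of the \<open>q\<close> smallest eigenvalues with multiplicity. This is meant for Hermitian
  matrices only, for which taking real parts loses nothing.\<close>

definition sum_smallest_eigenvalues :: "nat \<Rightarrow> complex ^ 'n ^ 'n::finite \<Rightarrow> real" where
  "sum_smallest_eigenvalues q A =
     sum_list (take q (sorted_list_of_multiset (image_mset Re (proots (charpoly A)))))"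


section \<open>Weighted spaces of \<open>(0,q)\<close>-forms\<close>

text \<open>Functions are Borel representatives; elements of the Hilbert spaces are such representatives
  modulo equality almost everywhere.\<close>

definition L2 :: "(complex ^ 'n::finite \<Rightarrow> real) \<Rightarrow> (complex ^ 'n \<Rightarrow> complex) set" where
  "L2 \<phi> = {f \<in> borel_measurable lborel.
             integrable lborel (\<lambda>z. (cmod (f z))\<^sup>2 * exp (- \<phi> z))}"

definition inner_L2 ::
  "(complex ^ 'n::finite \<Rightarrow> real) \<Rightarrow> (complex ^ 'n \<Rightarrow> complex) \<Rightarrow> (complex ^ 'n \<Rightarrow> complex) \<Rightarrow> complex"
  where
  "inner_L2 \<phi> f g = (LINT z|lborel. f z * cnj (g z) * complex_of_real (exp (- \<phi> z)))"

text \<open>A strictly increasing multi-index is identified with the set of its entries. A \<open>(0,q)\<close>-form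
  \<open>u\<close> is its family of coefficients \<open>u J\<close>; the values at sets \<open>J\<close> of cardinality other than \<open>q\<close>
  are ignored throughout.\<close>

type_synonym 'n form = "'n set \<Rightarrow> (complex, 'n) vec \<Rightarrow> complex"

definition multi_indices :: "nat \<Rightarrow> 'n::finite set set" where
  "multi_indices q = {J. card J = q}"

definition L2_forms :: "(complex ^ 'n::finite \<Rightarrow> real) \<Rightarrow> nat \<Rightarrow> 'n form set" where
  "L2_forms \<phi> q = {u. \<forall>J\<in>multi_indices q. u J \<in> L2 \<phi>}"

definition inner_forms ::
  "(complex ^ 'n::finite \<Rightarrow> real) \<Rightarrow> nat \<Rightarrow> 'n form \<Rightarrow> 'n form \<Rightarrow> complex" where
  "inner_forms \<phi> q u v = (\<Sum>J\<in>multi_indices q. inner_L2 \<phi> (u J) (v J))"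

definition norm_forms :: "(complex ^ 'n::finite \<Rightarrow> real) \<Rightarrow> nat \<Rightarrow> 'n form \<Rightarrow> real" where
  "norm_forms \<phi> q u = sqrt (Re (inner_forms \<phi> q u u))"

definition forms_eq :: "nat \<Rightarrow> 'n::finite form \<Rightarrow> 'n form \<Rightarrow> bool" where
  "forms_eq q u v \<longleftrightarrow> (\<forall>J\<in>multi_indices q. AE z in lborel. u J z = v J z)"


section \<open>The weighted \<open>\<partial>\<close>-bar complex\<close>

text \<open>For \<open>j \<notin> J\<close>, the form \<open>d(cnj z\<^sub>j) \<and> d(cnj z\<^sub>J)\<close> equals \<open>wedge_sign j J\<close> times the basis form with
  index set \<open>insert j J\<close>.\<close>

definition wedge_sign :: "'n::{finite,linorder} \<Rightarrow> 'n set \<Rightarrow> complex" where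
  "wedge_sign j J = (-1) ^ card {i \<in> J. i < j}"

text \<open>The operators are unbounded and are described by their graphs. In \<open>has_dbar \<phi> q u v\<close> the form
  \<open>u\<close> has degree \<open>q\<close> and \<open>v\<close> is its \<open>\<partial>\<close>-bar in the sense of distributions: the coefficient of
  \<open>\<partial>\<close>-bar \<open>u\<close> at \<open>K\<close> is the sum over \<open>j \<in> K\<close> of \<open>wedge_sign j (K - {j})\<close> times the distributional
  derivative of \<open>u (K - {j})\<close> with respect to the conjugate of \<open>z\<^sub>j\<close>.\<close>

definition has_dbar ::
  "(complex ^ 'n::{finite,linorder} \<Rightarrow> real) \<Rightarrow> nat \<Rightarrow> 'n form \<Rightarrow> 'n form \<Rightarrow> bool" where
  "has_dbar \<phi> q u v \<longleftrightarrow> u \<in> L2_forms \<phi> q \<and> v \<in> L2_forms \<phi> (q + 1) \<and>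
     (\<forall>K\<in>multi_indices (q + 1). \<forall>\<eta>. test_function \<eta> \<longrightarrow>
        (LINT z|lborel. v K z * \<eta> z) =
        (\<Sum>j\<in>K. wedge_sign j (K - {j}) * - (LINT z|lborel. u (K - {j}) z * d_zbar j \<eta> z)))"

text \<open>The graph of the Hilbert space adjoint of \<open>\<partial>\<close>-bar on \<open>(0,q)\<close>-forms: here \<open>v\<close> has degree
  \<open>q + 1\<close> and \<open>w\<close> has degree \<open>q\<close>.\<close>

definition has_dbar_adjoint ::
  "(complex ^ 'n::{finite,linorder} \<Rightarrow> real) \<Rightarrow> nat \<Rightarrow> 'n form \<Rightarrow> 'n form \<Rightarrow> bool" where
  "has_dbar_adjoint \<phi> q v w \<longleftrightarrow> v \<in> L2_forms \<phi> (q + 1) \<and> w \<in> L2_forms \<phi> q \<and>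
     (\<forall>u u'. has_dbar \<phi> q u u' \<longrightarrow> inner_forms \<phi> (q + 1) u' v = inner_forms \<phi> q u w)"

text \<open>The graph of the complex Laplacian on \<open>(0,q)\<close>-forms, \<open>q \<ge> 1\<close>, on the natural domain of the
  composed operators; this is the selfadjoint operator associated with the Dirichlet form on
  the intersection of the domains of \<open>\<partial>\<close>-bar and of its adjoint, and is what is meant by the maximal
  closure of the operator on forms with test function coefficients.\<close>

definition has_box ::
  "(complex ^ 'n::{finite,linorder} \<Rightarrow> real) \<Rightarrow> nat \<Rightarrow> 'n form \<Rightarrow> 'n form \<Rightarrow> bool" where
  "has_box \<phi> q u f \<longleftrightarrow> f \<in> L2_forms \<phi> q \<and>
     (\<exists>a b c d. has_dbar_adjoint \<phi> (q - 1) u a \<and> has_dbar \<phi> (q - 1) a b \<and>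
                has_dbar \<phi> q u c \<and> has_dbar_adjoint \<phi> q c d \<and>
                forms_eq q f (\<lambda>J z. b J z + d J z))"


section \<open>Bounded and compact operators, and the \<open>\<partial>\<close>-bar-Neumann operator\<close>

definition bounded_operator ::
  "(complex ^ 'n::finite \<Rightarrow> real) \<Rightarrow> nat \<Rightarrow> ('n form \<Rightarrow> 'n form) \<Rightarrow> bool" where
  "bounded_operator \<phi> q T \<longleftrightarrow>
     (\<forall>u\<in>L2_forms \<phi> q. T u \<in> L2_forms \<phi> q) \<and>
     (\<forall>u\<in>L2_forms \<phi> q. \<forall>v\<in>L2_forms \<phi> q.
        forms_eq q (T (\<lambda>J z. u J z + v J z)) (\<lambda>J z. T u J z + T v J z)) \<and>
     (\<forall>u\<in>L2_forms \<phi> q. \<forall>c. forms_eq q (T (\<lambda>J z. c * u J z)) (\<lambda>J z. c * T u J z)) \<and>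
     (\<exists>C. \<forall>u\<in>L2_forms \<phi> q. norm_forms \<phi> q (T u) \<le> C * norm_forms \<phi> q u)"

definition compact_operator ::
  "(complex ^ 'n::finite \<Rightarrow> real) \<Rightarrow> nat \<Rightarrow> ('n form \<Rightarrow> 'n form) \<Rightarrow> bool" where
  "compact_operator \<phi> q T \<longleftrightarrow> bounded_operator \<phi> q T \<and>
     (\<forall>u :: nat \<Rightarrow> 'n form.
        (\<forall>k. u k \<in> L2_forms \<phi> q) \<and> (\<exists>C. \<forall>k. norm_forms \<phi> q (u k) \<le> C) \<longrightarrow>
        (\<exists>r w. strict_mono r \<and> w \<in> L2_forms \<phi> q \<and>
           (\<lambda>k. norm_forms \<phi> q (\<lambda>J z. T (u (r k)) J z - w J z)) \<longlonglongrightarrow> 0))"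

text \<open>This determines the operator up to equality almost everywhere of its values.\<close>

definition dbar_neumann_operator ::
  "(complex ^ 'n::{finite,linorder} \<Rightarrow> real) \<Rightarrow> nat \<Rightarrow> ('n form \<Rightarrow> 'n form) \<Rightarrow> bool" where
  "dbar_neumann_operator \<phi> q N \<longleftrightarrow> bounded_operator \<phi> q N \<and>
     (\<forall>u\<in>L2_forms \<phi> q. has_box \<phi> q (N u) u)"

end

theory Submission
  imports Defs "HOL-Complex_Analysis.Great_Picard" "HOL-Library.Diagonal_Subsequence"
begin

text \<open>Write \<open>u\<close> for a \<open>(0,q)\<close>-form, \<open>|.|\<close> for the weighted norms and \<open>Q(u) = |\<partial>-bar u|\<^sup>2 + |\<partial>-bar* u|\<^sup>2\<close> for the
Dirichlet form. A solution \<open>u = N f\<close> of the Neumann problem satisfies \<open>Q(u) = Re (u, f)\<close>, so \<open>N\<close>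
maps bounded sets to sets that are bounded for \<open>|u|\<^sup>2 + Q(u)\<close>. Compactness of \<open>N\<close> therefore follows
from compactness of the embedding of the form domain into the space of square-integrable forms
(\<open>compact_embedding\<close>), and existence of \<open>N\<close> follows from the coercivity estimate \<open>|u|\<^sup>2 \<le> C Q(u)\<close>
(\<open>coercive\<close>) and Riesz representation.

Both estimates rest on the identity of Kohn, Morrey and Hoermander (\<open>kohn_morrey_hoermander\<close>),
which says for test forms that \<open>Q(u)\<close> is the sum of all \<open>|\<partial>u\<^sub>J/\<partial>(cnj z\<^sub>j)|\<^sup>2\<close> plus the integral of the
Levi matrix evaluated on the coefficients of \<open>u\<close>. The integrand of the second term is at least
\<open>s\<^sub>q |u|\<^sup>2\<close> pointwise (\<open>levi_form_lower_bound\<close>): diagonalise the Levi matrix; the contractions of \<open>u\<close>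
with an orthonormal eigenbasis have squared norms which lie between \<open>0\<close> and \<open>|u|\<^sup>2\<close> and add up to
\<open>q |u|\<^sup>2\<close>, and a weighted sum of the eigenvalues with such weights is smallest when the weight sits
on the \<open>q\<close> smallest ones. As \<open>s\<^sub>q\<close> tends to infinity, a bound for \<open>Q(u)\<close> makes the mass of \<open>u\<close> outside
large balls uniformly small (\<open>tail_small\<close>).

Inside a ball the weight is comparable to a constant. There the first term of the identity controls
all first derivatives, because for compactly supported functions the derivatives with respect to
\<open>z\<^sub>j\<close> and to its conjugate have equal unweighted norms (\<open>nn2_d_z_eq\<close>). Coercivity then is a Poincare
inequality (translate a compactly supported function off its support), and compactness is Rellich's
theorem (\<open>rellich\<close>), proved by mollification and the theorem of Arzela and Ascoli.

The estimates pass from test forms to the maximal domains since test forms are dense for the graph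
norm of the pair \<open>\<partial>-bar\<close>, \<open>\<partial>-bar*\<close> (\<open>test_forms_dense\<close>); this is Friedrichs' argument, with cutoffs
of vanishing gradient followed by mollification. Riesz representation on the graph yields a weak
solution; splitting \<open>f\<close> along the kernel of \<open>\<partial>-bar\<close> shows that it lies in the domain of the
Laplacian (\<open>weak_solution_has_box\<close>).\<close>

section \<open>Directional derivatives and differentiability classes\<close>

definition dd :: "'a \<Rightarrow> ('a::euclidean_space \<Rightarrow> 'b::real_normed_vector) \<Rightarrow> 'a \<Rightarrow> 'b" where
  "dd b f x = frechet_derivative f (at x) b"

lemma dd_eqI: "(f has_derivative f') (at x) \<Longrightarrow> dd b f x = f' b"
  unfolding dd_def using frechet_derivative_at by metis

lemma has_derivative_dd: "f differentiable at x \<Longrightarrow> (f has_derivative (\<lambda>b. dd b f x)) (at x)"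
  unfolding dd_def using frechet_derivative_works by metis

lemma dd_linear: "f differentiable at x \<Longrightarrow> linear (\<lambda>b. dd b f x)"
  using has_derivative_dd has_derivative_linear by blast

lemma C_k_Suc: "C_k (Suc k) f \<longleftrightarrow> (\<forall>x. f differentiable at x) \<and> (\<forall>b\<in>Basis. C_k k (dd b f))"
  by (simp add: dd_def[abs_def])

declare C_k.simps(2)[simp del]

lemma C_k_differentiable: "C_k (Suc k) f \<Longrightarrow> f differentiable at x"
  by (simp add: C_k_Suc)

lemma C_k_SucD: "C_k (Suc k) f \<Longrightarrow> C_k k f"
proof (induction k arbitrary: f)
  case 0
  then show ?case
    by (simp add: C_k_Suc continuous_on_eq_continuous_at differentiable_imp_continuous_within)
next
  case (Suc k)
  then show ?case by (simp add: C_k_Suc)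
qed

lemma C_k_le: "C_k k f \<Longrightarrow> j \<le> k \<Longrightarrow> C_k j f"
  by (induction k) (auto simp: le_Suc_eq dest: C_k_SucD)

lemma C_k_continuous: "C_k k f \<Longrightarrow> continuous_on UNIV f"
  using C_k_le[of k f 0] by simp

lemma dd_const [simp]: "dd b (\<lambda>x. c) = (\<lambda>x. 0)"
  by (auto intro!: ext dd_eqI[of _ "\<lambda>_. 0"] derivative_eq_intros)

lemma C_k_const [simp]: "C_k k (\<lambda>x. c)"
  by (induction k arbitrary: c) (auto simp: C_k_Suc)

lemma dd_add: "f differentiable at x \<Longrightarrow> g differentiable at x \<Longrightarrow>
    dd b (\<lambda>x. f x + g x) x = dd b f x + dd b g x"
  by (rule dd_eqI) (intro has_derivative_add has_derivative_dd)

lemma C_k_add: "C_k k f \<Longrightarrow> C_k k g \<Longrightarrow> C_k k (\<lambda>x. f x + g x)"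
proof (induction k arbitrary: f g)
  case 0 then show ?case by (simp add: continuous_on_add)
next
  case (Suc k)
  then have "dd b (\<lambda>x. f x + g x) = (\<lambda>x. dd b f x + dd b g x)" for b
    by (auto simp: C_k_Suc dd_add)
  with Suc show ?case by (auto simp: C_k_Suc)
qed

lemma dd_bilinear:
  assumes "bounded_bilinear h" "f differentiable at x" "g differentiable at x"
  shows "dd b (\<lambda>x. h (f x) (g x)) x = h (f x) (dd b g x) + h (dd b f x) (g x)"
  by (rule dd_eqI) (intro bounded_bilinear.FDERIV[OF assms(1)] has_derivative_dd assms)

lemma C_k_bilinear:
  assumes h: "bounded_bilinear h"
  shows "C_k k f \<Longrightarrow> C_k k g \<Longrightarrow> C_k k (\<lambda>x. h (f x) (g x))"
proof (induction k arbitrary: f g)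
  case 0 then show ?case by (simp add: bounded_bilinear.continuous_on[OF h])
next
  case (Suc k)
  then have e: "dd b (\<lambda>x. h (f x) (g x)) = (\<lambda>x. h (f x) (dd b g x) + h (dd b f x) (g x))" for b
    by (auto simp: C_k_Suc dd_bilinear[OF h])
  have "(\<lambda>x. h (f x) (g x)) differentiable at x" for x
    using bounded_bilinear.FDERIV[OF h has_derivative_dd has_derivative_dd, of f x g]
      Suc.prems by (auto simp: C_k_Suc differentiable_def)
  moreover have "C_k k (\<lambda>x. h (f x) (dd b g x) + h (dd b f x) (g x))" if "b \<in> Basis" for b
    using Suc.prems that by (intro C_k_add Suc.IH C_k_SucD[of k f] C_k_SucD[of k g]) (auto simp: C_k_Suc)
  ultimately show ?case by (simp add: C_k_Suc e)
qed

lemma dd_bounded_linear: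
  assumes "bounded_linear h" "f differentiable at x"
  shows "dd b (\<lambda>x. h (f x)) x = h (dd b f x)"
  by (rule dd_eqI) (intro bounded_linear.has_derivative[OF assms(1)] has_derivative_dd assms)

lemma C_k_bounded_linear:
  assumes h: "bounded_linear h"
  shows "C_k k f \<Longrightarrow> C_k k (\<lambda>x. h (f x))"
proof (induction k arbitrary: f)
  case 0 then show ?case by (simp add: bounded_linear.continuous_on[OF h])
next
  case (Suc k)
  then have e: "dd b (\<lambda>x. h (f x)) = (\<lambda>x. h (dd b f x))" for b
    by (auto simp: C_k_Suc dd_bounded_linear[OF h])
  have "(\<lambda>x. h (f x)) differentiable at x" for x
    using bounded_linear.has_derivative[OF h has_derivative_dd, of f x]
      Suc.prems by (auto simp: C_k_Suc differentiable_def)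
  with Suc show ?case by (simp add: C_k_Suc e)
qed

lemma C_k_mult: "C_k k f \<Longrightarrow> C_k k g \<Longrightarrow> C_k k (\<lambda>x. f x * g x :: 'b::real_normed_algebra)"
  by (rule C_k_bilinear[OF bounded_bilinear_mult])

lemma dd_mult: "f differentiable at x \<Longrightarrow> g differentiable at x \<Longrightarrow>
    dd b (\<lambda>x. f x * g x :: 'b::real_normed_algebra) x = f x * dd b g x + dd b f x * g x"
  by (rule dd_bilinear[OF bounded_bilinear_mult])

lemma C_k_sum: "(\<And>i. i \<in> I \<Longrightarrow> C_k k (f i)) \<Longrightarrow> C_k k (\<lambda>x. \<Sum>i\<in>I. f i x)"
  by (induction I rule: infinite_finite_induct) (auto intro: C_k_add)

lemma C_k_uminus: "C_k k f \<Longrightarrow> C_k k (\<lambda>x. - f x)"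
  using C_k_bounded_linear[OF bounded_linear_minus[OF bounded_linear_ident]] by auto

lemma C_k_diff: "C_k k f \<Longrightarrow> C_k k g \<Longrightarrow> C_k k (\<lambda>x. f x - g x)"
  using C_k_add[of k f "\<lambda>x. - g x"] C_k_uminus[of k g] by simp

lemma C_k_of_real: "C_k k f \<Longrightarrow> C_k k (\<lambda>x. complex_of_real (f x))"
  by (rule C_k_bounded_linear[OF bounded_linear_of_real])

lemma C_k_cnj: "C_k k f \<Longrightarrow> C_k k (\<lambda>x. cnj (f x))"
  by (rule C_k_bounded_linear[OF bounded_linear_cnj])

lemma dd_cnj: "f differentiable at x \<Longrightarrow> dd b (\<lambda>x. cnj (f x)) x = cnj (dd b f x)"
  by (rule dd_bounded_linear[OF bounded_linear_cnj])

lemma dd_of_real: "f differentiable at x \<Longrightarrow> dd b (\<lambda>x. complex_of_real (f x)) x = of_real (dd b f x)"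
  by (rule dd_bounded_linear[OF bounded_linear_of_real])

lemma dd_cmult: "f differentiable at x \<Longrightarrow> dd b (\<lambda>x. c * f x :: 'b::real_normed_algebra) x = c * dd b f x"
  by (rule dd_bounded_linear[OF bounded_linear_mult_right])

lemma dd_uminus: "f differentiable at x \<Longrightarrow> dd b (\<lambda>x. - f x) x = - dd b f x"
  by (rule dd_bounded_linear[OF bounded_linear_minus[OF bounded_linear_ident]])

lemma has_derivative_affine_comp:
  assumes "f differentiable at (c *\<^sub>R x + a)"
  shows "((\<lambda>x. f (c *\<^sub>R x + a)) has_derivative (\<lambda>b. c *\<^sub>R dd b f (c *\<^sub>R x + a))) (at x)"
proof -
  have "((\<lambda>x. f (c *\<^sub>R x + a)) has_derivative (\<lambda>b. dd (c *\<^sub>R b) f (c *\<^sub>R x + a))) (at x)"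
    by (rule has_derivative_compose[of "\<lambda>x. c *\<^sub>R x + a", OF _ has_derivative_dd[OF assms]])
       (auto intro!: derivative_eq_intros)
  moreover have "dd (c *\<^sub>R b) f (c *\<^sub>R x + a) = c *\<^sub>R dd b f (c *\<^sub>R x + a)" for b
    using linear_scale[OF dd_linear[OF assms]] .
  ultimately show ?thesis by simp
qed

lemma dd_affine: "f differentiable at (c *\<^sub>R x + a) \<Longrightarrow>
  dd b (\<lambda>x. f (c *\<^sub>R x + a)) x = c *\<^sub>R dd b f (c *\<^sub>R x + a)"
  by (rule dd_eqI) (rule has_derivative_affine_comp)

lemma C_k_affine: "C_k k f \<Longrightarrow> C_k k (\<lambda>x. f (c *\<^sub>R x + a))"
proof (induction k arbitrary: f)
  case 0 then show ?case
    by (auto intro!: continuous_intros continuous_on_compose2[of UNIV f])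
next
  case (Suc k)
  then have e: "dd b (\<lambda>x. f (c *\<^sub>R x + a)) = (\<lambda>x. c *\<^sub>R dd b f (c *\<^sub>R x + a))" for b
    by (auto simp: C_k_Suc dd_affine)
  have "(\<lambda>x. f (c *\<^sub>R x + a)) differentiable at x" for x
    using has_derivative_affine_comp[of f c x a] Suc.prems by (auto simp: C_k_Suc differentiable_def)
  with Suc show ?case
    by (auto simp: C_k_Suc e intro!: C_k_bounded_linear[OF bounded_linear_scaleR_right])
qed

lemma dd_expand: "f differentiable at x \<Longrightarrow> dd v f x = (\<Sum>b\<in>Basis. (v \<bullet> b) *\<^sub>R dd b f x)"
  using linear_sum[OF dd_linear, of f x "\<lambda>b. (v \<bullet> b) *\<^sub>R b" Basis]
  by (simp add: euclidean_representation linear_scale[OF dd_linear])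

text \<open>The classes refer to basis directions only; linearity of the derivative extends them to all directions.\<close>
lemma C_k_dd: assumes "C_k (Suc k) f" shows "C_k k (dd v f)"
proof -
  have "dd v f = (\<lambda>x. \<Sum>b\<in>Basis. (v \<bullet> b) *\<^sub>R dd b f x)"
    using assms by (auto simp: C_k_Suc intro!: ext dd_expand)
  moreover have "C_k k (\<lambda>x. \<Sum>b\<in>Basis. (v \<bullet> b) *\<^sub>R dd b f x)"
    using assms by (intro C_k_sum C_k_bounded_linear[OF bounded_linear_scaleR_right]) (auto simp: C_k_Suc)
  ultimately show ?thesis by simp
qed

lemma has_derivative_exp_dd: "f differentiable at x \<Longrightarrow>
    ((\<lambda>x. exp (f x :: real)) has_derivative (\<lambda>b. exp (f x) * dd b f x)) (at x)"
  using has_derivative_dd[of f x] by (auto intro!: derivative_eq_intros)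

lemma dd_exp: "f differentiable at x \<Longrightarrow> dd b (\<lambda>x. exp (f x :: real)) x = exp (f x) * dd b f x"
  by (rule dd_eqI) (rule has_derivative_exp_dd)

lemma C_k_exp: "C_k k f \<Longrightarrow> C_k k (\<lambda>x. exp (f x :: real))"
proof (induction k)
  case 0 then show ?case by (auto intro: continuous_intros)
next
  case (Suc k)
  have d: "f differentiable at x" for x using Suc.prems by (rule C_k_differentiable)
  have "dd b (\<lambda>x. exp (f x)) = (\<lambda>x. exp (f x) * dd b f x)" for b
    by (intro ext dd_exp d)
  moreover have "C_k k (\<lambda>x. exp (f x) * dd b f x)" for b
    using Suc by (intro C_k_mult) (auto intro: C_k_dd C_k_SucD)
  ultimately show ?case using has_derivative_exp_dd[OF d] by (auto simp: C_k_Suc differentiable_def)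
qed

lemma has_vector_derivative_line:
  assumes "f differentiable at (x + t *\<^sub>R v)"
  shows "((\<lambda>t. f (x + t *\<^sub>R v)) has_vector_derivative dd v f (x + t *\<^sub>R v)) (at t)"
proof -
  have "((\<lambda>t. f (x + t *\<^sub>R v)) has_derivative (\<lambda>s. dd (s *\<^sub>R v) f (x + t *\<^sub>R v))) (at t)"
    by (rule has_derivative_compose[of "\<lambda>t. x + t *\<^sub>R v", OF _ has_derivative_dd[OF assms]])
       (auto intro!: derivative_eq_intros)
  moreover have "dd (s *\<^sub>R v) f (x + t *\<^sub>R v) = s *\<^sub>R dd v f (x + t *\<^sub>R v)" for s
    using linear_scale[OF dd_linear[OF assms]] .
  ultimately show ?thesis by (simp add: has_vector_derivative_def)
qed

text \<open>Schwarz's theorem. Two applications of the mean value theorem turn the second difference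
\<open>S a b h h\<close> into \<open>h\<^sup>2\<close> times a mixed derivative at a nearby point, in either order of differentiation,
since \<open>S\<close> is symmetric.\<close>
lemma dd_commute_real:
  fixes f :: "'a::euclidean_space \<Rightarrow> real"
  assumes f: "C_k 2 f"
  shows "dd a (dd b f) x = dd b (dd a f) x"
proof -
  have df: "f differentiable at y" for y using f by (simp add: numeral_2_eq_2 C_k_Suc)
  have C1: "C_k 1 (dd v f)" for v using f C_k_dd[of 1 f] by (simp add: numeral_2_eq_2)
  have ddf: "dd v f differentiable at y" for v y by (rule C_k_differentiable[of 0]) (use C1 in simp)
  have C0: "continuous_on UNIV (dd w (dd v f))" for v w using C_k_dd[of 0 "dd v f"] C1 by simp
  define S where "S a b s t = f (x + s *\<^sub>R a + t *\<^sub>R b) - f (x + s *\<^sub>R a) - f (x + t *\<^sub>R b) + f x" for a b s t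
  have sym: "S a b s t = S b a t s" for a b s t by (simp add: S_def algebra_simps)
  have mv: "\<exists>s t. 0 < s \<and> s < h \<and> 0 < t \<and> t < h \<and> S a b h h = h * h * dd b (dd a f) (x + s *\<^sub>R a + t *\<^sub>R b)"
    if h: "h > 0" for h a b
  proof -
    define F where "F s = f ((x + h *\<^sub>R b) + s *\<^sub>R a) - f (x + s *\<^sub>R a)" for s
    have Fd: "DERIV F s :> dd a f ((x + h *\<^sub>R b) + s *\<^sub>R a) - dd a f (x + s *\<^sub>R a)" for s
      unfolding F_def has_real_derivative_iff_has_vector_derivative
      by (intro derivative_intros has_vector_derivative_line df)
    obtain s where s: "0 < s" "s < h" "F h - F 0 = h * (dd a f ((x + h *\<^sub>R b) + s *\<^sub>R a) - dd a f (x + s *\<^sub>R a))"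
      using MVT2[OF h, of F "\<lambda>s. dd a f ((x + h *\<^sub>R b) + s *\<^sub>R a) - dd a f (x + s *\<^sub>R a)", OF Fd] unfolding diff_zero by blast
    define G where "G t = dd a f ((x + s *\<^sub>R a) + t *\<^sub>R b)" for t
    have Gd: "DERIV G t :> dd b (dd a f) ((x + s *\<^sub>R a) + t *\<^sub>R b)" for t
      unfolding G_def has_real_derivative_iff_has_vector_derivative
      by (intro derivative_intros has_vector_derivative_line ddf)
    obtain t where t: "0 < t" "t < h" "G h - G 0 = h * dd b (dd a f) ((x + s *\<^sub>R a) + t *\<^sub>R b)"
      using MVT2[OF h, of G "\<lambda>t. dd b (dd a f) ((x + s *\<^sub>R a) + t *\<^sub>R b)", OF Gd] unfolding diff_zero by blast
    have "S a b h h = F h - F 0" by (simp add: S_def F_def algebra_simps)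
    also have "\<dots> = h * (G h - G 0)" using s by (simp add: G_def algebra_simps)
    finally show ?thesis using s t by auto
  qed
  have lim: "(\<lambda>n. S a b (1/Suc n) (1/Suc n) * (real (Suc n))^2) \<longlonglongrightarrow> dd b (dd a f) x" for a b
  proof -
    have "\<forall>n. \<exists>s t. 0 < s \<and> s < 1/Suc n \<and> 0 < t \<and> t < 1/Suc n \<and> S a b (1/Suc n) (1/Suc n) * (real (Suc n))^2 = dd b (dd a f) (x + s *\<^sub>R a + t *\<^sub>R b)"
    proof
      fix n
      from mv[of "1/Suc n" a b] obtain s t where
       "0 < s" "s < 1/Suc n" "0 < t" "t < 1/Suc n" and e: "S a b (1/Suc n) (1/Suc n) = 1/Suc n * (1/Suc n) * dd b (dd a f) (x + s *\<^sub>R a + t *\<^sub>R b)"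
        by auto
      then show "\<exists>s t. 0 < s \<and> s < 1/Suc n \<and> 0 < t \<and> t < 1/Suc n \<and> S a b (1/Suc n) (1/Suc n) * (real (Suc n))^2 = dd b (dd a f) (x + s *\<^sub>R a + t *\<^sub>R b)"
        by (intro exI[of _ s] exI[of _ t]) (simp add: power2_eq_square del: of_nat_Suc)
    qed
    then obtain s t where st: "\<And>n. 0 < s n \<and> s n < 1/Suc n \<and> 0 < t n \<and> t n < 1/Suc n \<and> S a b (1/Suc n) (1/Suc n) * (real (Suc n))^2 = dd b (dd a f) (x + s n *\<^sub>R a + t n *\<^sub>R b)"
      by metis
    have s0: "s \<longlonglongrightarrow> 0" and t0: "t \<longlonglongrightarrow> 0"
      using st by (auto intro!: real_tendsto_sandwich[OF _ _ tendsto_const LIMSEQ_Suc[OF lim_1_over_n]] always_eventually less_imp_le)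
    have "(\<lambda>n. x + s n *\<^sub>R a + t n *\<^sub>R b) \<longlonglongrightarrow> x + 0 *\<^sub>R a + 0 *\<^sub>R b"
      by (intro tendsto_intros s0 t0)
    then have "(\<lambda>n. dd b (dd a f) (x + s n *\<^sub>R a + t n *\<^sub>R b)) \<longlonglongrightarrow> dd b (dd a f) x"
      using C0[of b a] continuous_on_tendsto_compose[of UNIV "dd b (dd a f)"] by fastforce
    then show ?thesis using st by simp
  qed
  show ?thesis using LIMSEQ_unique[OF lim[of b a]] lim[of a b] sym by simp
qed

lemma dd_commute:
  fixes f :: "'a::euclidean_space \<Rightarrow> complex"
  assumes f: "C_k 2 f"
  shows "dd a (dd b f) x = dd b (dd a f) x"
proof -
  have df: "f differentiable at y" for y using f by (simp add: numeral_2_eq_2 C_k_Suc)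
  have C1: "C_k 1 (dd v f)" for v using f C_k_dd[of 1 f] by (simp add: numeral_2_eq_2)
  have ddf: "dd v f differentiable at y" for v y by (rule C_k_differentiable[of 0]) (use C1 in simp)
  have r: "dd b (\<lambda>x. Re (f x)) = (\<lambda>x. Re (dd b f x))" "dd b (\<lambda>x. Im (f x)) = (\<lambda>x. Im (dd b f x))" for b
    by (auto intro!: ext dd_bounded_linear bounded_linear_Re bounded_linear_Im df)
  have r2: "dd a (\<lambda>x. Re (dd b f x)) x = Re (dd a (dd b f) x)"
     "dd a (\<lambda>x. Im (dd b f x)) x = Im (dd a (dd b f) x)" for a b
    by (auto intro!: ext dd_bounded_linear bounded_linear_Re bounded_linear_Im ddf)
  show ?thesis
    using dd_commute_real[of "\<lambda>x. Re (f x)" a b x] dd_commute_real[of "\<lambda>x. Im (f x)" a b x]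
    by (simp add: r r2 f C_k_bounded_linear[OF bounded_linear_Re] C_k_bounded_linear[OF bounded_linear_Im] complex_eq_iff)
qed

section \<open>A smooth bump function and test functions\<close>

text \<open>The functions \<open>exp (-1/t) t\<^sup>-\<^sup>m\<close>, extended by zero: this family is closed under differentiation up to
linear combinations, so that smoothness can be proved by induction.\<close>
definition bump_exp :: "nat \<Rightarrow> real \<Rightarrow> real" where
  "bump_exp m t = (if t > 0 then exp (- inverse t) * inverse t ^ m else 0)"

text \<open>The quadratic bound gives differentiability at the origin. It is a single term of the exponential
series for \<open>exp (1/t)\<close>.\<close>
lemma bump_exp_bound: "\<bar>bump_exp m t\<bar> \<le> fact (m + 2) * t\<^sup>2"
proof (cases "t > 0")
  case True
  define y where "y = inverse t"
  have y: "y > 0" using True by (simp add: y_def)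
  have "(\<Sum>n\<in>{m+2}. y ^ n /\<^sub>R fact n) \<le> (\<Sum>n. y ^ n /\<^sub>R fact n)"
    using y by (intro sum_le_suminf summable_exp_generic) auto
  then have "y ^ (m+2) / fact (m+2) \<le> exp y" by (simp add: exp_def field_simps del: fact_Suc)
  then have "y ^ (m+2) * exp (-y) \<le> fact (m+2)"
    by (simp add: field_simps exp_minus del: fact_Suc)
  then have "y ^ (m+2) * exp (-y) * t^2 \<le> fact (m+2) * t^2"
    by (intro mult_right_mono) auto
  moreover have "y ^ (m+2) * exp (-y) * t^2 = \<bar>bump_exp m t\<bar>"
  proof -
    have "y * t = 1" using True by (simp add: y_def)
    then have "y * (y * (t * t)) = 1" by (metis mult.assoc mult.left_commute mult_1)
    then have "y ^ (m+2) * exp (-y) * t^2 = y ^ m * exp (-y)" by (simp add: power_add power2_eq_square mult_ac)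
    then show ?thesis using True by (simp add: bump_exp_def y_def)
  qed
  ultimately show ?thesis by simp
qed (simp add: bump_exp_def)

lemma DERIV_bump_exp: "DERIV (bump_exp m) t :> - real m * bump_exp (m + 1) t + bump_exp (m + 2) t"
proof -
  consider "t < 0" | "t = 0" | "t > 0" by linarith
  then show ?thesis
  proof cases
    case 1
    have "DERIV (\<lambda>t::real. 0::real) t :> 0" by simp
    then have "DERIV (bump_exp m) t :> 0"
      by (rule has_field_derivative_transform_within_open[where S="{..<0}"]) (use 1 in \<open>auto simp: bump_exp_def\<close>)
    with 1 show ?thesis by (simp add: bump_exp_def)
  next
    case 3
    have "DERIV (\<lambda>t::real. exp (- inverse t) * inverse t ^ m) t :>
        exp (- inverse t) * (inverse t)^2 * inverse t ^ m + exp (- inverse t) * (real m * inverse t ^ (m - 1) * (- ((inverse t)^2)))"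
      using 3 by (auto intro!: derivative_eq_intros simp: power2_eq_square)
    moreover have "exp (- inverse t) * (inverse t)^2 * inverse t ^ m + exp (- inverse t) * (real m * inverse t ^ (m - 1) * (- ((inverse t)^2)))
       = - real m * bump_exp (m + 1) t + bump_exp (m + 2) t"
      using 3 by (cases m) (simp_all add: bump_exp_def algebra_simps power2_eq_square del: inverse_eq_divide)
    ultimately have "DERIV (\<lambda>t::real. exp (- inverse t) * inverse t ^ m) t :> - real m * bump_exp (m + 1) t + bump_exp (m + 2) t"
      by simp
    then show ?thesis
      by (rule has_field_derivative_transform_within_open[where S="{0<..}"]) (use 3 in \<open>auto simp: bump_exp_def\<close>)
  next
    case 2
    have "((\<lambda>h. (bump_exp m (0 + h) - bump_exp m 0) / h) \<longlongrightarrow> 0) (at 0)"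
    proof (rule Lim_null_comparison)
      show "\<forall>\<^sub>F h in at 0. norm ((bump_exp m (0 + h) - bump_exp m 0) / h) \<le> fact (m+2) * \<bar>h\<bar>"
      proof (intro always_eventually allI)
        fix h :: real
        show "norm ((bump_exp m (0 + h) - bump_exp m 0) / h) \<le> fact (m+2) * \<bar>h\<bar>"
        proof (cases "h = 0")
          case False
          have "\<bar>bump_exp m h\<bar> / \<bar>h\<bar> \<le> fact (m+2) * h\<^sup>2 / \<bar>h\<bar>"
            by (intro divide_right_mono bump_exp_bound) auto
          also have "\<dots> = fact (m+2) * \<bar>h\<bar>" using False by (simp add: power2_eq_square field_simps abs_if)
          finally show ?thesis by (simp add: bump_exp_def[of m 0])
        qed simp
      qed
      show "((\<lambda>h. fact (m+2) * \<bar>h\<bar>) \<longlongrightarrow> 0) (at (0::real))" by (auto intro!: tendsto_eq_intros)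
    qed
    then have "DERIV (bump_exp m) 0 :> 0" by (simp add: DERIV_def)
    then show ?thesis by (simp add: 2 bump_exp_def[of _ 0])
  qed
qed

text \<open>An algebra of functions that contains its own directional derivatives; all its members are smooth.\<close>
inductive_set bump_alg :: "('a::euclidean_space \<Rightarrow> real) set" where
  base: "(\<lambda>x. bump_exp m (1 - x \<bullet> x)) \<in> bump_alg"
| const: "(\<lambda>x. c) \<in> bump_alg"
| inner: "(\<lambda>x. x \<bullet> b) \<in> bump_alg"
| add: "f \<in> bump_alg \<Longrightarrow> g \<in> bump_alg \<Longrightarrow> (\<lambda>x. f x + g x) \<in> bump_alg"
| mult: "f \<in> bump_alg \<Longrightarrow> g \<in> bump_alg \<Longrightarrow> (\<lambda>x. f x * g x) \<in> bump_alg"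

lemma bump_alg_dd: "f \<in> bump_alg \<Longrightarrow> (\<forall>x. f differentiable at x) \<and> (\<forall>b. dd b f \<in> bump_alg)"
proof (induction rule: bump_alg.induct)
  case (base m)
  have d: "((\<lambda>x. bump_exp m (1 - x \<bullet> x)) has_derivative (\<lambda>b. (- real m * bump_exp (m + 1) (1 - x \<bullet> x) + bump_exp (m + 2) (1 - x \<bullet> x)) * ((-2) * (x \<bullet> b)))) (at x)" for x :: 'a
    by (rule has_derivative_compose[of "\<lambda>x. 1 - x \<bullet> x", OF _ DERIV_bump_exp[unfolded has_field_derivative_def]])
       (auto intro!: derivative_eq_intros simp: inner_commute)
  then have "dd b (\<lambda>x. bump_exp m (1 - x \<bullet> x)) = (\<lambda>x. ((- real m) * bump_exp (m + 1) (1 - x \<bullet> x) + bump_exp (m + 2) (1 - x \<bullet> x)) * ((-2) * (x \<bullet> b)))" for b :: 'a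
    by (auto intro!: ext dd_eqI)
  moreover have "(\<lambda>x. ((- real m) * bump_exp (m + 1) (1 - x \<bullet> x) + bump_exp (m + 2) (1 - x \<bullet> x)) * ((-2) * (x \<bullet> b))) \<in> bump_alg" for b :: 'a
    by (intro bump_alg.mult bump_alg.add bump_alg.base bump_alg.const bump_alg.inner)
  ultimately show ?case using d by (auto simp: differentiable_def)
next
  case (const c) then show ?case by (auto intro: bump_alg.const)
next
  case (inner b)
  have d: "((\<lambda>x. x \<bullet> b) has_derivative (\<lambda>c. c \<bullet> b)) (at x)" for x :: 'a
    by (auto intro!: derivative_eq_intros)
  then have "dd c (\<lambda>x. x \<bullet> b) = (\<lambda>x. c \<bullet> b)" for c :: 'a by (auto intro!: ext dd_eqI)
  with d show ?case by (auto simp: differentiable_def intro: bump_alg.const)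
next
  case (add f g)
  then have "dd b (\<lambda>x. f x + g x) = (\<lambda>x. dd b f x + dd b g x)" for b by (auto intro!: ext dd_add)
  with add show ?case by (auto intro: bump_alg.add)
next
  case (mult f g)
  then have "dd b (\<lambda>x. f x * g x) = (\<lambda>x. f x * dd b g x + dd b f x * g x)" for b
    by (auto intro!: ext dd_mult)
  with mult show ?case by (auto intro!: bump_alg.add bump_alg.mult)
qed

lemma bump_alg_C_k: "f \<in> bump_alg \<Longrightarrow> C_k k f"
proof (induction k arbitrary: f)
  case 0
  then show ?case using bump_alg_dd[of f]
    by (auto simp: continuous_on_eq_continuous_at intro: differentiable_imp_continuous_within)
next
  case (Suc k)
  then show ?case using bump_alg_dd[of f] by (auto simp: C_k_Suc)
qed

definition bump :: "'a::euclidean_space \<Rightarrow> real" where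
  "bump x = exp 1 * bump_exp 0 (1 - x \<bullet> x)"

lemma C_k_bump: "C_k k bump"
proof -
  have "(\<lambda>x::'a. exp 1 * bump_exp 0 (1 - x \<bullet> x)) \<in> bump_alg"
    by (intro bump_alg.mult bump_alg.base bump_alg.const)
  moreover have "(bump :: 'a \<Rightarrow> real) = (\<lambda>x. exp 1 * bump_exp 0 (1 - x \<bullet> x))"
    by (auto simp: bump_def)
  ultimately show ?thesis using bump_alg_C_k by metis
qed

lemma bump_0 [simp]: "bump 0 = 1" by (simp add: bump_def bump_exp_def exp_minus flip: exp_add)
lemma bump_nonneg: "0 \<le> bump x" by (simp add: bump_def bump_exp_def)
lemma bump_le_1: "bump x \<le> 1"
proof (cases "1 - x \<bullet> x > 0")
  case True
  then have "exp (1 + - inverse (1 - x \<bullet> x)) \<le> exp 0"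
    by (subst exp_le_cancel_iff) (simp add: one_le_inverse_iff)
  with True show ?thesis by (simp add: bump_def bump_exp_def flip: exp_add)
qed (simp add: bump_def bump_exp_def)
lemma bump_eq_0: "norm x \<ge> 1 \<Longrightarrow> bump x = 0"
proof -
  assume "norm x \<ge> 1"
  then have "x \<bullet> x \<ge> 1" by (simp add: dot_square_norm)
  then show ?thesis by (simp add: bump_def bump_exp_def)
qed

lemma test_function_iff: "test_function \<eta> \<longleftrightarrow> (\<forall>k. C_k k \<eta>) \<and> bounded {x. \<eta> x \<noteq> 0}"
  by (simp add: test_function_def)

lemma test_function_C_k: "test_function \<eta> \<Longrightarrow> C_k k \<eta>"
  by (simp add: test_function_iff)

lemma test_function_bounded: "test_function \<eta> \<Longrightarrow> bounded {x. \<eta> x \<noteq> 0}"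
  by (simp add: test_function_iff)

lemma bounded_nonzero_dd: assumes "bounded {x. f x \<noteq> 0}" shows "bounded {x. dd b f x \<noteq> 0}"
proof -
  have "compact (closure {x. f x \<noteq> 0})" using assms by simp
  have "dd b f x = 0" if "x \<notin> closure {x. f x \<noteq> 0}" for x
  proof (rule dd_eqI[of _ "\<lambda>_. 0"])
    have "((\<lambda>x. 0) has_derivative (\<lambda>_. 0)) (at x)" by simp
    then show "(f has_derivative (\<lambda>_. 0)) (at x)"
      by (rule has_derivative_transform_within_open[of _ _ _ _ "- closure {x. f x \<noteq> 0}"])
         (use that closure_subset[of "{x. f x \<noteq> 0}"] in auto)
  qed
  then have "{x. dd b f x \<noteq> 0} \<subseteq> closure {x. f x \<noteq> 0}" by blast
  with assms show ?thesis using bounded_closure bounded_subset by blast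
qed

lemma bounded_nonzero_multL: "bounded {x. f x \<noteq> 0} \<Longrightarrow> bounded {x. f x * (g x :: 'a::mult_zero) \<noteq> 0}"
  by (erule bounded_subset) auto
lemma bounded_nonzero_multR: "bounded {x. g x \<noteq> 0} \<Longrightarrow> bounded {x. f x * (g x :: 'a::mult_zero) \<noteq> 0}"
  by (erule bounded_subset) auto
lemma bounded_nonzero_add: "bounded {x. f x \<noteq> 0} \<Longrightarrow> bounded {x. g x \<noteq> 0} \<Longrightarrow> bounded {x. f x + (g x :: 'a::monoid_add) \<noteq> 0}"
  by (rule bounded_subset[of "{x. f x \<noteq> 0} \<union> {x. g x \<noteq> 0}"]) auto

lemma test_function_dd: assumes "test_function \<eta>" shows "test_function (dd b \<eta>)"
  using assms bounded_nonzero_dd[of \<eta> b] C_k_dd[of _ \<eta> b] by (simp add: test_function_iff)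

lemma test_function_add: "test_function f \<Longrightarrow> test_function g \<Longrightarrow> test_function (\<lambda>x. f x + g x)"
  using bounded_nonzero_add[of f g] by (simp add: test_function_iff C_k_add)

lemma test_function_mult: "test_function f \<Longrightarrow> test_function g \<Longrightarrow> test_function (\<lambda>x. f x * g x)"
  using bounded_nonzero_multL[of f g] by (simp add: test_function_iff C_k_mult)

lemma test_function_cmult: "test_function f \<Longrightarrow> test_function (\<lambda>x. c * f x)"
  using bounded_nonzero_multR[of f "\<lambda>_. c"] by (simp add: test_function_iff C_k_mult)

lemma bounded_nonzero_affine:
  fixes a :: "'a::real_normed_vector"
  assumes "bounded {x. f x \<noteq> 0}" "c \<noteq> 0"
  shows "bounded {x. f (c *\<^sub>R x + a) \<noteq> 0}"
proof -
  obtain R where R: "\<And>x. f x \<noteq> 0 \<Longrightarrow> norm x \<le> R"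
    using assms(1) by (auto simp: bounded_iff)
  have "norm x \<le> (R + norm a) / \<bar>c\<bar>" if "f (c *\<^sub>R x + a) \<noteq> 0" for x
  proof -
    have "norm (c *\<^sub>R x) \<le> norm (c *\<^sub>R x + a) + norm a"
      using norm_triangle_ineq4[of "c *\<^sub>R x + a" a] by simp
    also have "\<dots> \<le> R + norm a" using R[OF that] by simp
    finally show ?thesis using assms(2) by (simp add: field_simps)
  qed
  then show ?thesis by (auto simp: bounded_iff)
qed

lemma test_function_affine: "test_function f \<Longrightarrow> c \<noteq> 0 \<Longrightarrow> test_function (\<lambda>x. f (c *\<^sub>R x + a))"
  using bounded_nonzero_affine[of f c a] by (simp add: test_function_iff C_k_affine)

lemma test_function_bump: "test_function (\<lambda>x. complex_of_real (bump x))"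
proof -
  have "bounded {x::'a. bump x \<noteq> 0}"
    by (rule bounded_subset[of "ball 0 1"]) (simp, use bump_eq_0 in \<open>force simp: not_le[symmetric]\<close>)
  hence "bounded {x::'a. complex_of_real (bump x) \<noteq> 0}" by (auto elim: bounded_subset)
  then show ?thesis by (simp add: test_function_iff C_k_of_real C_k_bump)
qed

section \<open>Integration by parts and translations\<close>

lemma borel_measurable_C_k: "C_k k f \<Longrightarrow> f \<in> borel_measurable borel"
  by (intro borel_measurable_continuous_onI C_k_continuous)

lemma integrable_compact_support:
  fixes f :: "'a::euclidean_space \<Rightarrow> 'b::{banach, second_countable_topology}"
  assumes "continuous_on UNIV f" "bounded {x. f x \<noteq> 0}"
  shows "integrable lborel f"
proof -
  have "integrable lborel (\<lambda>x. indicator (closure {x. f x \<noteq> 0}) x *\<^sub>R f x)"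
    using assms by (intro borel_integrable_compact) (auto intro: continuous_on_subset)
  moreover have "indicator (closure {x. f x \<noteq> 0}) x *\<^sub>R f x = f x" for x
    using closure_subset[of "{x. f x \<noteq> 0}"] by (auto simp: indicator_def)
  ultimately show ?thesis by simp
qed

lemma lborel_distr_affine: fixes a :: "'a::euclidean_space"
  assumes "\<bar>c\<bar> = 1" shows "distr lborel borel (\<lambda>x. a + c *\<^sub>R x) = lborel"
  using lborel_affine[of c a] assms by (auto simp: density_1)

lemma nn_integral_affine:
  fixes a :: "'a::euclidean_space"
  assumes "f \<in> borel_measurable borel" "\<bar>c\<bar> = 1"
  shows "(\<integral>\<^sup>+x. f (a + c *\<^sub>R x) \<partial>lborel) = (\<integral>\<^sup>+x. f x \<partial>lborel)"
  using nn_integral_distr[of "\<lambda>x. a + c *\<^sub>R x" lborel borel f] assms lborel_distr_affine[of c a] by simp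

lemma nn_integral_shift:
  fixes a :: "'a::euclidean_space"
  assumes "f \<in> borel_measurable borel"
  shows "(\<integral>\<^sup>+x. f (x + a) \<partial>lborel) = (\<integral>\<^sup>+x. f x \<partial>lborel)"
  using nn_integral_affine[OF assms, of 1 a] by (simp add: add.commute)

lemma integral_affine:
  fixes a :: "'a::euclidean_space" and f :: "'a \<Rightarrow> 'b::{banach, second_countable_topology}"
  assumes "f \<in> borel_measurable borel" "\<bar>c\<bar> = 1"
  shows "(LINT x|lborel. f (a + c *\<^sub>R x)) = (LINT x|lborel. f x)"
  using integral_distr[of "\<lambda>x. a + c *\<^sub>R x" lborel borel f] assms lborel_distr_affine[of c a] by simp

lemma integrable_affine:
  fixes a :: "'a::euclidean_space" and f :: "'a \<Rightarrow> 'b::{banach, second_countable_topology}"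
  assumes "integrable lborel f" "\<bar>c\<bar> = 1"
  shows "integrable lborel (\<lambda>x. f (a + c *\<^sub>R x))"
  using integrable_distr[of "\<lambda>x. a + c *\<^sub>R x" lborel borel f] assms lborel_distr_affine[of c a] by simp

lemma integral_shift:
  fixes a :: "'a::euclidean_space" and f :: "'a \<Rightarrow> 'b::{banach, second_countable_topology}"
  assumes "f \<in> borel_measurable borel"
  shows "(LINT x|lborel. f (x + a)) = (LINT x|lborel. f x)"
  using integral_affine[OF assms, of 1 a] by (simp add: add.commute)

lemma integrable_shift:
  fixes a :: "'a::euclidean_space" and f :: "'a \<Rightarrow> 'b::{banach, second_countable_topology}"
  assumes "integrable lborel f" shows "integrable lborel (\<lambda>x. f (x + a))"
  using integrable_affine[OF assms, of 1 a] by (simp add: add.commute)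

lemma compact_support_bounded:
  fixes f :: "'a::euclidean_space \<Rightarrow> 'b::real_normed_vector"
  assumes "continuous_on UNIV f" "bounded {x. f x \<noteq> 0}"
  obtains B where "B \<ge> 0" "\<And>x. norm (f x) \<le> B"
proof -
  have "compact (f ` closure {x. f x \<noteq> 0})"
    using assms by (intro compact_continuous_image) (auto intro: continuous_on_subset)
  then obtain B where B: "\<And>y. y \<in> f ` closure {x. f x \<noteq> 0} \<Longrightarrow> norm y \<le> B"
    using compact_imp_bounded bounded_iff by metis
  have "norm (f x) \<le> max 0 B" for x
  proof (cases "f x = 0")
    case False
    then have "x \<in> closure {x. f x \<noteq> 0}" using closure_subset[of "{x. f x \<noteq> 0}"] by blast
    then have "norm (f x) \<le> B" by (intro B imageI)
    then show ?thesis by simp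
  qed simp
  then show ?thesis using that[of "max 0 B"] by simp
qed

lemma norm_dd_le: "f differentiable at x \<Longrightarrow> norm (dd v f x) \<le> norm v * (\<Sum>b\<in>Basis. norm (dd b f x))"
  by (subst dd_expand, assumption, rule order_trans[OF norm_sum], subst sum_distrib_left)
     (auto intro!: sum_mono mult_right_mono Basis_le_norm)

text \<open>A compactly supported function of class \<open>C\<^sup>1\<close> has bounded partial derivatives, hence is Lipschitz.\<close>
lemma C_1_Lipschitz:
  fixes f :: "'a::euclidean_space \<Rightarrow> 'b::real_normed_vector"
  assumes f: "C_k 1 f" and b: "bounded {x. f x \<noteq> 0}"
  obtains B where "B \<ge> 0" "\<And>x y. norm (f x - f y) \<le> B * norm (x - y)" "\<And>v x. norm (dd v f x) \<le> B * norm v"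
proof -
  have d: "f differentiable at x" for x by (rule C_k_differentiable[of 0]) (use f in simp)
  have "\<exists>B. B \<ge> 0 \<and> (\<forall>x. norm (dd i f x) \<le> B)" for i
    using compact_support_bounded[of "dd i f"] C_k_dd[of 0 f i] f bounded_nonzero_dd[OF b, of i]
    by (metis C_k.simps(1) One_nat_def)
  then obtain B where B: "\<And>i. B i \<ge> 0" "\<And>i x. norm (dd i f x) \<le> B i" by metis
  have bd: "norm (dd v f x) \<le> (\<Sum>i\<in>Basis. B i) * norm v" for v x
    by (subst mult.commute, rule order_trans[OF norm_dd_le[OF d] mult_left_mono[OF sum_mono]]) (auto intro!: B)
  have "norm (f x - f y) \<le> (\<Sum>i\<in>Basis. B i) * norm (x - y)" for x y
    by (rule differentiable_bound[of UNIV f "\<lambda>x v. dd v f x"])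
       (auto intro!: onorm_le bd has_derivative_dd d)
  with bd show ?thesis using that[of "\<Sum>i\<in>Basis. B i"] B sum_nonneg[of Basis B] by auto
qed

text \<open>The difference quotients have integral zero by translation invariance, and they converge
dominatedly, by the Lipschitz bound and the compact support.\<close>
lemma integral_dd_eq_0:
  fixes f :: "'a::euclidean_space \<Rightarrow> complex"
  assumes f: "C_k 1 f" and b: "bounded {x. f x \<noteq> 0}"
  shows "(LINT x|lborel. dd v f x) = 0"
proof -
  obtain B where B: "B \<ge> 0" "\<And>x y. norm (f x - f y) \<le> B * norm (x - y)"
    using C_1_Lipschitz[OF f b] by metis
  obtain R where R: "\<And>x. f x \<noteq> 0 \<Longrightarrow> norm x \<le> R" using b by (auto simp: bounded_iff)
  have d: "f differentiable at x" for x by (rule C_k_differentiable[of 0]) (use f in simp)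
  have fi: "integrable lborel f" using f b by (intro integrable_compact_support C_k_continuous)
  have fm [measurable]: "f \<in> borel_measurable borel" using f by (rule borel_measurable_C_k)
  have dm [measurable]: "dd v f \<in> borel_measurable borel" using borel_measurable_C_k[OF C_k_dd[of 0 f v]] f by simp
  define F where "F n x = real (Suc n) *\<^sub>R (f (x + (1 / real (Suc n)) *\<^sub>R v) - f x)" for n x
  have "(\<lambda>n. LINT x|lborel. F n x) \<longlonglongrightarrow> (LINT x|lborel. dd v f x)"
  proof (rule integral_dominated_convergence[where w="\<lambda>x. B * norm v * indicator (cball 0 (R + norm v)) x"])
    show "dd v f \<in> borel_measurable lborel" "\<And>n. F n \<in> borel_measurable lborel"
      unfolding F_def by simp_all
    show "integrable lborel (\<lambda>x::'a. B * norm v * indicator (cball 0 (R + norm v)) x)"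
      by (intro integrable_mult_right integrable_real_indicator) (auto simp: emeasure_lborel_cball_finite[unfolded infinity_ennreal_def])
    show "AE x in lborel. (\<lambda>n. F n x) \<longlonglongrightarrow> dd v f x"
    proof (intro AE_I2)
      fix x
      have "((\<lambda>t. f (x + t *\<^sub>R v)) has_vector_derivative dd v f (x + 0 *\<^sub>R v)) (at 0)"
        using d by (intro has_vector_derivative_line) auto
      then have "((\<lambda>h. norm (f (x + h *\<^sub>R v) - f x - h *\<^sub>R dd v f x) / norm h) \<longlongrightarrow> 0) (at 0)"
        by (simp add: has_vector_derivative_def has_derivative_at)
      moreover have "filterlim (\<lambda>n. 1 / real (Suc n)) (at 0) sequentially"
        unfolding filterlim_at using LIMSEQ_Suc[OF lim_1_over_n] by simp
      ultimately have "(\<lambda>n. norm (f (x + (1 / real (Suc n)) *\<^sub>R v) - f x - (1 / real (Suc n)) *\<^sub>R dd v f x) / norm (1 / real (Suc n))) \<longlonglongrightarrow> 0"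
        by (rule filterlim_compose)
      moreover have "norm (f (x + (1 / real (Suc n)) *\<^sub>R v) - f x - (1 / real (Suc n)) *\<^sub>R dd v f x) / norm (1 / real (Suc n)) = norm (F n x - dd v f x)" for n
      proof -
        have "F n x - dd v f x = real (Suc n) *\<^sub>R (f (x + (1 / real (Suc n)) *\<^sub>R v) - f x - (1 / real (Suc n)) *\<^sub>R dd v f x)"
          by (simp add: F_def scaleR_diff_right del: of_nat_Suc)
        then show ?thesis by (simp del: of_nat_Suc)
      qed
      ultimately have "(\<lambda>n. norm (F n x - dd v f x)) \<longlonglongrightarrow> 0" by simp
      then show "(\<lambda>n. F n x) \<longlonglongrightarrow> dd v f x" by (simp add: tendsto_norm_zero_iff LIM_zero_iff)
    qed
    show "AE x in lborel. norm (F n x) \<le> B * norm v * indicator (cball 0 (R + norm v)) x" for n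
    proof (intro AE_I2)
      fix x
      let ?t = "1 / real (Suc n)"
      show "norm (F n x) \<le> B * norm v * indicator (cball 0 (R + norm v)) x"
      proof (cases "x \<in> cball 0 (R + norm v)")
        case True
        have "norm (F n x) = real (Suc n) * norm (f (x + ?t *\<^sub>R v) - f x)" by (simp add: F_def)
        also have "\<dots> \<le> real (Suc n) * (B * norm ((x + ?t *\<^sub>R v) - x))" by (intro mult_left_mono B) auto
        also have "\<dots> = B * norm v" by (simp add: field_simps del: of_nat_Suc)
        finally show ?thesis using True by simp
      next
        case False
        have t: "norm (?t *\<^sub>R v) \<le> norm v" using mult_left_le_one_le[of "norm v" ?t] by simp
        have "norm x > R + norm v" "norm v \<ge> 0" using False by auto
        moreover have "norm (x + ?t *\<^sub>R v) \<ge> norm x - norm (?t *\<^sub>R v)" by (metis norm_diff_ineq)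
        ultimately have "norm x > R" "norm (x + ?t *\<^sub>R v) > R" using t by linarith+
        then have "f x = 0" "f (x + ?t *\<^sub>R v) = 0" using R by (metis not_less)+
        then show ?thesis using False by (simp add: F_def)
      qed
    qed
  qed
  moreover have "(LINT x|lborel. F n x) = 0" for n
    unfolding F_def using fi integrable_shift[OF fi] integral_shift[OF fm]
    by (simp add: Bochner_Integration.integral_diff)
  ultimately show ?thesis by (simp add: LIMSEQ_const_iff)
qed

lemma integral_dd_by_parts:
  fixes f :: "'a::euclidean_space \<Rightarrow> complex"
  assumes f: "C_k 1 f" and g: "C_k 1 g" and b: "bounded {x. f x \<noteq> 0} \<or> bounded {x. g x \<noteq> 0}"
  shows "(LINT x|lborel. dd v f x * g x) = - (LINT x|lborel. f x * dd v g x)"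
proof -
  have b0: "bounded {x. f x * g x \<noteq> 0}" using b bounded_nonzero_multL bounded_nonzero_multR by metis
  have df: "f differentiable at x" "g differentiable at x" for x
    by (rule C_k_differentiable[of 0], use f g in simp)+
  have c: "continuous_on UNIV f" "continuous_on UNIV g" "continuous_on UNIV (dd v f)" "continuous_on UNIV (dd v g)"
    using f g C_k_continuous C_k_dd[of 0 f] C_k_dd[of 0 g] by auto
  have i: "integrable lborel (\<lambda>x. dd v f x * g x)" "integrable lborel (\<lambda>x. f x * dd v g x)"
  proof -
    have b1: "bounded {x. dd v f x * g x \<noteq> 0}" "bounded {x. f x * dd v g x \<noteq> 0}"
      using b bounded_nonzero_dd bounded_nonzero_multL bounded_nonzero_multR by metis+
    then show "integrable lborel (\<lambda>x. dd v f x * g x)" "integrable lborel (\<lambda>x. f x * dd v g x)"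
      by (auto intro!: integrable_compact_support continuous_on_mult c)
  qed
  have "(LINT x|lborel. f x * dd v g x + dd v f x * g x) = (LINT x|lborel. dd v (\<lambda>x. f x * g x) x)"
    by (simp add: dd_mult df)
  also have "\<dots> = 0" by (rule integral_dd_eq_0[OF C_k_mult[OF f g] b0])
  finally show ?thesis using i by (simp add: eq_neg_iff_add_eq_0 add.commute)
qed

lemma sq_norm_integral_le:
  fixes g :: "real \<Rightarrow> complex"
  assumes [measurable]: "g \<in> borel_measurable borel" and "integrable lborel (\<lambda>t. indicator {0..1} t *\<^sub>R g t)"
  shows "ennreal ((cmod (LINT t|lborel. indicator {0..1} t *\<^sub>R g t))\<^sup>2) \<le> (\<integral>\<^sup>+t. indicator {0..1} t * ennreal ((cmod (g t))\<^sup>2) \<partial>lborel)"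
proof -
  have "ennreal (cmod (LINT t|lborel. indicator {0..1} t *\<^sub>R g t)) \<le> (\<integral>\<^sup>+t. norm (indicator {0..1} t *\<^sub>R g t) \<partial>lborel)"
    by (rule integral_norm_bound_ennreal[OF assms(2)])
  also have "\<dots> = (\<integral>\<^sup>+t. indicator {0..1} t * (indicator {0..1} t * ennreal (cmod (g t))) \<partial>lborel)"
    by (intro nn_integral_cong) (auto simp: indicator_def)
  finally have "(ennreal (cmod (LINT t|lborel. indicator {0..1} t *\<^sub>R g t)))\<^sup>2 \<le> \<dots>\<^sup>2"
    by (rule power_mono) simp
  also have "\<dots> \<le> (\<integral>\<^sup>+t. (indicator {0..1::real} t)^2 \<partial>lborel) * (\<integral>\<^sup>+t. (indicator {0..1} t * ennreal (cmod (g t)))^2 \<partial>lborel)"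
    by (rule Cauchy_Schwarz_nn_integral) measurable
  also have "(\<integral>\<^sup>+t. (indicator {0..1::real} t)^2 \<partial>lborel) = (\<integral>\<^sup>+t. indicator {0..1::real} t \<partial>lborel)"
    by (intro nn_integral_cong) (auto simp: indicator_def)
  also have "\<dots> = 1" by simp
  also have "(\<integral>\<^sup>+t. (indicator {0..1} t * ennreal (cmod (g t)))^2 \<partial>lborel) = (\<integral>\<^sup>+t. indicator {0..1} t * ennreal ((cmod (g t))\<^sup>2) \<partial>lborel)"
    by (intro nn_integral_cong) (auto simp: indicator_def ennreal_power)
  finally show ?thesis by (simp add: ennreal_power)
qed

text \<open>Write the difference as an integral of the derivative over the segment, use Cauchy-Schwarz on the
unit interval, and exchange the integrals. The bound feeds both the Poincare inequality and the
compactness theorem.\<close>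
lemma translation_estimate:
  fixes f :: "'a::euclidean_space \<Rightarrow> complex"
  assumes f: "C_k 1 f"
  shows "(\<integral>\<^sup>+x. ennreal ((cmod (f (x + h) - f x))\<^sup>2) \<partial>lborel) \<le> (\<integral>\<^sup>+x. ennreal ((cmod (dd h f x))\<^sup>2) \<partial>lborel)"
proof -
  have d: "f differentiable at x" for x by (rule C_k_differentiable[of 0]) (use f in simp)
  have c: "continuous_on UNIV (dd h f)" using f C_k_dd[of 0 f h] by simp
  have [measurable]: "dd h f \<in> borel_measurable borel" using c by (rule borel_measurable_continuous_onI)
  have [measurable]: "f \<in> borel_measurable borel" using f by (rule borel_measurable_C_k)
  have pt: "ennreal ((cmod (f (x + h) - f x))\<^sup>2) \<le> (\<integral>\<^sup>+t. indicator {0..1} t * ennreal ((cmod (dd h f (x + t *\<^sub>R h)))\<^sup>2) \<partial>lborel)" for x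
  proof -
    have cl: "continuous_on {0..1} (\<lambda>t. dd h f (x + t *\<^sub>R h))"
      by (intro continuous_on_compose2[OF c] continuous_intros) auto
    have "(LINT t|lborel. indicator {0..1} t *\<^sub>R dd h f (x + t *\<^sub>R h)) = f (x + 1 *\<^sub>R h) - f (x + 0 *\<^sub>R h)"
      by (rule integral_FTC_Icc[where F="\<lambda>t. f (x + t *\<^sub>R h)"])
         (auto intro!: has_vector_derivative_at_within has_vector_derivative_line d cl)
    moreover have "integrable lborel (\<lambda>t. indicator {0..1} t *\<^sub>R dd h f (x + t *\<^sub>R h))"
      by (intro borel_integrable_compact cl) auto
    ultimately show ?thesis using sq_norm_integral_le[of "\<lambda>t. dd h f (x + t *\<^sub>R h)"] by simp
  qed
  have "(\<integral>\<^sup>+x. ennreal ((cmod (f (x + h) - f x))\<^sup>2) \<partial>lborel) \<le>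
     (\<integral>\<^sup>+x. (\<integral>\<^sup>+t. indicator {0..1::real} t * ennreal ((cmod (dd h f (x + t *\<^sub>R h)))\<^sup>2) \<partial>lborel) \<partial>lborel)"
    by (intro nn_integral_mono pt)
  also have "\<dots> = (\<integral>\<^sup>+t. (\<integral>\<^sup>+x. indicator {0..1::real} t * ennreal ((cmod (dd h f (x + t *\<^sub>R h)))\<^sup>2) \<partial>lborel) \<partial>lborel)"
    by (rule lborel_pair.Fubini') measurable
  also have "\<dots> = (\<integral>\<^sup>+t. indicator {0..1::real} t * (\<integral>\<^sup>+x. ennreal ((cmod (dd h f x))\<^sup>2) \<partial>lborel) \<partial>lborel)"
    by (intro nn_integral_cong) (simp add: nn_integral_cmult nn_integral_shift[of "\<lambda>x. ennreal ((cmod (dd h f x))\<^sup>2)"])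
  also have "\<dots> = (\<integral>\<^sup>+x. ennreal ((cmod (dd h f x))\<^sup>2) \<partial>lborel)"
    by (simp add: nn_integral_multc)
  finally show ?thesis .
qed

section \<open>Convolution with mollifiers\<close>

text \<open>The integrand contains \<open>\<eta> (w - z)\<close> rather than \<open>\<eta> (z - w)\<close>, so that for fixed \<open>z\<close> it pairs \<open>f\<close> with the
translated test function as in the definition of a distributional derivative. The price is a sign
whenever a derivative moves onto \<open>\<eta>\<close>.\<close>
definition conv :: "('a::euclidean_space \<Rightarrow> complex) \<Rightarrow> ('a \<Rightarrow> complex) \<Rightarrow> 'a \<Rightarrow> complex" where
  "conv f \<eta> z = (LINT w|lborel. f w * \<eta> (w - z))"

lemma integrable_mult_bounded_continuous:
  fixes f :: "'a::euclidean_space \<Rightarrow> complex"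
  assumes f: "integrable lborel f" and c: "continuous_on UNIV \<eta>" and b: "\<And>x. norm (\<eta> x) \<le> B"
  shows "integrable lborel (\<lambda>x. f x * \<eta> x)"
proof (rule Bochner_Integration.integrable_bound)
  show "integrable lborel (\<lambda>x. B *\<^sub>R f x)" using f by simp
  have [measurable]: "\<eta> \<in> borel_measurable borel" using c by (rule borel_measurable_continuous_onI)
  show "(\<lambda>x. f x * \<eta> x) \<in> borel_measurable lborel" using borel_measurable_integrable[OF f] by simp
  have "norm (f x * \<eta> x) \<le> norm (B *\<^sub>R f x)" for x
  proof -
    have "norm (f x * \<eta> x) \<le> norm (f x) * B" by (simp add: norm_mult mult_left_mono b)
    also have "\<dots> \<le> norm (f x) * \<bar>B\<bar>" by (simp add: mult_left_mono)
    finally show ?thesis by (simp add: mult.commute norm_mult)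
  qed
  then show "AE x in lborel. norm (f x * \<eta> x) \<le> norm (B *\<^sub>R f x)" by simp
qed

lemma test_function_bound: assumes "test_function \<eta>" obtains B where "B \<ge> 0" "\<And>x. norm (\<eta> x) \<le> B"
  using compact_support_bounded[OF C_k_continuous[OF test_function_C_k] test_function_bounded] assms by metis

lemma integrable_mult_test:
  assumes "integrable lborel f" "test_function \<eta>"
  shows "integrable lborel (\<lambda>x. f x * \<eta> x)"
  using test_function_bound[OF assms(2)] integrable_mult_bounded_continuous[OF assms(1) C_k_continuous[OF test_function_C_k[OF assms(2)]]]
  by metis

lemma test_function_shift: "test_function \<eta> \<Longrightarrow> test_function (\<lambda>x. \<eta> (x - z))"
  using test_function_affine[of \<eta> 1 "-z"] by simp

lemma dd_shift: "f differentiable at (x - z) \<Longrightarrow> dd b (\<lambda>x. f (x - z)) x = dd b f (x - z)"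
  using dd_affine[of f 1 x "-z" b] by simp

text \<open>The difference quotients of \<open>\<eta>\<close> approximate its derivative uniformly, with an error of second order
by the Lipschitz continuity of the first derivatives.\<close>
lemma conv_has_derivative:
  assumes f: "integrable lborel f" and t: "test_function \<eta>"
  shows "(conv f \<eta> has_derivative (\<lambda>v. - conv f (dd v \<eta>) z)) (at z)"
proof -
  have d: "\<eta> differentiable at x" for x by (rule C_k_differentiable[of 0]) (use t in \<open>simp add: test_function_iff\<close>)
  have tv: "test_function (dd v \<eta>)" for v by (rule test_function_dd[OF t])
  have dv: "dd v \<eta> differentiable at x" for x v by (rule C_k_differentiable[of 0]) (use tv in \<open>simp add: test_function_iff\<close>)
  have int: "integrable lborel (\<lambda>w. f w * \<eta> (w - z))" if "test_function \<eta>" for z \<eta>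
    by (intro integrable_mult_test f test_function_shift that)
  \<comment> \<open>Lipschitz constant\<close>
  have "\<exists>B. B \<ge> 0 \<and> (\<forall>x y. norm (dd i \<eta> x - dd i \<eta> y) \<le> B * norm (x - y))" for i
    using C_1_Lipschitz[OF test_function_C_k[OF tv] test_function_bounded[OF tv], of i] by metis
  then obtain Bi where Bi: "\<And>i. Bi i \<ge> 0" "\<And>i x y. norm (dd i \<eta> x - dd i \<eta> y) \<le> Bi i * norm (x - y)"
    by metis
  define L where "L = (\<Sum>i\<in>Basis. Bi i)"
  have L0: "L \<ge> 0" using Bi by (auto simp: L_def intro: sum_nonneg)
  have L: "norm (dd v \<eta> x - dd v \<eta> y) \<le> L * norm (x - y) * norm v" for v x y
  proof -
    have "dd v \<eta> x - dd v \<eta> y = (\<Sum>b\<in>Basis. (v \<bullet> b) *\<^sub>R (dd b \<eta> x - dd b \<eta> y))"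
      by (simp add: dd_expand[OF d, of v] sum_subtractf scaleR_diff_right)
    also have "norm \<dots> \<le> (\<Sum>b\<in>Basis. norm v * (Bi b * norm (x - y)))"
      by (rule order_trans[OF norm_sum]) (auto intro!: sum_mono mult_mono Basis_le_norm Bi)
    also have "\<dots> = L * norm (x - y) * norm v" by (simp add: L_def sum_distrib_right sum_distrib_left mult_ac)
    finally show ?thesis .
  qed
  have T: "norm (\<eta> (x - h) - \<eta> x + dd h \<eta> x) \<le> L * norm h * norm h" for x h
  proof -
    have "norm ((\<eta> (x - h) - dd (x - h) \<eta> x) - (\<eta> x - dd x \<eta> x)) \<le> L * norm h * norm ((x - h) - x)"
    proof (rule differentiable_bound[where S="cball x (norm h)" and f'="\<lambda>y v. dd v \<eta> y - dd v \<eta> x"])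
      fix y assume y: "y \<in> cball x (norm h)"
      show "((\<lambda>y. \<eta> y - dd y \<eta> x) has_derivative (\<lambda>v. dd v \<eta> y - dd v \<eta> x)) (at y within cball x (norm h))"
        using bounded_linear_imp_has_derivative[OF has_derivative_bounded_linear[OF has_derivative_dd[OF d, of x]]]
        by (intro has_derivative_diff has_derivative_at_withinI[OF has_derivative_dd[OF d]])
      show "onorm (\<lambda>v. dd v \<eta> y - dd v \<eta> x) \<le> L * norm h"
      proof (rule onorm_le)
        fix v :: 'a
        have "L * norm (y - x) * norm v \<le> L * norm h * norm v"
          using y L0 by (intro mult_right_mono mult_left_mono) (auto simp: dist_norm norm_minus_commute)
        then show "norm (dd v \<eta> y - dd v \<eta> x) \<le> L * norm h * norm v" using L[of v y x] by linarith
      qed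
    qed auto
    moreover have "dd (x - h) \<eta> x = dd x \<eta> x - dd h \<eta> x" using linear_diff[OF dd_linear[OF d]] .
    ultimately show ?thesis by (simp add: algebra_simps)
  qed
  have lin: "linear (\<lambda>v. - conv f (dd v \<eta>) z)"
  proof (rule linearI)
    fix a b r
    have "dd (a + b) \<eta> x = dd a \<eta> x + dd b \<eta> x" "dd (r *\<^sub>R a) \<eta> x = r *\<^sub>R dd a \<eta> x" for x
      using linear_add[OF dd_linear[OF d]] linear_scale[OF dd_linear[OF d]] by auto
    then show "- conv f (dd (a + b) \<eta>) z = - conv f (dd a \<eta>) z + - conv f (dd b \<eta>) z"
      "- conv f (dd (r *\<^sub>R a) \<eta>) z = r *\<^sub>R (- conv f (dd a \<eta>) z)"
      by (simp_all add: conv_def distrib_left int[OF tv])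
  qed
  define K where "K = L * (LINT w|lborel. norm (f w))"
  have K0: "K \<ge> 0" using L0 by (simp add: K_def)
  have main: "norm (conv f \<eta> (z + h) - conv f \<eta> z - (- conv f (dd h \<eta>) z)) \<le> K * norm h * norm h" for h
  proof -
    have "conv f \<eta> (z + h) - conv f \<eta> z - (- conv f (dd h \<eta>) z) =
      (LINT w|lborel. f w * \<eta> (w - (z + h)) - f w * \<eta> (w - z) + f w * dd h \<eta> (w - z))"
      by (simp add: conv_def int t tv)
    also have "\<dots> = (LINT w|lborel. f w * (\<eta> ((w - z) - h) - \<eta> (w - z) + dd h \<eta> (w - z)))"
      by (simp add: algebra_simps diff_diff_eq2)
    also have "norm \<dots> \<le> (LINT w|lborel. norm (f w) * (L * norm h * norm h))"
    proof (rule Bochner_Integration.integral_norm_bound_integral)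
      have "integrable lborel (\<lambda>w. f w * \<eta> (w - (z + h)) - f w * \<eta> (w - z) + f w * dd h \<eta> (w - z))"
        by (intro Bochner_Integration.integrable_add Bochner_Integration.integrable_diff int t tv)
      then show "integrable lborel (\<lambda>w. f w * (\<eta> ((w - z) - h) - \<eta> (w - z) + dd h \<eta> (w - z)))"
        by (simp add: algebra_simps diff_diff_eq2)
      show "integrable lborel (\<lambda>w. norm (f w) * (L * norm h * norm h))" using f by simp
    qed (simp add: norm_mult mult_left_mono T)
    also have "\<dots> = K * norm h * norm h" by (simp add: K_def mult_ac)
    finally show ?thesis .
  qed
  show ?thesis unfolding has_derivative_at
  proof
    show "bounded_linear (\<lambda>v. - conv f (dd v \<eta>) z)" using lin by (rule linear_conv_bounded_linear[THEN iffD1])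
    show "(\<lambda>h. norm (conv f \<eta> (z + h) - conv f \<eta> z - (- conv f (dd h \<eta>) z)) / norm h) \<midarrow>0\<rightarrow> 0"
    proof (rule Lim_null_comparison)
      show "\<forall>\<^sub>F h in at 0. norm (norm (conv f \<eta> (z + h) - conv f \<eta> z - (- conv f (dd h \<eta>) z)) / norm h) \<le> K * norm h"
        using main K0 by (intro always_eventually allI) (simp add: divide_simps)
      show "((\<lambda>h. K * norm h) \<longlongrightarrow> 0) (at (0::'a))" by (auto intro!: tendsto_eq_intros)
    qed
  qed
qed

lemma dd_conv: "integrable lborel f \<Longrightarrow> test_function \<eta> \<Longrightarrow> dd v (conv f \<eta>) z = - conv f (dd v \<eta>) z"
  by (rule dd_eqI) (rule conv_has_derivative)

lemma C_k_conv: "integrable lborel f \<Longrightarrow> test_function \<eta> \<Longrightarrow> C_k k (conv f \<eta>)"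
proof (induction k arbitrary: \<eta>)
  case 0
  then show ?case using conv_has_derivative[of f \<eta>]
    by (auto simp: continuous_on_eq_continuous_at intro: has_derivative_continuous)
next
  case (Suc k)
  have "dd v (conv f \<eta>) = (\<lambda>z. - conv f (dd v \<eta>) z)" for v using dd_conv[OF Suc.prems] by blast
  moreover have "C_k k (\<lambda>z. - conv f (dd v \<eta>) z)" for v
    using Suc.IH[OF Suc.prems(1) test_function_dd[OF Suc.prems(2)]] by (rule C_k_uminus)
  ultimately show ?case using conv_has_derivative[OF Suc.prems] by (auto simp: C_k_Suc differentiable_def)
qed

lemma conv_eq_0:
  assumes "\<And>x. norm x > R \<Longrightarrow> f x = 0" "\<And>x. norm x \<ge> \<delta> \<Longrightarrow> \<eta> x = 0" "norm z > R + \<delta>"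
  shows "conv f \<eta> z = 0"
proof -
  have "f w * \<eta> (w - z) = 0" for w
  proof (cases "norm w > R")
    case False
    have "norm z \<le> norm w + norm (w - z)" by (metis norm_triangle_sub norm_minus_commute)
    then have "norm (w - z) \<ge> \<delta>" using False assms(3) by linarith
    then show ?thesis using assms(2) by simp
  qed (use assms in auto)
  then have "(\<lambda>w. f w * \<eta> (w - z)) = (\<lambda>w. 0)" by blast
  then show ?thesis by (simp add: conv_def)
qed

lemma test_function_conv:
  assumes f: "integrable lborel f" and t: "test_function \<eta>" and b: "bounded {x. f x \<noteq> 0}"
  shows "test_function (conv f \<eta>)"
proof -
  obtain R where R: "\<And>x. f x \<noteq> 0 \<Longrightarrow> norm x \<le> R" using b by (auto simp: bounded_iff)
  obtain S where S: "\<And>x. \<eta> x \<noteq> 0 \<Longrightarrow> norm x \<le> S" using test_function_bounded[OF t] by (auto simp: bounded_iff)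
  have "conv f \<eta> z = 0" if "norm z > R + (S + 1)" for z
    by (rule conv_eq_0[OF _ _ that]) (use R S in force)+
  then have "{z. conv f \<eta> z \<noteq> 0} \<subseteq> cball 0 (R + (S + 1))" by force
  then show ?thesis using C_k_conv[OF f t] by (auto simp: test_function_iff intro: bounded_subset)
qed

definition mollifier :: "real \<Rightarrow> ('a::euclidean_space \<Rightarrow> real) \<Rightarrow> bool" where
  "mollifier \<delta> \<rho> \<longleftrightarrow> test_function (\<lambda>x. complex_of_real (\<rho> x)) \<and> (\<forall>x. 0 \<le> \<rho> x) \<and> (\<forall>x. norm x \<ge> \<delta> \<longrightarrow> \<rho> x = 0) \<and>
     integrable lborel \<rho> \<and> (LINT x|lborel. \<rho> x) = 1"

lemma mollifier_exists: assumes "\<delta> > 0" obtains \<rho> :: "'a::euclidean_space \<Rightarrow> real" where "mollifier \<delta> \<rho>"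
proof -
  define b where "b x = bump ((1/\<delta>) *\<^sub>R x)" for x :: 'a
  have t: "test_function (\<lambda>x. complex_of_real (b x))"
    unfolding b_def using test_function_affine[OF test_function_bump, of "1/\<delta>" 0] assms by simp
  have cb: "continuous_on UNIV b"
    unfolding b_def by (intro continuous_on_compose2[OF C_k_continuous[OF C_k_bump]] continuous_intros) auto
  have bb: "bounded {x. b x \<noteq> 0}" using test_function_bounded[OF t] by simp
  have b0: "b x \<ge> 0" for x by (simp add: b_def bump_nonneg)
  have bz: "b x = 0" if "norm x \<ge> \<delta>" for x unfolding b_def by (rule bump_eq_0) (use that assms in \<open>simp\<close>)
  have i: "integrable lborel b" by (intro integrable_compact_support cb bb)
  define c where "c = (LINT x|lborel. b x)"
  have "c > 0"
  proof -
    have "c \<noteq> 0"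
    proof
      assume "c = 0"
      then have "AE x in lborel. b x = 0" using integral_nonneg_eq_0_iff_AE[OF i] b0 by (simp add: c_def)
      then have "{x. b x \<noteq> 0} \<in> null_sets lborel"
        using AE_iff_null[of lborel "\<lambda>x. b x = 0"] borel_measurable_continuous_onI[OF cb] by simp
      then have "negligible {x. b x \<noteq> 0}"
        by (simp add: negligible_iff_null_sets null_sets_completionI)
      moreover have "open {x. b x \<noteq> 0}" using open_Collect_neq[OF cb continuous_on_const, of 0] by simp
      ultimately have "{x. b x \<noteq> 0} = {}" using open_not_negligible by blast
      moreover have "b 0 = 1" by (simp add: b_def)
      ultimately show False by (metis (mono_tags) empty_iff mem_Collect_eq zero_neq_one)
    qed
    moreover have "c \<ge> 0" unfolding c_def using b0 by simp
    ultimately show ?thesis by simp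
  qed
  then have "mollifier \<delta> (\<lambda>x. b x / c)"
    using test_function_cmult[OF t, of "1 / complex_of_real c"] b0 bz i
    by (auto simp: mollifier_def c_def)
  then show ?thesis using that by blast
qed

abbreviation moll_conv :: "('a::euclidean_space \<Rightarrow> complex) \<Rightarrow> ('a \<Rightarrow> real) \<Rightarrow> 'a \<Rightarrow> complex" where
  "moll_conv f \<rho> \<equiv> conv f (\<lambda>x. complex_of_real (\<rho> x))"

text \<open>The squared norm for Lebesgue measure, as an extended nonnegative number, so that measurability is
all that its manipulation requires.\<close>
definition nn2 :: "('a::euclidean_space \<Rightarrow> complex) \<Rightarrow> ennreal" where
  "nn2 f = (\<integral>\<^sup>+x. ennreal ((cmod (f x))\<^sup>2) \<partial>lborel)"

text \<open>A mollification is an average of translates, so its distance from \<open>f\<close> is at most the largest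
distance of a small translate; this is Jensen's inequality.\<close>
lemma moll_conv_diff_le:
  fixes f :: "'a::euclidean_space \<Rightarrow> complex"
  assumes m: "mollifier \<delta> \<rho>" and f: "integrable lborel f"
    and E: "\<And>h. norm h \<le> \<delta> \<Longrightarrow> nn2 (\<lambda>x. f (x + h) - f x) \<le> E"
  shows "nn2 (\<lambda>z. moll_conv f \<rho> z - f z) \<le> E"
proof -
  have t: "test_function (\<lambda>x. complex_of_real (\<rho> x))" and r0: "\<And>x. \<rho> x \<ge> 0" and rz: "\<And>x. norm x \<ge> \<delta> \<Longrightarrow> \<rho> x = 0"
    and ri: "integrable lborel \<rho>" and r1: "(LINT x|lborel. \<rho> x) = 1" using m by (auto simp: mollifier_def)
  have [measurable]: "f \<in> borel_measurable borel" using borel_measurable_integrable[OF f] by simp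
  have [measurable]: "\<rho> \<in> borel_measurable borel" using borel_measurable_integrable[OF ri] by simp
  have nr: "(\<integral>\<^sup>+h. ennreal (\<rho> h) \<partial>lborel) = 1" using nn_integral_eq_integral[OF ri] r0 r1 by simp
  have pt: "ennreal ((cmod (moll_conv f \<rho> z - f z))\<^sup>2) \<le> (\<integral>\<^sup>+h. ennreal (\<rho> h) * ennreal ((cmod (f (z + h) - f z))\<^sup>2) \<partial>lborel)" for z
  proof -
    have i1: "integrable lborel (\<lambda>h. f (z + h) * complex_of_real (\<rho> h))"
      using integrable_mult_test[OF integrable_shift[OF f, of z] t] by (simp add: add.commute)
    have i2: "integrable lborel (\<lambda>h. f z * complex_of_real (\<rho> h))" using ri by simp
    have i: "integrable lborel (\<lambda>h. (f (z + h) - f z) * complex_of_real (\<rho> h))"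
      using Bochner_Integration.integrable_diff[OF i1 i2] by (simp add: algebra_simps)
    have "moll_conv f \<rho> z = (LINT h|lborel. f (z + h) * complex_of_real (\<rho> h))"
      using integral_shift[of "\<lambda>w. f w * complex_of_real (\<rho> (w - z))" z] by (simp add: conv_def add.commute)
    moreover have "f z = (LINT h|lborel. f z * complex_of_real (\<rho> h))" using r1 by simp
    ultimately have "moll_conv f \<rho> z - f z = (LINT h|lborel. (f (z + h) - f z) * complex_of_real (\<rho> h))"
      using i1 i2 by (simp add: algebra_simps)
    then have "ennreal (cmod (moll_conv f \<rho> z - f z)) \<le> (\<integral>\<^sup>+h. norm ((f (z + h) - f z) * complex_of_real (\<rho> h)) \<partial>lborel)"
      using integral_norm_bound_ennreal[OF i] by simp
    also have "\<dots> = (\<integral>\<^sup>+h. ennreal (sqrt (\<rho> h)) * ennreal (sqrt (\<rho> h) * cmod (f (z + h) - f z)) \<partial>lborel)"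
      using r0 by (intro nn_integral_cong) (simp add: norm_mult ennreal_mult'[symmetric] mult_ac flip: mult.assoc)
    finally have "(ennreal (cmod (moll_conv f \<rho> z - f z)))\<^sup>2 \<le> \<dots>\<^sup>2" by (rule power_mono) simp
    also have "\<dots> \<le> (\<integral>\<^sup>+h. (ennreal (sqrt (\<rho> h)))^2 \<partial>lborel) * (\<integral>\<^sup>+h. (ennreal (sqrt (\<rho> h) * cmod (f (z + h) - f z)))^2 \<partial>lborel)"
      by (rule Cauchy_Schwarz_nn_integral) measurable
    also have "(\<integral>\<^sup>+h. (ennreal (sqrt (\<rho> h)))^2 \<partial>lborel) = 1" using nr r0 by (simp add: ennreal_power)
    also have "(\<integral>\<^sup>+h. (ennreal (sqrt (\<rho> h) * cmod (f (z + h) - f z)))^2 \<partial>lborel) =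
       (\<integral>\<^sup>+h. ennreal (\<rho> h) * ennreal ((cmod (f (z + h) - f z))\<^sup>2) \<partial>lborel)"
      using r0 by (intro nn_integral_cong) (simp add: ennreal_power power_mult_distrib ennreal_mult)
    finally show ?thesis by (simp add: ennreal_power)
  qed
  have "nn2 (\<lambda>z. moll_conv f \<rho> z - f z) \<le> (\<integral>\<^sup>+z. \<integral>\<^sup>+h. ennreal (\<rho> h) * ennreal ((cmod (f (z + h) - f z))\<^sup>2) \<partial>lborel \<partial>lborel)"
    unfolding nn2_def by (intro nn_integral_mono pt)
  also have "\<dots> = (\<integral>\<^sup>+h. \<integral>\<^sup>+z. ennreal (\<rho> h) * ennreal ((cmod (f (z + h) - f z))\<^sup>2) \<partial>lborel \<partial>lborel)"
    by (rule lborel_pair.Fubini') measurable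
  also have "\<dots> = (\<integral>\<^sup>+h. ennreal (\<rho> h) * nn2 (\<lambda>x. f (x + h) - f x) \<partial>lborel)"
    by (simp add: nn_integral_cmult nn2_def)
  also have "\<dots> \<le> (\<integral>\<^sup>+h. ennreal (\<rho> h) * E \<partial>lborel)"
    using E rz by (intro nn_integral_mono) (metis le_cases mult_left_mono zero_le ennreal_0 mult_zero_left order_refl)
  also have "\<dots> = E" by (simp add: nn_integral_multc nr)
  finally show ?thesis .
qed

lemma sq_norm_add_le: "(norm (a + b))\<^sup>2 \<le> 2 * (norm a)\<^sup>2 + 2 * (norm (b :: 'a::real_normed_vector))\<^sup>2"
proof -
  have "(norm (a + b))\<^sup>2 \<le> (norm a + norm b)\<^sup>2" by (intro power_mono norm_triangle_ineq) auto
  also have "\<dots> \<le> 2 * (norm a)\<^sup>2 + 2 * (norm b)\<^sup>2"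
    using sum_squares_bound[of "norm a" "norm b"] by (simp add: power2_sum)
  finally show ?thesis .
qed

lemma nn2_add_le:
  assumes [measurable]: "f \<in> borel_measurable borel" "g \<in> borel_measurable borel"
  shows "nn2 (\<lambda>x. f x + g x) \<le> 2 * nn2 f + 2 * nn2 g"
proof -
  have "nn2 (\<lambda>x. f x + g x) \<le> (\<integral>\<^sup>+x. 2 * ennreal ((cmod (f x))\<^sup>2) + 2 * ennreal ((cmod (g x))\<^sup>2) \<partial>lborel)"
    unfolding nn2_def by (intro nn_integral_mono)
      (simp add: ennreal_mult[of 2, simplified, symmetric] ennreal_plus[symmetric] sq_norm_add_le del: ennreal_plus)
  also have "\<dots> = 2 * nn2 f + 2 * nn2 g" by (simp add: nn2_def nn_integral_add nn_integral_cmult)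
  finally show ?thesis .
qed

section \<open>Mean-square approximation and local compactness\<close>

lemma ennreal_numeral_mult: "0 \<le> e \<Longrightarrow> numeral k * ennreal e = ennreal (numeral k * e)"
  by (simp add: ennreal_mult)

lemma nn2_shift: "f \<in> borel_measurable borel \<Longrightarrow> nn2 (\<lambda>x. f (x + h)) = nn2 f"
  unfolding nn2_def by (rule nn_integral_shift) measurable

lemma nn2_minus_commute: "nn2 (\<lambda>x. f x - g x) = nn2 (\<lambda>x. g x - f x)"
  by (simp add: nn2_def norm_minus_commute)

lemma nn2_le_bounded:
  fixes f :: "'a::euclidean_space \<Rightarrow> complex"
  assumes "\<And>x. norm x > R \<Longrightarrow> f x = 0" "\<And>x. norm (f x) \<le> e" "R \<ge> 0"
  shows "nn2 f \<le> ennreal (e\<^sup>2 * measure lborel (cball (0::'a) R))"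
proof -
  have e: "e \<ge> 0" using assms(2) norm_ge_zero order_trans by blast
  have "nn2 f \<le> (\<integral>\<^sup>+x. ennreal (e\<^sup>2) * indicator (cball (0::'a) R) x \<partial>lborel)"
    unfolding nn2_def
  proof (intro nn_integral_mono)
    fix x
    show "ennreal ((cmod (f x))\<^sup>2) \<le> ennreal (e\<^sup>2) * indicator (cball 0 R) x"
      using assms(1)[of x] power_mono[OF assms(2)[of x], of 2] by (cases "norm x > R") (auto simp: indicator_def)
  qed
  also have "\<dots> = ennreal (e\<^sup>2) * emeasure lborel (cball (0::'a) R)" by (rule nn_integral_cmult_indicator) simp
  also have "\<dots> = ennreal (e\<^sup>2) * ennreal (measure lborel (cball (0::'a) R))"
    using emeasure_eq_ennreal_measure[of lborel "cball (0::'a) R"] emeasure_lborel_cball_finite[of "0::'a" R] by simp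
  finally show ?thesis by (simp add: ennreal_mult)
qed

lemma ex_nat_lt_of_tendsto_0:
  fixes u :: "nat \<Rightarrow> ennreal" assumes "u \<longlonglongrightarrow> 0" "E > (0::ennreal)" shows "\<exists>m. u m < E"
  using order_tendstoD(2)[OF assms] by (auto simp: eventually_sequentially)

text \<open>First truncate \<open>f\<close> in space and in size. The truncation is an almost everywhere limit of continuous
functions; clamping these by a nearest-point projection and a cutoff makes the convergence dominated.\<close>
lemma continuous_compact_dense_nn2:
  fixes f :: "'a::euclidean_space \<Rightarrow> complex"
  assumes f [measurable]: "f \<in> borel_measurable borel" and fin: "nn2 f < \<infinity>" and E: "E > 0"
  obtains g where "continuous_on UNIV g" "bounded {x. g x \<noteq> 0}" "nn2 (\<lambda>x. f x - g x) \<le> E"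
proof -
  have [measurable]: "cball (0::'a) a \<in> sets borel" for a by simp
  define fm where "fm m x = (if norm x \<le> real m \<and> cmod (f x) \<le> real m then f x else 0)" for m x
  have fmm [measurable]: "fm m \<in> borel_measurable borel" for m unfolding fm_def by measurable
  have "(\<lambda>m. nn2 (\<lambda>x. f x - fm m x)) \<longlonglongrightarrow> (\<integral>\<^sup>+x. 0 \<partial>(lborel :: 'a measure))"
    unfolding nn2_def
  proof (rule nn_integral_dominated_convergence[where w="\<lambda>x. ennreal ((cmod (f x))\<^sup>2)"])
    show "(\<integral>\<^sup>+ x. ennreal ((cmod (f x))\<^sup>2) \<partial>lborel) < \<infinity>" using fin by (simp add: nn2_def)
    show "AE x in lborel. ennreal ((cmod (f x - fm j x))\<^sup>2) \<le> ennreal ((cmod (f x))\<^sup>2)" for j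
      by (auto simp: fm_def)
    show "AE x in lborel. (\<lambda>i. ennreal ((cmod (f x - fm i x))\<^sup>2)) \<longlonglongrightarrow> 0"
    proof (intro AE_I2)
      fix x
      obtain n where n: "real n \<ge> max (norm x) (cmod (f x))" using real_arch_simple by blast
      have "\<forall>\<^sub>F i in sequentially. ennreal ((cmod (f x - fm i x))\<^sup>2) = 0"
        unfolding eventually_sequentially by (rule exI[of _ n]) (use n in \<open>auto simp: fm_def\<close>)
      then show "(\<lambda>i. ennreal ((cmod (f x - fm i x))\<^sup>2)) \<longlonglongrightarrow> 0" by (rule tendsto_eventually)
    qed
  qed measurable
  moreover have E4: "E / 4 > 0" using E by (simp add: ennreal_zero_less_divide)
  ultimately obtain m where m: "nn2 (\<lambda>x. f x - fm m x) < E / 4" using ex_nat_lt_of_tendsto_0 by force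
  have "fm m \<in> borel_measurable lebesgue" using fmm[of m] by (intro measurable_completion) simp
  then have "fm m measurable_on UNIV" by (intro lebesgue_measurable_imp_measurable_on) auto
  then obtain N g where N: "negligible N" and gc: "\<And>n. continuous_on UNIV (g n)"
    and gl: "\<And>x. x \<notin> N \<Longrightarrow> (\<lambda>n. g n x) \<longlonglongrightarrow> fm m x" unfolding measurable_on_def by auto
  define cut where "cut x = max 0 (min 1 (real m + 1 - norm x))" for x :: 'a
  define T where "T y = closest_point (cball 0 (real m)) y" for y :: complex
  define G where "G n x = cut x *\<^sub>R T (g n x)" for n x
  have Tc: "continuous_on UNIV T" unfolding T_def[abs_def] by (intro continuous_on_closest_point) auto
  have Tb: "norm (T y) \<le> real m" for y using closest_point_in_set[of "cball 0 (real m)" y] by (auto simp: T_def)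
  have cutb: "0 \<le> cut x" "cut x \<le> 1" for x by (auto simp: cut_def)
  have Gc: "continuous_on UNIV (G n)" for n
    unfolding G_def cut_def by (intro continuous_intros continuous_on_compose2[OF Tc gc]) auto
  have Gz: "G n x = 0" if "norm x > real m + 1" for n x using that by (simp add: G_def cut_def)
  have Gb: "norm (G n x) \<le> real m" for n x
    using mult_mono[OF cutb(2) Tb[of "g n x"]] cutb by (simp add: G_def)
  have [measurable]: "G n \<in> borel_measurable borel" for n using Gc by (rule borel_measurable_continuous_onI)
  have "(\<lambda>n. nn2 (\<lambda>x. fm m x - G n x)) \<longlonglongrightarrow> (\<integral>\<^sup>+x. 0 \<partial>(lborel :: 'a measure))"
    unfolding nn2_def
  proof (rule nn_integral_dominated_convergence[where w="\<lambda>x. ennreal ((2 * real m)\<^sup>2) * indicator (cball 0 (real m + 1)) x"])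
    show "(\<integral>\<^sup>+ x. ennreal ((2 * real m)\<^sup>2) * indicator (cball (0::'a) (real m + 1)) x \<partial>lborel) < \<infinity>"
      using emeasure_lborel_cball_finite[of "0::'a" "real m + 1"]
      by (subst nn_integral_cmult_indicator) (auto simp: ennreal_mult_less_top)
    show "AE x in lborel. ennreal ((cmod (fm m x - G j x))\<^sup>2) \<le> ennreal ((2 * real m)\<^sup>2) * indicator (cball 0 (real m + 1)) x" for j
    proof (intro AE_I2)
      fix x
      show "ennreal ((cmod (fm m x - G j x))\<^sup>2) \<le> ennreal ((2 * real m)\<^sup>2) * indicator (cball 0 (real m + 1)) x"
      proof (cases "norm x > real m + 1")
        case True then show ?thesis by (simp add: Gz fm_def)
      next
        case False
        have "cmod (fm m x) \<le> real m" by (auto simp: fm_def)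
        then have "cmod (fm m x - G j x) \<le> 2 * real m" using Gb[of j x] norm_triangle_ineq4[of "fm m x" "G j x"] by linarith
        then show ?thesis using False power_mono[of "cmod (fm m x - G j x)" "2 * real m" 2] by (simp add: ennreal_leI)
      qed
    qed
    have "AE x in lborel. x \<notin> N"
    proof -
      have "N \<in> null_sets (completion lborel)" using N by (simp add: negligible_iff_null_sets)
      then have "AE x in completion lborel. x \<notin> N" by (rule AE_not_in)
      then show ?thesis by (simp add: AE_completion_iff)
    qed
    then show "AE x in lborel. (\<lambda>n. ennreal ((cmod (fm m x - G n x))\<^sup>2)) \<longlonglongrightarrow> 0"
    proof eventually_elim
      fix x assume x: "x \<notin> N"
      have "T (fm m x) = fm m x" unfolding T_def by (rule closest_point_self) (auto simp: fm_def)
      moreover have "(\<lambda>n. T (g n x)) \<longlonglongrightarrow> T (fm m x)"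
        using continuous_on_tendsto_compose[OF Tc gl[OF x]] by simp
      ultimately have "(\<lambda>n. G n x) \<longlonglongrightarrow> cut x *\<^sub>R fm m x" unfolding G_def by (intro tendsto_intros) simp
      moreover have "cut x *\<^sub>R fm m x = fm m x" by (simp add: cut_def fm_def)
      ultimately have "(\<lambda>n. (cmod (fm m x - G n x))\<^sup>2) \<longlonglongrightarrow> (cmod (fm m x - fm m x))\<^sup>2" by (intro tendsto_intros) simp
      then show "(\<lambda>n. ennreal ((cmod (fm m x - G n x))\<^sup>2)) \<longlonglongrightarrow> 0" using tendsto_ennrealI by fastforce
    qed
  qed measurable
  then obtain n where n: "nn2 (\<lambda>x. fm m x - G n x) < E / 4" using ex_nat_lt_of_tendsto_0 E4 by force
  have "nn2 (\<lambda>x. f x - G n x) = nn2 (\<lambda>x. (f x - fm m x) + (fm m x - G n x))" by simp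
  also have "\<dots> \<le> 2 * nn2 (\<lambda>x. f x - fm m x) + 2 * nn2 (\<lambda>x. fm m x - G n x)" by (rule nn2_add_le) measurable
  also have "\<dots> \<le> 2 * (E / 4) + 2 * (E / 4)" using m n by (intro add_mono mult_left_mono) auto
  also have "\<dots> = 4 * (E / 4)" by (simp add: distrib_right[symmetric])
  also have "\<dots> = E" by (simp add: ennreal_times_divide mult.commute[of 4] mult_divide_eq_ennreal)
  finally have "nn2 (\<lambda>x. f x - G n x) \<le> E" .
  moreover have "bounded {x. G n x \<noteq> 0}"
    by (rule bounded_subset[of "cball 0 (real m + 1)"]) (use Gz not_le_imp_less in \<open>auto, blast\<close>)
  ultimately show ?thesis using that Gc by blast
qed

text \<open>For a continuous compactly supported function this is uniform continuity; density gives the general case.\<close>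
lemma nn2_translation_continuous:
  fixes f :: "'a::euclidean_space \<Rightarrow> complex"
  assumes f [measurable]: "f \<in> borel_measurable borel" and fin: "nn2 f < \<infinity>" and E: "E > (0::real)"
  obtains \<delta> where "\<delta> > 0" "\<And>h. norm h \<le> \<delta> \<Longrightarrow> nn2 (\<lambda>x. f (x + h) - f x) \<le> ennreal E"
proof -
  obtain g where gc: "continuous_on UNIV g" and gb: "bounded {x. g x \<noteq> 0}" and fg: "nn2 (\<lambda>x. f x - g x) \<le> ennreal (E/12)"
    using continuous_compact_dense_nn2[OF f fin, of "ennreal (E/12)"] E by force
  have [measurable]: "g \<in> borel_measurable borel" using gc by (rule borel_measurable_continuous_onI)
  obtain R where R: "\<And>x. g x \<noteq> 0 \<Longrightarrow> norm x \<le> R" "R > 0" using gb by (auto simp: bounded_pos)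
  define V where "V = measure lborel (cball (0::'a) (R+1))"
  have V0: "V \<ge> 0" by (simp add: V_def)
  define e where "e = sqrt (E / (8 * (V + 1)))"
  have e0: "e > 0" using E V0 by (simp add: e_def)
  have eV: "e\<^sup>2 * V \<le> E / 8"
  proof -
    have "e\<^sup>2 * V \<le> e\<^sup>2 * (V + 1)" by (intro mult_left_mono) auto
    moreover have "e\<^sup>2 = E / (8 * (V + 1))" using E V0 by (simp add: e_def)
    moreover have "E / (8 * (V + 1)) * (V + 1) = E / 8" using V0 by (simp add: field_simps)
    ultimately show ?thesis by metis
  qed
  have "uniformly_continuous_on (cball 0 (R+2)) g"
    using gc by (intro compact_uniformly_continuous) (auto intro: continuous_on_subset)
  then obtain d where d: "d > 0" "\<And>x y. x \<in> cball 0 (R+2) \<Longrightarrow> y \<in> cball 0 (R+2) \<Longrightarrow> dist y x < d \<Longrightarrow> dist (g y) (g x) < e"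
    unfolding uniformly_continuous_on_def using e0 by metis
  define \<delta> where "\<delta> = min 1 (d/2)"
  have "nn2 (\<lambda>x. f (x + h) - f x) \<le> ennreal E" if h: "norm h \<le> \<delta>" for h
  proof -
    have h1: "norm h \<le> 1" "norm h < d" using h d by (auto simp: \<delta>_def)
    have gz: "g (x + h) - g x = 0" if "norm x > R + 1" for x
    proof -
      have "norm (x + h) \<ge> norm x - norm h" by (metis norm_diff_ineq)
      then have "norm (x + h) > R" "norm x > R" using h1 that by linarith+
      then have "g (x + h) = 0" "g x = 0" using R(1) not_less by blast+
      then show ?thesis by simp
    qed
    have ge: "norm (g (x + h) - g x) \<le> e" for x
    proof (cases "norm x > R + 1")
      case True with gz e0 show ?thesis by simp
    next
      case False
      have "norm (x + h) \<le> norm x + norm h" by (rule norm_triangle_ineq)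
      then have "x \<in> cball 0 (R+2)" "x + h \<in> cball 0 (R+2)" using False h1 by auto
      then have "dist (g (x + h)) (g x) < e" using h1 by (intro d) (auto simp: dist_norm)
      then show ?thesis by (simp add: dist_norm)
    qed
    have g2: "nn2 (\<lambda>x. g (x + h) - g x) \<le> ennreal (E/8)"
      by (rule order_trans[OF nn2_le_bounded[where R="R+1" and e=e]])
         (use gz ge R(2) eV in \<open>auto simp: V_def intro!: ennreal_leI\<close>)
    have "nn2 (\<lambda>x. f (x + h) - f x) = nn2 (\<lambda>x. (f (x + h) - g (x + h)) + ((g (x + h) - g x) + (g x - f x)))"
      by simp
    also have "\<dots> \<le> 2 * nn2 (\<lambda>x. f (x + h) - g (x + h)) + 2 * nn2 (\<lambda>x. (g (x + h) - g x) + (g x - f x))"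
      by (rule nn2_add_le) measurable
    also have "\<dots> \<le> 2 * nn2 (\<lambda>x. f (x + h) - g (x + h)) + 2 * (2 * nn2 (\<lambda>x. g (x + h) - g x) + 2 * nn2 (\<lambda>x. g x - f x))"
      by (intro add_left_mono mult_left_mono nn2_add_le) auto
    also have "nn2 (\<lambda>x. f (x + h) - g (x + h)) = nn2 (\<lambda>x. f x - g x)" using nn2_shift[of "\<lambda>x. f x - g x" h] by simp
    also have "nn2 (\<lambda>x. g x - f x) = nn2 (\<lambda>x. f x - g x)" by (rule nn2_minus_commute)
    also have "2 * nn2 (\<lambda>x. f x - g x) + 2 * (2 * nn2 (\<lambda>x. g (x + h) - g x) + 2 * nn2 (\<lambda>x. f x - g x)) \<le>
      2 * ennreal (E/12) + 2 * (2 * ennreal (E/8) + 2 * ennreal (E/12))"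
      by (intro add_mono mult_left_mono fg g2) auto
    also have "\<dots> = ennreal (2 * (E/12) + 2 * (2 * (E/8) + 2 * (E/12)))"
      using E by (simp add: ennreal_numeral_mult ennreal_plus[symmetric] del: ennreal_plus)
    also have "2 * (E/12) + 2 * (2 * (E/8) + 2 * (E/12)) = E" by simp
    finally show ?thesis .
  qed
  moreover have "\<delta> > 0" using d by (simp add: \<delta>_def)
  ultimately show ?thesis using that by blast
qed

lemma mollifier_mono: "mollifier \<delta> \<rho> \<Longrightarrow> \<delta> \<le> \<delta>' \<Longrightarrow> mollifier \<delta>' \<rho>"
  by (auto simp: mollifier_def)

lemma moll_conv_approx:
  fixes f :: "'a::euclidean_space \<Rightarrow> complex"
  assumes f: "integrable lborel f" and fin: "nn2 f < \<infinity>" and E: "E > (0::real)"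
  obtains \<delta> where "\<delta> > 0" "\<And>\<rho>. mollifier \<delta> \<rho> \<Longrightarrow> nn2 (\<lambda>x. moll_conv f \<rho> x - f x) \<le> ennreal E"
proof -
  have "f \<in> borel_measurable borel" using borel_measurable_integrable[OF f] by simp
  from nn2_translation_continuous[OF this fin E] obtain \<delta> where
    d: "\<delta> > 0" "\<And>h. norm h \<le> \<delta> \<Longrightarrow> nn2 (\<lambda>x. f (x + h) - f x) \<le> ennreal E" by metis
  then show ?thesis using that[of \<delta>] moll_conv_diff_le[OF _ f] by blast
qed

text \<open>The translation bound makes mollification at one fixed scale uniformly close to the identity on the
sequence. The mollified functions are equibounded and equicontinuous, so that Arzela-Ascoli applies.
The subsequence is Cauchy only up to \<open>E\<close>, since the scale depends on \<open>E\<close>; \<open>diagonal_cauchy\<close> removes this.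
The finite index \<open>i\<close> carries the coefficients of a form.\<close>
lemma rellich:
  fixes f :: "nat \<Rightarrow> 'i::finite \<Rightarrow> 'a::euclidean_space \<Rightarrow> complex"
  assumes fi: "\<And>k i. integrable lborel (f k i)" and supp: "\<And>k i x. norm x > R \<Longrightarrow> f k i x = 0" and R: "R \<ge> 0"
    and bd: "\<And>k i. nn2 (f k i) \<le> ennreal C" and C: "C \<ge> 0"
    and tr: "\<And>k i h. nn2 (\<lambda>x. f k i (x + h) - f k i x) \<le> ennreal (K * (norm h)\<^sup>2)" and K: "K \<ge> 0" and E: "E > 0"
  shows "\<exists>r::nat \<Rightarrow> nat. strict_mono r \<and> (\<forall>k l i. nn2 (\<lambda>x. f (r k) i x - f (r l) i x) \<le> ennreal E)"
proof -
  have [measurable]: "f k i \<in> borel_measurable borel" for k i using borel_measurable_integrable[OF fi] by simp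
  \<comment> \<open>translations by less than \<open>\<delta>\<close> cost at most \<open>K \<delta>\<^sup>2 \<le> E / 16\<close>, and the support grows by at most \<open>1\<close>\<close>
  define \<delta> where "\<delta> = min 1 (sqrt (E / (16 * (K + 1))))"
  have d: "\<delta> > 0" "\<delta> \<le> 1" using E K by (auto simp: \<delta>_def)
  have "\<delta>\<^sup>2 \<le> (sqrt (E / (16 * (K + 1))))\<^sup>2" using d by (intro power_mono) (auto simp: \<delta>_def)
  then have d2: "\<delta>\<^sup>2 \<le> E / (16 * (K + 1))" using E K by simp
  then have Kd: "K * \<delta>\<^sup>2 \<le> E / 16"
  proof -
    have "K * \<delta>\<^sup>2 \<le> K * (E / (16 * (K + 1)))" using d2 K by (intro mult_left_mono) auto
    also have "\<dots> \<le> E / 16" using E K by (simp add: field_simps)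
    finally show ?thesis .
  qed
  obtain \<rho> :: "'a \<Rightarrow> real" where m: "mollifier \<delta> \<rho>" using mollifier_exists[OF d(1)] by blast
  define \<eta> where "\<eta> x = complex_of_real (\<rho> x)" for x
  have t: "test_function \<eta>" and ez: "\<And>x. norm x \<ge> \<delta> \<Longrightarrow> \<eta> x = 0" using m by (auto simp: mollifier_def \<eta>_def[abs_def])
  define c where "c k i = conv (f k i) \<eta>" for k i
  have c1: "nn2 (\<lambda>z. c k i z - f k i z) \<le> ennreal (E/16)" for k i
    unfolding c_def \<eta>_def[abs_def]
  proof (rule moll_conv_diff_le[OF m fi])
    fix h :: 'a assume "norm h \<le> \<delta>"
    then have "K * (norm h)\<^sup>2 \<le> E / 16" using Kd K by (smt (verit) mult_left_mono norm_ge_zero power_mono)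
    then show "nn2 (\<lambda>x. f k i (x + h) - f k i x) \<le> ennreal (E/16)" using tr order_trans ennreal_leI by meson
  qed
  have cz: "c k i z = 0" if "norm z > R + 1" for k i z
    unfolding c_def by (rule conv_eq_0[where R=R and \<delta>=\<delta>]) (use supp ez that d in auto)
  have cm [measurable]: "c k i \<in> borel_measurable borel" for k i
    unfolding c_def by (rule borel_measurable_C_k[OF C_k_conv[OF fi t, where k=0]])
  define V where "V = measure lborel (cball (0::'a) R)"
  define C1 where "C1 = V + C"
  have C10: "C1 \<ge> 0" by (simp add: C1_def V_def C)
  have L1: "(LINT w|lborel. cmod (f k i w)) \<le> C1" for k i
  proof -
    have "ennreal (LINT w|lborel. cmod (f k i w)) = (\<integral>\<^sup>+w. ennreal (cmod (f k i w)) \<partial>lborel)"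
      using nn_integral_eq_integral[OF integrable_norm[OF fi[of k i]]] by simp
    also have "\<dots> \<le> (\<integral>\<^sup>+w. indicator (cball (0::'a) R) w + ennreal ((cmod (f k i w))\<^sup>2) \<partial>lborel)"
    proof (intro nn_integral_mono)
      fix w
      have "cmod (f k i w) \<le> 1 + (cmod (f k i w))\<^sup>2" using zero_le_power2[of "cmod (f k i w) - 1"] by (simp add: power2_diff)  (smt (verit) zero_le_power2)
      then have "ennreal (cmod (f k i w)) \<le> 1 + ennreal ((cmod (f k i w))\<^sup>2)"
        by (metis ennreal_1 ennreal_leI ennreal_plus zero_le_one zero_le_power2)
      then show "ennreal (cmod (f k i w)) \<le> indicator (cball 0 R) w + ennreal ((cmod (f k i w))\<^sup>2)"
        using supp[of w k i] by (cases "norm w > R") (auto simp: indicator_def)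
    qed
    also have "\<dots> = emeasure lborel (cball (0::'a) R) + nn2 (f k i)" unfolding nn2_def by (subst nn_integral_add) (auto intro!: borel_measurable_indicator)
    also have "\<dots> \<le> ennreal V + ennreal C"
      using emeasure_eq_ennreal_measure[of lborel "cball (0::'a) R"] emeasure_lborel_cball_finite[of "0::'a" R] bd[of k i]
      by (intro add_mono) (auto simp: V_def)
    also have "\<dots> = ennreal C1" by (simp add: C1_def C V_def)
    finally show ?thesis using C10 by simp
  qed
  obtain B where B: "B \<ge> 0" "\<And>x. norm (\<eta> x) \<le> B" using test_function_bound[OF t] by metis
  obtain L where L: "L \<ge> 0" "\<And>x y. norm (\<eta> x - \<eta> y) \<le> L * norm (x - y)"
    using C_1_Lipschitz[OF test_function_C_k[OF t] test_function_bounded[OF t]] by metis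
  have int: "integrable lborel (\<lambda>w. f k i w * \<eta> (w - z))" for k i z
    by (intro integrable_mult_test fi test_function_shift t)
  have cb: "norm (c k i z) \<le> C1 * B" for k i z
  proof -
    have "norm (c k i z) \<le> (LINT w|lborel. cmod (f k i w) * B)" unfolding c_def conv_def
      by (rule Bochner_Integration.integral_norm_bound_integral) (auto simp: int fi norm_mult intro: mult_left_mono B)
    also have "\<dots> \<le> C1 * B" using L1[of k i] B by (simp add: mult_right_mono)
    finally show ?thesis .
  qed
  have cl: "norm (c k i z - c k i z') \<le> C1 * L * norm (z - z')" for k i z z'
  proof -
    have "c k i z - c k i z' = (LINT w|lborel. f k i w * (\<eta> (w - z) - \<eta> (w - z')))"
      by (simp add: c_def conv_def int right_diff_distrib)
    also have "norm \<dots> \<le> (LINT w|lborel. cmod (f k i w) * (L * norm (z - z')))"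
    proof (rule Bochner_Integration.integral_norm_bound_integral)
      show "integrable lborel (\<lambda>w. f k i w * (\<eta> (w - z) - \<eta> (w - z')))" by (simp add: right_diff_distrib int)
      show "norm (f k i w * (\<eta> (w - z) - \<eta> (w - z'))) \<le> cmod (f k i w) * (L * norm (z - z'))" for w
        using L(2)[of "w - z" "w - z'"] by (simp add: norm_mult mult_left_mono norm_minus_commute)
    qed (simp add: fi)
    also have "\<dots> \<le> C1 * (L * norm (z - z'))" using L1[of k i] L by (simp add: mult_right_mono)
    finally show ?thesis by (simp add: mult_ac)
  qed
  define F :: "nat \<Rightarrow> 'a \<Rightarrow> complex ^ 'i" where "F k z = (\<chi> i. c k i z)" for k z
  have vl: "norm (x :: complex ^ 'i) \<le> real CARD('i) * e" if "\<And>i. norm (x $ i) \<le> e" for x e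
    unfolding norm_vec_def by (rule order_trans[OF L2_set_le_sum]) (use sum_bounded_above[of UNIV "\<lambda>i. norm (x $ i)" e] that in auto)
  obtain g r where r: "strict_mono (r :: nat \<Rightarrow> nat)"
    and conv: "\<And>e. 0 < e \<Longrightarrow> \<exists>N. \<forall>n x. n \<ge> N \<and> x \<in> cball 0 (R+1) \<longrightarrow> norm (F (r n) x - g x) < e"
  proof (rule Arzela_Ascoli[of "cball 0 (R+1)" F "real CARD('i) * (C1 * B)"])
    show "norm (F n x) \<le> real CARD('i) * (C1 * B)" for n x by (rule vl) (simp add: F_def cb)
    fix x and e :: real assume e: "0 < e"
    define M where "M = real CARD('i) * (C1 * L)"
    have M: "M \<ge> 0" using C10 L by (simp add: M_def)
    have "norm (F n x - F n y) < e" if "norm (x - y) < e / (M + 1)" for n y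
    proof -
      have "norm (F n x - F n y) \<le> real CARD('i) * (C1 * L * norm (x - y))" by (rule vl) (simp add: F_def cl)
      also have "\<dots> = M * norm (x - y)" by (simp add: M_def)
      also have "\<dots> \<le> (M + 1) * norm (x - y)" by (simp add: mult_right_mono)
      also have "\<dots> < e" using that M by (simp add: field_simps)
      finally show ?thesis .
    qed
    then show "\<exists>d. 0 < d \<and> (\<forall>n y. y \<in> cball 0 (R+1) \<and> norm (x - y) < d \<longrightarrow> norm (F n x - F n y) < e)"
      using e M by (intro exI[of _ "e / (M + 1)"]) auto
  qed (auto)
  define V' where "V' = measure lborel (cball (0::'a) (R+1))"
  define e where "e = sqrt (E / (16 * (V' + 1)))"
  have V': "V' \<ge> 0" by (simp add: V'_def)
  have e: "e > 0" using E V' by (simp add: e_def)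
  have eV: "e\<^sup>2 * V' \<le> E / 16"
  proof -
    have "e\<^sup>2 * V' \<le> e\<^sup>2 * (V' + 1)" by (intro mult_left_mono) auto
    moreover have "e\<^sup>2 = E / (16 * (V' + 1))" using E V' by (simp add: e_def)
    moreover have "E / (16 * (V' + 1)) * (V' + 1) = E / 16" using V' by (simp add: field_simps)
    ultimately show ?thesis by metis
  qed
  obtain N where N: "\<And>n x. n \<ge> N \<Longrightarrow> x \<in> cball 0 (R+1) \<Longrightarrow> norm (F (r n) x - g x) < e / 2"
    using conv[of "e/2"] e by auto
  define s where "s n = r (n + N)" for n
  have s: "strict_mono s" using r by (auto simp: s_def strict_mono_def)
  have cc: "nn2 (\<lambda>z. c (s k) i z - c (s l) i z) \<le> ennreal (E/16)" for k l i
  proof (rule order_trans[OF nn2_le_bounded[where R="R+1" and e=e]])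
    show "norm (c (s k) i x - c (s l) i x) \<le> e" for x
    proof (cases "norm x > R + 1")
      case True then show ?thesis using cz e by simp
    next
      case False
      then have "norm (F (s k) x - g x) < e/2" "norm (F (s l) x - g x) < e/2" using N by (auto simp: s_def)
      then have "norm (F (s k) x - F (s l) x) < e" by (metis dist_norm dist_triangle_half_r dist_commute)
      moreover have "norm (c (s k) i x - c (s l) i x) \<le> norm (F (s k) x - F (s l) x)"
        using Finite_Cartesian_Product.norm_nth_le[of "F (s k) x - F (s l) x" i] by (simp add: F_def)
      ultimately show ?thesis by linarith
    qed
  qed (use cz R eV in \<open>auto simp: V'_def intro!: ennreal_leI\<close>)
  have "nn2 (\<lambda>x. f (s k) i x - f (s l) i x) \<le> ennreal E" for k l i
  proof -
    have "nn2 (\<lambda>x. f (s k) i x - f (s l) i x) = nn2 (\<lambda>x. (f (s k) i x - c (s k) i x) + ((c (s k) i x - c (s l) i x) + (c (s l) i x - f (s l) i x)))"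
      by simp
    also have "\<dots> \<le> 2 * nn2 (\<lambda>x. f (s k) i x - c (s k) i x) + 2 * nn2 (\<lambda>x. (c (s k) i x - c (s l) i x) + (c (s l) i x - f (s l) i x))"
      by (rule nn2_add_le) measurable
    also have "\<dots> \<le> 2 * nn2 (\<lambda>x. f (s k) i x - c (s k) i x) + 2 * (2 * nn2 (\<lambda>x. c (s k) i x - c (s l) i x) + 2 * nn2 (\<lambda>x. c (s l) i x - f (s l) i x))"
      by (intro add_left_mono mult_left_mono nn2_add_le) auto
    also have "\<dots> \<le> 2 * ennreal (E/16) + 2 * (2 * ennreal (E/16) + 2 * ennreal (E/16))"
      by (intro add_mono mult_left_mono c1 cc order_trans[OF eq_refl[OF nn2_minus_commute] c1]) auto
    also have "\<dots> = ennreal (2 * (E/16) + 2 * (2 * (E/16) + 2 * (E/16)))"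
      using E by (simp add: ennreal_numeral_mult ennreal_plus[symmetric] del: ennreal_plus)
    also have "\<dots> \<le> ennreal E" using E by (intro ennreal_leI) simp
    finally show ?thesis .
  qed
  then show ?thesis using s by (intro exI[of _ s] conjI allI)
qed

section \<open>Riesz representation and weighted square-integrable functions\<close>

lemma cnj_of_real_measurable [measurable]: "cnj \<in> borel_measurable borel" "complex_of_real \<in> borel_measurable borel"
  by (intro borel_measurable_continuous_onI continuous_intros)+

text \<open>A real semi-inner product on a set. The linear combinations are a parameter, because the vectors will
be forms and triples of forms, whose types carry no vector space structure. The product is only
semidefinite, because functions that vanish almost everywhere are not identified with zero.\<close>
locale semi_inner =
  fixes V :: "'v set" and lc :: "real \<Rightarrow> 'v \<Rightarrow> real \<Rightarrow> 'v \<Rightarrow> 'v" and B :: "'v \<Rightarrow> 'v \<Rightarrow> real"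
  assumes closed: "u \<in> V \<Longrightarrow> v \<in> V \<Longrightarrow> lc a u b v \<in> V"
    and lin: "u \<in> V \<Longrightarrow> v \<in> V \<Longrightarrow> w \<in> V \<Longrightarrow> B (lc a u b v) w = a * B u w + b * B v w"
    and sym: "u \<in> V \<Longrightarrow> v \<in> V \<Longrightarrow> B u v = B v u"
    and pos: "u \<in> V \<Longrightarrow> 0 \<le> B u u"
begin

lemma lin2: "u \<in> V \<Longrightarrow> v \<in> V \<Longrightarrow> w \<in> V \<Longrightarrow> B w (lc a u b v) = a * B w u + b * B w v"
  using lin sym closed by metis

lemma expand: "u \<in> V \<Longrightarrow> v \<in> V \<Longrightarrow> B (lc a u b v) (lc a u b v) = a\<^sup>2 * B u u + 2 * a * b * B u v + b\<^sup>2 * B v v"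
  by (simp add: lin lin2 closed sym[of v u] power2_eq_square algebra_simps)

lemma cauchy_schwarz: assumes "u \<in> V" "v \<in> V" shows "(B u v)\<^sup>2 \<le> B u u * B v v"
proof (cases "B v v = 0")
  case False
  have "0 \<le> (B v v)\<^sup>2 * B u u + 2 * B v v * (- B u v) * B u v + (- B u v)\<^sup>2 * B v v"
    using pos[OF closed[OF assms, of "B v v" "- B u v"]] expand[OF assms] by metis
  also have "\<dots> = B v v * (B u u * B v v - (B u v)\<^sup>2)" by (simp add: power2_eq_square algebra_simps)
  finally show ?thesis using pos[OF assms(2)] False by (simp add: zero_le_mult_iff)
next
  case True
  have "B u v = 0"
  proof (rule ccontr)
    assume nz: "B u v \<noteq> 0"
    \<comment> \<open>a multiple of \<open>v\<close> that would make the squared norm of \<open>u + t v\<close> negative\<close>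
    define t where "t = - (B u u + 1) / (2 * B u v)"
    have "0 \<le> B u u + 2 * t * B u v" using pos[OF closed[OF assms, of 1 t]] expand[OF assms, of 1 t] True by simp
    also have "\<dots> = - 1" using nz by (simp add: t_def field_simps)
    finally show False by simp
  qed
  with True show ?thesis by simp
qed

text \<open>A minimising sequence of the functional \<open>J u = B u u - 2 F u\<close> is Cauchy by the parallelogram law; its limit
minimises \<open>J\<close>, and the vanishing of the first variation is the representation of \<open>F\<close>. Completeness
enters as a hypothesis in the form that it takes for a semi-inner product.\<close>
lemma riesz:
  assumes ne: "V \<noteq> {}"
    and complete: "\<And>x. (\<And>n. x n \<in> V) \<Longrightarrow>
      (\<And>e. e > 0 \<Longrightarrow> \<exists>M. \<forall>m\<ge>M. \<forall>n\<ge>M. B (lc 1 (x m) (-1) (x n)) (lc 1 (x m) (-1) (x n)) < e) \<Longrightarrow>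
      \<exists>l\<in>V. (\<lambda>n. B (lc 1 (x n) (-1) l) (lc 1 (x n) (-1) l)) \<longlonglongrightarrow> 0"
    and Flin: "\<And>a u b v. u \<in> V \<Longrightarrow> v \<in> V \<Longrightarrow> F (lc a u b v) = a * F u + b * F v"
    and Fb: "\<And>u. u \<in> V \<Longrightarrow> (F u)\<^sup>2 \<le> C * B u u" and C0: "0 \<le> C"
  shows "\<exists>u\<in>V. \<forall>v\<in>V. B u v = F v"
proof -
  define J where "J u = B u u - 2 * F u" for u
  have Jlow: "- C \<le> J u" if "u \<in> V" for u
  proof -
    have "2 * F u \<le> B u u + C"
    proof -
      have "(2 * F u)\<^sup>2 \<le> 4 * (C * B u u)" using Fb[OF that] by (simp add: power_mult_distrib)
      also have "\<dots> \<le> (B u u + C)\<^sup>2" using zero_le_power2[of "B u u - C"] by (simp add: power2_eq_square algebra_simps)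
      finally show ?thesis using C0 pos[OF that] by (meson power2_le_imp_le add_nonneg_nonneg)
    qed
    then show ?thesis by (simp add: J_def)
  qed
  define d where "d = Inf (J ` V)"
  have bb: "bdd_below (J ` V)" using Jlow by (intro bdd_belowI2[of V "- C" J]) auto
  have dle: "d \<le> J u" if "u \<in> V" for u unfolding d_def using bb that by (auto intro: cInf_lower)
  have "\<exists>u\<in>V. J u < d + 1 / real (Suc n)" for n
    using cInf_lessD[of "J ` V" "d + 1 / real (Suc n)"] ne by (auto simp: d_def)
  then obtain x where x: "\<And>n. x n \<in> V" "\<And>n. J (x n) < d + 1 / real (Suc n)" by metis
  have J_par: "B (lc 1 u (-1) v) (lc 1 u (-1) v) = 2 * J u + 2 * J v - 4 * J (lc (1/2) u (1/2) v)" if "u \<in> V" "v \<in> V" for u v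
    using that by (simp add: J_def expand Flin power2_eq_square algebra_simps)
  have par: "B (lc 1 (x m) (-1) (x n)) (lc 1 (x m) (-1) (x n)) \<le> 2 / real (Suc m) + 2 / real (Suc n)" for m n
    using J_par[OF x(1) x(1), of m n] dle[OF closed[OF x(1) x(1), of "1/2" m "1/2" n]] x(2)[of m] x(2)[of n]
    by (simp del: of_nat_Suc)
  have "\<exists>l\<in>V. (\<lambda>n. B (lc 1 (x n) (-1) l) (lc 1 (x n) (-1) l)) \<longlonglongrightarrow> 0"
  proof (rule complete[OF x(1)])
    fix e :: real assume e: "e > 0"
    obtain M where M: "real M > 4 / e" using reals_Archimedean2 by blast
    then have M0: "real M > 0" using e by (smt (verit) divide_pos_pos)
    have "B (lc 1 (x m) (-1) (x n)) (lc 1 (x m) (-1) (x n)) < e" if "m \<ge> M" "n \<ge> M" for m n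
    proof -
      have "2 / real (Suc m) < 2 / real M" "2 / real (Suc n) < 2 / real M"
        using that M0 by (auto intro!: divide_strict_left_mono)
      moreover have "4 / real M < e" using M M0 e by (simp add: field_simps)
      ultimately show ?thesis using par[of m n] by linarith
    qed
    then show "\<exists>M. \<forall>m\<ge>M. \<forall>n\<ge>M. B (lc 1 (x m) (-1) (x n)) (lc 1 (x m) (-1) (x n)) < e" by blast
  qed
  then obtain l where l: "l \<in> V" "(\<lambda>n. B (lc 1 (x n) (-1) l) (lc 1 (x n) (-1) l)) \<longlonglongrightarrow> 0" by blast
  define h where "h n = lc 1 (x n) (-1) l" for n
  have hV: "h n \<in> V" for n unfolding h_def by (intro closed x l)
  have h0: "(\<lambda>n. B (h n) (h n)) \<longlonglongrightarrow> 0" using l by (simp add: h_def)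
  have null: "(\<lambda>n. G (h n)) \<longlonglongrightarrow> 0" if G: "\<And>u. u \<in> V \<Longrightarrow> (G u)\<^sup>2 \<le> K * B u u" for G K
  proof -
    have "(\<lambda>n. (G (h n))\<^sup>2) \<longlonglongrightarrow> 0"
      by (rule tendsto_sandwich[of "\<lambda>_. 0" _ _ "\<lambda>n. K * B (h n) (h n)"])
         (use G hV h0 tendsto_mult_right_zero in auto)
    then have "(\<lambda>n. sqrt ((G (h n))\<^sup>2)) \<longlonglongrightarrow> sqrt 0" by (rule tendsto_real_sqrt)
    then show ?thesis by (simp add: tendsto_rabs_zero_iff)
  qed
  have Jx: "J (x n) = J l + 2 * B l (h n) - 2 * F (h n) + B (h n) (h n)" for n
    using x(1)[of n] l(1) by (simp add: J_def h_def expand Flin lin2 sym[of l "x n"] algebra_simps)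
  have "(\<lambda>n. J (x n)) \<longlonglongrightarrow> J l + 2 * 0 - 2 * 0 + 0"
    unfolding Jx by (intro tendsto_intros h0 null[of "\<lambda>u. B l u" "B l l"] null[of F C] Fb) (use cauchy_schwarz l in auto)
  moreover have "(\<lambda>n. J (x n)) \<longlonglongrightarrow> d"
    by (rule real_tendsto_sandwich[of "\<lambda>_. d" _ _ "\<lambda>n. d + 1 / real (Suc n)"])
       (auto intro!: always_eventually less_imp_le x dle LIMSEQ_inverse_real_of_nat_add[of d, unfolded inverse_eq_divide] simp del: of_nat_Suc)
  ultimately have Jl: "J l = d" using LIMSEQ_unique by fastforce
  have "B l v = F v" if v: "v \<in> V" for v
  proof -
    define D where "D = B l v - F v"
    have q: "0 \<le> 2 * t * D + t\<^sup>2 * B v v" for t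
    proof -
      have "J (lc 1 l t v) = J l + 2 * t * D + t\<^sup>2 * B v v"
        using l(1) v by (simp add: J_def D_def expand Flin algebra_simps)
      then show ?thesis using dle[OF closed[OF l(1) v, of 1 t]] Jl by simp
    qed
    define b where "b = B v v + 1"
    have b: "b > 0" "B v v < b" using pos[OF v] by (auto simp: b_def)
    have "0 \<le> 2 * (- D / b) * D + (- D / b)\<^sup>2 * B v v" by (rule q)
    also have "\<dots> \<le> 2 * (- D / b) * D + (- D / b)\<^sup>2 * b" using b by (intro add_left_mono mult_left_mono) auto
    also have "\<dots> = - (D\<^sup>2 / b)" using b by (simp add: field_simps power2_eq_square)
    finally have "D\<^sup>2 \<le> 0" using b by (simp add: divide_le_0_iff)
    then show ?thesis by (simp add: D_def)
  qed
  with l(1) show ?thesis by blast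
qed

end

locale weight =
  fixes \<phi> :: "complex ^ 'n::{finite,linorder} \<Rightarrow> real"
  assumes phi_cont: "continuous_on UNIV \<phi>"
begin

lemma phi_measurable [measurable]: "\<phi> \<in> borel_measurable borel"
  using phi_cont by (rule borel_measurable_continuous_onI)

lemma L2_measurable: "f \<in> L2 \<phi> \<Longrightarrow> f \<in> borel_measurable borel" by (simp add: L2_def)

lemma L2_add: assumes "f \<in> L2 \<phi>" "g \<in> L2 \<phi>" shows "(\<lambda>z. f z + g z) \<in> L2 \<phi>"
proof -
  note [measurable] = assms[THEN L2_measurable]
  have "integrable lborel (\<lambda>z. (cmod (f z + g z))\<^sup>2 * exp (- \<phi> z))"
  proof (rule Bochner_Integration.integrable_bound)
    show "integrable lborel (\<lambda>z. 2 * ((cmod (f z))\<^sup>2 * exp (- \<phi> z)) + 2 * ((cmod (g z))\<^sup>2 * exp (- \<phi> z)))"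
      using assms by (simp add: L2_def)
    have "(cmod (f z + g z))\<^sup>2 * exp (- \<phi> z) \<le> 2 * ((cmod (f z))\<^sup>2 * exp (- \<phi> z)) + 2 * ((cmod (g z))\<^sup>2 * exp (- \<phi> z))" for z
      using mult_right_mono[OF sq_norm_add_le[of "f z" "g z"], of "exp (- \<phi> z)"] by (simp add: algebra_simps)
    then show "AE z in lborel. norm ((cmod (f z + g z))\<^sup>2 * exp (- \<phi> z)) \<le> norm (2 * ((cmod (f z))\<^sup>2 * exp (- \<phi> z)) + 2 * ((cmod (g z))\<^sup>2 * exp (- \<phi> z)))"
      by (intro AE_I2) (smt (verit) real_norm_def zero_le_mult_iff exp_ge_zero zero_le_power2)
  qed measurable
  then show ?thesis by (simp add: L2_def)
qed

lemma L2_cmult: assumes "f \<in> L2 \<phi>" shows "(\<lambda>z. c * f z) \<in> L2 \<phi>"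
  using assms by (auto simp: L2_def norm_mult power_mult_distrib mult.assoc)

lemma L2_0 [simp]: "(\<lambda>z. 0) \<in> L2 \<phi>" by (simp add: L2_def)

lemma L2_diff: "f \<in> L2 \<phi> \<Longrightarrow> g \<in> L2 \<phi> \<Longrightarrow> (\<lambda>z. f z - g z) \<in> L2 \<phi>"
  using L2_add[of f "\<lambda>z. -1 * g z"] L2_cmult[of g "-1"] by simp

lemma L2_sum: "(\<And>i. i \<in> I \<Longrightarrow> f i \<in> L2 \<phi>) \<Longrightarrow> (\<lambda>z. \<Sum>i\<in>I. f i z) \<in> L2 \<phi>"
  by (induction I rule: infinite_finite_induct) (auto intro: L2_add)

lemma L2_bounded_mult:
  assumes f: "f \<in> L2 \<phi>" and [measurable]: "g \<in> borel_measurable borel" and b: "\<And>z. cmod (g z) \<le> B"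
  shows "(\<lambda>z. g z * f z) \<in> L2 \<phi>"
proof -
  note [measurable] = f[THEN L2_measurable]
  have "integrable lborel (\<lambda>z. (cmod (g z * f z))\<^sup>2 * exp (- \<phi> z))"
  proof (rule Bochner_Integration.integrable_bound)
    show "integrable lborel (\<lambda>z. B\<^sup>2 * ((cmod (f z))\<^sup>2 * exp (- \<phi> z)))"
      using f by (simp add: L2_def)
    have "(cmod (g z * f z))\<^sup>2 * exp (- \<phi> z) \<le> B\<^sup>2 * ((cmod (f z))\<^sup>2 * exp (- \<phi> z))" for z
      using power_mono[OF b[of z], of 2] by (simp add: norm_mult power_mult_distrib mult_right_mono mult.assoc)
    then show "AE z in lborel. norm ((cmod (g z * f z))\<^sup>2 * exp (- \<phi> z)) \<le> norm (B\<^sup>2 * ((cmod (f z))\<^sup>2 * exp (- \<phi> z)))"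
      by simp
  qed measurable
  then show ?thesis by (simp add: L2_def)
qed

lemma L2_compact_support:
  assumes "continuous_on UNIV f" "bounded {z. f z \<noteq> 0}" shows "f \<in> L2 \<phi>"
proof -
  have "integrable lborel (\<lambda>z. (cmod (f z))\<^sup>2 * exp (- \<phi> z))"
    using assms phi_cont by (intro integrable_compact_support continuous_intros) (auto elim: bounded_subset)
  then show ?thesis using assms borel_measurable_continuous_onI by (auto simp: L2_def)
qed

lemma inner_integrable:
  assumes f: "f \<in> L2 \<phi>" and g: "g \<in> L2 \<phi>"
  shows "integrable lborel (\<lambda>z. f z * cnj (g z) * complex_of_real (exp (- \<phi> z)))"
proof (rule Bochner_Integration.integrable_bound)
  note [measurable] = f[THEN L2_measurable] g[THEN L2_measurable]
  show "(\<lambda>z. f z * cnj (g z) * complex_of_real (exp (- \<phi> z))) \<in> borel_measurable lborel" by measurable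
  show "integrable lborel (\<lambda>z. (cmod (f z))\<^sup>2 * exp (- \<phi> z) + (cmod (g z))\<^sup>2 * exp (- \<phi> z))"
    using f g by (simp add: L2_def)
  have "cmod (f z * cnj (g z) * complex_of_real (exp (- \<phi> z))) \<le> (cmod (f z))\<^sup>2 * exp (- \<phi> z) + (cmod (g z))\<^sup>2 * exp (- \<phi> z)" for z
  proof -
    have "cmod (f z) * cmod (g z) \<le> (cmod (f z))\<^sup>2 + (cmod (g z))\<^sup>2"
      using sum_squares_bound[of "cmod (f z)" "cmod (g z)"] mult_nonneg_nonneg[OF norm_ge_zero[of "f z"] norm_ge_zero[of "g z"]] by linarith
    then have "cmod (f z) * cmod (g z) * exp (- \<phi> z) \<le> ((cmod (f z))\<^sup>2 + (cmod (g z))\<^sup>2) * exp (- \<phi> z)"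
      by (rule mult_right_mono) simp
    then show ?thesis by (simp only: norm_mult complex_mod_cnj norm_of_real abs_exp_cancel distrib_right)
  qed
  note le = this
  show "AE z in lborel. norm (f z * cnj (g z) * complex_of_real (exp (- \<phi> z))) \<le> norm ((cmod (f z))\<^sup>2 * exp (- \<phi> z) + (cmod (g z))\<^sup>2 * exp (- \<phi> z))"
    by (intro AE_I2 order_trans[OF le]) simp
qed

lemma inner_add_left: "f \<in> L2 \<phi> \<Longrightarrow> g \<in> L2 \<phi> \<Longrightarrow> h \<in> L2 \<phi> \<Longrightarrow>
   inner_L2 \<phi> (\<lambda>z. f z + g z) h = inner_L2 \<phi> f h + inner_L2 \<phi> g h"
  unfolding inner_L2_def using inner_integrable by (simp add: distrib_right Bochner_Integration.integral_add)

lemma inner_cmult_left: "inner_L2 \<phi> (\<lambda>z. c * f z) h = c * inner_L2 \<phi> f h"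
  by (simp add: inner_L2_def mult.assoc)

lemma inner_commute: "inner_L2 \<phi> g f = cnj (inner_L2 \<phi> f g)"
  unfolding inner_L2_def Bochner_Integration.integral_cnj[symmetric] by (rule Bochner_Integration.integral_cong) simp_all

lemma inner_sum_left: "finite I \<Longrightarrow> (\<And>i. i \<in> I \<Longrightarrow> f i \<in> L2 \<phi>) \<Longrightarrow> h \<in> L2 \<phi> \<Longrightarrow>
   inner_L2 \<phi> (\<lambda>z. \<Sum>i\<in>I. f i z) h = (\<Sum>i\<in>I. inner_L2 \<phi> (f i) h)"
proof (induction I rule: finite_induct)
  case empty then show ?case by (simp add: inner_L2_def)
next
  case (insert i I) then show ?case by (simp add: inner_add_left L2_sum)
qed

text \<open>The squared norm of the weighted space; it is zero by convention for functions that are not square-integrable.\<close>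
definition n2 :: "((complex, 'n) vec \<Rightarrow> complex) \<Rightarrow> real" where
  "n2 f = (LINT z|lborel. (cmod (f z))\<^sup>2 * exp (- \<phi> z))"

lemma n2_nonneg: "0 \<le> n2 f" by (simp add: n2_def)

lemma inner_self: "inner_L2 \<phi> f f = complex_of_real (n2 f)"
proof -
  have "f z * cnj (f z) * complex_of_real (exp (- \<phi> z)) = complex_of_real ((cmod (f z))\<^sup>2 * exp (- \<phi> z))" for z
    by (simp only: of_real_mult complex_norm_square)
  then show ?thesis unfolding inner_L2_def n2_def by (simp only: integral_complex_of_real)
qed

lemma n2_ennreal: assumes "f \<in> L2 \<phi>" shows "ennreal (n2 f) = (\<integral>\<^sup>+z. ennreal ((cmod (f z))\<^sup>2 * exp (- \<phi> z)) \<partial>lborel)"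
  unfolding n2_def using assms by (intro nn_integral_eq_integral[symmetric]) (auto simp: L2_def)

lemma L2_I_nn: assumes [measurable]: "f \<in> borel_measurable borel" and "(\<integral>\<^sup>+z. ennreal ((cmod (f z))\<^sup>2 * exp (- \<phi> z)) \<partial>lborel) \<le> ennreal E" and "E \<ge> 0"
  shows "f \<in> L2 \<phi>" "n2 f \<le> E"
proof -
  have "integrable lborel (\<lambda>z. (cmod (f z))\<^sup>2 * exp (- \<phi> z))"
    by (rule integrableI_nonneg) (use assms(2) in \<open>auto intro: le_less_trans\<close>)
  then show "f \<in> L2 \<phi>" by (simp add: L2_def)
  from n2_ennreal[OF this] assms show "n2 f \<le> E" by (metis ennreal_le_iff)
qed

text \<open>The argument of Riesz and Fischer: along a rapidly converging subsequence the differences are summable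
almost everywhere, and Fatou's lemma identifies the pointwise limit as the limit in the mean.\<close>
lemma L2_complete:
  assumes f: "\<And>k. f k \<in> L2 \<phi>" and C: "\<And>e. e > 0 \<Longrightarrow> \<exists>M. \<forall>k\<ge>M. \<forall>l\<ge>M. n2 (\<lambda>z. f k z - f l z) < e"
  shows "\<exists>w\<in>L2 \<phi>. (\<lambda>k. n2 (\<lambda>z. f k z - w z)) \<longlonglongrightarrow> 0"
proof -
  note [measurable] = f[THEN L2_measurable]
  have "\<exists>M. \<forall>k\<ge>M. \<forall>l\<ge>M. n2 (\<lambda>z. f k z - f l z) < (1/4)^j" for j by (rule C) simp
  then obtain M where M: "\<And>j k l. k \<ge> M j \<Longrightarrow> l \<ge> M j \<Longrightarrow> n2 (\<lambda>z. f k z - f l z) < (1/4)^j" by metis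
  define r where "r j = j + Max (M ` {..j})" for j
  have "M j \<le> Max (M ` {..j})" for j by (intro Max_ge) auto
  then have rM: "r j \<ge> M j" for j by (simp add: r_def trans_le_add2)
  have rj: "r j \<ge> j" for j by (simp add: r_def)
  have rmono: "r j \<le> r (Suc j)" for j unfolding r_def by (intro add_mono Max_mono) auto
  define g where "g j = f (r j)" for j
  have gL: "g j \<in> L2 \<phi>" for j by (simp add: g_def f)
  have [measurable]: "g j \<in> borel_measurable borel" for j using gL by (rule L2_measurable)
  have gd: "n2 (\<lambda>z. g (Suc j) z - g j z) < (1/4)^j" for j
    unfolding g_def using rM[of j] rmono[of j] by (intro M) auto
  have "(\<integral>\<^sup>+z. (\<Sum>j. ennreal (2^j * ((cmod (g (Suc j) z - g j z))\<^sup>2 * exp (- \<phi> z)))) \<partial>lborel) =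
     (\<Sum>j. \<integral>\<^sup>+z. ennreal (2^j * ((cmod (g (Suc j) z - g j z))\<^sup>2 * exp (- \<phi> z))) \<partial>lborel)"
    by (rule nn_integral_suminf) measurable
  also have "\<dots> = (\<Sum>j. ennreal (2^j * n2 (\<lambda>z. g (Suc j) z - g j z)))"
    by (intro suminf_cong) (simp add: ennreal_mult n2_nonneg nn_integral_cmult n2_ennreal L2_diff gL)
  also have "\<dots> \<le> (\<Sum>j. ennreal ((1/2)^j))"
  proof (intro suminf_le ennreal_leI)
    fix j
    have "2^j * n2 (\<lambda>z. g (Suc j) z - g j z) \<le> 2^j * (1/4)^j" using gd[of j] by (intro mult_left_mono) auto
    also have "\<dots> = (1/2)^j" by (simp add: power_mult_distrib[symmetric])
    finally show "2^j * n2 (\<lambda>z. g (Suc j) z - g j z) \<le> (1/2)^j" .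
  qed auto
  also have "\<dots> = ennreal (\<Sum>j. (1/2)^j)" by (intro suminf_ennreal2) auto
  also have "\<dots> < \<infinity>" by simp
  finally have "AE z in lborel. (\<Sum>j. ennreal (2^j * ((cmod (g (Suc j) z - g j z))\<^sup>2 * exp (- \<phi> z)))) \<noteq> \<infinity>"
    by (intro nn_integral_PInf_AE) auto
  then have conv: "AE z in lborel. convergent (\<lambda>j. g j z)"
  proof eventually_elim
    fix z assume "(\<Sum>j. ennreal (2^j * ((cmod (g (Suc j) z - g j z))\<^sup>2 * exp (- \<phi> z)))) \<noteq> \<infinity>"
    then have "summable (\<lambda>j. 2^j * ((cmod (g (Suc j) z - g j z))\<^sup>2 * exp (- \<phi> z)))"
      by (intro summable_suminf_not_top) auto
    then have "(\<lambda>j. 2^j * ((cmod (g (Suc j) z - g j z))\<^sup>2 * exp (- \<phi> z))) \<longlonglongrightarrow> 0" by (rule summable_LIMSEQ_zero)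
    then have "Bseq (\<lambda>j. 2^j * ((cmod (g (Suc j) z - g j z))\<^sup>2 * exp (- \<phi> z)))"
      using convergent_imp_Bseq convergentI by blast
    then obtain K where K: "\<And>j. norm (2^j * ((cmod (g (Suc j) z - g j z))\<^sup>2 * exp (- \<phi> z))) \<le> K"
      unfolding Bseq_def by blast
    have "norm (g (Suc j) z - g j z) \<le> sqrt (K * exp (\<phi> z)) * (1 / sqrt 2)^j" for j
    proof -
      have "2^j * (cmod (g (Suc j) z - g j z))\<^sup>2 \<le> K * exp (\<phi> z)"
        using K[of j] by (simp add: exp_minus field_simps)
      then have "(cmod (g (Suc j) z - g j z))\<^sup>2 \<le> K * exp (\<phi> z) * (1/2)^j" by (simp add: field_simps power_divide)
      then have "cmod (g (Suc j) z - g j z) \<le> sqrt (K * exp (\<phi> z) * (1/2)^j)" by (rule real_le_rsqrt)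
      then show ?thesis by (simp only: real_sqrt_mult real_sqrt_power real_sqrt_divide real_sqrt_one)
    qed
    note A = this
    have B: "summable (\<lambda>j. sqrt (K * exp (\<phi> z)) * (1 / sqrt 2)^j)"
      by (intro summable_mult summable_geometric) auto
    have "summable (\<lambda>j. g (Suc j) z - g j z)"
      by (rule summable_comparison_test'[OF B, of 0]) (rule A)
    then have "convergent (\<lambda>n. \<Sum>j<n. g (Suc j) z - g j z)" by (simp add: summable_iff_convergent)
    then have "convergent (\<lambda>n. g n z - g 0 z)" by (simp only: sum_lessThan_telescope[of "\<lambda>n. g n z"])
    then show "convergent (\<lambda>j. g j z)" using convergent_add[OF _ convergent_const[of "g 0 z"]] by fastforce
  qed
  define w where "w z = lim (\<lambda>j. g j z)" for z
  have wm [measurable]: "w \<in> borel_measurable borel" unfolding w_def by (rule borel_measurable_lim_metric) simp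
  have fat: "(\<integral>\<^sup>+z. ennreal ((cmod (f k z - w z))\<^sup>2 * exp (- \<phi> z)) \<partial>lborel) \<le> ennreal e"
    if e: "e > 0" and k: "\<And>l. l \<ge> k \<Longrightarrow> n2 (\<lambda>z. f k z - f l z) < e" for k e
  proof -
    have "(\<integral>\<^sup>+z. ennreal ((cmod (f k z - w z))\<^sup>2 * exp (- \<phi> z)) \<partial>lborel) =
      (\<integral>\<^sup>+z. liminf (\<lambda>j. ennreal ((cmod (f k z - g j z))\<^sup>2 * exp (- \<phi> z))) \<partial>lborel)"
    proof (rule nn_integral_cong_AE)
      show "AE z in lborel. ennreal ((cmod (f k z - w z))\<^sup>2 * exp (- \<phi> z)) = liminf (\<lambda>j. ennreal ((cmod (f k z - g j z))\<^sup>2 * exp (- \<phi> z)))"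
        using conv
      proof eventually_elim
        fix z assume "convergent (\<lambda>j. g j z)"
        then have "(\<lambda>j. g j z) \<longlonglongrightarrow> w z" by (simp add: w_def convergent_LIMSEQ_iff)
        then have "(\<lambda>j. ennreal ((cmod (f k z - g j z))\<^sup>2 * exp (- \<phi> z))) \<longlonglongrightarrow> ennreal ((cmod (f k z - w z))\<^sup>2 * exp (- \<phi> z))"
          by (intro tendsto_ennrealI tendsto_intros)
        then show "ennreal ((cmod (f k z - w z))\<^sup>2 * exp (- \<phi> z)) = liminf (\<lambda>j. ennreal ((cmod (f k z - g j z))\<^sup>2 * exp (- \<phi> z)))"
          using lim_imp_Liminf[OF sequentially_bot] by metis
      qed
    qed
    also have "\<dots> \<le> liminf (\<lambda>j. \<integral>\<^sup>+z. ennreal ((cmod (f k z - g j z))\<^sup>2 * exp (- \<phi> z)) \<partial>lborel)"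
      by (rule nn_integral_liminf) measurable
    also have "\<dots> = liminf (\<lambda>j. ennreal (n2 (\<lambda>z. f k z - g j z)))" by (simp add: n2_ennreal L2_diff gL f)
    also have "\<dots> \<le> ennreal e"
    proof -
      have "\<forall>\<^sub>F j in sequentially. ennreal (n2 (\<lambda>z. f k z - g j z)) \<le> ennreal e"
        unfolding eventually_sequentially g_def
        by (rule exI[of _ k]) (use rj k in \<open>meson ennreal_leI less_imp_le order_trans\<close>)
      then show ?thesis using Liminf_le[of sequentially] by auto
    qed
    finally show ?thesis .
  qed
  have fw: "\<exists>M. \<forall>k\<ge>M. (\<lambda>z. f k z - w z) \<in> L2 \<phi> \<and> n2 (\<lambda>z. f k z - w z) \<le> e" if e: "e > 0" for e
  proof -
    obtain M where M: "\<And>k l. k \<ge> M \<Longrightarrow> l \<ge> M \<Longrightarrow> n2 (\<lambda>z. f k z - f l z) < e" using C[OF e] by blast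
    have "(\<integral>\<^sup>+z. ennreal ((cmod (f k z - w z))\<^sup>2 * exp (- \<phi> z)) \<partial>lborel) \<le> ennreal e" if "k \<ge> M" for k
      using that by (intro fat e M) auto
    then show ?thesis using L2_I_nn[of "\<lambda>z. f _ z - w z" e] e by (intro exI[of _ M]) auto
  qed
  obtain M where "(\<lambda>z. f M z - w z) \<in> L2 \<phi>" using fw[of 1] by auto
  from L2_diff[OF f[of M] this] have "w \<in> L2 \<phi>" by simp
  moreover have "(\<lambda>k. n2 (\<lambda>z. f k z - w z)) \<longlonglongrightarrow> 0"
  proof (rule LIMSEQ_I)
    fix e :: real assume "e > 0"
    then obtain M where M: "\<And>k. k \<ge> M \<Longrightarrow> n2 (\<lambda>z. f k z - w z) \<le> e/2" using fw[of "e/2"] by auto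
    show "\<exists>M. \<forall>k\<ge>M. norm (n2 (\<lambda>z. f k z - w z) - 0) < e"
      using \<open>e > 0\<close> n2_nonneg by (intro exI[of _ M]) (auto intro: le_less_trans[OF M])
  qed
  ultimately show ?thesis by blast
qed

end

section \<open>Signs in the exterior algebra\<close>

lemma wedge_sign_square [simp]: "wedge_sign j L * wedge_sign j L = 1"
  by (simp add: wedge_sign_def power_mult_distrib[symmetric])

lemma cnj_wedge_sign [simp]: "cnj (wedge_sign j L) = wedge_sign j L"
  by (simp add: wedge_sign_def)

lemma cmod_wedge_sign [simp]: "cmod (wedge_sign j L) = 1"
  by (simp add: wedge_sign_def norm_power)

lemma wedge_sign_insert: assumes "k \<notin> L" shows "wedge_sign j (insert k L) = (if k < j then -1 else 1) * wedge_sign j L"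
proof -
  have "{i \<in> insert k L. i < j} = (if k < j then insert k {i \<in> L. i < j} else {i \<in> L. i < j})" by auto
  then show ?thesis using assms by (simp add: wedge_sign_def)
qed

lemma wedge_sign_swap:
  assumes "j \<noteq> k" "j \<notin> L" "k \<notin> L"
  shows "wedge_sign j (insert k L) * wedge_sign k (insert j L) = - (wedge_sign j L * wedge_sign k L)"
  using assms by (auto simp: wedge_sign_insert)

lemma multi_indices_insert: "j \<notin> L \<Longrightarrow> L \<in> multi_indices q \<Longrightarrow> insert j L \<in> multi_indices (Suc q)"
  and multi_indices_remove: "j \<in> K \<Longrightarrow> K \<in> multi_indices (Suc q) \<Longrightarrow> K - {j} \<in> multi_indices q"
  for L K :: "'n::finite set"
  by (simp_all add: multi_indices_def)

lemma sum_insert_remove: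
  fixes F :: "'n::finite \<Rightarrow> 'n set \<Rightarrow> 'c::comm_monoid_add"
  shows "(\<Sum>K\<in>multi_indices (Suc q). \<Sum>j\<in>K. F j (K - {j})) = (\<Sum>J\<in>multi_indices q. \<Sum>j\<in>-J. F j J)"
proof -
  have "(\<Sum>K\<in>multi_indices (Suc q). \<Sum>j\<in>K. F j (K - {j})) = (\<Sum>(K,j)\<in>Sigma (multi_indices (Suc q)) (\<lambda>K. K). F j (K - {j}))"
    by (rule sum.Sigma) auto
  also have "\<dots> = (\<Sum>(J,j)\<in>Sigma (multi_indices q) (\<lambda>J. -J). F j J)"
    by (rule sum.reindex_bij_witness[of _ "\<lambda>(J,j). (insert j J, j)" "\<lambda>(K,j). (K - {j}, j)"])
       (auto simp: insert_absorb multi_indices_insert multi_indices_remove)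
  also have "\<dots> = (\<Sum>J\<in>multi_indices q. \<Sum>j\<in>-J. F j J)"
    by (rule sum.Sigma[symmetric]) auto
  finally show ?thesis .
qed

lemma sum_diag_split:
  fixes f :: "'n::finite \<Rightarrow> 'n \<Rightarrow> 'c::comm_monoid_add"
  shows "(\<Sum>j\<in>S. \<Sum>k\<in>S. f j k) = (\<Sum>j\<in>S. f j j) + (\<Sum>j\<in>S. \<Sum>k\<in>S - {j}. f j k)"
  by (simp add: sum.distrib[symmetric] sum.remove[of S])

text \<open>The anticommutation relation of wedging with \<open>d(cnj z\<^sub>j)\<close> and contracting with \<open>d(cnj z\<^sub>k)\<close>, summed
against an array \<open>F\<close>. On the diagonal an index \<open>j\<close> lies either in \<open>J\<close> or outside, which gives the sum
over all \<open>j\<close>; off the diagonal the two sides cancel by \<open>wedge_sign_swap\<close>.\<close>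
lemma wedge_contraction_identity:
  fixes F :: "'n::{finite,linorder} \<Rightarrow> 'n \<Rightarrow> 'n set \<Rightarrow> 'n set \<Rightarrow> complex"
  shows "(\<Sum>K\<in>multi_indices (Suc (Suc p)). \<Sum>j\<in>K. \<Sum>k\<in>K. wedge_sign j (K - {j}) * wedge_sign k (K - {k}) * F j k (K - {j}) (K - {k}))
    + (\<Sum>L\<in>multi_indices p. \<Sum>j\<in>-L. \<Sum>k\<in>-L. wedge_sign j L * wedge_sign k L * F j k (insert k L) (insert j L))
   = (\<Sum>J\<in>multi_indices (Suc p). \<Sum>j\<in>UNIV. F j j J J)"
proof -
  have 1: "(\<Sum>K\<in>multi_indices (Suc (Suc p)). \<Sum>j\<in>K. \<Sum>k\<in>K. wedge_sign j (K - {j}) * wedge_sign k (K - {k}) * F j k (K - {j}) (K - {k}))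
    = (\<Sum>K\<in>multi_indices (Suc (Suc p)). \<Sum>j\<in>K. F j j (K - {j}) (K - {j}))
     + (\<Sum>K\<in>multi_indices (Suc (Suc p)). \<Sum>j\<in>K. \<Sum>k\<in>K - {j}. wedge_sign j (K - {j}) * wedge_sign k (K - {k}) * F j k (K - {j}) (K - {k}))"
    by (subst sum_diag_split) (simp add: sum.distrib)
  have 2: "(\<Sum>L\<in>multi_indices p. \<Sum>j\<in>-L. \<Sum>k\<in>-L. wedge_sign j L * wedge_sign k L * F j k (insert k L) (insert j L))
    = (\<Sum>L\<in>multi_indices p. \<Sum>j\<in>-L. F j j (insert j L) (insert j L))
     + (\<Sum>L\<in>multi_indices p. \<Sum>j\<in>-L. \<Sum>k\<in>-L - {j}. wedge_sign j L * wedge_sign k L * F j k (insert k L) (insert j L))"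
    by (subst sum_diag_split) (simp add: sum.distrib)
  have 3: "(\<Sum>K\<in>multi_indices (Suc (Suc p)). \<Sum>j\<in>K. \<Sum>k\<in>K - {j}. wedge_sign j (K - {j}) * wedge_sign k (K - {k}) * F j k (K - {j}) (K - {k}))
    = - (\<Sum>L\<in>multi_indices p. \<Sum>j\<in>-L. \<Sum>k\<in>-L - {j}. wedge_sign j L * wedge_sign k L * F j k (insert k L) (insert j L))"
  proof -
    have "(\<Sum>K\<in>multi_indices (Suc (Suc p)). \<Sum>j\<in>K. \<Sum>k\<in>K - {j}. wedge_sign j (K - {j}) * wedge_sign k (K - {k}) * F j k (K - {j}) (K - {k}))
     = (\<Sum>(K,j,k)\<in>Sigma (multi_indices (Suc (Suc p))) (\<lambda>K. Sigma K (\<lambda>j. K - {j})). wedge_sign j (K - {j}) * wedge_sign k (K - {k}) * F j k (K - {j}) (K - {k}))"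
      by (simp add: sum.Sigma split_beta)
    also have "\<dots> = (\<Sum>(L,j,k)\<in>Sigma (multi_indices p) (\<lambda>L. Sigma (-L) (\<lambda>j. -L - {j})). - (wedge_sign j L * wedge_sign k L * F j k (insert k L) (insert j L)))"
    proof (rule sum.reindex_bij_witness[of _ "\<lambda>(L,j,k). (insert j (insert k L), j, k)" "\<lambda>(K,j,k). (K - {j} - {k}, j, k)"], goal_cases)
      case (1 a) then show ?case by (auto simp: insert_absorb)
    next
      case (2 a) then show ?case by (auto intro!: multi_indices_remove)
    next
      case (3 b) then show ?case by auto
    next
      case (4 b) then show ?case by (auto intro!: multi_indices_insert)
    next
      case (5 a)
      obtain K j k where a: "a = (K, j, k)" by (cases a)
      define L where "L = K - {j} - {k}"
      have e: "K - {j} = insert k L" "K - {k} = insert j L" "j \<notin> L" "k \<notin> L" "j \<noteq> k" using 5 by (auto simp: L_def a)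
      show ?case unfolding a prod.case L_def[symmetric] unfolding e(1,2) using wedge_sign_swap[OF e(5,3,4)] by simp
    qed
    also have "\<dots> = - (\<Sum>L\<in>multi_indices p. \<Sum>j\<in>-L. \<Sum>k\<in>-L - {j}. wedge_sign j L * wedge_sign k L * F j k (insert k L) (insert j L))"
      by (simp add: sum.Sigma split_beta sum_negf)
    finally show ?thesis .
  qed
  have 4: "(\<Sum>K\<in>multi_indices (Suc (Suc p)). \<Sum>j\<in>K. F j j (K - {j}) (K - {j})) = (\<Sum>J\<in>multi_indices (Suc p). \<Sum>j\<in>-J. F j j J J)"
    by (rule sum_insert_remove[of "\<lambda>j J. F j j J J"])
  have 5: "(\<Sum>L\<in>multi_indices p. \<Sum>j\<in>-L. F j j (insert j L) (insert j L)) = (\<Sum>J\<in>multi_indices (Suc p). \<Sum>j\<in>J. F j j J J)"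
    unfolding sum_insert_remove[of "\<lambda>j L. F j j (insert j L) (insert j L)", symmetric]
    by (intro sum.cong) (auto simp: insert_absorb)
  have 6: "(\<Sum>j\<in>-J. F j j J J) + (\<Sum>j\<in>J. F j j J J) = (\<Sum>j\<in>UNIV. F j j J J)" for J
    by (subst sum.union_disjoint[symmetric]) auto
  show ?thesis unfolding 1 2 3 4 5 using 6 by (simp add: sum.distrib[symmetric])
qed

section \<open>Hermitian matrices and sums of smallest eigenvalues\<close>

text \<open>The Hermitian inner product of vectors, linear in the first argument; the library inner product on
this type is its real part.\<close>
definition hip :: "complex ^ 'n \<Rightarrow> complex ^ 'n::finite \<Rightarrow> complex" where
  "hip x y = (\<Sum>i\<in>UNIV. x $ i * cnj (y $ i))"

lemma hip_add: "hip (x + y) z = hip x z + hip y z" by (simp add: hip_def distrib_right sum.distrib)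
lemma hip_scale: "hip (c *s x) z = c * hip x z" by (simp add: hip_def sum_distrib_left mult.assoc)
lemma hip_scaleR: "hip (c *\<^sub>R x) z = of_real c * hip x z" by (simp add: hip_def scaleR_sum_right[symmetric]) (simp add: scaleR_conv_of_real)
lemma hip_cnj: "hip y x = cnj (hip x y)" by (simp add: hip_def mult.commute)
lemma Re_hip: "Re (hip x y) = x \<bullet> y" by (simp add: hip_def inner_vec_def inner_complex_def)
lemma hip_self: "hip x x = of_real (x \<bullet> x)"
  using Re_hip[of x x] hip_cnj[of x x] by (simp add: complex_eq_iff)
lemma hip_scale2: "hip x (c *s y) = cnj c * hip x y" using hip_scale[of c y x] hip_cnj by (metis complex_cnj_mult)

lemma continuous_on_hip [continuous_intros]: "continuous_on S f \<Longrightarrow> continuous_on S (\<lambda>x. hip (f x) y)"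
  unfolding hip_def by (intro continuous_intros)

lemma hermitian_hip:
  assumes "\<And>i j. A $ i $ j = cnj (A $ j $ i)"
  shows "hip (A *v x) y = hip x (A *v y)"
proof -
  have "hip (A *v x) y = (\<Sum>i\<in>UNIV. \<Sum>j\<in>UNIV. A $ i $ j * x $ j * cnj (y $ i))"
    by (simp add: hip_def matrix_vector_mult_def sum_distrib_right)
  also have "\<dots> = (\<Sum>j\<in>UNIV. \<Sum>i\<in>UNIV. A $ i $ j * x $ j * cnj (y $ i))" by (rule sum.swap)
  also have "\<dots> = (\<Sum>j\<in>UNIV. \<Sum>i\<in>UNIV. x $ j * cnj (A $ j $ i * y $ i))"
  proof (intro sum.cong refl)
    fix i j
    have "A $ i $ j = cnj (A $ j $ i)" by (rule assms)
    then show "A $ i $ j * x $ j * cnj (y $ i) = x $ j * cnj (A $ j $ i * y $ i)" by (simp only: complex_cnj_mult mult_ac)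
  qed
  also have "\<dots> = hip x (A *v y)"
    by (simp add: hip_def matrix_vector_mult_def sum_distrib_left)
  finally show ?thesis .
qed

text \<open>The next eigenvector minimises the quadratic form on the unit sphere of the orthogonal complement of
those found so far. That complement is nontrivial because the \<open>k\<close> vectors and their multiples by \<open>\<i>\<close>
span at most \<open>2 k\<close> of the \<open>2 n\<close> real dimensions.\<close>
lemma hermitian_orthonormal_eigenvectors:
  fixes A :: "complex ^ 'n ^ 'n::finite"
  assumes H: "\<And>i j. A $ i $ j = cnj (A $ j $ i)"
  shows "k \<le> CARD('n) \<Longrightarrow> \<exists>v lam. (\<forall>i<k. \<forall>j<k. hip (v i) (v j) = (if i = j then 1 else 0)) \<and>
     (\<forall>i<k. A *v v i = complex_of_real (lam i) *s v i)"
proof (induction k)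
  case 0 then show ?case by simp
next
  case (Suc k)
  then obtain v lam where on: "\<And>i j. i < k \<Longrightarrow> j < k \<Longrightarrow> hip (v i) (v j) = (if i = j then 1 else 0)"
    and ev: "\<And>i. i < k \<Longrightarrow> A *v v i = complex_of_real (lam i) *s v i" by auto
  define W where "W = {x. \<forall>i<k. hip x (v i) = 0}"
  have lin: "A *v (x + t *\<^sub>R y) = A *v x + t *\<^sub>R (A *v y)" for x y t
    by (simp add: vec_eq_iff matrix_vector_mult_def algebra_simps sum.distrib scaleR_sum_right)
  have WA: "A *v x \<in> W" if "x \<in> W" for x
    using that by (auto simp: W_def hermitian_hip[OF H] ev hip_scale2)
  have Wlin: "x + t *\<^sub>R y \<in> W" if "x \<in> W" "y \<in> W" for x y t
    using that by (auto simp: W_def hip_add hip_scaleR)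
  obtain a where a: "a \<noteq> 0" "a \<in> W"
  proof -
    define S where "S = v ` {..<k} \<union> (\<lambda>i. \<i> *s v i) ` {..<k}"
    have "card S \<le> k + k" unfolding S_def
      by (rule order_trans[OF card_Un_le]) (intro add_mono order_trans[OF card_image_le]; simp)
    moreover have "dim (span S) \<le> card S" unfolding dim_span by (rule dim_le_card') (simp add: S_def)
    ultimately have "dim (span S) < DIM(complex ^ 'n)" using Suc.prems by simp
    then have "span S \<noteq> UNIV" by (metis dim_UNIV less_irrefl)
    then obtain a where a: "a \<noteq> 0" "\<And>x. x \<in> span S \<Longrightarrow> a \<bullet> x = 0" using span_not_UNIV_orthogonal by metis
    have "hip a (v i) = 0" if "i < k" for i
    proof -
      have "v i \<in> span S" "\<i> *s v i \<in> span S" using that by (auto simp: S_def intro!: span_base)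
      then have "Re (hip a (v i)) = 0" "Re (hip a (\<i> *s v i)) = 0" using a(2) by (simp_all add: Re_hip)
      then show ?thesis by (simp add: hip_scale2 complex_eq_iff)
    qed
    then show ?thesis using that a by (simp add: W_def)
  qed
  define S where "S = W \<inter> sphere 0 1"
  have cW: "closed W"
  proof -
    have "W = (\<Inter>i\<in>{..<k}. {x. hip x (v i) = 0})" by (auto simp: W_def)
    also have "closed \<dots>" by (intro closed_INT ballI closed_Collect_eq continuous_intros)
    finally show ?thesis .
  qed
  have "compact S" unfolding S_def using cW by (intro closed_Int_compact) auto
  moreover have "(1 / norm a) *\<^sub>R a \<in> S"
    using a Wlin[of 0 a "1 / norm a"] by (simp add: S_def) (simp add: W_def hip_def)
  moreover have "continuous_on S (\<lambda>x. (A *v x) \<bullet> x)"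
    by (intro continuous_intros linear_continuous_on matrix_vector_mul_bounded_linear)
  ultimately obtain x where x: "x \<in> S" "\<And>y. y \<in> S \<Longrightarrow> (A *v x) \<bullet> x \<le> (A *v y) \<bullet> y"
    using continuous_attains_inf[of S] by blast
  define \<mu> where "\<mu> = (A *v x) \<bullet> x"
  have xW: "x \<in> W" and xx: "x \<bullet> x = 1" using x(1) by (auto simp: S_def norm_eq_1)
  have sym: "(A *v u) \<bullet> w = (A *v w) \<bullet> u" for u w
    using hermitian_hip[OF H, of u w] by (metis Re_hip inner_commute)
  have low: "\<mu> * (y \<bullet> y) \<le> (A *v y) \<bullet> y" if "y \<in> W" for y
  proof (cases "y = 0")
    case False
    define s where "s = 1 / norm y"
    have "s *\<^sub>R y \<in> S" using that False Wlin[of 0 y s] by (simp add: S_def s_def) (simp add: W_def hip_def)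
    then have "\<mu> \<le> (A *v (s *\<^sub>R y)) \<bullet> (s *\<^sub>R y)" unfolding \<mu>_def by (rule x(2))
    also have "A *v (s *\<^sub>R y) = s *\<^sub>R (A *v y)" using lin[of 0 s y] by simp
    also have "s *\<^sub>R (A *v y) \<bullet> (s *\<^sub>R y) = ((A *v y) \<bullet> y) / (y \<bullet> y)"
      by (simp add: s_def dot_square_norm power2_eq_square)
    finally show ?thesis using False by (simp add: field_simps)
  qed simp
  define y where "y = A *v x - \<mu> *\<^sub>R x"
  have yW: "y \<in> W" unfolding y_def using Wlin[OF WA[OF xW] xW, of "-\<mu>"] by simp
  define D where "D = (A *v x) \<bullet> y - \<mu> * (x \<bullet> y)"
  define E where "E = (A *v y) \<bullet> y - \<mu> * (y \<bullet> y)"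
  have q: "0 \<le> 2 * t * D + t\<^sup>2 * E" for t
  proof -
    have "0 \<le> (A *v (x + t *\<^sub>R y)) \<bullet> (x + t *\<^sub>R y) - \<mu> * ((x + t *\<^sub>R y) \<bullet> (x + t *\<^sub>R y))"
      using low[OF Wlin[OF xW yW]] by simp
    also have "\<dots> = 2 * t * D + t\<^sup>2 * E"
      using xx \<mu>_def sym[of y x] by (simp add: D_def E_def lin lin[of 0 t y, simplified] inner_add_left inner_add_right inner_commute[of y x] algebra_simps power2_eq_square)
    finally show ?thesis .
  qed
  have E0: "E \<ge> 0" using low[OF yW] by (simp add: E_def)
  have "D = 0"
  proof -
    define b where "b = E + 1"
    have b: "b > 0" "E < b" using E0 by (auto simp: b_def)
    have "0 \<le> 2 * (- D / b) * D + (- D / b)\<^sup>2 * E" by (rule q)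
    also have "\<dots> \<le> 2 * (- D / b) * D + (- D / b)\<^sup>2 * b" using b by (intro add_left_mono mult_left_mono) auto
    also have "\<dots> = - (D\<^sup>2 / b)" using b by (simp add: field_simps power2_eq_square)
    finally have "D\<^sup>2 \<le> 0" using b by (simp add: divide_le_0_iff)
    then show ?thesis by simp
  qed
  moreover have "D = y \<bullet> y" by (simp add: D_def y_def inner_diff_left inner_diff_right inner_commute[of x "A *v x"])
  ultimately have "A *v x = \<mu> *\<^sub>R x" by (simp add: y_def)
  then have evx: "A *v x = complex_of_real \<mu> *s x" by (simp add: vec_eq_iff scaleR_conv_of_real[where 'a=complex])
  have "hip x x = 1" using xx by (simp add: hip_self)
  moreover have "hip x (v i) = 0" "hip (v i) x = 0" if "i < k" for i using xW that hip_cnj[of x "v i"] by (auto simp: W_def)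
  ultimately show ?case using on ev evx
    by (intro exI[of _ "v(k := x)"] exI[of _ "lam(k := \<mu>)"]) (auto simp: less_Suc_eq)
qed

lemma hermitian_spectral:
  fixes A :: "complex ^ 'n ^ 'n::finite"
  assumes H: "\<And>i j. A $ i $ j = cnj (A $ j $ i)"
  obtains V :: "'n \<Rightarrow> complex ^ 'n" and lam :: "'n \<Rightarrow> real"
  where "\<And>k l. hip (V k) (V l) = (if k = l then 1 else 0)"
    and "\<And>i j. (\<Sum>l\<in>UNIV. V l $ i * cnj (V l $ j)) = (if i = j then 1 else 0)"
    and "\<And>i j. A $ i $ j = (\<Sum>l\<in>UNIV. of_real (lam l) * V l $ i * cnj (V l $ j))"
proof -
  obtain v lam where on: "\<And>i j. i < CARD('n) \<Longrightarrow> j < CARD('n) \<Longrightarrow> hip (v i) (v j) = (if i = j then 1 else 0)"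
    and ev: "\<And>i. i < CARD('n) \<Longrightarrow> A *v v i = complex_of_real (lam i) *s v i"
    using hermitian_orthonormal_eigenvectors[OF H order_refl] by auto
  obtain e where e: "bij_betw e (UNIV :: 'n set) {..<CARD('n)}"
    using ex_bij_betw_finite_nat[of "UNIV :: 'n set"] by (auto simp: atLeast0LessThan)
  have el: "e i < CARD('n)" and ei: "e i = e j \<longleftrightarrow> i = j" for i j using e by (auto simp: bij_betw_def inj_eq)
  define V where "V l = v (e l)" for l
  have o: "hip (V k) (V l) = (if k = l then 1 else 0)" for k l using on el ei by (simp add: V_def)
  define P where "P = (\<chi> i l. V l $ i)"
  define Q where "Q = (\<chi> l j. cnj (V l $ j))"
  have "Q ** P = mat 1"
    using o[THEN arg_cong[of _ _ cnj]] by (auto simp: vec_eq_iff matrix_matrix_mult_def mat_def P_def Q_def hip_def mult.commute if_distrib[of cnj])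
  then have PQ: "P ** Q = mat 1" by (rule matrix_left_right_inverse[THEN iffD1])
  have c: "(\<Sum>l\<in>UNIV. V l $ i * cnj (V l $ j)) = (if i = j then 1 else 0)" for i j
    using PQ by (simp add: vec_eq_iff matrix_matrix_mult_def mat_def P_def Q_def)
  have AV: "(\<Sum>m\<in>UNIV. A $ i $ m * V l $ m) = of_real (lam (e l)) * V l $ i" for i l
    using ev[OF el[of l]] by (simp add: V_def vec_eq_iff matrix_vector_mult_def)
  have "(\<Sum>l\<in>UNIV. of_real (lam (e l)) * V l $ i * cnj (V l $ j)) = A $ i $ j" for i j
  proof -
    have "(\<Sum>l\<in>UNIV. of_real (lam (e l)) * V l $ i * cnj (V l $ j)) = (\<Sum>l\<in>UNIV. \<Sum>m\<in>UNIV. A $ i $ m * (V l $ m * cnj (V l $ j)))"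
      unfolding AV[symmetric] by (simp add: sum_distrib_right mult.assoc)
    also have "\<dots> = (\<Sum>m\<in>UNIV. A $ i $ m * (\<Sum>l\<in>UNIV. V l $ m * cnj (V l $ j)))"
      by (subst sum.swap) (simp add: sum_distrib_left)
    also have "\<dots> = A $ i $ j" by (simp add: c if_distrib[of "\<lambda>x. _ * x"] cong: if_cong)
    finally show ?thesis .
  qed
  then show ?thesis using that[of V "\<lambda>l. lam (e l)"] o c by simp
qed

text \<open>The unitary change of basis is carried out with matrices of constant polynomials.\<close>
lemma charpoly_spectral:
  fixes A :: "complex ^ 'n ^ 'n::finite" and V :: "'n \<Rightarrow> complex ^ 'n"
  assumes c: "\<And>i j. (\<Sum>l\<in>UNIV. V l $ i * cnj (V l $ j)) = (if i = j then 1 else 0)"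
    and A: "\<And>i j. A $ i $ j = (\<Sum>l\<in>UNIV. of_real (lam l) * V l $ i * cnj (V l $ j))"
  shows "charpoly A = (\<Prod>l\<in>UNIV. [:- of_real (lam l), 1:])"
proof -
  define M where "M = (\<chi> i l. [:V l $ i:])"
  define N where "N = (\<chi> l j. [:cnj (V l $ j):])"
  define D :: "complex poly ^ 'n ^ 'n" where "D = (\<chi> l m. if l = m then [:- of_real (lam l), 1:] else 0)"
  have psum: "(\<Sum>l\<in>I. [:f l:]) = [:\<Sum>l\<in>I. f l:]" for f :: "'n \<Rightarrow> complex" and I
    by (induction I rule: infinite_finite_induct) auto
  have MN: "M ** N = mat 1"
    using c by (auto simp: vec_eq_iff matrix_matrix_mult_def mat_def M_def N_def psum mult.commute)
  have "(M ** D ** N) $ i $ j = (if i = j then [:0, 1:] else 0) - [:A $ i $ j:]" for i j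
  proof -
    have "(M ** D ** N) $ i $ j = (\<Sum>l\<in>UNIV. [:V l $ i:] * [:- of_real (lam l), 1:] * [:cnj (V l $ j):])"
      by (simp add: matrix_matrix_mult_def M_def N_def D_def if_distrib[of "\<lambda>x. _ * x"] cong: if_cong)
    also have "\<dots> = (\<Sum>l\<in>UNIV. [:0,1:] * [:V l $ i * cnj (V l $ j):] - [:of_real (lam l) * V l $ i * cnj (V l $ j):])"
      by (intro sum.cong) (auto simp: mult_ac)
    also have "\<dots> = [:0,1:] * [:\<Sum>l\<in>UNIV. V l $ i * cnj (V l $ j):] - [:\<Sum>l\<in>UNIV. of_real (lam l) * V l $ i * cnj (V l $ j):]"
      by (simp only: sum_subtractf sum_distrib_left[symmetric] psum)
    also have "\<dots> = (if i = j then [:0, 1:] else 0) - [:A $ i $ j:]" unfolding c A[symmetric] by simp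
    finally show ?thesis .
  qed
  then have "charpoly A = det (M ** D ** N)" unfolding charpoly_def by (intro arg_cong[of _ _ det]) (simp add: vec_eq_iff)
  also have "\<dots> = det M * det D * det N" by (simp add: det_mul)
  also have "\<dots> = det D * det (M ** N)" by (simp add: det_mul)
  also have "\<dots> = det D" by (simp add: MN)
  also have "\<dots> = (\<Prod>l\<in>UNIV. [:- of_real (lam l), 1:])" by (subst det_diagonal) (auto simp: D_def)
  finally show ?thesis .
qed

lemma proots_spectral:
  "image_mset Re (proots (\<Prod>l\<in>(UNIV::'n::finite set). [:- of_real (lam l), 1:])) = image_mset lam (mset_set UNIV)"
  by (subst proots_prod) (auto simp: sum_unfold_sum_mset image_mset.compositionality o_def)

lemma sorted_list_image_mset_eq:
  fixes lam :: "'n::{finite,linorder} \<Rightarrow> real"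
  shows "\<exists>xs. distinct xs \<and> set xs = (UNIV :: 'n set) \<and> sorted_list_of_multiset (image_mset lam (mset_set UNIV)) = map lam xs"
proof -
  obtain ys where ys: "set ys = (UNIV :: 'n set)" "distinct ys" using finite_distinct_list[of "UNIV :: 'n set"] by auto
  define xs where "xs = sort_key lam ys"
  have m: "mset xs = mset_set UNIV" using mset_set_set[OF ys(2)] by (simp add: xs_def ys(1))
  have "sorted_list_of_multiset (image_mset lam (mset_set UNIV)) = map lam xs"
  proof -
    have "image_mset lam (mset_set UNIV) = mset (map lam xs)" by (simp add: m)
    moreover have "sorted (map lam xs)" by (simp add: xs_def)
    ultimately show ?thesis by (simp only: sorted_list_of_multiset_mset sorted_sort_id)
  qed
  then show ?thesis using ys by (intro exI[of _ xs]) (simp add: xs_def)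
qed

text \<open>The bathtub principle: moving weight from large to small eigenvalues decreases the sum, and with
weights at most \<open>1\<close> and of total \<open>q\<close> the \<open>q\<close> smallest eigenvalues can be filled completely. The proof
compares every eigenvalue with the \<open>q\<close>-th one.\<close>
lemma sum_smallest_le:
  fixes lam :: "'n::{finite,linorder} \<Rightarrow> real"
  assumes t: "\<And>l. 0 \<le> t l" "\<And>l. t l \<le> 1" and st: "(\<Sum>l\<in>UNIV. t l) = real q" and q: "1 \<le> q" "q \<le> CARD('n)"
  shows "sum_list (take q (sorted_list_of_multiset (image_mset lam (mset_set UNIV)))) \<le> (\<Sum>l\<in>UNIV. lam l * t l)"
proof -
  obtain xs where xs: "distinct xs" "set xs = (UNIV :: 'n set)"
    and s: "sorted_list_of_multiset (image_mset lam (mset_set UNIV)) = map lam xs" using sorted_list_image_mset_eq by blast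
  have len: "length xs = CARD('n)" using distinct_card[OF xs(1)] xs(2) by simp
  have srt: "sorted (map lam xs)" unfolding s[symmetric] by simp
  define n where "n = CARD('n)"
  have re: "(\<Sum>l\<in>UNIV. f l) = (\<Sum>i<n. f (xs ! i))" for f :: "'n \<Rightarrow> real"
    using sum.reindex_bij_betw[OF bij_betw_nth[OF xs(1) _ xs(2)[symmetric]], of "{..<n}" f] len by (simp add: n_def)
  \<comment> \<open>the \<open>q\<close>-th smallest eigenvalue; list positions start at \<open>0\<close>\<close>
  define c where "c = lam (xs ! (q - 1))"
  have lo: "lam (xs ! i) \<le> c" if "i < q" for i
    using sorted_nth_mono[OF srt, of i "q - 1"] that q len by (simp add: c_def)
  have hi: "c \<le> lam (xs ! i)" if "q \<le> i" "i < n" for i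
    using sorted_nth_mono[OF srt, of "q - 1" i] that q len by (simp add: c_def n_def)
  have qn: "q \<le> n" using q by (simp add: n_def)
  have split: "(\<Sum>i<n. f i) = (\<Sum>i<q. f i) + (\<Sum>i=q..<n. f i)" for f :: "nat \<Rightarrow> real"
    using sum.atLeastLessThan_concat[of 0 q n f] qn by (simp add: lessThan_atLeast0)
  have "sum_list (take q (map lam xs)) = (\<Sum>i<q. lam (xs ! i))"
    using qn len by (simp add: sum_list_sum_nth n_def lessThan_atLeast0 min_def)
  also have "\<dots> \<le> (\<Sum>i<n. lam (xs ! i) * t (xs ! i))"
  proof -
    have "c * (t (xs ! i) - 1) \<le> lam (xs ! i) * t (xs ! i) - lam (xs ! i)" if "i < q" for i
      using mult_right_mono[OF lo[OF that], of "1 - t (xs ! i)"] t by (simp add: algebra_simps)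
    then have a: "(\<Sum>i<q. c * (t (xs ! i) - 1)) \<le> (\<Sum>i<q. lam (xs ! i) * t (xs ! i) - lam (xs ! i))"
      by (intro sum_mono) auto
    have b: "(\<Sum>i=q..<n. c * t (xs ! i)) \<le> (\<Sum>i=q..<n. lam (xs ! i) * t (xs ! i))"
      using hi t by (intro sum_mono mult_right_mono) auto
    have "(\<Sum>i<q. c * (t (xs ! i) - 1)) + (\<Sum>i=q..<n. c * t (xs ! i)) = c * ((\<Sum>i<q. t (xs ! i)) + (\<Sum>i=q..<n. t (xs ! i)) - real q)"
      by (simp add: sum_distrib_left[symmetric] sum_subtractf algebra_simps)
    also have "(\<Sum>i<q. t (xs ! i)) + (\<Sum>i=q..<n. t (xs ! i)) = real q" using st re[of t] split[of "\<lambda>i. t (xs ! i)"] by simp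
    finally show ?thesis using a b split[of "\<lambda>i. lam (xs ! i) * t (xs ! i)"] by (simp add: sum_subtractf)
  qed
  finally show ?thesis by (simp add: s re)
qed

text \<open>The coefficient at \<open>L\<close> of the contraction of \<open>g\<close> with the \<open>j\<close>-th basis vector, that is the
antisymmetric extension of \<open>g\<close> to the multi-index \<open>j L\<close>.\<close>
definition contr :: "'n::{finite,linorder} \<Rightarrow> ('n set \<Rightarrow> complex) \<Rightarrow> 'n set \<Rightarrow> complex" where
  "contr j g L = (if j \<in> L then 0 else wedge_sign j L * g (insert j L))"

text \<open>Contraction with a unit vector and wedging with the dual covector have squared norms that add up to
the squared norm of \<open>g\<close>, by the anticommutation relation.\<close>
lemma contraction_le:
  fixes g :: "'n::{finite,linorder} set \<Rightarrow> complex" and v :: "(complex, 'n) vec"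
  assumes v: "hip v v = 1"
  shows "(\<Sum>L\<in>multi_indices p. (cmod (\<Sum>j\<in>UNIV. v $ j * contr j g L))\<^sup>2) \<le> (\<Sum>J\<in>multi_indices (Suc p). (cmod (g J))\<^sup>2)"
proof -
  define F where "F j k J J' = cnj (v $ j) * g J * (v $ k) * cnj (g J')" for j k J J'
  have 1: "of_real ((cmod (\<Sum>j\<in>K. wedge_sign j (K - {j}) * cnj (v $ j) * g (K - {j})))\<^sup>2) =
    (\<Sum>j\<in>K. \<Sum>k\<in>K. wedge_sign j (K - {j}) * wedge_sign k (K - {k}) * F j k (K - {j}) (K - {k}))" for K
    unfolding complex_norm_square cnj_sum sum_product by (intro sum.cong refl) (simp add: F_def mult_ac)
  have 2: "of_real ((cmod (\<Sum>j\<in>UNIV. v $ j * contr j g L))\<^sup>2) =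
    (\<Sum>j\<in>-L. \<Sum>k\<in>-L. wedge_sign j L * wedge_sign k L * F j k (insert k L) (insert j L))" for L
  proof -
    have "(\<Sum>j\<in>UNIV. v $ j * contr j g L) = (\<Sum>j\<in>-L. v $ j * (wedge_sign j L * g (insert j L)))"
      by (rule sum.mono_neutral_cong_right) (auto simp: contr_def)
    note e = this
    show ?thesis unfolding e complex_norm_square cnj_sum sum_product
      by (subst sum.swap, intro sum.cong refl) (simp add: F_def mult_ac)
  qed
  have 3: "(\<Sum>j\<in>UNIV. F j j J J) = of_real ((cmod (g J))\<^sup>2)" for J
  proof -
    have "(\<Sum>j\<in>UNIV. F j j J J) = hip v v * (g J * cnj (g J))"
      unfolding hip_def sum_distrib_right by (intro sum.cong) (auto simp: F_def mult_ac)
    then show ?thesis unfolding complex_norm_square using v by simp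
  qed
  have "complex_of_real ((\<Sum>K\<in>multi_indices (Suc (Suc p)). (cmod (\<Sum>j\<in>K. wedge_sign j (K - {j}) * cnj (v $ j) * g (K - {j})))\<^sup>2) +
     (\<Sum>L\<in>multi_indices p. (cmod (\<Sum>j\<in>UNIV. v $ j * contr j g L))\<^sup>2)) = of_real (\<Sum>J\<in>multi_indices (Suc p). (cmod (g J))\<^sup>2)"
    using wedge_contraction_identity[of F p] by (simp only: of_real_add of_real_sum 1 2 3)
  then have "(\<Sum>K\<in>multi_indices (Suc (Suc p)). (cmod (\<Sum>j\<in>K. wedge_sign j (K - {j}) * cnj (v $ j) * g (K - {j})))\<^sup>2) +
     (\<Sum>L\<in>multi_indices p. (cmod (\<Sum>j\<in>UNIV. v $ j * contr j g L))\<^sup>2) = (\<Sum>J\<in>multi_indices (Suc p). (cmod (g J))\<^sup>2)"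
    by (simp only: of_real_eq_iff)
  moreover have "0 \<le> (\<Sum>K\<in>multi_indices (Suc (Suc p)). (cmod (\<Sum>j\<in>K. wedge_sign j (K - {j}) * cnj (v $ j) * g (K - {j})))\<^sup>2)"
    by (intro sum_nonneg) auto
  ultimately show ?thesis by linarith
qed

text \<open>Each coefficient \<open>g J\<close> occurs once for every element of \<open>J\<close>.\<close>
lemma sum_contr_sq:
  fixes g :: "'n::{finite,linorder} set \<Rightarrow> complex"
  shows "(\<Sum>L\<in>multi_indices p. \<Sum>j\<in>UNIV. (cmod (contr j g L))\<^sup>2) = real (Suc p) * (\<Sum>J\<in>multi_indices (Suc p). (cmod (g J))\<^sup>2)"
proof -
  have "(\<Sum>j\<in>UNIV. (cmod (contr j g L))\<^sup>2) = (\<Sum>j\<in>-L. (cmod (g (insert j L)))\<^sup>2)" for L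
    by (rule sum.mono_neutral_cong_right) (auto simp: contr_def norm_mult)
  then have "(\<Sum>L\<in>multi_indices p. \<Sum>j\<in>UNIV. (cmod (contr j g L))\<^sup>2) = (\<Sum>J\<in>multi_indices (Suc p). \<Sum>j\<in>J. (cmod (g (insert j (J - {j}))))\<^sup>2)"
    unfolding sum_insert_remove[of "\<lambda>j L. (cmod (g (insert j L)))\<^sup>2"] by simp
  also have "\<dots> = (\<Sum>J\<in>multi_indices (Suc p). \<Sum>j\<in>J. (cmod (g J))\<^sup>2)"
    by (intro sum.cong refl) (auto simp: insert_absorb)
  also have "\<dots> = (\<Sum>J\<in>multi_indices (Suc p). real (Suc p) * (cmod (g J))\<^sup>2)"
    by (intro sum.cong) (auto simp: multi_indices_def)
  finally show ?thesis by (simp add: sum_distrib_left)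
qed

text \<open>In an eigenbasis the form is the sum of the eigenvalues with weights \<open>T l\<close>, the squared norms of the
contractions with the eigenvectors. These satisfy \<open>0 \<le> T l \<le> |g|\<^sup>2\<close> and add up to \<open>(p + 1) |g|\<^sup>2\<close>, so that
the bathtub principle applies to \<open>T l / |g|\<^sup>2\<close>.\<close>
lemma levi_form_lower_bound:
  fixes A :: "((complex, 'n) vec, 'n::{finite,linorder}) vec" and g :: "'n set \<Rightarrow> complex"
  assumes H: "\<And>i j. A $ i $ j = cnj (A $ j $ i)" and p: "Suc p \<le> CARD('n)"
  shows "sum_smallest_eigenvalues (Suc p) A * (\<Sum>J\<in>multi_indices (Suc p). (cmod (g J))\<^sup>2) \<le>
    Re (\<Sum>L\<in>multi_indices p. \<Sum>j\<in>UNIV. \<Sum>k\<in>UNIV. A $ j $ k * contr j g L * cnj (contr k g L))"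
proof -
  obtain V and lam :: "'n \<Rightarrow> real" where on: "\<And>k l. hip (V k) (V l) = (if k = l then 1 else 0)"
    and c: "\<And>i j. (\<Sum>l\<in>UNIV. V l $ i * cnj (V l $ j)) = (if i = j then 1 else 0)"
    and A: "\<And>i j. A $ i $ j = (\<Sum>l\<in>UNIV. of_real (lam l) * V l $ i * cnj (V l $ j))"
    by (rule hermitian_spectral[OF H]) blast
  define G where "G = (\<Sum>J\<in>multi_indices (Suc p). (cmod (g J))\<^sup>2)"
  define T where "T l = (\<Sum>L\<in>multi_indices p. (cmod (\<Sum>j\<in>UNIV. V l $ j * contr j g L))\<^sup>2)" for l
  have T0: "T l \<ge> 0" for l by (simp add: T_def sum_nonneg)
  have TG: "T l \<le> G" for l unfolding T_def G_def by (rule contraction_le) (simp add: on)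
  have sq: "(\<Sum>j\<in>UNIV. \<Sum>k\<in>UNIV. (\<Sum>l\<in>UNIV. of_real (m l) * V l $ j * cnj (V l $ k)) * U j * cnj (U k))
     = of_real (\<Sum>l\<in>UNIV. m l * (cmod (\<Sum>j\<in>UNIV. V l $ j * U j))\<^sup>2)" for m and U :: "'n \<Rightarrow> complex"
  proof -
    have "(\<Sum>j\<in>UNIV. \<Sum>k\<in>UNIV. (\<Sum>l\<in>UNIV. of_real (m l) * V l $ j * cnj (V l $ k)) * U j * cnj (U k))
      = (\<Sum>j\<in>UNIV. \<Sum>k\<in>UNIV. \<Sum>l\<in>UNIV. of_real (m l) * ((V l $ j * U j) * cnj (V l $ k * U k)))"
      unfolding sum_distrib_right by (intro sum.cong refl) (simp add: mult_ac)
    also have "\<dots> = (\<Sum>j\<in>UNIV. \<Sum>l\<in>UNIV. \<Sum>k\<in>UNIV. of_real (m l) * ((V l $ j * U j) * cnj (V l $ k * U k)))"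
      by (intro sum.cong refl sum.swap)
    also have "\<dots> = (\<Sum>l\<in>UNIV. \<Sum>j\<in>UNIV. \<Sum>k\<in>UNIV. of_real (m l) * ((V l $ j * U j) * cnj (V l $ k * U k)))"
      by (rule sum.swap)
    also have "\<dots> = (\<Sum>l\<in>UNIV. of_real (m l) * ((\<Sum>j\<in>UNIV. V l $ j * U j) * cnj (\<Sum>k\<in>UNIV. V l $ k * U k)))"
    proof -
      have "(\<Sum>j\<in>UNIV. V l $ j * U j) * cnj (\<Sum>k\<in>UNIV. V l $ k * U k) = (\<Sum>j\<in>UNIV. \<Sum>k\<in>UNIV. V l $ j * U j * cnj (V l $ k * U k))" for l
        by (simp only: cnj_sum sum_product)
      then show ?thesis by (simp only: sum_distrib_left)
    qed
    also have "\<dots> = of_real (\<Sum>l\<in>UNIV. m l * (cmod (\<Sum>j\<in>UNIV. V l $ j * U j))\<^sup>2)"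
      by (simp only: of_real_sum of_real_mult complex_norm_square)
    finally show ?thesis .
  qed
  have form: "(\<Sum>L\<in>multi_indices p. \<Sum>j\<in>UNIV. \<Sum>k\<in>UNIV. A $ j $ k * contr j g L * cnj (contr k g L)) = of_real (\<Sum>l\<in>UNIV. lam l * T l)"
    unfolding A sq by (simp only: of_real_sum[symmetric] of_real_eq_iff T_def sum_distrib_left) (rule sum.swap)
  have "(\<Sum>L\<in>multi_indices p. \<Sum>l\<in>UNIV. (cmod (\<Sum>j\<in>UNIV. V l $ j * contr j g L))\<^sup>2) = (\<Sum>L\<in>multi_indices p. \<Sum>j\<in>UNIV. (cmod (contr j g L))\<^sup>2)"
  proof (rule sum.cong[OF refl])
    fix L
    have "complex_of_real (\<Sum>l\<in>UNIV. (cmod (\<Sum>j\<in>UNIV. V l $ j * contr j g L))\<^sup>2) = (\<Sum>j\<in>UNIV. \<Sum>k\<in>UNIV. (if j = k then 1 else 0) * contr j g L * cnj (contr k g L))"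
      using sq[of "\<lambda>_. 1" "\<lambda>j. contr j g L"] by (simp add: c)
    also have "\<dots> = (\<Sum>j\<in>UNIV. contr j g L * cnj (contr j g L))"
      by (intro sum.cong refl) (simp add: if_distrib[of "\<lambda>x. x * _"] cong: if_cong)
    also have "\<dots> = of_real (\<Sum>j\<in>UNIV. (cmod (contr j g L))\<^sup>2)" by (simp only: of_real_sum complex_norm_square)
    finally show "(\<Sum>l\<in>UNIV. (cmod (\<Sum>j\<in>UNIV. V l $ j * contr j g L))\<^sup>2) = (\<Sum>j\<in>UNIV. (cmod (contr j g L))\<^sup>2)"
      by (simp only: of_real_eq_iff)
  qed
  then have ST: "(\<Sum>l\<in>UNIV. T l) = real (Suc p) * G"
    unfolding T_def G_def sum_contr_sq[symmetric] by (subst sum.swap)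
  have s: "sum_smallest_eigenvalues (Suc p) A = sum_list (take (Suc p) (sorted_list_of_multiset (image_mset lam (mset_set UNIV))))"
    unfolding sum_smallest_eigenvalues_def charpoly_spectral[OF c A] proots_spectral ..
  show ?thesis
  proof (cases "G = 0")
    case True
    then have "T l = 0" for l using T0[of l] TG[of l] by simp
    then show ?thesis unfolding form G_def[symmetric] by (simp add: True)
  next
    case False
    then have G: "G > 0" using T0 TG by (metis order_trans order_le_less)
    have "sum_smallest_eigenvalues (Suc p) A \<le> (\<Sum>l\<in>UNIV. lam l * (T l / G))"
      unfolding s using T0 TG G ST p by (intro sum_smallest_le) (auto simp: sum_divide_distrib[symmetric])
    also have "\<dots> = (\<Sum>l\<in>UNIV. lam l * T l) / G" by (simp add: sum_divide_distrib)
    finally show ?thesis unfolding form G_def[symmetric] using G by (simp add: field_simps)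
  qed
qed

section \<open>Wirtinger calculus and the Levi matrix\<close>

lemma d_z_dd: "d_z j f z = (dd (axis j 1) f z - \<i> * dd (axis j \<i>) f z) / 2"
  by (simp add: d_z_def dd_def)
lemma d_zbar_dd: "d_zbar j f z = (dd (axis j 1) f z + \<i> * dd (axis j \<i>) f z) / 2"
  by (simp add: d_zbar_def dd_def)

lemma C1_differentiable: "C_k 1 f \<Longrightarrow> f differentiable at x"
  using C_k_differentiable[of 0 f x] by simp
lemma C2_differentiable: "C_k 2 f \<Longrightarrow> f differentiable at x"
  using C_k_differentiable[of 1 f x] by (simp add: numeral_2_eq_2)
lemma C2_C1: "C_k 2 f \<Longrightarrow> C_k 1 f" using C_k_le[of 2 f 1] by simp
lemma C1_dd: "C_k 2 f \<Longrightarrow> C_k 1 (dd v f)" using C_k_dd[of 1 f v] by (simp add: numeral_2_eq_2)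

lemma d_z_mult: "f differentiable at z \<Longrightarrow> g differentiable at z \<Longrightarrow> d_z j (\<lambda>z. f z * g z) z = f z * d_z j g z + d_z j f z * g z"
  by (simp add: d_z_dd dd_mult algebra_simps add_divide_distrib diff_divide_distrib)
lemma d_zbar_mult: "f differentiable at z \<Longrightarrow> g differentiable at z \<Longrightarrow> d_zbar j (\<lambda>z. f z * g z) z = f z * d_zbar j g z + d_zbar j f z * g z"
  by (simp add: d_zbar_dd dd_mult algebra_simps add_divide_distrib diff_divide_distrib)
lemma d_zbar_add: "f differentiable at z \<Longrightarrow> g differentiable at z \<Longrightarrow> d_zbar j (\<lambda>z. f z + g z) z = d_zbar j f z + d_zbar j g z"
  by (simp add: d_zbar_dd dd_add algebra_simps add_divide_distrib)
lemma d_zbar_uminus: "f differentiable at z \<Longrightarrow> d_zbar j (\<lambda>z. - f z) z = - d_zbar j f z"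
  by (simp add: d_zbar_dd dd_uminus algebra_simps add_divide_distrib diff_divide_distrib)
lemma d_zbar_cnj: "f differentiable at z \<Longrightarrow> d_zbar j (\<lambda>z. cnj (f z)) z = cnj (d_z j f z)"
  by (simp add: d_z_dd d_zbar_dd dd_cnj)
lemma d_z_cnj: "f differentiable at z \<Longrightarrow> d_z j (\<lambda>z. cnj (f z)) z = cnj (d_zbar j f z)"
  by (simp add: d_z_dd d_zbar_dd dd_cnj)
lemma d_zbar_shift: "f differentiable at (x - z) \<Longrightarrow> d_zbar j (\<lambda>x. f (x - z)) x = d_zbar j f (x - z)"
  by (simp add: d_zbar_dd dd_shift)
lemma d_z_shift: "f differentiable at (x - z) \<Longrightarrow> d_z j (\<lambda>x. f (x - z)) x = d_z j f (x - z)"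
  by (simp add: d_z_dd dd_shift)

lemma C_k_cmult: "C_k k f \<Longrightarrow> C_k k (\<lambda>x. c * f x :: complex)" by (simp add: C_k_mult)

lemma C_k_d_z: assumes "C_k (Suc k) f" shows "C_k k (d_z j f)"
proof -
  have "d_z j f = (\<lambda>z. (1/2) * (dd (axis j 1) f z - \<i> * dd (axis j \<i>) f z))" by (auto simp: d_z_dd)
  then show ?thesis by (simp only:) (intro C_k_cmult C_k_diff C_k_dd assms)
qed
lemma C_k_d_zbar: assumes "C_k (Suc k) f" shows "C_k k (d_zbar j f)"
proof -
  have "d_zbar j f = (\<lambda>z. (1/2) * (dd (axis j 1) f z + \<i> * dd (axis j \<i>) f z))" by (auto simp: d_zbar_dd)
  then show ?thesis by (simp only:) (intro C_k_cmult C_k_add C_k_dd assms)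
qed
lemma C1_d_z: "C_k 2 f \<Longrightarrow> C_k 1 (d_z j f)" using C_k_d_z[of 1 f j] by (simp add: numeral_2_eq_2)
lemma C1_d_zbar: "C_k 2 f \<Longrightarrow> C_k 1 (d_zbar j f)" using C_k_d_zbar[of 1 f j] by (simp add: numeral_2_eq_2)

lemma test_function_d_z: "test_function f \<Longrightarrow> test_function (d_z j f)"
  and test_function_d_zbar: "test_function f \<Longrightarrow> test_function (d_zbar j f)"
proof -
  assume f: "test_function f"
  have "d_z j f = (\<lambda>z. (1/2) * (dd (axis j 1) f z + (- \<i>) * dd (axis j \<i>) f z))" by (auto simp: d_z_dd)
  then show "test_function (d_z j f)" by (simp only:) (intro test_function_cmult test_function_add test_function_dd f)
next
  assume f: "test_function f"
  have "d_zbar j f = (\<lambda>z. (1/2) * (dd (axis j 1) f z + \<i> * dd (axis j \<i>) f z))" by (auto simp: d_zbar_dd)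
  then show "test_function (d_zbar j f)" by (simp only:) (intro test_function_cmult test_function_add test_function_dd f)
qed

lemma bounded_nonzero_d_z: "bounded {x. f x \<noteq> 0} \<Longrightarrow> bounded {x. d_z j f x \<noteq> 0}"
  by (rule bounded_subset[of "{x. dd (axis j 1) f x \<noteq> 0} \<union> {x. dd (axis j \<i>) f x \<noteq> 0}"])
     (auto simp: d_z_dd bounded_nonzero_dd)
lemma bounded_nonzero_d_zbar: "bounded {x. f x \<noteq> 0} \<Longrightarrow> bounded {x. d_zbar j f x \<noteq> 0}"
  by (rule bounded_subset[of "{x. dd (axis j 1) f x \<noteq> 0} \<union> {x. dd (axis j \<i>) f x \<noteq> 0}"])
     (auto simp: d_zbar_dd bounded_nonzero_dd)

lemma dd_combo: fixes f :: "'a::euclidean_space \<Rightarrow> complex" shows "C_k 2 f \<Longrightarrow> dd v (\<lambda>z. (dd a f z + c * dd b f z) / 2) z = (dd v (dd a f) z + c * dd v (dd b f) z) / 2"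
proof -
  assume f: "C_k 2 f"
  have d: "dd w f differentiable at x" for w x using C1_differentiable[OF C1_dd[OF f]] .
  have d': "(\<lambda>x. c * dd b f x) differentiable at x" for x
    using C1_differentiable[OF C_k_cmult[OF C1_dd[OF f]]] .
  have d'': "(\<lambda>x. dd a f x + c * dd b f x) differentiable at x" for x
    using C1_differentiable[OF C_k_add[OF C1_dd[OF f] C_k_cmult[OF C1_dd[OF f]]]] .
  have "dd v (\<lambda>z. (1/2) * (dd a f z + c * dd b f z)) z = (1/2) * (dd v (dd a f) z + c * dd v (dd b f) z)"
    by (simp only: dd_cmult[OF d''] dd_add[OF d d'] dd_cmult[OF d])
  then show ?thesis by simp
qed

lemma d_z_fun: "d_z j f = (\<lambda>z. (dd (axis j 1) f z + (-\<i>) * dd (axis j \<i>) f z) / 2)" by (auto simp: d_z_dd)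
lemma d_zbar_fun: "d_zbar j f = (\<lambda>z. (dd (axis j 1) f z + \<i> * dd (axis j \<i>) f z) / 2)" by (auto simp: d_zbar_dd)

lemma d_z_d_zbar_commute: assumes f: "C_k 2 f" shows "d_z j (d_zbar k f) z = d_zbar k (d_z j f) z"
  unfolding d_z_dd[of j "d_zbar k f"] d_zbar_dd[of k "d_z j f"] d_z_fun d_zbar_fun
  unfolding dd_combo[OF f] dd_commute[OF f, of "axis k 1"] dd_commute[OF f, of "axis k \<i>"]
  by (simp add: algebra_simps add_divide_distrib diff_divide_distrib)

lemma d_zbar_commute: assumes f: "C_k 2 f" shows "d_zbar j (d_zbar k f) z = d_zbar k (d_zbar j f) z"
  unfolding d_zbar_dd[of j "d_zbar k f"] d_zbar_dd[of k "d_zbar j f"] d_zbar_fun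
  unfolding dd_combo[OF f] dd_commute[OF f, of "axis k 1"] dd_commute[OF f, of "axis k \<i>"]
  by (simp add: algebra_simps add_divide_distrib diff_divide_distrib)

lemma d_zbar_by_parts:
  assumes f: "C_k 1 f" and g: "C_k 1 g" and b: "bounded {x. f x \<noteq> 0} \<or> bounded {x. g x \<noteq> 0}"
  shows "(LINT x|lborel. d_zbar j f x * g x) = - (LINT x|lborel. f x * d_zbar j g x)"
proof -
  have c: "continuous_on UNIV f" "continuous_on UNIV g" "continuous_on UNIV (dd v f)" "continuous_on UNIV (dd v g)" for v
    using f g C_k_continuous C_k_dd[of 0 f] C_k_dd[of 0 g] by auto
  have "bounded {x. dd v f x * g x \<noteq> 0}" "bounded {x. f x * dd v g x \<noteq> 0}" for v
    using b bounded_nonzero_dd bounded_nonzero_multL bounded_nonzero_multR by metis+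
  then have i: "integrable lborel (\<lambda>x. dd v f x * g x)" "integrable lborel (\<lambda>x. f x * dd v g x)" for v
    by (auto intro!: integrable_compact_support continuous_on_mult c)
  have i2: "integrable lborel (\<lambda>x. \<i> * dd v f x * g x)" "integrable lborel (\<lambda>x. f x * (\<i> * dd v g x))" for v
    using integrable_mult_right[OF i(1), of \<i>] integrable_mult_right[OF i(2), of \<i>] by (simp_all add: mult_ac)
  note p = integral_dd_by_parts[OF f g b]
  have e1: "(LINT x|lborel. d_zbar j f x * g x) = ((LINT x|lborel. dd (axis j 1) f x * g x) + \<i> * (LINT x|lborel. dd (axis j \<i>) f x * g x)) / 2"
  proof -
    have "(LINT x|lborel. d_zbar j f x * g x) = (LINT x|lborel. (dd (axis j 1) f x * g x + \<i> * (dd (axis j \<i>) f x * g x)) / 2)"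
      by (rule Bochner_Integration.integral_cong) (simp_all add: d_zbar_dd field_simps)
    then show ?thesis using i by simp
  qed
  have e2: "(LINT x|lborel. f x * d_zbar j g x) = ((LINT x|lborel. f x * dd (axis j 1) g x) + \<i> * (LINT x|lborel. f x * dd (axis j \<i>) g x)) / 2"
  proof -
    have "(LINT x|lborel. f x * d_zbar j g x) = (LINT x|lborel. (f x * dd (axis j 1) g x + \<i> * (f x * dd (axis j \<i>) g x)) / 2)"
      by (rule Bochner_Integration.integral_cong) (simp_all add: d_zbar_dd field_simps)
    then show ?thesis using i by simp
  qed
  show ?thesis unfolding e1 e2 p by (simp add: algebra_simps add_divide_distrib diff_divide_distrib)
qed

lemma levi_hermitian:
  assumes "C_k 2 \<phi>" shows "levi_matrix \<phi> z $ j $ k = cnj (levi_matrix \<phi> z $ k $ j)"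
proof -
  define f where "f w = complex_of_real (\<phi> w)" for w
  have f: "C_k 2 f" unfolding f_def by (rule C_k_of_real[OF assms])
  have df: "f differentiable at x" for x by (rule C2_differentiable[OF f])
  have e: "(\<lambda>w. cnj (d_zbar j f w)) = d_z j f" for j using d_z_cnj[OF df, of j] by (intro ext) (simp add: f_def[abs_def])
  have "cnj (d_z k (d_zbar j f) z) = d_zbar k (\<lambda>w. cnj (d_zbar j f w)) z"
    by (rule d_zbar_cnj[symmetric]) (rule C1_differentiable[OF C1_d_zbar[OF f]])
  also have "\<dots> = d_z j (d_zbar k f) z" unfolding e using d_z_d_zbar_commute[OF f] by simp
  finally show ?thesis by (simp add: levi_matrix_def f_def[abs_def])
qed

lemma cnj_levi: assumes "C_k 2 \<phi>"
  shows "cnj (levi_matrix \<phi> z $ j $ k) = d_zbar j (d_z k (\<lambda>w. complex_of_real (\<phi> w))) z"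
  using levi_hermitian[OF assms, of z k j] d_z_d_zbar_commute[OF C_k_of_real[OF assms], of k j z] by (simp add: levi_matrix_def)

lemma hess_bilinear:
  fixes \<phi> :: "'a::euclidean_space \<Rightarrow> real"
  assumes f: "C_k 2 \<phi>"
  shows "dd (a *\<^sub>R u + b *\<^sub>R v) (dd w \<phi>) x = a * dd u (dd w \<phi>) x + b * dd v (dd w \<phi>) x"
    and "dd w (dd (a *\<^sub>R u + b *\<^sub>R v) \<phi>) x = a * dd w (dd u \<phi>) x + b * dd w (dd v \<phi>) x"
proof -
  have d: "\<phi> differentiable at x" "dd w \<phi> differentiable at x" for w x
    using C2_differentiable[OF f] C1_differentiable[OF C1_dd[OF f]] by auto
  show *: "dd (a *\<^sub>R u + b *\<^sub>R v) (dd w \<phi>) x = a * dd u (dd w \<phi>) x + b * dd v (dd w \<phi>) x" for w u v a b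
    by (simp add: linear_add[OF dd_linear[OF d(2)[of w x]]] linear_scale[OF dd_linear[OF d(2)[of w x]]])
  show "dd w (dd (a *\<^sub>R u + b *\<^sub>R v) \<phi>) x = a * dd w (dd u \<phi>) x + b * dd w (dd v \<phi>) x"
    using * dd_commute_real[OF f] by simp
qed

text \<open>The Levi form is a quarter of the Laplacian of the restriction to the complex line spanned by \<open>v\<close>,
expressed by the real Hessian.\<close>
lemma levi_form_hess:
  fixes \<phi> :: "complex ^ 'n::finite \<Rightarrow> real"
  assumes f: "C_k 2 \<phi>"
  shows "4 * Re (\<Sum>j\<in>UNIV. \<Sum>k\<in>UNIV. levi_matrix \<phi> z $ j $ k * v $ j * cnj (v $ k)) =
    dd v (dd v \<phi>) z + dd (\<i> *s v) (dd (\<i> *s v) \<phi>) z"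
proof -
  define H where "H u w = dd u (dd w \<phi>) z" for u w
  have d: "\<phi> differentiable at x" "dd w \<phi> differentiable at x" for w x
    using C2_differentiable[OF f] C1_differentiable[OF C1_dd[OF f]] by auto
  have l1: "linear (\<lambda>u. H u w)" for w unfolding H_def by (rule dd_linear[OF d(2)])
  have l2: "linear (\<lambda>w. H u w)" for u
    using l1 unfolding H_def dd_commute_real[OF f, of u] .
  define f' where "f' w = complex_of_real (\<phi> w)" for w
  have f2: "C_k 2 f'" unfolding f'_def by (rule C_k_of_real[OF f])
  have ddf: "dd u f' = (\<lambda>x. of_real (dd u \<phi> x))" for u unfolding f'_def using dd_of_real[OF d(1)] by blast
  have ddf2: "dd u (dd w f') z = of_real (H u w)" for u w
    unfolding ddf H_def by (rule dd_of_real[OF d(2)])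
  have M: "levi_matrix \<phi> z $ j $ k = (of_real (H (axis j 1) (axis k 1) + H (axis j \<i>) (axis k \<i>)) + \<i> * of_real (H (axis j 1) (axis k \<i>) - H (axis j \<i>) (axis k 1))) / 4" for j k
    unfolding levi_matrix_def f'_def[abs_def, symmetric] vec_lambda_beta
    unfolding d_z_dd[of j "d_zbar k f'"] unfolding d_zbar_fun dd_combo[OF f2] ddf2
    by (simp add: algebra_simps add_divide_distrib diff_divide_distrib)
  have rep: "u = (\<Sum>j\<in>UNIV. Re (u $ j) *\<^sub>R axis j 1 + Im (u $ j) *\<^sub>R axis j \<i>)" for u :: "complex ^ 'n"
  proof -
    have "(\<Sum>j\<in>UNIV. Re (u $ j) *\<^sub>R axis j 1 + Im (u $ j) *\<^sub>R axis j \<i>) $ i = u $ i" for i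
    proof -
      have "(\<Sum>j\<in>UNIV. Re (u $ j) *\<^sub>R axis j 1 + Im (u $ j) *\<^sub>R axis j \<i>) $ i = (\<Sum>j\<in>UNIV. if i = j then u $ i else 0)"
        unfolding sum_component by (intro sum.cong refl) (auto simp: axis_def complex_eq_iff)
      then show ?thesis by simp
    qed
    then show ?thesis by (simp add: vec_eq_iff)
  qed
  have HH: "H u u = (\<Sum>j\<in>UNIV. \<Sum>k\<in>UNIV.
     Re (u $ j) * Re (u $ k) * H (axis j 1) (axis k 1) + Re (u $ j) * Im (u $ k) * H (axis j 1) (axis k \<i>) +
     Im (u $ j) * Re (u $ k) * H (axis j \<i>) (axis k 1) + Im (u $ j) * Im (u $ k) * H (axis j \<i>) (axis k \<i>))" for u
  proof -
    have "H u u = (\<Sum>j\<in>UNIV. H (Re (u $ j) *\<^sub>R axis j 1 + Im (u $ j) *\<^sub>R axis j \<i>) u)"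
      by (subst (1) rep) (rule linear_sum[OF l1])
    also have "\<dots> = (\<Sum>j\<in>UNIV. \<Sum>k\<in>UNIV. H (Re (u $ j) *\<^sub>R axis j 1 + Im (u $ j) *\<^sub>R axis j \<i>) (Re (u $ k) *\<^sub>R axis k 1 + Im (u $ k) *\<^sub>R axis k \<i>))"
    proof (intro sum.cong refl)
      fix j
      show "H (Re (u $ j) *\<^sub>R axis j 1 + Im (u $ j) *\<^sub>R axis j \<i>) u = (\<Sum>k\<in>UNIV. H (Re (u $ j) *\<^sub>R axis j 1 + Im (u $ j) *\<^sub>R axis j \<i>) (Re (u $ k) *\<^sub>R axis k 1 + Im (u $ k) *\<^sub>R axis k \<i>))"
        unfolding linear_sum[OF l2, symmetric] rep[of u, symmetric] ..
    qed
    finally show ?thesis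
      by (simp add: linear_add[OF l1] linear_add[OF l2] linear_scale[OF l1] linear_scale[OF l2] algebra_simps)
  qed
  have T: "4 * Re (levi_matrix \<phi> z $ j $ k * v $ j * cnj (v $ k)) =
     (Re (v $ j) * Re (v $ k) + Im (v $ j) * Im (v $ k)) * (H (axis j 1) (axis k 1) + H (axis j \<i>) (axis k \<i>))
     + (Re (v $ j) * Im (v $ k) - Im (v $ j) * Re (v $ k)) * (H (axis j 1) (axis k \<i>) - H (axis j \<i>) (axis k 1))" for j k
    unfolding M by (simp add: field_simps)
  have "4 * Re (\<Sum>j\<in>UNIV. \<Sum>k\<in>UNIV. levi_matrix \<phi> z $ j $ k * v $ j * cnj (v $ k)) =
     (\<Sum>j\<in>UNIV. \<Sum>k\<in>UNIV. 4 * Re (levi_matrix \<phi> z $ j $ k * v $ j * cnj (v $ k)))"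
    unfolding Re_sum sum_distrib_left ..
  also have "\<dots> = H v v + H (\<i> *s v) (\<i> *s v)"
    unfolding HH T sum.distrib[symmetric] by (intro sum.cong refl) (simp add: algebra_simps)
  finally have "4 * Re (\<Sum>j\<in>UNIV. \<Sum>k\<in>UNIV. levi_matrix \<phi> z $ j $ k * v $ j * cnj (v $ k)) = H v v + H (\<i> *s v) (\<i> *s v)" .
  then show ?thesis by (simp add: H_def)
qed

text \<open>Insert the second-order Taylor bound into the submean value inequality on a small circle. The
first-order terms and the mixed second-order term have mean zero over the circle, and the squares of
sine and cosine have mean \<open>1/2\<close>; what remains is the claimed sum times \<open>r\<^sup>2/4\<close>.\<close>
lemma psh_hess_nonneg:
  fixes \<phi> :: "complex ^ 'n::finite \<Rightarrow> real"
  assumes f: "C_k 2 \<phi>" and psh: "plurisubharmonic \<phi>"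
  shows "0 \<le> dd w (dd w \<phi>) z + dd (\<i> *s w) (dd (\<i> *s w) \<phi>) z"
proof (rule field_le_epsilon)
  fix e :: real assume e: "e > 0"
  define H where "H x u v = dd u (dd v \<phi>) x" for x u v
  define w' where "w' = \<i> *s w"
  have d: "\<phi> differentiable at x" "dd w \<phi> differentiable at x" for w x
    using C2_differentiable[OF f] C1_differentiable[OF C1_dd[OF f]] by auto
  have Hc: "continuous_on UNIV (\<lambda>x. H x u v)" for u v unfolding H_def using C_k_dd[of 0 "dd v \<phi>" u] C1_dd[OF f, of v] by simp
  define vt where "vt t = cos t *\<^sub>R w + sin t *\<^sub>R w'" for t
  have vt: "cis t *s w = vt t" for t
    by (simp add: vt_def w'_def vec_eq_iff cis.ctr complex_eq_iff)
  have Hvt: "H x (vt t) (vt t) = (cos t)\<^sup>2 * H x w w + sin t * cos t * (H x w w' + H x w' w) + (sin t)\<^sup>2 * H x w' w'" for x t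
    unfolding H_def vt_def by (simp add: hess_bilinear[OF f] power2_eq_square algebra_simps)
  define T where "T x = \<bar>H x w w - H z w w\<bar> + \<bar>H x w w' - H z w w'\<bar> + \<bar>H x w' w - H z w' w\<bar> + \<bar>H x w' w' - H z w' w'\<bar>" for x
  have Tle: "H x (vt t) (vt t) \<le> H z (vt t) (vt t) + T x" for x t
  proof -
    have b: "c * (p - q) \<le> \<bar>p - q\<bar>" if "\<bar>c\<bar> \<le> 1" for c p q :: real
      using mult_right_mono[OF that, of "\<bar>p - q\<bar>"] abs_ge_self[of "c * (p - q)"] by (simp add: abs_mult)
    have c1: "\<bar>(cos t)\<^sup>2\<bar> \<le> 1" "\<bar>(sin t)\<^sup>2\<bar> \<le> 1" by (auto simp: power_le_one_iff abs_square_le_1)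
    have c2: "\<bar>sin t * cos t\<bar> \<le> 1" using mult_mono[of "\<bar>sin t\<bar>" 1 "\<bar>cos t\<bar>" 1] by (simp add: abs_mult)
    show ?thesis unfolding Hvt T_def
      using b[OF c1(1), of "H x w w" "H z w w"] b[OF c2, of "H x w w'" "H z w w'"] b[OF c2, of "H x w' w" "H z w' w"] b[OF c1(2), of "H x w' w'" "H z w' w'"]
      by (simp add: algebra_simps)
  qed
  have Tc: "continuous_on UNIV T" unfolding T_def[abs_def] by (intro continuous_intros Hc)
  have "T z = 0" by (simp add: T_def)
  obtain \<delta> where \<delta>0: "\<delta> > 0" "\<And>x. dist x z < \<delta> \<Longrightarrow> dist (T x) (T z) < e/2"
    using Tc[unfolded continuous_on_iff, rule_format, of z "e/2"] e by auto
  note \<delta> = \<delta>0(1)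
  have Tsm: "T x < e/2" if "dist x z < \<delta>" for x
    using \<delta>0(2)[OF that] \<open>T z = 0\<close> by (auto simp: dist_real_def)
  define r where "r = \<delta> / (2 * (norm w + norm w' + 1))"
  have n: "norm w + norm w' + 1 > 0" by (simp add: add_nonneg_pos)
  define m where "m = norm w + norm w' + 1"
  have r: "r > 0" unfolding r_def using \<delta> n by simp
  have vn: "norm (s *\<^sub>R vt t) < \<delta>" if "0 \<le> s" "s \<le> r" for s t
  proof -
    have "norm (vt t) \<le> \<bar>cos t\<bar> * norm w + \<bar>sin t\<bar> * norm w'" unfolding vt_def by (rule order_trans[OF norm_triangle_ineq]) simp
    also have "\<dots> \<le> norm w + norm w'" by (intro add_mono mult_left_le_one_le) auto
    finally have "norm (vt t) \<le> norm w + norm w' + 1" by simp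
    then have "norm (s *\<^sub>R vt t) \<le> r * (norm w + norm w' + 1)" using that r by (auto intro!: mult_mono)
    also have "\<dots> = \<delta> / 2" using n unfolding r_def m_def[symmetric] by (simp add: field_simps)
    finally show ?thesis using \<delta> by simp
  qed
  define L where "L v = dd v \<phi> z" for v
  have taylor: "\<phi> (z + r *\<^sub>R vt t) \<le> \<phi> z + r * L (vt t) + r\<^sup>2 / 2 * (H z (vt t) (vt t) + e/2)" for t
  proof -
    define F where "F m s = (if m = 0 then \<phi> (z + s *\<^sub>R vt t) else if m = 1 then dd (vt t) \<phi> (z + s *\<^sub>R vt t) else H (z + s *\<^sub>R vt t) (vt t) (vt t))" for m :: nat and s
    have D0: "DERIV (F 0) s :> F 1 s" for s
      unfolding F_def has_real_derivative_iff_has_vector_derivative by simp (intro has_vector_derivative_line d)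
    have D1: "DERIV (F 1) s :> F 2 s" for s
      unfolding F_def H_def has_real_derivative_iff_has_vector_derivative by simp (intro has_vector_derivative_line d)
    have D: "DERIV (F m) s :> F (Suc m) s" if "m < 2" for m s
      using that D0 D1 by (cases m) (auto simp: numeral_2_eq_2 less_Suc_eq)
    obtain s where s: "0 < s" "s < r" "F 0 r = (\<Sum>m<2. F m 0 / fact m * r ^ m) + F 2 s / fact 2 * r ^ 2"
      using Maclaurin[OF r, of 2 F "F 0"] D by auto
    have "F 2 s \<le> H z (vt t) (vt t) + e/2"
      using Tle[of "z + s *\<^sub>R vt t" t] Tsm[of "z + s *\<^sub>R vt t"] vn[of s t] s by (simp add: F_def dist_norm)
    then have "F 2 s / 2 * r\<^sup>2 \<le> (H z (vt t) (vt t) + e/2) / 2 * r\<^sup>2" by (intro mult_right_mono) auto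
    moreover have "F 0 r = \<phi> z + r * L (vt t) + F 2 s / 2 * r\<^sup>2"
      using s(3) by (simp add: numeral_2_eq_2 F_def L_def mult.commute fact_numeral)
    ultimately show ?thesis by (simp add: F_def mult.commute)
  qed
  have Lvt: "L (vt t) = cos t * L w + sin t * L w'" for t
    unfolding L_def vt_def by (simp add: linear_add[OF dd_linear[OF d(1)]] linear_scale[OF dd_linear[OF d(1)]])
  define g where "g t = \<phi> z + r * (cos t * L w + sin t * L w') + r\<^sup>2 / 2 * ((cos t)\<^sup>2 * H z w w + sin t * cos t * (H z w w' + H z w' w) + (sin t)\<^sup>2 * H z w' w' + e/2)" for t
  define G where "G t = \<phi> z * t + r * (sin t * L w - cos t * L w') + r\<^sup>2 / 2 * ((t / 2 + sin t * cos t / 2) * H z w w + (sin t)\<^sup>2 / 2 * (H z w w' + H z w' w) + (t / 2 - sin t * cos t / 2) * H z w' w' + e/2 * t)" for t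
  have GD: "DERIV G t :> g t" for t
  proof -
    have sc: "(sin t)\<^sup>2 = 1 - (cos t)\<^sup>2" by (simp add: sin_squared_eq)
    show ?thesis unfolding G_def g_def
      by (rule derivative_eq_intros refl | simp)+ (simp add: sc power2_eq_square[symmetric] algebra_simps, simp add: sc power2_eq_square[symmetric] field_simps)
  qed
  have gc: "continuous_on {0..2*pi} g" unfolding g_def by (intro continuous_intros)
  have gI: "set_integrable lborel {0..2*pi} g" by (rule borel_integrable_atLeastAtMost'[OF gc])
  have "(LINT t:{0..2*pi}|lborel. g t) = G (2*pi) - G 0"
    unfolding set_lebesgue_integral_def
    by (rule integral_FTC_Icc[OF _ _ gc]) (use GD in \<open>auto simp: has_real_derivative_iff_has_vector_derivative intro: has_vector_derivative_at_within\<close>)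
  also have "\<dots> = 2 * pi * \<phi> z + r\<^sup>2 / 2 * (pi * (H z w w + H z w' w' + e))" by (simp add: G_def algebra_simps)
  finally have gi: "(LINT t:{0..2*pi}|lborel. g t) = 2 * pi * \<phi> z + r\<^sup>2 / 2 * (pi * (H z w w + H z w' w' + e))" .
  have e1: "cis t *s (r *\<^sub>R w) = r *\<^sub>R vt t" for t
    unfolding vt[symmetric] by (simp add: vec_eq_iff)
  have "set_integrable lborel {0..2 * pi} (\<lambda>t. \<phi> (z + cis t *s (r *\<^sub>R w)))"
    and sm: "\<phi> z \<le> (LINT t:{0..2 * pi}|lborel. \<phi> (z + cis t *s (r *\<^sub>R w))) / (2 * pi)"
    using psh unfolding plurisubharmonic_def by blast+
  then have "(LINT t:{0..2 * pi}|lborel. \<phi> (z + cis t *s (r *\<^sub>R w))) \<le> (LINT t:{0..2*pi}|lborel. g t)"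
    by (intro set_integral_mono gI) (use taylor in \<open>auto simp: e1 g_def Lvt Hvt\<close>)
  then have "2 * pi * \<phi> z \<le> 2 * pi * \<phi> z + r\<^sup>2 / 2 * (pi * (H z w w + H z w' w' + e))"
    using sm gi by (simp add: field_simps)
  then have "0 \<le> r\<^sup>2 / 2 * pi * (H z w w + H z w' w' + e)" by simp
  moreover have "0 < r\<^sup>2 / 2 * pi" using r by simp
  ultimately have "0 \<le> H z w w + H z w' w' + e" by (metis mult_pos_neg not_le)
  then show "0 \<le> dd w (dd w \<phi>) z + dd (\<i> *s w) (dd (\<i> *s w) \<phi>) z + e" by (simp add: H_def w'_def)
qed

lemma levi_psd:
  assumes "C_k 2 \<phi>" "plurisubharmonic \<phi>"
  shows "0 \<le> Re (\<Sum>j\<in>UNIV. \<Sum>k\<in>UNIV. levi_matrix \<phi> z $ j $ k * v j * cnj (v k))"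
  using psh_hess_nonneg[OF assms, of "\<chi> j. v j" z] levi_form_hess[OF assms(1), of z "\<chi> j. v j"] by simp

section \<open>The Kohn-Morrey-Hoermander identity\<close>

locale psh_weight = weight \<phi> for \<phi> :: "(complex, 'n::{finite,linorder}) vec \<Rightarrow> real" +
  assumes phi_nonneg: "0 \<le> \<phi> z" and C2: "C_k 2 \<phi>" and psh: "plurisubharmonic \<phi>"
begin

definition phic :: "(complex, 'n) vec \<Rightarrow> complex" where "phic z = complex_of_real (\<phi> z)"
definition wt :: "(complex, 'n) vec \<Rightarrow> complex" where "wt z = complex_of_real (exp (- \<phi> z))"

text \<open>The formal adjoint of \<open>-\<partial>/\<partial>(cnj z\<^sub>j)\<close> for the weight \<open>exp (- \<phi>)\<close>.\<close>
definition delta :: "'n \<Rightarrow> ((complex, 'n) vec \<Rightarrow> complex) \<Rightarrow> (complex, 'n) vec \<Rightarrow> complex" where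
  "delta j f z = d_z j f z - d_z j phic z * f z"

lemma C2_phic: "C_k 2 phic" unfolding phic_def[abs_def] by (rule C_k_of_real[OF C2])
lemma C2_wt: "C_k 2 wt" unfolding wt_def[abs_def] by (intro C_k_of_real C_k_exp C_k_uminus C2)
lemma cnj_phic [simp]: "cnj (phic z) = phic z" by (simp add: phic_def)
lemma cnj_wt [simp]: "cnj (wt z) = wt z" by (simp add: wt_def)
lemma inner_wt: "inner_L2 \<phi> f g = (LINT z|lborel. f z * cnj (g z) * wt z)" by (simp add: inner_L2_def wt_def)

lemma cnj_d_z_phic: "cnj (d_z j phic z) = d_zbar j phic z"
  using d_zbar_cnj[OF C2_differentiable[OF C2_phic, of z], of j] by simp

lemma d_zbar_wt: "d_zbar j wt z = - d_zbar j phic z * wt z"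
proof -
  have d: "\<phi> differentiable at z" by (rule C2_differentiable[OF C2])
  then have d': "(\<lambda>z. - \<phi> z) differentiable at z" by simp
  have "(\<lambda>z. exp (- \<phi> z)) differentiable at z" by (rule C2_differentiable[OF C_k_exp[OF C_k_uminus[OF C2]]])
  then have "dd b wt z = - (dd b phic z) * wt z" for b
    unfolding wt_def[abs_def] phic_def[abs_def] using d d'
    by (simp add: dd_of_real dd_exp dd_uminus)
  then show ?thesis by (simp add: d_zbar_dd algebra_simps add_divide_distrib diff_divide_distrib)
qed

lemma d_z_wt: "d_z j wt z = - d_z j phic z * wt z"
proof -
  have "d_z j (\<lambda>z. cnj (wt z)) z = cnj (d_zbar j wt z)" by (rule d_z_cnj) (rule C2_differentiable[OF C2_wt])
  then show ?thesis by (simp add: d_zbar_wt cnj_d_z_phic[symmetric])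
qed

lemma C1_delta: "C_k 2 f \<Longrightarrow> C_k 1 (delta j f)"
  unfolding delta_def[abs_def] by (intro C_k_diff C_k_mult C1_d_z C2_phic C2_C1)

lemma bounded_nonzero_delta: "bounded {z. f z \<noteq> 0} \<Longrightarrow> bounded {z. delta j f z \<noteq> 0}"
  by (rule bounded_subset[of "{z. d_z j f z \<noteq> 0} \<union> {z. f z \<noteq> 0}"]) (auto simp: delta_def bounded_nonzero_d_z)

lemma inner_d_zbar:
  assumes f: "C_k 1 f" and h: "C_k 1 h" and b: "bounded {z. f z \<noteq> 0} \<or> bounded {z. h z \<noteq> 0}"
  shows "inner_L2 \<phi> (d_zbar j f) h = - inner_L2 \<phi> f (delta j h)"
proof -
  have c: "C_k 1 (\<lambda>z. cnj (h z) * wt z)" by (intro C_k_mult C_k_cnj h C2_C1[OF C2_wt])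
  have dh: "h differentiable at z" "(\<lambda>z. cnj (h z)) differentiable at z" "wt differentiable at z" for z
    using h C_k_cnj[OF h] C2_wt by (auto intro: C1_differentiable C2_differentiable)
  have b': "bounded {z. f z \<noteq> 0} \<or> bounded {z. cnj (h z) * wt z \<noteq> 0}"
    using b bounded_nonzero_multL[of "\<lambda>z. cnj (h z)" wt] by auto
  have e: "d_zbar j (\<lambda>z. cnj (h z) * wt z) z = cnj (delta j h z) * wt z" for z
    by (simp add: d_zbar_mult[OF dh(2,3)] d_zbar_cnj[OF dh(1)] d_zbar_wt delta_def cnj_d_z_phic algebra_simps)
  have "inner_L2 \<phi> (d_zbar j f) h = (LINT z|lborel. d_zbar j f z * (cnj (h z) * wt z))" by (simp add: inner_wt mult.assoc)
  also have "\<dots> = - (LINT z|lborel. f z * (cnj (delta j h z) * wt z))" unfolding d_zbar_by_parts[OF f c b'] e ..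
  finally show ?thesis by (simp add: inner_wt mult.assoc)
qed

text \<open>The commutator is where the Levi matrix enters.\<close>
lemma d_zbar_delta:
  assumes g: "C_k 2 g"
  shows "d_zbar j (delta k g) z = delta k (d_zbar j g) z - cnj (levi_matrix \<phi> z $ j $ k) * g z"
proof -
  have d: "d_z k g differentiable at z" "d_z k phic differentiable at z" "g differentiable at z"
    using C1_d_z[OF g] C1_d_z[OF C2_phic] g by (auto intro: C1_differentiable C2_differentiable)
  have d': "(\<lambda>z. d_z k phic z * g z) differentiable at z"
    by (rule C1_differentiable[OF C_k_mult[OF C1_d_z[OF C2_phic] C2_C1[OF g]]])
  then have d'': "(\<lambda>z. - (d_z k phic z * g z)) differentiable at z" by simp
  have "delta k g = (\<lambda>z. d_z k g z + - (d_z k phic z * g z))" by (auto simp: delta_def)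
  then have "d_zbar j (delta k g) z = d_zbar j (d_z k g) z - (d_z k phic z * d_zbar j g z + d_zbar j (d_z k phic) z * g z)"
    by (simp only: d_zbar_add[OF d(1) d''] d_zbar_uminus[OF d'] d_zbar_mult[OF d(2,3)]) simp
  then show ?thesis by (simp add: delta_def d_z_d_zbar_commute[OF g, symmetric] cnj_levi[OF C2] phic_def[abs_def] algebra_simps)
qed

lemma continuous_levi: "continuous_on UNIV (\<lambda>z. levi_matrix \<phi> z $ j $ k)"
proof -
  have "C_k 0 (d_z j (d_zbar k phic))" using C_k_d_z[of 0 "d_zbar k phic"] C1_d_zbar[OF C2_phic] by simp
  then show ?thesis by (simp add: levi_matrix_def phic_def[abs_def])
qed

text \<open>Integrate by parts, commute the two derivatives, and integrate by parts back.\<close>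
lemma inner_delta_delta:
  assumes f: "C_k 2 f" "bounded {z. f z \<noteq> 0}" and g: "C_k 2 g" "bounded {z. g z \<noteq> 0}"
  shows "inner_L2 \<phi> (delta j f) (delta k g) = inner_L2 \<phi> (d_zbar k f) (d_zbar j g) + (LINT z|lborel. levi_matrix \<phi> z $ j $ k * f z * cnj (g z) * wt z)"
proof -
  define m where "m z = cnj (levi_matrix \<phi> z $ j $ k) * g z" for z
  have mc: "continuous_on UNIV m" unfolding m_def by (intro continuous_intros continuous_levi C_k_continuous[OF g(1)])
  have mL: "m \<in> L2 \<phi>" by (rule L2_compact_support[OF mc]) (use g(2) in \<open>auto simp: m_def elim: bounded_subset\<close>)
  have fL: "f \<in> L2 \<phi>" by (rule L2_compact_support[OF C_k_continuous[OF f(1)] f(2)])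
  have dL: "delta k (d_zbar j g) \<in> L2 \<phi>"
  proof (rule L2_compact_support)
    have "continuous_on UNIV (d_zbar j g)" "continuous_on UNIV (d_z k phic)"
      using C1_d_zbar[OF g(1)] C1_d_z[OF C2_phic] C_k_continuous by blast+
    moreover have "continuous_on UNIV (d_z k (d_zbar j g))" using C_k_d_z[of 0 "d_zbar j g"] C1_d_zbar[OF g(1)] by simp
    ultimately show "continuous_on UNIV (delta k (d_zbar j g))" unfolding delta_def by (intro continuous_intros)
    show "bounded {z. delta k (d_zbar j g) z \<noteq> 0}" by (intro bounded_nonzero_delta bounded_nonzero_d_zbar g)
  qed
  have "inner_L2 \<phi> (delta j f) (delta k g) = cnj (inner_L2 \<phi> (delta k g) (delta j f))" by (rule inner_commute)
  also have "inner_L2 \<phi> (delta k g) (delta j f) = - inner_L2 \<phi> (d_zbar j (delta k g)) f"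
    using inner_d_zbar[OF C1_delta[OF g(1)] C2_C1[OF f(1)], of k j] f(2) by simp
  also have "d_zbar j (delta k g) = (\<lambda>z. delta k (d_zbar j g) z + -1 * m z)" by (auto simp: d_zbar_delta[OF g(1)] m_def)
  also have "inner_L2 \<phi> (\<lambda>z. delta k (d_zbar j g) z + -1 * m z) f = inner_L2 \<phi> (delta k (d_zbar j g)) f - inner_L2 \<phi> m f"
    by (subst inner_add_left[OF dL L2_cmult[OF mL] fL]) (simp only: inner_cmult_left, simp)
  also have "cnj (- (inner_L2 \<phi> (delta k (d_zbar j g)) f - inner_L2 \<phi> m f)) = - inner_L2 \<phi> f (delta k (d_zbar j g)) + inner_L2 \<phi> f m"
    using inner_commute[of f m] inner_commute[of f "delta k (d_zbar j g)"] by simp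
  also have "- inner_L2 \<phi> f (delta k (d_zbar j g)) = inner_L2 \<phi> (d_zbar k f) (d_zbar j g)"
    using inner_d_zbar[OF C2_C1[OF f(1)] C1_d_zbar[OF g(1)], of j k] f(2) by simp
  also have "inner_L2 \<phi> f m = (LINT z|lborel. levi_matrix \<phi> z $ j $ k * f z * cnj (g z) * wt z)"
    by (simp add: inner_wt m_def mult_ac)
  finally show ?thesis .
qed

definition dbar_form :: "'n form \<Rightarrow> 'n form" where
  "dbar_form g K z = (\<Sum>j\<in>K. wedge_sign j (K - {j}) * d_zbar j (g (K - {j})) z)"
definition dstar_form :: "'n form \<Rightarrow> 'n form" where
  "dstar_form g L z = - (\<Sum>j\<in>-L. wedge_sign j L * delta j (g (insert j L)) z)"
definition Q :: "nat \<Rightarrow> 'n form \<Rightarrow> real" where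
  "Q p g = (\<Sum>K\<in>multi_indices (Suc (Suc p)). n2 (dbar_form g K)) + (\<Sum>L\<in>multi_indices p. n2 (dstar_form g L))"

text \<open>The integrand of the curvature term; it is the quadratic form of the Levi matrix on the contractions of \<open>g\<close>.\<close>
definition levi_term :: "nat \<Rightarrow> 'n form \<Rightarrow> (complex, 'n) vec \<Rightarrow> complex" where
  "levi_term p g z = (\<Sum>L\<in>multi_indices p. \<Sum>j\<in>UNIV. \<Sum>k\<in>UNIV. levi_matrix \<phi> z $ j $ k * contr j (\<lambda>J. g J z) L * cnj (contr k (\<lambda>J. g J z) L))"

definition test_form :: "'n form \<Rightarrow> bool" where "test_form g \<longleftrightarrow> (\<forall>J. test_function (g J))"

lemma L2_test: "test_function f \<Longrightarrow> f \<in> L2 \<phi>"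
  by (rule L2_compact_support) (auto intro: C_k_continuous test_function_C_k test_function_bounded)

lemma L2_delta: "test_function f \<Longrightarrow> delta j f \<in> L2 \<phi>"
  by (rule L2_compact_support[OF C_k_continuous[OF C1_delta] bounded_nonzero_delta]) (auto intro: test_function_C_k test_function_bounded)

lemma inner_sum_sum:
  assumes "finite I" "\<And>i. i \<in> I \<Longrightarrow> f i \<in> L2 \<phi>"
  shows "inner_L2 \<phi> (\<lambda>z. \<Sum>i\<in>I. c i * f i z) (\<lambda>z. \<Sum>i\<in>I. c i * f i z) = (\<Sum>i\<in>I. \<Sum>k\<in>I. c i * cnj (c k) * inner_L2 \<phi> (f i) (f k))"
proof -
  have L: "(\<lambda>z. \<Sum>i\<in>I. c i * f i z) \<in> L2 \<phi>" by (intro L2_sum L2_cmult assms)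
  have "inner_L2 \<phi> (f i) (\<lambda>z. \<Sum>i\<in>I. c i * f i z) = (\<Sum>k\<in>I. cnj (c k) * inner_L2 \<phi> (f i) (f k))" if "i \<in> I" for i
  proof -
    have "inner_L2 \<phi> (f i) (\<lambda>z. \<Sum>i\<in>I. c i * f i z) = cnj (inner_L2 \<phi> (\<lambda>z. \<Sum>i\<in>I. c i * f i z) (f i))" by (rule inner_commute)
    also have "\<dots> = cnj (\<Sum>k\<in>I. c k * inner_L2 \<phi> (f k) (f i))"
      using assms that by (subst inner_sum_left) (auto intro: L2_cmult simp: inner_cmult_left)
    also have "\<dots> = (\<Sum>k\<in>I. cnj (c k) * cnj (inner_L2 \<phi> (f k) (f i)))" by simp
    finally show ?thesis by (simp add: inner_commute[of "f i"])
  qed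
  then show ?thesis using assms L
    by (subst inner_sum_left) (auto intro: L2_cmult simp: inner_cmult_left sum_distrib_left mult.assoc)
qed

lemma levi_term_continuous: "test_form g \<Longrightarrow> continuous_on UNIV (levi_term p g)"
proof -
  assume g: "test_form g"
  have c: "continuous_on UNIV (\<lambda>z. contr j (\<lambda>J. g J z) L)" for j L
    using g by (cases "j \<in> L") (auto simp: contr_def test_form_def intro!: continuous_intros C_k_continuous[OF test_function_C_k[OF test_function_cmult, where k=0]])
  show ?thesis unfolding levi_term_def by (intro continuous_intros continuous_levi c)
qed

lemma levi_term_support: assumes "test_form g" shows "bounded {z. levi_term p g z \<noteq> 0}"
proof (rule bounded_subset)
  show "bounded (\<Union>J\<in>UNIV. {z. g J z \<noteq> 0})" using assms by (intro bounded_UN) (auto simp: test_form_def test_function_bounded)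
  show "{z. levi_term p g z \<noteq> 0} \<subseteq> (\<Union>J\<in>UNIV. {z. g J z \<noteq> 0})"
  proof (rule ccontr)
    assume "\<not> ?thesis"
    then obtain z where z: "levi_term p g z \<noteq> 0" "\<And>J. g J z = 0" by auto
    then show False by (simp add: levi_term_def contr_def cong: if_cong)
  qed
qed

text \<open>Expand both norms in \<open>Q\<close> into sums of inner products, and move the derivatives in the second one with
\<open>inner_delta_delta\<close>. The terms with derivatives then combine through \<open>wedge_contraction_identity\<close> into
the full sum over \<open>j\<close> and \<open>J\<close>, and the commutators give the Levi term.\<close>
lemma kohn_morrey_hoermander:
  assumes g: "test_form g"
  shows "of_real (Q p g) = of_real (\<Sum>J\<in>multi_indices (Suc p). \<Sum>j\<in>UNIV. n2 (d_zbar j (g J))) + (LINT z|lborel. levi_term p g z * wt z)"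
proof -
  have t: "test_function (g J)" for J using g by (simp add: test_form_def)
  have C2g: "C_k 2 (g J)" and bg: "bounded {z. g J z \<noteq> 0}" for J using t test_function_C_k test_function_bounded by auto
  have zL: "d_zbar j (g J) \<in> L2 \<phi>" for j J by (intro L2_test test_function_d_zbar t)
  define F where "F j k J J' = inner_L2 \<phi> (d_zbar j (g J)) (d_zbar k (g J'))" for j k J J'
  define I where "I j k L = (LINT z|lborel. levi_matrix \<phi> z $ j $ k * g (insert j L) z * cnj (g (insert k L) z) * wt z)" for j k L
  have 1: "of_real (n2 (dbar_form g K)) = (\<Sum>j\<in>K. \<Sum>k\<in>K. wedge_sign j (K - {j}) * wedge_sign k (K - {k}) * F j k (K - {j}) (K - {k}))" for K
  proof -
    have "dbar_form g K = (\<lambda>z. \<Sum>j\<in>K. wedge_sign j (K - {j}) * d_zbar j (g (K - {j})) z)" by (auto simp: dbar_form_def)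
    then show ?thesis unfolding inner_self[symmetric] using inner_sum_sum[of K "\<lambda>j. d_zbar j (g (K - {j}))" "\<lambda>j. wedge_sign j (K - {j})"] zL
      by (simp add: F_def)
  qed
  have 2: "of_real (n2 (dstar_form g L)) = (\<Sum>j\<in>-L. \<Sum>k\<in>-L. wedge_sign j L * wedge_sign k L * (F k j (insert j L) (insert k L) + I j k L))" for L
  proof -
    have e: "dstar_form g L = (\<lambda>z. \<Sum>j\<in>-L. (- wedge_sign j L) * delta j (g (insert j L)) z)" by (auto simp: dstar_form_def sum_negf)
    have "of_real (n2 (dstar_form g L)) = (\<Sum>j\<in>-L. \<Sum>k\<in>-L. (- wedge_sign j L) * cnj (- wedge_sign k L) * inner_L2 \<phi> (delta j (g (insert j L))) (delta k (g (insert k L))))"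
      unfolding inner_self[symmetric] e by (rule inner_sum_sum) (auto intro: L2_delta t)
    then show ?thesis by (simp add: inner_delta_delta[OF C2g bg C2g bg] F_def I_def)
  qed
  have "of_real (Q p g) = (\<Sum>K\<in>multi_indices (Suc (Suc p)). \<Sum>j\<in>K. \<Sum>k\<in>K. wedge_sign j (K - {j}) * wedge_sign k (K - {k}) * F j k (K - {j}) (K - {k}))
     + (\<Sum>L\<in>multi_indices p. \<Sum>j\<in>-L. \<Sum>k\<in>-L. wedge_sign j L * wedge_sign k L * F k j (insert j L) (insert k L))
     + (\<Sum>L\<in>multi_indices p. \<Sum>j\<in>-L. \<Sum>k\<in>-L. wedge_sign j L * wedge_sign k L * I j k L)"
    unfolding Q_def of_real_add of_real_sum 1 2 by (simp add: distrib_left sum.distrib)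
  also have "(\<Sum>L\<in>multi_indices p. \<Sum>j\<in>-L. \<Sum>k\<in>-L. wedge_sign j L * wedge_sign k L * F k j (insert j L) (insert k L))
     = (\<Sum>L\<in>multi_indices p. \<Sum>j\<in>-L. \<Sum>k\<in>-L. wedge_sign j L * wedge_sign k L * F j k (insert k L) (insert j L))"
    by (rule sum.cong[OF refl], subst sum.swap) (simp add: mult.commute)
  also note wedge_contraction_identity[of F p]
  also have "(\<Sum>J\<in>multi_indices (Suc p). \<Sum>j\<in>UNIV. F j j J J) = of_real (\<Sum>J\<in>multi_indices (Suc p). \<Sum>j\<in>UNIV. n2 (d_zbar j (g J)))"
    by (simp add: F_def inner_self)
  also have "(\<Sum>L\<in>multi_indices p. \<Sum>j\<in>-L. \<Sum>k\<in>-L. wedge_sign j L * wedge_sign k L * I j k L) = (LINT z|lborel. levi_term p g z * wt z)"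
  proof -
    have ic: "integrable lborel (\<lambda>z. levi_matrix \<phi> z $ j $ k * g J z * cnj (g J' z) * wt z)" for j k J J'
      using bg[of J] by (intro integrable_compact_support continuous_intros continuous_levi C_k_continuous[OF C2g] C_k_continuous[OF C2_wt]) (auto elim: bounded_subset)
    have e: "levi_term p g z * wt z = (\<Sum>L\<in>multi_indices p. \<Sum>j\<in>-L. \<Sum>k\<in>-L. wedge_sign j L * wedge_sign k L * (levi_matrix \<phi> z $ j $ k * g (insert j L) z * cnj (g (insert k L) z) * wt z))" for z
    proof -
      have "(\<Sum>j\<in>UNIV. \<Sum>k\<in>UNIV. levi_matrix \<phi> z $ j $ k * contr j (\<lambda>J. g J z) L * cnj (contr k (\<lambda>J. g J z) L)) =
        (\<Sum>j\<in>-L. \<Sum>k\<in>-L. levi_matrix \<phi> z $ j $ k * (wedge_sign j L * g (insert j L) z) * cnj (wedge_sign k L * g (insert k L) z))" for L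
        by (intro sum.mono_neutral_cong_right; auto simp: contr_def intro!: sum.mono_neutral_cong_right)
      then show ?thesis by (simp add: levi_term_def sum_distrib_left sum_distrib_right mult_ac)
    qed
    show ?thesis unfolding e I_def by (simp add: ic Bochner_Integration.integral_sum)
  qed
  finally show ?thesis .
qed

lemma levi_term_Re_nonneg: "0 \<le> Re (levi_term p g z)"
  unfolding levi_term_def Re_sum[of _ "multi_indices p"] by (intro sum_nonneg levi_psd[OF C2 psh])

lemma levi_term_lower_bound:
  assumes "Suc p \<le> CARD('n)"
  shows "sum_smallest_eigenvalues (Suc p) (levi_matrix \<phi> z) * (\<Sum>J\<in>multi_indices (Suc p). (cmod (g J z))\<^sup>2) \<le> Re (levi_term p g z)"
  unfolding levi_term_def by (rule levi_form_lower_bound[OF levi_hermitian[OF C2] assms])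

lemma kohn_morrey_hoermander_real:
  assumes g: "test_form g"
  shows "Q p g = (\<Sum>J\<in>multi_indices (Suc p). \<Sum>j\<in>UNIV. n2 (d_zbar j (g J))) + (LINT z|lborel. Re (levi_term p g z) * exp (- \<phi> z))"
    and "integrable lborel (\<lambda>z. Re (levi_term p g z) * exp (- \<phi> z))"
proof -
  have i: "integrable lborel (\<lambda>z. levi_term p g z * wt z)"
    using levi_term_support[OF g, of p]
    by (intro integrable_compact_support continuous_intros levi_term_continuous[OF g] C_k_continuous[OF C2_wt]) (auto elim: bounded_subset)
  have e: "Re (levi_term p g z * wt z) = Re (levi_term p g z) * exp (- \<phi> z)" for z by (simp add: wt_def)
  show "integrable lborel (\<lambda>z. Re (levi_term p g z) * exp (- \<phi> z))" using integrable_Re[OF i] by (simp only: e)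
  show "Q p g = (\<Sum>J\<in>multi_indices (Suc p). \<Sum>j\<in>UNIV. n2 (d_zbar j (g J))) + (LINT z|lborel. Re (levi_term p g z) * exp (- \<phi> z))"
    using arg_cong[OF kohn_morrey_hoermander[OF g, of p], of Re] integral_Re[OF i, unfolded e] by simp
qed

lemma sum_d_zbar_le_Q:
  assumes g: "test_form g"
  shows "(\<Sum>J\<in>multi_indices (Suc p). \<Sum>j\<in>UNIV. n2 (d_zbar j (g J))) \<le> Q p g"
  using kohn_morrey_hoermander_real(1)[OF g, of p] levi_term_Re_nonneg by (simp add: integral_nonneg)

text \<open>Outside the ball the Levi term dominates \<open>c |g|\<^sup>2\<close> by the eigenvalue bound, and inside it is nonnegative
by plurisubharmonicity.\<close>
lemma tail_le_Q:
  assumes g: "test_form g" and p: "Suc p \<le> CARD('n)" and c: "c \<ge> 0"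
    and s: "\<And>z. norm z \<ge> R \<Longrightarrow> c \<le> sum_smallest_eigenvalues (Suc p) (levi_matrix \<phi> z)"
  shows "c * (\<Sum>J\<in>multi_indices (Suc p). n2 (\<lambda>z. indicator {z. norm z \<ge> R} z * g J z)) \<le> Q p g"
proof -
  have t: "test_function (g J)" for J using g by (simp add: test_form_def)
  have iL: "(\<lambda>z. indicator {z. norm z \<ge> R} z * g J z) \<in> L2 \<phi>" for J
  proof (rule L2_bounded_mult[where B=1])
    have "closed {z::(complex,'n) vec. norm z \<ge> R}" by (intro closed_Collect_le continuous_intros)
    then show "(\<lambda>z. indicator {z. norm z \<ge> R} z :: complex) \<in> borel_measurable borel" by (intro borel_measurable_indicator) auto
  qed (auto simp: indicator_def L2_test t)
  have ii: "integrable lborel (\<lambda>z. (cmod (indicator {z. norm z \<ge> R} z * g J z))\<^sup>2 * exp (- \<phi> z))" for J using iL by (simp add: L2_def)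
  have "c * (\<Sum>J\<in>multi_indices (Suc p). n2 (\<lambda>z. indicator {z. norm z \<ge> R} z * g J z)) =
    (LINT z|lborel. c * (\<Sum>J\<in>multi_indices (Suc p). (cmod (indicator {z. norm z \<ge> R} z * g J z))\<^sup>2 * exp (- \<phi> z)))"
    unfolding n2_def using ii by (simp add: Bochner_Integration.integral_sum)
  also have "\<dots> \<le> (LINT z|lborel. Re (levi_term p g z) * exp (- \<phi> z))"
  proof (rule integral_mono)
    show "integrable lborel (\<lambda>z. c * (\<Sum>J\<in>multi_indices (Suc p). (cmod (indicator {z. norm z \<ge> R} z * g J z))\<^sup>2 * exp (- \<phi> z)))"
      using ii by (intro integrable_mult_right Bochner_Integration.integrable_sum)
    show "integrable lborel (\<lambda>z. Re (levi_term p g z) * exp (- \<phi> z))" by (rule kohn_morrey_hoermander_real(2)[OF g])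
    fix z
    show "c * (\<Sum>J\<in>multi_indices (Suc p). (cmod (indicator {z. norm z \<ge> R} z * g J z))\<^sup>2 * exp (- \<phi> z)) \<le> Re (levi_term p g z) * exp (- \<phi> z)"
    proof (cases "norm z \<ge> R")
      case True
      have "c * (\<Sum>J\<in>multi_indices (Suc p). (cmod (g J z))\<^sup>2) \<le> Re (levi_term p g z)"
        by (rule order_trans[OF mult_right_mono[OF s[OF True]] levi_term_lower_bound[OF p]]) (simp add: sum_nonneg)
      then have "c * (\<Sum>J\<in>multi_indices (Suc p). (cmod (g J z))\<^sup>2) * exp (- \<phi> z) \<le> Re (levi_term p g z) * exp (- \<phi> z)"
        by (rule mult_right_mono) simp
      then show ?thesis using True by (simp add: sum_distrib_right mult.assoc)
    next
      case False then show ?thesis using levi_term_Re_nonneg by simp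
    qed
  qed
  also have "\<dots> \<le> Q p g"
  proof -
    have "0 \<le> (\<Sum>J\<in>multi_indices (Suc p). \<Sum>j\<in>UNIV. n2 (d_zbar j (g J)))" by (intro sum_nonneg n2_nonneg)
    then show ?thesis using kohn_morrey_hoermander_real(1)[OF g, of p] by linarith
  qed
  finally show ?thesis .
qed

end

section \<open>Mollification of forms in the domains of the operators\<close>

lemma d_zbar_const0 [simp]: "d_zbar j (\<lambda>z. 0) = (\<lambda>z. 0)" by (auto simp: d_zbar_dd)

lemma conv_combo:
  assumes f: "integrable lborel f" and a: "test_function a" and b: "test_function b"
  shows "conv f (\<lambda>x. (a x + c * b x) / 2) z = (conv f a z + c * conv f b z) / 2"
proof -
  have i: "integrable lborel (\<lambda>w. f w * a (w - z))" "integrable lborel (\<lambda>w. f w * b (w - z))"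
    by (intro integrable_mult_test f test_function_shift a b)+
  have "conv f (\<lambda>x. (a x + c * b x) / 2) z = (LINT w|lborel. (f w * a (w - z) + c * (f w * b (w - z))) / 2)"
    unfolding conv_def by (rule Bochner_Integration.integral_cong) (simp_all add: field_simps)
  then show ?thesis using i by (simp add: conv_def)
qed

lemma d_zbar_conv:
  assumes "integrable lborel f" "test_function \<eta>"
  shows "d_zbar j (conv f \<eta>) z = - conv f (d_zbar j \<eta>) z"
  unfolding d_zbar_fun[of j \<eta>] conv_combo[OF assms(1) test_function_dd[OF assms(2)] test_function_dd[OF assms(2)]]
  by (simp add: d_zbar_dd dd_conv[OF assms] algebra_simps add_divide_distrib diff_divide_distrib)

lemma d_z_conv:
  assumes "integrable lborel f" "test_function \<eta>"
  shows "d_z j (conv f \<eta>) z = - conv f (d_z j \<eta>) z"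
  unfolding d_z_fun[of j \<eta>] conv_combo[OF assms(1) test_function_dd[OF assms(2)] test_function_dd[OF assms(2)]]
  by (simp add: d_z_dd dd_conv[OF assms] algebra_simps add_divide_distrib diff_divide_distrib)

context weight
begin

lemma exp_phi_bounded_below:
  obtains m where "m > 0" "\<And>z. norm z \<le> R \<Longrightarrow> m \<le> exp (- \<phi> z)"
proof -
  have "compact (\<phi> ` cball 0 R)" using phi_cont by (intro compact_continuous_image) (auto intro: continuous_on_subset)
  then obtain B where "\<And>y. y \<in> \<phi> ` cball 0 R \<Longrightarrow> norm y \<le> B" using compact_imp_bounded bounded_iff by metis
  then have "\<phi> z \<le> B" if "norm z \<le> R" for z using that by (force simp: abs_le_iff)
  then show ?thesis using that[of "exp (- B)"] by auto
qed

text \<open>On a ball the weight is bounded below, so that the weighted norm controls the unweighted one.\<close>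
lemma nn2_le_n2:
  assumes f: "f \<in> L2 \<phi>" and s: "\<And>z. norm z > R \<Longrightarrow> f z = 0" and m: "m > 0" "\<And>z. norm z \<le> R \<Longrightarrow> m \<le> exp (- \<phi> z)"
  shows "nn2 f \<le> ennreal (n2 f / m)"
proof -
  note [measurable] = f[THEN L2_measurable]
  have "nn2 f \<le> (\<integral>\<^sup>+z. ennreal (1/m) * ennreal ((cmod (f z))\<^sup>2 * exp (- \<phi> z)) \<partial>lborel)"
    unfolding nn2_def
  proof (intro nn_integral_mono)
    fix z
    have "(cmod (f z))\<^sup>2 \<le> (1/m) * ((cmod (f z))\<^sup>2 * exp (- \<phi> z))"
    proof (cases "norm z > R")
      case False
      then have "(cmod (f z))\<^sup>2 * m \<le> (cmod (f z))\<^sup>2 * exp (- \<phi> z)" using m(2)[of z] by (intro mult_left_mono) auto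
      then show ?thesis using m(1) by (simp add: field_simps)
    qed (simp add: s)
    then show "ennreal ((cmod (f z))\<^sup>2) \<le> ennreal (1/m) * ennreal ((cmod (f z))\<^sup>2 * exp (- \<phi> z))"
      using m(1) by (simp add: ennreal_mult[symmetric] ennreal_leI del: ennreal_1)
  qed
  also have "\<dots> = ennreal (1/m) * ennreal (n2 f)" by (simp add: nn_integral_cmult n2_ennreal[OF f])
  also have "\<dots> = ennreal (n2 f / m)" using m(1) n2_nonneg[of f] by (simp add: ennreal_mult[symmetric] del: ennreal_1)
  finally show ?thesis .
qed

lemma L2_bounded_support_integrable:
  assumes f: "f \<in> L2 \<phi>" and s: "\<And>z. norm z > R \<Longrightarrow> f z = 0"
  shows "integrable lborel f" "nn2 f < \<infinity>"
proof -
  note [measurable] = f[THEN L2_measurable]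
  obtain m where m: "m > 0" "\<And>z. norm z \<le> R \<Longrightarrow> m \<le> exp (- \<phi> z)" using exp_phi_bounded_below[of R] by blast
  have "nn2 f \<le> ennreal (n2 f / m)" by (rule nn2_le_n2[OF f s m])
  then show nf: "nn2 f < \<infinity>" by (simp add: le_less_trans)
  show "integrable lborel f"
  proof (rule integrableI_bounded)
    have "(\<integral>\<^sup>+z. ennreal (cmod (f z)) \<partial>lborel) \<le> (\<integral>\<^sup>+z. indicator (cball (0::(complex,'n) vec) R) z + ennreal ((cmod (f z))\<^sup>2) \<partial>lborel)"
    proof (intro nn_integral_mono)
      fix z
      have "2 * cmod (f z) * 1 \<le> (cmod (f z))\<^sup>2 + 1\<^sup>2" by (rule sum_squares_bound)
      then have "cmod (f z) \<le> 1 + (cmod (f z))\<^sup>2" using norm_ge_zero[of "f z"] unfolding power_one mult_1_right by linarith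
      then have "ennreal (cmod (f z)) \<le> 1 + ennreal ((cmod (f z))\<^sup>2)"
        by (metis ennreal_1 ennreal_leI ennreal_plus zero_le_one zero_le_power2)
      then show "ennreal (cmod (f z)) \<le> indicator (cball 0 R) z + ennreal ((cmod (f z))\<^sup>2)"
        using s[of z] by (cases "norm z > R") (auto simp: indicator_def)
    qed
    also have "\<dots> = emeasure lborel (cball (0::(complex,'n) vec) R) + nn2 f"
      unfolding nn2_def by (subst nn_integral_add) (auto intro!: borel_measurable_indicator)
    also have "\<dots> < \<infinity>" using nf emeasure_lborel_cball_finite[of "0::(complex,'n) vec" R] by simp
    finally show "(\<integral>\<^sup>+z. ennreal (norm (f z)) \<partial>lborel) < \<infinity>" .
  qed measurable
qed

text \<open>The weight is at most \<open>1\<close> because \<open>\<phi>\<close> is nonnegative.\<close>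
lemma n2_le_nn2:
  assumes [measurable]: "f \<in> borel_measurable borel" and p: "\<And>z. 0 \<le> \<phi> z" and E: "nn2 f \<le> ennreal E" "E \<ge> 0"
  shows "f \<in> L2 \<phi>" "n2 f \<le> E"
proof -
  have "(\<integral>\<^sup>+z. ennreal ((cmod (f z))\<^sup>2 * exp (- \<phi> z)) \<partial>lborel) \<le> nn2 f"
    unfolding nn2_def using p by (intro nn_integral_mono ennreal_leI mult_left_le) auto
  from order_trans[OF this E(1)] have "(\<integral>\<^sup>+z. ennreal ((cmod (f z))\<^sup>2 * exp (- \<phi> z)) \<partial>lborel) \<le> ennreal E" .
  from L2_I_nn[OF assms(1) this E(2)] show "f \<in> L2 \<phi>" "n2 f \<le> E" by auto
qed

lemma n2_add_le: assumes "f \<in> L2 \<phi>" "g \<in> L2 \<phi>" shows "n2 (\<lambda>z. f z + g z) \<le> 2 * n2 f + 2 * n2 g"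
proof -
  have i: "integrable lborel (\<lambda>z. (cmod (h z))\<^sup>2 * exp (- \<phi> z))" if "h \<in> L2 \<phi>" for h using that by (simp add: L2_def)
  have "n2 (\<lambda>z. f z + g z) \<le> (LINT z|lborel. 2 * ((cmod (f z))\<^sup>2 * exp (- \<phi> z)) + 2 * ((cmod (g z))\<^sup>2 * exp (- \<phi> z)))"
    unfolding n2_def
  proof (rule integral_mono)
    show "integrable lborel (\<lambda>z. (cmod (f z + g z))\<^sup>2 * exp (- \<phi> z))" by (rule i[OF L2_add[OF assms]])
    show "integrable lborel (\<lambda>z. 2 * ((cmod (f z))\<^sup>2 * exp (- \<phi> z)) + 2 * ((cmod (g z))\<^sup>2 * exp (- \<phi> z)))" using i assms by simp
    show "(cmod (f z + g z))\<^sup>2 * exp (- \<phi> z) \<le> 2 * ((cmod (f z))\<^sup>2 * exp (- \<phi> z)) + 2 * ((cmod (g z))\<^sup>2 * exp (- \<phi> z))" for z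
      using mult_right_mono[OF sq_norm_add_le[of "f z" "g z"], of "exp (- \<phi> z)"] by (simp add: algebra_simps)
  qed
  also have "\<dots> = 2 * n2 f + 2 * n2 g" using i assms by (simp add: n2_def)
  finally show ?thesis .
qed

lemma n2_cmult: "n2 (\<lambda>z. c * f z) = (cmod c)\<^sup>2 * n2 f"
  by (simp add: n2_def norm_mult power_mult_distrib mult.assoc)

lemma n2_mono:
  assumes f: "f \<in> borel_measurable borel" and g: "g \<in> L2 \<phi>" and le: "\<And>z. cmod (f z) \<le> cmod (g z)"
  shows "f \<in> L2 \<phi>" "n2 f \<le> n2 g"
proof -
  have m: "(cmod (f z))\<^sup>2 * exp (- \<phi> z) \<le> (cmod (g z))\<^sup>2 * exp (- \<phi> z)" for z using le[of z] by (intro mult_right_mono power_mono) auto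
  have i: "integrable lborel (\<lambda>z. (cmod (g z))\<^sup>2 * exp (- \<phi> z))" using g by (simp add: L2_def)
  have j: "integrable lborel (\<lambda>z. (cmod (f z))\<^sup>2 * exp (- \<phi> z))"
  proof (rule Bochner_Integration.integrable_bound[OF i])
    note [measurable] = f
    show "(\<lambda>z. (cmod (f z))\<^sup>2 * exp (- \<phi> z)) \<in> borel_measurable lborel" by measurable
  qed (use m in simp)
  then show "f \<in> L2 \<phi>" using f by (simp add: L2_def)
  show "n2 f \<le> n2 g" unfolding n2_def by (rule integral_mono[OF j i m])
qed

lemma n2_bounded_mult:
  assumes f: "f \<in> L2 \<phi>" and g: "g \<in> borel_measurable borel" and b: "\<And>z. cmod (g z) \<le> B"
  shows "n2 (\<lambda>z. g z * f z) \<le> B\<^sup>2 * n2 f"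
proof -
  have B: "B \<ge> 0" using b norm_ge_zero order_trans by blast
  have "n2 (\<lambda>z. g z * f z) \<le> n2 (\<lambda>z. of_real B * f z)"
  proof (intro n2_mono(2) L2_cmult f)
    show "(\<lambda>z. g z * f z) \<in> borel_measurable borel" using g f[THEN L2_measurable] by (rule borel_measurable_times)
    show "cmod (g z * f z) \<le> cmod (of_real B * f z)" for z using b[of z] B by (simp add: norm_mult mult_right_mono)
  qed
  then show ?thesis by (simp add: n2_cmult)
qed

lemma n2_null_mult:
  assumes f: "f \<in> L2 \<phi>" and m: "\<And>n. m n \<in> borel_measurable borel" and b: "\<And>n z. cmod (m n z) \<le> B"
    and l: "\<And>z. (\<lambda>n. m n z) \<longlonglongrightarrow> 0"
  shows "(\<lambda>n. n2 (\<lambda>z. m n z * f z)) \<longlonglongrightarrow> 0"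
proof -
  note [measurable] = m f[THEN L2_measurable]
  have "(\<lambda>n. n2 (\<lambda>z. m n z * f z)) \<longlonglongrightarrow> (LINT z|(lborel :: (complex,'n) vec measure). 0)"
    unfolding n2_def
  proof (rule integral_dominated_convergence[where w="\<lambda>z. B\<^sup>2 * ((cmod (f z))\<^sup>2 * exp (- \<phi> z))"])
    show "integrable lborel (\<lambda>z. B\<^sup>2 * ((cmod (f z))\<^sup>2 * exp (- \<phi> z)))" using f by (simp add: L2_def)
    show "AE z in lborel. (\<lambda>n. (cmod (m n z * f z))\<^sup>2 * exp (- \<phi> z)) \<longlonglongrightarrow> 0"
    proof (intro AE_I2)
      fix z
      have "(\<lambda>n. (cmod (m n z * f z))\<^sup>2 * exp (- \<phi> z)) \<longlonglongrightarrow> (cmod (0 * f z))\<^sup>2 * exp (- \<phi> z)" by (intro tendsto_intros l)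
      then show "(\<lambda>n. (cmod (m n z * f z))\<^sup>2 * exp (- \<phi> z)) \<longlonglongrightarrow> 0" by simp
    qed
    have "(cmod (m n z * f z))\<^sup>2 * exp (- \<phi> z) \<le> B\<^sup>2 * ((cmod (f z))\<^sup>2 * exp (- \<phi> z))" for n z
      using power_mono[OF b[of n z], of 2] by (simp add: norm_mult power_mult_distrib mult_right_mono mult.assoc)
    then show "AE z in lborel. norm ((cmod (m n z * f z))\<^sup>2 * exp (- \<phi> z)) \<le> B\<^sup>2 * ((cmod (f z))\<^sup>2 * exp (- \<phi> z))" for n by simp
  qed measurable
  then show ?thesis by simp
qed

end

context psh_weight
begin

lemma L2_C1: "C_k 1 f \<Longrightarrow> bounded {z. f z \<noteq> 0} \<Longrightarrow> f \<in> L2 \<phi>"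
  by (intro L2_compact_support C_k_continuous)

lemma L2_d_zbar_C1: "C_k 1 f \<Longrightarrow> bounded {z. f z \<noteq> 0} \<Longrightarrow> d_zbar j f \<in> L2 \<phi>"
  by (intro L2_compact_support bounded_nonzero_d_zbar C_k_continuous[OF C_k_d_zbar[of 0]]) auto

lemma has_dbar_classical:
  assumes a: "\<And>J. C_k 1 (a J)" and b: "\<And>J. bounded {z. a J z \<noteq> 0}"
  shows "has_dbar \<phi> p a (dbar_form a)"
  unfolding has_dbar_def
proof (intro conjI ballI allI impI)
  show "a \<in> L2_forms \<phi> p" using L2_C1[OF a b] by (simp add: L2_forms_def)
  have "dbar_form a K \<in> L2 \<phi>" for K
    unfolding dbar_form_def[abs_def] by (intro L2_sum L2_cmult L2_d_zbar_C1 a b)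
  then show "dbar_form a \<in> L2_forms \<phi> (p + 1)" by (simp add: L2_forms_def)
  fix K \<eta> assume t: "test_function (\<eta> :: (complex, 'n) vec \<Rightarrow> complex)"
  have i: "integrable lborel (\<lambda>z. d_zbar j (a J) z * \<eta> z)" for j J
    using C_k_continuous[OF test_function_C_k[OF t, of 0]] C_k_continuous[OF C_k_d_zbar[of 0 "a J" j]] a[of J]
    by (intro integrable_compact_support continuous_intros bounded_nonzero_multL bounded_nonzero_d_zbar b) auto
  have "(LINT z|lborel. dbar_form a K z * \<eta> z) = (LINT z|lborel. (\<Sum>j\<in>K. wedge_sign j (K - {j}) * (d_zbar j (a (K - {j})) z * \<eta> z)))"
    by (simp add: dbar_form_def sum_distrib_right mult.assoc)
  also have "\<dots> = (\<Sum>j\<in>K. wedge_sign j (K - {j}) * (LINT z|lborel. d_zbar j (a (K - {j})) z * \<eta> z))"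
    using i by (simp add: Bochner_Integration.integral_sum)
  also have "\<dots> = (\<Sum>j\<in>K. wedge_sign j (K - {j}) * - (LINT z|lborel. a (K - {j}) z * d_zbar j \<eta> z))"
    using d_zbar_by_parts[OF a test_function_C_k[OF t]] b by simp
  finally show "(LINT z|lborel. dbar_form a K z * \<eta> z) = (\<Sum>j\<in>K. wedge_sign j (K - {j}) * - (LINT z|lborel. a (K - {j}) z * d_zbar j \<eta> z))" .
qed

text \<open>The adjoint is characterised by its pairing with arbitrary forms in the domain of \<open>\<partial>\<close>-bar. Forms with a
single coefficient of class \<open>C\<^sup>1\<close> suffice to read off a distributional equation.\<close>
lemma adjoint_weak:
  assumes ad: "has_dbar_adjoint \<phi> p u w" and L: "L \<in> multi_indices p" and psi: "C_k 1 \<psi>" "bounded {z. \<psi> z \<noteq> 0}"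
  shows "(LINT z|lborel. w L z * \<psi> z * wt z) = (\<Sum>j\<in>-L. wedge_sign j L * (LINT z|lborel. u (insert j L) z * d_z j \<psi> z * wt z))"
proof -
  \<comment> \<open>the conjugate compensates for the antilinearity of the inner product in its second argument\<close>
  define a :: "'n form" where "a J = (if J = L then (\<lambda>z. cnj (\<psi> z)) else (\<lambda>z. 0))" for J
  have aC: "C_k 1 (a J)" and ab: "bounded {z. a J z \<noteq> 0}" for J using psi by (auto simp: a_def C_k_cnj)
  have uL: "u \<in> L2_forms \<phi> (p + 1)" and wL: "w \<in> L2_forms \<phi> p"
    and adj: "inner_forms \<phi> (p + 1) (dbar_form a) u = inner_forms \<phi> p a w"
    using ad has_dbar_classical[OF aC ab] by (auto simp: has_dbar_adjoint_def)
  have dp: "\<psi> differentiable at z" for z by (rule C1_differentiable[OF psi(1)])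
  have "inner_forms \<phi> p a w = (\<Sum>J\<in>multi_indices p. if J = L then inner_L2 \<phi> (\<lambda>z. cnj (\<psi> z)) (w L) else 0)"
    unfolding inner_forms_def by (intro sum.cong) (auto simp: a_def inner_L2_def)
  also have "\<dots> = inner_L2 \<phi> (\<lambda>z. cnj (\<psi> z)) (w L)" using L by simp
  also have "\<dots> = cnj (inner_L2 \<phi> (w L) (\<lambda>z. cnj (\<psi> z)))" by (rule inner_commute)
  finally have 1: "inner_forms \<phi> p a w = cnj (LINT z|lborel. w L z * \<psi> z * wt z)" by (simp add: inner_wt)
  have "inner_forms \<phi> (p + 1) (dbar_form a) u = (\<Sum>K\<in>multi_indices (Suc p). \<Sum>j\<in>K. wedge_sign j (K - {j}) * inner_L2 \<phi> (d_zbar j (a (K - {j}))) (u (insert j (K - {j}))))"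
    unfolding inner_forms_def Suc_eq_plus1[symmetric]
  proof (intro sum.cong refl)
    fix K :: "'n set" assume K: "K \<in> multi_indices (Suc p)"
    then have "u K \<in> L2 \<phi>" using uL by (simp add: L2_forms_def)
    then have "inner_L2 \<phi> (dbar_form a K) (u K) = (\<Sum>j\<in>K. wedge_sign j (K - {j}) * inner_L2 \<phi> (d_zbar j (a (K - {j}))) (u K))"
      unfolding dbar_form_def[abs_def] by (subst inner_sum_left) (auto simp: inner_cmult_left intro: L2_cmult L2_d_zbar_C1 aC ab)
    also have "\<dots> = (\<Sum>j\<in>K. wedge_sign j (K - {j}) * inner_L2 \<phi> (d_zbar j (a (K - {j}))) (u (insert j (K - {j}))))"
      by (intro sum.cong) (auto simp: insert_absorb)
    finally show "inner_L2 \<phi> (dbar_form a K) (u K) = (\<Sum>j\<in>K. wedge_sign j (K - {j}) * inner_L2 \<phi> (d_zbar j (a (K - {j}))) (u (insert j (K - {j}))))" .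
  qed
  also have "\<dots> = (\<Sum>J\<in>multi_indices p. \<Sum>j\<in>-J. wedge_sign j J * inner_L2 \<phi> (d_zbar j (a J)) (u (insert j J)))"
    by (rule sum_insert_remove[of "\<lambda>j J. wedge_sign j J * inner_L2 \<phi> (d_zbar j (a J)) (u (insert j J))"])
  also have "\<dots> = (\<Sum>J\<in>multi_indices p. if J = L then (\<Sum>j\<in>-L. wedge_sign j L * inner_L2 \<phi> (d_zbar j (a L)) (u (insert j L))) else 0)"
    by (intro sum.cong) (auto simp: a_def inner_L2_def)
  also have "\<dots> = (\<Sum>j\<in>-L. wedge_sign j L * inner_L2 \<phi> (d_zbar j (a L)) (u (insert j L)))" using L by simp
  also have "\<dots> = cnj (\<Sum>j\<in>-L. wedge_sign j L * (LINT z|lborel. u (insert j L) z * d_z j \<psi> z * wt z))"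
  proof -
    have e: "d_zbar j (a L) = (\<lambda>z. cnj (d_z j \<psi> z))" for j using d_zbar_cnj[OF dp] by (auto simp: a_def)
    have "inner_L2 \<phi> (d_zbar j (a L)) (u J) = cnj (LINT z|lborel. u J z * d_z j \<psi> z * wt z)" for j J
      unfolding e inner_commute[of _ "u J"] by (simp add: inner_wt)
    then show ?thesis by simp
  qed
  finally have 2: "inner_forms \<phi> (p + 1) (dbar_form a) u = cnj (\<Sum>j\<in>-L. wedge_sign j L * (LINT z|lborel. u (insert j L) z * d_z j \<psi> z * wt z))" .
  show ?thesis by (rule complex_cnj_cancel_iff[THEN iffD1, OF trans[OF trans[OF 2[symmetric] adj] 1], symmetric])
qed

text \<open>The operator has constant coefficients and commutes with convolution, so that the only additional terms
come from the derivatives of the cutoff \<open>ch\<close>.\<close>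
lemma dbar_form_conv:
  assumes hd: "has_dbar \<phi> q u v" and K: "K \<in> multi_indices (Suc q)" and chi: "test_function ch" and eta: "test_function \<eta>"
  shows "dbar_form (\<lambda>J. conv (\<lambda>z. ch z * u J z) \<eta>) K z =
    conv (\<lambda>z. ch z * v K z + (\<Sum>j\<in>K. wedge_sign j (K - {j}) * (d_zbar j ch z * u (K - {j}) z))) \<eta> z"
proof -
  have uL: "u (K - {j}) \<in> L2 \<phi>" if "j \<in> K" for j using hd multi_indices_remove[OF that K] by (auto simp: has_dbar_def L2_forms_def)
  have vL: "v K \<in> L2 \<phi>" using hd K by (auto simp: has_dbar_def L2_forms_def)
  have tL: "(\<lambda>z. t z * f z) \<in> L2 \<phi>" if "test_function t" "f \<in> L2 \<phi>" for t f
    using test_function_bound[OF that(1)] L2_bounded_mult[OF that(2) borel_measurable_C_k[OF test_function_C_k[OF that(1), of 0]]] by metis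
  have ti: "integrable lborel (\<lambda>z. t z * f z)" if tt: "test_function t" "f \<in> L2 \<phi>" for t f
  proof -
    obtain R where R: "\<And>z. t z \<noteq> 0 \<Longrightarrow> norm z \<le> R" using test_function_bounded[OF tt(1)] by (auto simp: bounded_iff)
    show ?thesis by (rule L2_bounded_support_integrable(1)[OF tL[OF tt], of R]) (use R in force)
  qed
  define \<eta>z where "\<eta>z w = \<eta> (w - z)" for w
  have ez: "test_function \<eta>z" unfolding \<eta>z_def[abs_def] by (rule test_function_shift[OF eta])
  have de: "d_zbar j \<eta> (w - z) = d_zbar j \<eta>z w" for j w unfolding \<eta>z_def[abs_def]
    by (rule d_zbar_shift[symmetric]) (rule C2_differentiable[OF test_function_C_k[OF eta]])
  have dm: "d_zbar j (\<lambda>w. ch w * \<eta>z w) w = ch w * d_zbar j \<eta>z w + d_zbar j ch w * \<eta>z w" for j w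
    by (intro d_zbar_mult C2_differentiable test_function_C_k chi ez)
  have weak: "(LINT w|lborel. v K w * (ch w * \<eta>z w)) = (\<Sum>j\<in>K. wedge_sign j (K - {j}) * - (LINT w|lborel. u (K - {j}) w * d_zbar j (\<lambda>w. ch w * \<eta>z w) w))"
    using hd K test_function_mult[OF chi ez] by (simp add: has_dbar_def)
  have i1: "integrable lborel (\<lambda>w. (ch w * u (K - {j}) w) * d_zbar j \<eta>z w)" if "j \<in> K" for j
    using ti[OF test_function_mult[OF chi test_function_d_zbar[OF ez, of j]] uL[OF that]] by (simp add: mult_ac)
  have i2: "integrable lborel (\<lambda>w. d_zbar j ch w * u (K - {j}) w * \<eta>z w)" if "j \<in> K" for j
    using ti[OF test_function_mult[OF test_function_d_zbar[OF chi, of j] ez] uL[OF that]] by (simp add: mult_ac)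
  have i3: "integrable lborel (\<lambda>w. ch w * v K w * \<eta>z w)" using ti[OF test_function_mult[OF chi ez] vL] by (simp add: mult_ac)
  have 1: "d_zbar j (conv (\<lambda>z. ch z * u (K - {j}) z) \<eta>) z = - (LINT w|lborel. u (K - {j}) w * d_zbar j (\<lambda>w. ch w * \<eta>z w) w) + (LINT w|lborel. d_zbar j ch w * u (K - {j}) w * \<eta>z w)"
    if "j \<in> K" for j
  proof -
    have "d_zbar j (conv (\<lambda>z. ch z * u (K - {j}) z) \<eta>) z = - conv (\<lambda>z. ch z * u (K - {j}) z) (d_zbar j \<eta>) z"
      by (rule d_zbar_conv[OF ti[OF chi uL[OF that]] eta])
    also have "conv (\<lambda>z. ch z * u (K - {j}) z) (d_zbar j \<eta>) z = (LINT w|lborel. (ch w * u (K - {j}) w) * d_zbar j \<eta>z w)"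
      by (simp add: conv_def de)
    moreover have "(LINT w|lborel. u (K - {j}) w * d_zbar j (\<lambda>w. ch w * \<eta>z w) w) = (LINT w|lborel. (ch w * u (K - {j}) w) * d_zbar j \<eta>z w + d_zbar j ch w * u (K - {j}) w * \<eta>z w)"
      unfolding dm by (simp add: algebra_simps)
    ultimately show ?thesis using i1[OF that] i2[OF that] by simp
  qed
  have "dbar_form (\<lambda>J. conv (\<lambda>z. ch z * u J z) \<eta>) K z = (\<Sum>j\<in>K. wedge_sign j (K - {j}) * - (LINT w|lborel. u (K - {j}) w * d_zbar j (\<lambda>w. ch w * \<eta>z w) w))
     + (\<Sum>j\<in>K. wedge_sign j (K - {j}) * (LINT w|lborel. d_zbar j ch w * u (K - {j}) w * \<eta>z w))"
    unfolding dbar_form_def sum.distrib[symmetric] by (intro sum.cong refl) (simp only: 1 distrib_left)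
  also have "\<dots> = (LINT w|lborel. ch w * v K w * \<eta>z w) + (LINT w|lborel. (\<Sum>j\<in>K. wedge_sign j (K - {j}) * (d_zbar j ch w * u (K - {j}) w * \<eta>z w)))"
  proof -
    have w': "(LINT w|lborel. v K w * (ch w * \<eta>z w)) = (LINT w|lborel. ch w * v K w * \<eta>z w)" by (simp add: mult_ac)
    show ?thesis unfolding weak[symmetric] w' using i2 by (simp add: Bochner_Integration.integral_sum)
  qed
  also have "\<dots> = (LINT w|lborel. ch w * v K w * \<eta>z w + (\<Sum>j\<in>K. wedge_sign j (K - {j}) * (d_zbar j ch w * u (K - {j}) w * \<eta>z w)))"
    using i2 i3 by (intro Bochner_Integration.integral_add[symmetric] Bochner_Integration.integrable_sum integrable_mult_right)
  also have "\<dots> = conv (\<lambda>z. ch z * v K z + (\<Sum>j\<in>K. wedge_sign j (K - {j}) * (d_zbar j ch z * u (K - {j}) z))) \<eta> z"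
    unfolding conv_def by (simp add: \<eta>z_def distrib_right sum_distrib_right mult.assoc)
  finally show ?thesis .
qed

text \<open>In contrast to \<open>\<partial>\<close>-bar, the adjoint has the variable coefficient \<open>\<partial>\<phi>/\<partial>z\<^sub>j\<close>, which does not commute with
convolution: it appears once inside the convolution, and once outside through \<open>delta\<close>.\<close>
lemma dstar_form_conv:
  assumes ad: "has_dbar_adjoint \<phi> p u w" and L: "L \<in> multi_indices p" and chi: "test_function ch" and eta: "test_function \<eta>"
  shows "dstar_form (\<lambda>J. conv (\<lambda>z. ch z * u J z) \<eta>) L z =
    conv (\<lambda>z. ch z * w L z - (\<Sum>j\<in>-L. wedge_sign j L * ((d_z j ch z + ch z * d_z j phic z) * u (insert j L) z))) \<eta> z
    + (\<Sum>j\<in>-L. wedge_sign j L * (d_z j phic z * conv (\<lambda>z. ch z * u (insert j L) z) \<eta> z))"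
proof -
  have uL: "u (insert j L) \<in> L2 \<phi>" if "j \<in> -L" for j using ad multi_indices_insert[of j L p] L that by (auto simp: has_dbar_adjoint_def L2_forms_def)
  have wL: "w L \<in> L2 \<phi>" using ad L by (auto simp: has_dbar_adjoint_def L2_forms_def)
  have ti: "integrable lborel (\<lambda>z. t z * f z)" if t: "continuous_on UNIV t" "bounded {z. t z \<noteq> 0}" and fL: "f \<in> L2 \<phi>" for t f
  proof -
    obtain R where R: "\<And>z. t z \<noteq> 0 \<Longrightarrow> norm z \<le> R" using t(2) by (auto simp: bounded_iff)
    have "(\<lambda>z. t z * f z) \<in> L2 \<phi>"
      using compact_support_bounded[OF t] L2_bounded_mult[OF fL borel_measurable_continuous_onI[OF t(1)]] by metis
    then show ?thesis by (rule L2_bounded_support_integrable(1)[of _ R]) (use R in force)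
  qed
  have tc: "continuous_on UNIV t" "bounded {z. t z \<noteq> 0}" if "test_function t" for t :: "(complex,'n) vec \<Rightarrow> complex"
    using that by (auto intro: C_k_continuous[OF test_function_C_k[where k=0]] test_function_bounded)
  define \<eta>z where "\<eta>z w = \<eta> (w - z)" for w
  have ez: "test_function \<eta>z" unfolding \<eta>z_def[abs_def] by (rule test_function_shift[OF eta])
  have de: "d_z j \<eta> (w - z) = d_z j \<eta>z w" for j w unfolding \<eta>z_def[abs_def]
    by (rule d_z_shift[symmetric]) (rule C2_differentiable[OF test_function_C_k[OF eta]])
  have dm: "d_z j (\<lambda>w. ch w * \<eta>z w) w = ch w * d_z j \<eta>z w + d_z j ch w * \<eta>z w" for j w
    by (intro d_z_mult C2_differentiable test_function_C_k chi ez)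
  define ew where "ew x = complex_of_real (exp (\<phi> x))" for x
  have C2ew: "C_k 2 ew" unfolding ew_def[abs_def] by (intro C_k_of_real C_k_exp C2)
  have ewt: "ew x * wt x = 1" for x by (simp add: ew_def wt_def flip: of_real_mult exp_add)
  have dew: "d_z j ew x * wt x = d_z j phic x" for j x
  proof -
    have "(\<lambda>x. ew x * wt x) = (\<lambda>x. 1)" using ewt by blast
    moreover have "d_z j (\<lambda>x. ew x * wt x) x = ew x * d_z j wt x + d_z j ew x * wt x"
      by (intro d_z_mult C2_differentiable C2ew C2_wt)
    ultimately have "0 = ew x * d_z j wt x + d_z j ew x * wt x" by (simp add: d_z_dd)
    then have "d_z j ew x * wt x = d_z j phic x * (ew x * wt x)" by (auto simp: d_z_wt algebra_simps)
    then show ?thesis by (simp add: ewt)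
  qed
  define \<psi> where "\<psi> x = ch x * \<eta>z x * ew x" for x
  have t: "test_function (\<lambda>x. ch x * \<eta>z x)" by (rule test_function_mult[OF chi ez])
  have psi: "C_k 1 \<psi>" unfolding \<psi>_def[abs_def] by (intro C_k_mult[OF test_function_C_k[OF t]] C2_C1 C2ew)
  have psib: "bounded {x. \<psi> x \<noteq> 0}" unfolding \<psi>_def by (rule bounded_nonzero_multL[OF test_function_bounded[OF t]])
  have pw: "\<psi> x * wt x = ch x * \<eta>z x" for x by (simp add: \<psi>_def mult.assoc ewt)
  have dpsi: "d_z j \<psi> x * wt x = d_z j (\<lambda>w. ch w * \<eta>z w) x + ch x * \<eta>z x * d_z j phic x" for j x
  proof -
    have "d_z j \<psi> x = ch x * \<eta>z x * d_z j ew x + d_z j (\<lambda>w. ch w * \<eta>z w) x * ew x"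
      unfolding \<psi>_def[abs_def] by (intro d_z_mult C2_differentiable C2ew test_function_C_k[OF t])
    then have "d_z j \<psi> x * wt x = ch x * \<eta>z x * (d_z j ew x * wt x) + d_z j (\<lambda>w. ch w * \<eta>z w) x * (ew x * wt x)" by (simp add: algebra_simps)
    then show ?thesis by (simp add: dew ewt)
  qed
  have phc: "continuous_on UNIV (d_z j phic)" for j using C_k_continuous[OF C1_d_z[OF C2_phic]] .
  have weak: "(LINT x|lborel. w L x * (ch x * \<eta>z x)) = (\<Sum>j\<in>-L. wedge_sign j L * (LINT x|lborel. u (insert j L) x * (d_z j (\<lambda>w. ch w * \<eta>z w) x + ch x * \<eta>z x * d_z j phic x)))"
    using adjoint_weak[OF ad L psi psib] by (simp add: mult.assoc pw dpsi)
  have i1: "integrable lborel (\<lambda>x. (ch x * u (insert j L) x) * d_z j \<eta>z x)" if "j \<in> -L" for j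
    using ti[OF tc[OF test_function_mult[OF chi test_function_d_z[OF ez, of j]]] uL[OF that]] by (simp add: mult_ac)
  have i2: "integrable lborel (\<lambda>x. (d_z j ch x + ch x * d_z j phic x) * u (insert j L) x * \<eta>z x)" if "j \<in> -L" for j
  proof -
    have "integrable lborel (\<lambda>x. ((d_z j ch x + ch x * d_z j phic x) * \<eta>z x) * u (insert j L) x)"
      by (rule ti[OF _ _ uL[OF that]]) (intro continuous_intros phc tc(1) test_function_d_z chi ez, rule bounded_nonzero_multR[OF tc(2)[OF ez]])
    then show ?thesis by (simp add: mult_ac)
  qed
  have i3: "integrable lborel (\<lambda>x. ch x * w L x * \<eta>z x)" using ti[OF tc[OF test_function_mult[OF chi ez]] wL] by (simp add: mult_ac)
  have 1: "- d_z j (conv (\<lambda>z. ch z * u (insert j L) z) \<eta>) z = (LINT x|lborel. u (insert j L) x * (d_z j (\<lambda>w. ch w * \<eta>z w) x + ch x * \<eta>z x * d_z j phic x))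
      - (LINT x|lborel. (d_z j ch x + ch x * d_z j phic x) * u (insert j L) x * \<eta>z x)"
    if "j \<in> -L" for j
  proof -
    have "d_z j (conv (\<lambda>z. ch z * u (insert j L) z) \<eta>) z = - conv (\<lambda>z. ch z * u (insert j L) z) (d_z j \<eta>) z"
      by (rule d_z_conv[OF ti[OF tc[OF chi] uL[OF that]] eta])
    moreover have "conv (\<lambda>z. ch z * u (insert j L) z) (d_z j \<eta>) z = (LINT w|lborel. (ch w * u (insert j L) w) * d_z j \<eta>z w)"
      by (simp add: conv_def de)
    moreover have "(LINT x|lborel. u (insert j L) x * (d_z j (\<lambda>w. ch w * \<eta>z w) x + ch x * \<eta>z x * d_z j phic x)) =
       (LINT x|lborel. (ch x * u (insert j L) x) * d_z j \<eta>z x + (d_z j ch x + ch x * d_z j phic x) * u (insert j L) x * \<eta>z x)"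
      unfolding dm by (simp add: algebra_simps)
    ultimately show ?thesis using i1[OF that] i2[OF that] by simp
  qed
  have "dstar_form (\<lambda>J. conv (\<lambda>z. ch z * u J z) \<eta>) L z = (\<Sum>j\<in>-L. wedge_sign j L * (- d_z j (conv (\<lambda>z. ch z * u (insert j L) z) \<eta>) z))
     + (\<Sum>j\<in>-L. wedge_sign j L * (d_z j phic z * conv (\<lambda>z. ch z * u (insert j L) z) \<eta> z))"
    unfolding dstar_form_def delta_def sum.distrib[symmetric] sum_negf[symmetric] by (intro sum.cong refl) (simp add: algebra_simps)
  also have "(\<Sum>j\<in>-L. wedge_sign j L * (- d_z j (conv (\<lambda>z. ch z * u (insert j L) z) \<eta>) z)) =
     (\<Sum>j\<in>-L. wedge_sign j L * (LINT x|lborel. u (insert j L) x * (d_z j (\<lambda>w. ch w * \<eta>z w) x + ch x * \<eta>z x * d_z j phic x)))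
     - (\<Sum>j\<in>-L. wedge_sign j L * (LINT x|lborel. (d_z j ch x + ch x * d_z j phic x) * u (insert j L) x * \<eta>z x))"
    unfolding sum_subtractf[symmetric] by (intro sum.cong refl) (simp only: 1 right_diff_distrib)
  also have "\<dots> = (LINT x|lborel. ch x * w L x * \<eta>z x) - (LINT x|lborel. (\<Sum>j\<in>-L. wedge_sign j L * ((d_z j ch x + ch x * d_z j phic x) * u (insert j L) x * \<eta>z x)))"
  proof -
    have w': "(LINT x|lborel. w L x * (ch x * \<eta>z x)) = (LINT x|lborel. ch x * w L x * \<eta>z x)" by (simp add: mult_ac)
    show ?thesis unfolding weak[symmetric] w' using i2 by (simp add: Bochner_Integration.integral_sum)
  qed
  also have "\<dots> = (LINT x|lborel. ch x * w L x * \<eta>z x - (\<Sum>j\<in>-L. wedge_sign j L * ((d_z j ch x + ch x * d_z j phic x) * u (insert j L) x * \<eta>z x)))"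
    using i2 i3 by (intro Bochner_Integration.integral_diff[symmetric] Bochner_Integration.integrable_sum integrable_mult_right)
  also have "\<dots> = conv (\<lambda>z. ch z * w L z - (\<Sum>j\<in>-L. wedge_sign j L * ((d_z j ch z + ch z * d_z j phic z) * u (insert j L) z))) \<eta> z"
    unfolding conv_def by (simp add: \<eta>z_def left_diff_distrib sum_distrib_right mult.assoc)
  finally show ?thesis .
qed

end

section \<open>Density of test forms\<close>

lemma eventually_three_small:
  fixes a b c :: "'i::finite \<Rightarrow> nat \<Rightarrow> real"
  assumes "\<And>i. (\<lambda>n. a i n) \<longlonglongrightarrow> 0" "\<And>i. i \<in> X \<Longrightarrow> (\<lambda>n. b i n) \<longlonglongrightarrow> 0" "\<And>i. i \<in> Y \<Longrightarrow> (\<lambda>n. c i n) \<longlonglongrightarrow> 0" "E > 0"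
  shows "\<exists>n. (\<forall>i. a i n < E) \<and> (\<forall>i\<in>X. b i n < E) \<and> (\<forall>i\<in>Y. c i n < E)"
proof -
  have "\<forall>\<^sub>F n in sequentially. (\<forall>i\<in>UNIV. a i n < E) \<and> (\<forall>i\<in>X. b i n < E) \<and> (\<forall>i\<in>Y. c i n < E)"
    using assms by (intro eventually_conj eventually_ball_finite ballI) (auto intro: order_tendstoD)
  then obtain n where "(\<forall>i\<in>UNIV. a i n < E) \<and> (\<forall>i\<in>X. b i n < E) \<and> (\<forall>i\<in>Y. c i n < E)"
    using eventually_happens sequentially_bot by blast
  then show ?thesis by blast
qed

context weight
begin

text \<open>Sequences of square-integrable functions that tend to zero in the weighted norm.\<close>
definition null :: "(nat \<Rightarrow> (complex, 'n) vec \<Rightarrow> complex) \<Rightarrow> bool" where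
  "null X \<longleftrightarrow> (\<forall>n. X n \<in> L2 \<phi>) \<and> (\<lambda>n. n2 (X n)) \<longlonglongrightarrow> 0"

lemma null_add: assumes "null X" "null Y" shows "null (\<lambda>n z. X n z + Y n z)"
proof -
  have "(\<lambda>n. n2 (\<lambda>z. X n z + Y n z)) \<longlonglongrightarrow> 0"
  proof (rule tendsto_sandwich[of "\<lambda>_. 0"])
    show "\<forall>\<^sub>F n in sequentially. n2 (\<lambda>z. X n z + Y n z) \<le> 2 * n2 (X n) + 2 * n2 (Y n)"
      using assms by (intro always_eventually allI n2_add_le) (auto simp: null_def)
    show "(\<lambda>n. 2 * n2 (X n) + 2 * n2 (Y n)) \<longlonglongrightarrow> 0"
      using assms by (auto simp: null_def intro!: tendsto_add_zero tendsto_mult_right_zero)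
  qed (auto simp: n2_nonneg)
  with assms show ?thesis by (auto simp: null_def L2_add)
qed

lemma null_cmult: "null X \<Longrightarrow> null (\<lambda>n z. c * X n z)"
  by (auto simp: null_def n2_cmult L2_cmult intro!: tendsto_mult_right_zero)

lemma null_0: "null (\<lambda>n z. 0)" by (simp add: null_def n2_def)

lemma null_sum: "(\<And>i. i \<in> I \<Longrightarrow> null (X i)) \<Longrightarrow> null (\<lambda>n z. \<Sum>i\<in>I. X i n z)"
  by (induction I rule: infinite_finite_induct) (auto intro: null_0 null_add)

lemma null_dom:
  assumes "null X" "\<And>n. Y n \<in> borel_measurable borel" "\<And>n z. cmod (Y n z) \<le> B * cmod (X n z)" and B: "B \<ge> 0"
  shows "null Y"
proof -
  have X: "X n \<in> L2 \<phi>" for n using assms(1) by (simp add: null_def)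
  have m: "cmod (Y n z) \<le> cmod (of_real B * X n z)" for n z using assms(3)[of n z] B by (simp add: norm_mult)
  have "(\<lambda>n. n2 (Y n)) \<longlonglongrightarrow> 0"
  proof (rule tendsto_sandwich[of "\<lambda>_. 0"])
    show "\<forall>\<^sub>F n in sequentially. n2 (Y n) \<le> n2 (\<lambda>z. of_real B * X n z)"
      by (intro always_eventually allI n2_mono(2)[OF assms(2) L2_cmult[OF X] m])
    show "(\<lambda>n. n2 (\<lambda>z. of_real B * X n z)) \<longlonglongrightarrow> 0" using null_cmult[OF assms(1), of "of_real B"] by (simp add: null_def)
  qed (auto simp: n2_nonneg)
  then show ?thesis using n2_mono(1)[OF assms(2) L2_cmult[OF X] m] by (simp add: null_def)
qed

end

context psh_weight
begin

lemma test_form_J: "test_form g \<Longrightarrow> test_function (g J)" by (simp add: test_form_def)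

lemma L2_test_mult: "test_function t \<Longrightarrow> f \<in> L2 \<phi> \<Longrightarrow> (\<lambda>z. t z * f z) \<in> L2 \<phi>"
  using test_function_bound[of t] L2_bounded_mult[of f t] borel_measurable_C_k[OF test_function_C_k[of t 0]] by metis

lemma null_moll:
  assumes f: "f \<in> L2 \<phi>" and s: "\<And>z. norm z > R \<Longrightarrow> f z = 0" and m: "\<And>n. mollifier (1 / real (Suc n)) (\<rho> n)"
  shows "null (\<lambda>n z. moll_conv f (\<rho> n) z - f z)"
proof -
  note i = L2_bounded_support_integrable[OF f]
  have t: "test_function (\<lambda>x. complex_of_real (\<rho> n x))" for n using m[of n] by (simp add: mollifier_def)
  have fi: "integrable lborel f" and fin: "nn2 f < \<infinity>" by (rule i, rule s, assumption)+
  have meas: "(\<lambda>z. moll_conv f (\<rho> n) z - f z) \<in> borel_measurable borel" for n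
    using borel_measurable_C_k[OF C_k_conv[OF fi t, of 0]] f[THEN L2_measurable] by (rule borel_measurable_diff)
  have ev: "\<exists>N. \<forall>n\<ge>N. nn2 (\<lambda>z. moll_conv f (\<rho> n) z - f z) \<le> ennreal E" if E0: "E > 0" for E
  proof -
    obtain \<delta> where d: "\<delta> > 0" "\<And>\<rho>. mollifier \<delta> \<rho> \<Longrightarrow> nn2 (\<lambda>x. moll_conv f \<rho> x - f x) \<le> ennreal E"
      using moll_conv_approx[OF fi fin E0] by metis
    obtain N where N: "1 / real (Suc N) < \<delta>" using nat_approx_posE[OF d(1)] by blast
    have "1 / real (Suc n) \<le> \<delta>" if "n \<ge> N" for n
      using N that frac_le[of 1 1 "real (Suc N)" "real (Suc n)"] by simp
    then show ?thesis using d(2) mollifier_mono[OF m] by blast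
  qed
  have L: "(\<lambda>z. moll_conv f (\<rho> n) z - f z) \<in> L2 \<phi>" for n
  proof (rule L2_diff[OF L2_test f])
    have "norm z \<le> R" if "f z \<noteq> 0" for z using s[of z] that by (cases "norm z \<le> R") auto
    then have "bounded {z. f z \<noteq> 0}" by (auto simp: bounded_iff)
    then show "test_function (moll_conv f (\<rho> n))" by (rule test_function_conv[OF fi t])
  qed
  have "(\<lambda>n. n2 (\<lambda>z. moll_conv f (\<rho> n) z - f z)) \<longlonglongrightarrow> 0"
  proof (rule LIMSEQ_I)
    fix e :: real assume e: "e > 0"
    then obtain N where N: "\<And>n. n \<ge> N \<Longrightarrow> nn2 (\<lambda>z. moll_conv f (\<rho> n) z - f z) \<le> ennreal (e/2)" using ev[of "e/2"] by auto
    have "n2 (\<lambda>z. moll_conv f (\<rho> n) z - f z) \<le> e/2" if "n \<ge> N" for n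
      using n2_le_nn2(2)[OF meas phi_nonneg N[OF that]] e by simp
    then show "\<exists>N. \<forall>n\<ge>N. norm (n2 (\<lambda>z. moll_conv f (\<rho> n) z - f z) - 0) < e"
    proof (intro exI[of _ N] allI impI)
      fix n assume "n \<ge> N"
      then have "n2 (\<lambda>z. moll_conv f (\<rho> n) z - f z) \<le> e/2" by fact
      then show "norm (n2 (\<lambda>z. moll_conv f (\<rho> n) z - f z) - 0) < e" using e n2_nonneg[of "\<lambda>z. moll_conv f (\<rho> n) z - f z"] by simp
    qed
  qed
  with L show ?thesis by (simp add: null_def)
qed

text \<open>Mollify a compactly supported multiple of \<open>u\<close>. The coefficient of the adjoint has order zero and is
bounded on compact sets, so that its failure to commute with mollification tends to zero, although
the first derivatives of \<open>u\<close> are not individually square-integrable. The values of \<open>u\<close> off the degree are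
assumed to vanish since a test form has test functions for all its coefficients.\<close>
lemma local_approximation:
  assumes hd: "has_dbar \<phi> (Suc p) u v" and ad: "has_dbar_adjoint \<phi> p u w"
    and u0: "\<And>J. J \<notin> multi_indices (Suc p) \<Longrightarrow> u J = (\<lambda>z. 0)" and ch: "test_function ch"
  obtains g where "\<And>n. test_form (g n)"
    "\<And>J. null (\<lambda>n z. g n J z - ch z * u J z)"
    "\<And>K. K \<in> multi_indices (Suc (Suc p)) \<Longrightarrow> null (\<lambda>n z. dbar_form (g n) K z - (ch z * v K z + (\<Sum>j\<in>K. wedge_sign j (K - {j}) * (d_zbar j ch z * u (K - {j}) z))))"
    "\<And>L. L \<in> multi_indices p \<Longrightarrow> null (\<lambda>n z. dstar_form (g n) L z - (ch z * w L z - (\<Sum>j\<in>-L. wedge_sign j L * (d_z j ch z * u (insert j L) z))))"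
proof -
  have "\<exists>\<rho> :: (complex,'n) vec \<Rightarrow> real. mollifier (1 / real (Suc n)) \<rho>" for n
    using mollifier_exists[of "1 / real (Suc n)"] by (metis of_nat_0_less_iff zero_less_Suc zero_less_divide_1_iff)
  then obtain \<rho> :: "nat \<Rightarrow> (complex,'n) vec \<Rightarrow> real" where m: "\<And>n. mollifier (1 / real (Suc n)) (\<rho> n)" by metis
  define \<eta> where "\<eta> n x = complex_of_real (\<rho> n x)" for n x
  have t: "test_function (\<eta> n)" for n using m[of n] by (simp add: mollifier_def \<eta>_def[abs_def])
  obtain R where R: "\<And>z. ch z \<noteq> 0 \<Longrightarrow> norm z \<le> R" using test_function_bounded[OF ch] by (auto simp: bounded_iff)
  define R' where "R' = R + 1"
  have chz: "ch z = 0" "dd b ch z = 0" if "norm z > R'" for z b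
  proof -
    show "ch z = 0" using R[of z] that by (auto simp: R'_def)
    show "dd b ch z = 0"
    proof (rule dd_eqI[of _ "\<lambda>_. 0"])
      have "open {z::(complex,'n) vec. norm z > R}" by (intro open_Collect_less continuous_intros)
      then show "(ch has_derivative (\<lambda>_. 0)) (at z)"
        using that by (intro has_derivative_transform_within_open[of "\<lambda>_. 0" "\<lambda>_. 0" z UNIV "{z. norm z > R}" ch])
          (auto simp: R'_def, metis R not_le)
    qed
  qed
  have dchz: "d_z j ch z = 0" "d_zbar j ch z = 0" if "norm z > R'" for z j
    using chz(2)[OF that] by (simp_all add: d_z_dd d_zbar_dd)
  have uL: "u J \<in> L2 \<phi>" for J using hd u0[of J] by (cases "J \<in> multi_indices (Suc p)") (auto simp: has_dbar_def L2_forms_def)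
  have vL: "v K \<in> L2 \<phi>" if "K \<in> multi_indices (Suc (Suc p))" for K using hd that by (simp add: has_dbar_def L2_forms_def)
  have wL: "w L \<in> L2 \<phi>" if "L \<in> multi_indices p" for L using ad that by (simp add: has_dbar_adjoint_def L2_forms_def)
  define U where "U J z = ch z * u J z" for J z
  have UL: "U J \<in> L2 \<phi>" for J unfolding U_def[abs_def] by (rule L2_test_mult[OF ch uL])
  have Uz: "U J z = 0" if "norm z > R'" for J z using chz(1)[OF that] by (simp add: U_def)
  define g where "g n = (\<lambda>J. conv (U J) (\<eta> n))" for n
  have tg: "test_form (g n)" for n unfolding test_form_def g_def
  proof (intro allI test_function_conv L2_bounded_support_integrable(1)[OF UL Uz] t)
    show "bounded {z. U J z \<noteq> 0}" for J by (rule bounded_subset[OF test_function_bounded[OF ch]]) (auto simp: U_def)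
  qed
  have nU: "null (\<lambda>n z. g n J z - U J z)" for J
    unfolding g_def \<eta>_def[abs_def] by (rule null_moll[OF UL Uz m])
  have phc: "continuous_on UNIV (d_z j phic)" for j using C_k_continuous[OF C1_d_z[OF C2_phic]] .
  have chdL: "(\<lambda>z. (d_z j ch z + ch z * d_z j phic z) * f z) \<in> L2 \<phi>" if f: "f \<in> L2 \<phi>" for f j
  proof -
    have c: "continuous_on UNIV (\<lambda>z. d_z j ch z + ch z * d_z j phic z)"
      by (intro continuous_intros phc C_k_continuous[OF test_function_C_k[where k=0]] test_function_d_z ch)
    have b: "bounded {z. d_z j ch z + ch z * d_z j phic z \<noteq> 0}"
      by (intro bounded_nonzero_add bounded_nonzero_multL bounded_nonzero_d_z test_function_bounded[OF ch])
    show ?thesis using compact_support_bounded[OF c b] L2_bounded_mult[OF f borel_measurable_continuous_onI[OF c]] by metis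
  qed
  show ?thesis
  proof (rule that[of g])
    show "test_form (g n)" for n by (rule tg)
    show "null (\<lambda>n z. g n J z - ch z * u J z)" for J using nU[of J] by (simp add: U_def)
    fix K :: "'n set" assume K: "K \<in> multi_indices (Suc (Suc p))"
    define V where "V z = ch z * v K z + (\<Sum>j\<in>K. wedge_sign j (K - {j}) * (d_zbar j ch z * u (K - {j}) z))" for z
    have "V \<in> L2 \<phi>" unfolding V_def[abs_def]
      by (intro L2_add L2_sum L2_cmult L2_test_mult ch test_function_d_zbar uL vL K)
    moreover have "V z = 0" if "norm z > R'" for z using chz(1)[OF that] dchz(2)[OF that] by (simp add: V_def)
    ultimately have "null (\<lambda>n z. moll_conv V (\<rho> n) z - V z)" by (rule null_moll[OF _ _ m])
    moreover have "dbar_form (g n) K z = moll_conv V (\<rho> n) z" for n z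
      using dbar_form_conv[OF hd K ch t, of n z] by (simp add: g_def U_def[abs_def] V_def[abs_def] \<eta>_def[abs_def])
    ultimately show "null (\<lambda>n z. dbar_form (g n) K z - (ch z * v K z + (\<Sum>j\<in>K. wedge_sign j (K - {j}) * (d_zbar j ch z * u (K - {j}) z))))"
      by (simp add: V_def)
  next
    fix L :: "'n set" assume L: "L \<in> multi_indices p"
    define W where "W z = ch z * w L z - (\<Sum>j\<in>-L. wedge_sign j L * ((d_z j ch z + ch z * d_z j phic z) * u (insert j L) z))" for z
    have WL: "W \<in> L2 \<phi>" unfolding W_def[abs_def]
      by (intro L2_diff L2_sum L2_cmult L2_test_mult ch chdL uL wL L)
    have "W z = 0" if "norm z > R'" for z using chz(1)[OF that] dchz(1)[OF that] by (simp add: W_def)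
    then have n1: "null (\<lambda>n z. moll_conv W (\<rho> n) z - W z)" by (rule null_moll[OF WL _ m])
    have n2': "null (\<lambda>n z. d_z j phic z * (g n J z - U J z))" for j J
    proof -
      obtain B where B: "\<And>z. norm z \<le> R' + 1 \<Longrightarrow> cmod (d_z j phic z) \<le> B"
      proof -
        have "compact (d_z j phic ` cball 0 (R' + 1))" using phc by (intro compact_continuous_image) (auto intro: continuous_on_subset)
        then obtain B where "\<And>y. y \<in> d_z j phic ` cball 0 (R' + 1) \<Longrightarrow> norm y \<le> B" using compact_imp_bounded bounded_iff by metis
        then have "\<And>z. norm z \<le> R' + 1 \<Longrightarrow> cmod (d_z j phic z) \<le> B" by force
        then show ?thesis using that by blast
      qed
      have z: "g n J z - U J z = 0" if "norm z > R' + 1" for n z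
      proof -
        have "\<eta> n x = 0" if "norm x \<ge> 1" for x
          using m[of n] that mollifier_mono[OF m[of n], of 1] by (simp add: mollifier_def \<eta>_def)
        then have "conv (U J) (\<eta> n) z = 0" using that by (intro conv_eq_0[where R=R' and \<delta>=1]) (auto simp: Uz)
        then show ?thesis using Uz[of z J] that by (simp add: g_def)
      qed
      show ?thesis
      proof (rule null_dom[OF nU[of J], where B="max 0 B"])
        have "(\<lambda>z. g n J z - U J z) \<in> borel_measurable borel" for n using nU[of J] L2_measurable by (auto simp: null_def)
        then show "(\<lambda>z. d_z j phic z * (g n J z - U J z)) \<in> borel_measurable borel" for n
          using borel_measurable_continuous_onI[OF phc[of j]] by (intro borel_measurable_times)
        show "cmod (d_z j phic z * (g n J z - U J z)) \<le> max 0 B * cmod (g n J z - U J z)" for n z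
          using B[of z] z[of z n] by (cases "norm z > R' + 1") (auto simp: norm_mult intro!: mult_right_mono)
      qed simp
    qed
    have "dstar_form (g n) L z - (ch z * w L z - (\<Sum>j\<in>-L. wedge_sign j L * (d_z j ch z * u (insert j L) z))) =
       (moll_conv W (\<rho> n) z - W z) + (\<Sum>j\<in>-L. wedge_sign j L * (d_z j phic z * (g n (insert j L) z - U (insert j L) z)))" for n z
    proof -
      have "dstar_form (g n) L z = moll_conv W (\<rho> n) z + (\<Sum>j\<in>-L. wedge_sign j L * (d_z j phic z * g n (insert j L) z))"
        using dstar_form_conv[OF ad L ch t, of n z] by (simp add: g_def U_def[abs_def] W_def[abs_def] \<eta>_def[abs_def])
      moreover have "W z = (ch z * w L z - (\<Sum>j\<in>-L. wedge_sign j L * (d_z j ch z * u (insert j L) z))) - (\<Sum>j\<in>-L. wedge_sign j L * (d_z j phic z * U (insert j L) z))"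
        by (simp add: W_def U_def algebra_simps sum.distrib)
      ultimately show ?thesis by (simp add: sum_subtractf right_diff_distrib)
    qed
    then show "null (\<lambda>n z. dstar_form (g n) L z - (ch z * w L z - (\<Sum>j\<in>-L. wedge_sign j L * (d_z j ch z * u (insert j L) z))))"
      using null_add[OF n1 null_sum[OF null_cmult[OF n2']]] by simp
  qed
qed

text \<open>Cutoffs that tend to \<open>1\<close> pointwise and whose gradients tend to zero uniformly.\<close>
definition cutoff :: "nat \<Rightarrow> (complex,'n) vec \<Rightarrow> complex" where
  "cutoff n z = complex_of_real (bump ((1 / real (Suc n)) *\<^sub>R z))"

lemma test_function_cutoff: "test_function (cutoff n)"
  unfolding cutoff_def[abs_def] using test_function_affine[OF test_function_bump, of "1 / real (Suc n)" 0] by simp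

lemma null_cutoff: assumes "f \<in> L2 \<phi>" shows "null (\<lambda>n z. cutoff n z * f z - f z)"
proof -
  have m: "(\<lambda>z. cutoff n z - 1) \<in> borel_measurable borel" for n
    using borel_measurable_C_k[OF test_function_C_k[OF test_function_cutoff, where k=0]] by (intro borel_measurable_diff) auto
  have b: "cmod (cutoff n z - 1) \<le> 1" for n z
  proof -
    have "cutoff n z - 1 = of_real (bump ((1 / real (Suc n)) *\<^sub>R z) - 1)" by (simp add: cutoff_def)
    then show ?thesis using bump_nonneg[of "(1 / real (Suc n)) *\<^sub>R z"] bump_le_1[of "(1 / real (Suc n)) *\<^sub>R z"] by (simp only: norm_of_real)
  qed
  have l: "(\<lambda>n. cutoff n z - 1) \<longlonglongrightarrow> 0" for z
  proof -
    have "(\<lambda>n. (1 / real (Suc n)) *\<^sub>R z) \<longlonglongrightarrow> 0 *\<^sub>R z" by (intro tendsto_intros LIMSEQ_Suc[OF lim_1_over_n])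
    then have "(\<lambda>n. bump ((1 / real (Suc n)) *\<^sub>R z)) \<longlonglongrightarrow> bump 0"
      using continuous_on_tendsto_compose[OF C_k_continuous[OF C_k_bump[where k=0]]] by fastforce
    then have "(\<lambda>n. cutoff n z - 1) \<longlonglongrightarrow> complex_of_real (bump 0) - 1" unfolding cutoff_def by (intro tendsto_intros)
    then show ?thesis by simp
  qed
  have "(\<lambda>z. (cutoff n z - 1) * f z) = (\<lambda>z. cutoff n z * f z - f z)" for n by (auto simp: algebra_simps)
  then show ?thesis using n2_null_mult[OF assms m b l] L2_bounded_mult[OF assms m b] by (simp add: null_def)
qed

lemma dd_cutoff: "dd b (cutoff n) z = (1 / real (Suc n)) *\<^sub>R dd b (\<lambda>z. complex_of_real (bump z)) ((1 / real (Suc n)) *\<^sub>R z)"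
  unfolding cutoff_def[abs_def]
  using dd_affine[of "\<lambda>z. complex_of_real (bump z)" "1 / real (Suc n)" z 0 b, OF C2_differentiable[OF test_function_C_k[OF test_function_bump]]] by simp

lemma null_d_cutoff_aux:
  assumes f: "f \<in> L2 \<phi>" and D: "\<And>n z. D n z = (dd (axis j 1) (cutoff n) z + c * dd (axis j \<i>) (cutoff n) z) / 2" and c: "cmod c = 1"
  shows "null (\<lambda>n z. D n z * f z)"
proof -
  have "\<exists>B. B \<ge> 0 \<and> (\<forall>z. cmod (dd b (\<lambda>z. complex_of_real (bump z)) z) \<le> B)" for b :: "(complex,'n) vec"
    using test_function_bound[OF test_function_dd[OF test_function_bump, of b]] by metis
  then obtain B where B: "\<And>b. B b \<ge> 0" "\<And>b z. cmod (dd b (\<lambda>z. complex_of_real (bump z)) z) \<le> B (b :: (complex,'n) vec)" by metis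
  define C where "C = B (axis j 1) + B (axis j \<i>)"
  have C: "C \<ge> 0" using B by (simp add: C_def)
  have b: "cmod (D n z) \<le> C * (1 / real (Suc n))" for n z
  proof -
    have "cmod (dd b (cutoff n) z) \<le> B b * (1 / real (Suc n))" for b
      using mult_right_mono[OF B(2)[of b "(1 / real (Suc n)) *\<^sub>R z"], of "1 / real (Suc n)"] by (simp add: dd_cutoff mult.commute)
    then have "cmod (dd (axis j 1) (cutoff n) z + c * dd (axis j \<i>) (cutoff n) z) \<le> C * (1 / real (Suc n))"
      unfolding C_def distrib_right using c by (intro order_trans[OF norm_triangle_ineq] add_mono) (auto simp: norm_mult)
    then show ?thesis unfolding D norm_divide using C by (simp add: field_simps)
  qed
  have b': "cmod (D n z) \<le> C" for n z
    using b[of n z] C mult_left_mono[of "1 / real (Suc n)" 1 C] by simp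
  have m: "D n \<in> borel_measurable borel" for n
  proof -
    have "D n = (\<lambda>z. (dd (axis j 1) (cutoff n) z + c * dd (axis j \<i>) (cutoff n) z) / 2)" by (auto simp: D)
    moreover have "(\<lambda>z. (dd (axis j 1) (cutoff n) z + c * dd (axis j \<i>) (cutoff n) z) / 2) \<in> borel_measurable borel"
      by (intro borel_measurable_continuous_onI continuous_intros C_k_continuous[OF test_function_C_k[where k=0]] test_function_dd test_function_cutoff) auto
    ultimately show ?thesis by simp
  qed
  have l: "(\<lambda>n. D n z) \<longlonglongrightarrow> 0" for z
  proof (rule Lim_null_comparison)
    show "\<forall>\<^sub>F n in sequentially. norm (D n z) \<le> C * (1 / real (Suc n))" using b by simp
    show "(\<lambda>n. C * (1 / real (Suc n))) \<longlonglongrightarrow> 0" by (intro tendsto_mult_right_zero LIMSEQ_Suc[OF lim_1_over_n])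
  qed
  show ?thesis using n2_null_mult[OF f m b' l] L2_bounded_mult[OF f m b'] by (simp add: null_def)
qed

lemma null_d_zbar_cutoff: "f \<in> L2 \<phi> \<Longrightarrow> null (\<lambda>n z. d_zbar j (cutoff n) z * f z)"
  by (rule null_d_cutoff_aux[where c="\<i>"]) (auto simp: d_zbar_dd)
lemma null_d_z_cutoff: "f \<in> L2 \<phi> \<Longrightarrow> null (\<lambda>n z. d_z j (cutoff n) z * f z)"
  by (rule null_d_cutoff_aux[where c="-\<i>"]) (auto simp: d_z_dd)

text \<open>The cutoff terms are small because the gradients of the cutoffs tend to zero. First fix a cutoff, then
mollify at a scale that depends on it.\<close>
lemma test_forms_dense_aux:
  assumes hd: "has_dbar \<phi> (Suc p) u v" and ad: "has_dbar_adjoint \<phi> p u w" and E: "E > 0"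
    and u0: "\<And>J. J \<notin> multi_indices (Suc p) \<Longrightarrow> u J = (\<lambda>z. 0)"
  shows "\<exists>g. test_form g \<and> (\<forall>J\<in>multi_indices (Suc p). n2 (\<lambda>z. g J z - u J z) \<le> E) \<and>
    (\<forall>K\<in>multi_indices (Suc (Suc p)). n2 (\<lambda>z. dbar_form g K z - v K z) \<le> E) \<and>
    (\<forall>L\<in>multi_indices p. n2 (\<lambda>z. dstar_form g L z - w L z) \<le> E)"
proof -
  have uL: "u J \<in> L2 \<phi>" for J using hd u0[of J] by (cases "J \<in> multi_indices (Suc p)") (auto simp: has_dbar_def L2_forms_def)
  have vL: "v K \<in> L2 \<phi>" if "K \<in> multi_indices (Suc (Suc p))" for K using hd that by (simp add: has_dbar_def L2_forms_def)
  have wL: "w L \<in> L2 \<phi>" if "L \<in> multi_indices p" for L using ad that by (simp add: has_dbar_adjoint_def L2_forms_def)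
  define A where "A n J z = cutoff n z * u J z - u J z" for n J z
  define B where "B n K z = (cutoff n z * v K z + (\<Sum>j\<in>K. wedge_sign j (K - {j}) * (d_zbar j (cutoff n) z * u (K - {j}) z))) - v K z" for n K z
  define C where "C n L z = (cutoff n z * w L z - (\<Sum>j\<in>-L. wedge_sign j L * (d_z j (cutoff n) z * u (insert j L) z))) - w L z" for n L z
  have nA: "null (\<lambda>n. A n J)" for J unfolding A_def[abs_def] by (rule null_cutoff[OF uL])
  have nB: "null (\<lambda>n. B n K)" if "K \<in> multi_indices (Suc (Suc p))" for K
  proof -
    have "B n K = (\<lambda>z. (cutoff n z * v K z - v K z) + (\<Sum>j\<in>K. wedge_sign j (K - {j}) * (d_zbar j (cutoff n) z * u (K - {j}) z)))" for n
      by (auto simp: B_def)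
    then show ?thesis by (simp only:) (intro null_add null_sum null_cmult null_cutoff null_d_zbar_cutoff uL vL that)
  qed
  have nC: "null (\<lambda>n. C n L)" if "L \<in> multi_indices p" for L
  proof -
    have "C n L = (\<lambda>z. (cutoff n z * w L z - w L z) + (-1) * (\<Sum>j\<in>-L. wedge_sign j L * (d_z j (cutoff n) z * u (insert j L) z)))" for n
      by (auto simp: C_def)
    then show ?thesis by (simp only:) (intro null_add null_sum null_cmult null_cutoff null_d_z_cutoff uL wL that)
  qed
  have E4: "E / 4 > 0" using E by simp
  obtain n where An: "\<And>J. n2 (A n J) < E/4" and Bn: "\<And>K. K \<in> multi_indices (Suc (Suc p)) \<Longrightarrow> n2 (B n K) < E/4"
    and Cn: "\<And>L. L \<in> multi_indices p \<Longrightarrow> n2 (C n L) < E/4"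
    using eventually_three_small[of "\<lambda>J n. n2 (A n J)" "multi_indices (Suc (Suc p))" "\<lambda>J n. n2 (B n J)" "multi_indices p" "\<lambda>J n. n2 (C n J)", OF _ _ _ E4]
      nA nB nC unfolding null_def by blast
  obtain g where g: "\<And>m. test_form (g m)"
    "\<And>J. null (\<lambda>m z. g m J z - cutoff n z * u J z)"
    "\<And>K. K \<in> multi_indices (Suc (Suc p)) \<Longrightarrow> null (\<lambda>m z. dbar_form (g m) K z - (cutoff n z * v K z + (\<Sum>j\<in>K. wedge_sign j (K - {j}) * (d_zbar j (cutoff n) z * u (K - {j}) z))))"
    "\<And>L. L \<in> multi_indices p \<Longrightarrow> null (\<lambda>m z. dstar_form (g m) L z - (cutoff n z * w L z - (\<Sum>j\<in>-L. wedge_sign j L * (d_z j (cutoff n) z * u (insert j L) z))))"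
  proof (rule local_approximation[OF hd ad _ test_function_cutoff[of n]], goal_cases)
    case (1 J) show ?case by (rule u0[OF 1(2)])
  next
    case (2 g) show ?case by (rule that[OF 2(2-5)])
  qed
  define A' where "A' m J z = g m J z - cutoff n z * u J z" for m J z
  define B' where "B' m K z = dbar_form (g m) K z - (cutoff n z * v K z + (\<Sum>j\<in>K. wedge_sign j (K - {j}) * (d_zbar j (cutoff n) z * u (K - {j}) z)))" for m K z
  define C' where "C' m L z = dstar_form (g m) L z - (cutoff n z * w L z - (\<Sum>j\<in>-L. wedge_sign j L * (d_z j (cutoff n) z * u (insert j L) z)))" for m L z
  have nA': "null (\<lambda>m. A' m J)" for J unfolding A'_def[abs_def] by (rule g)
  have nB': "null (\<lambda>m. B' m K)" if "K \<in> multi_indices (Suc (Suc p))" for K unfolding B'_def[abs_def] by (rule g(3)[OF that])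
  have nC': "null (\<lambda>m. C' m L)" if "L \<in> multi_indices p" for L unfolding C'_def[abs_def] by (rule g(4)[OF that])
  obtain m where Am: "\<And>J. n2 (A' m J) < E/4" and Bm: "\<And>K. K \<in> multi_indices (Suc (Suc p)) \<Longrightarrow> n2 (B' m K) < E/4"
    and Cm: "\<And>L. L \<in> multi_indices p \<Longrightarrow> n2 (C' m L) < E/4"
    using eventually_three_small[of "\<lambda>J n. n2 (A' n J)" "multi_indices (Suc (Suc p))" "\<lambda>J n. n2 (B' n J)" "multi_indices p" "\<lambda>J n. n2 (C' n J)", OF _ _ _ E4]
      nA' nB' nC' unfolding null_def by blast
  have two: "n2 (\<lambda>z. X z + Y z) \<le> E" if "n2 X < E/4" "n2 Y < E/4" "X \<in> L2 \<phi>" "Y \<in> L2 \<phi>" for X Y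
    using n2_add_le[OF that(3,4)] that(1,2) by linarith
  show ?thesis
  proof (intro exI[of _ "g m"] conjI ballI g(1))
    fix J :: "'n set"
    have "n2 (\<lambda>z. A' m J z + A n J z) \<le> E" using nA'[of J] nA[of J] by (intro two Am An) (auto simp: null_def)
    then show "n2 (\<lambda>z. g m J z - u J z) \<le> E" by (simp add: A'_def A_def)
  next
    fix K :: "'n set" assume K: "K \<in> multi_indices (Suc (Suc p))"
    have "n2 (\<lambda>z. B' m K z + B n K z) \<le> E" using nB'[OF K] nB[OF K] by (intro two Bm Bn K) (auto simp: null_def)
    then show "n2 (\<lambda>z. dbar_form (g m) K z - v K z) \<le> E" by (simp add: B'_def B_def)
  next
    fix L :: "'n set" assume L: "L \<in> multi_indices p"
    have "n2 (\<lambda>z. C' m L z + C n L z) \<le> E" using nC'[OF L] nC[OF L] by (intro two Cm Cn L) (auto simp: null_def)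
    then show "n2 (\<lambda>z. dstar_form (g m) L z - w L z) \<le> E" by (simp add: C'_def C_def)
  qed
qed

text \<open>Test forms are dense in the intersection of the two domains for the graph norm. Setting the values of
\<open>u\<close> off the degree to zero reduces this to the preceding lemma.\<close>
lemma test_forms_dense:
  assumes hd: "has_dbar \<phi> (Suc p) u v" and ad: "has_dbar_adjoint \<phi> p u w" and E: "E > 0"
  shows "\<exists>g. test_form g \<and> (\<forall>J\<in>multi_indices (Suc p). n2 (\<lambda>z. g J z - u J z) \<le> E) \<and>
    (\<forall>K\<in>multi_indices (Suc (Suc p)). n2 (\<lambda>z. dbar_form g K z - v K z) \<le> E) \<and>
    (\<forall>L\<in>multi_indices p. n2 (\<lambda>z. dstar_form g L z - w L z) \<le> E)"
proof -
  define u' where "u' J = (if J \<in> multi_indices (Suc p) then u J else (\<lambda>z. 0))" for J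
  have "has_dbar \<phi> (Suc p) u' v"
    using hd unfolding has_dbar_def by (auto simp: u'_def L2_forms_def multi_indices_remove intro!: sum.cong)
  moreover have "has_dbar_adjoint \<phi> p u' w"
    using ad unfolding has_dbar_adjoint_def by (auto simp: u'_def L2_forms_def inner_forms_def cong: sum.cong)
  ultimately have "\<exists>g. test_form g \<and> (\<forall>J\<in>multi_indices (Suc p). n2 (\<lambda>z. g J z - u' J z) \<le> E) \<and>
    (\<forall>K\<in>multi_indices (Suc (Suc p)). n2 (\<lambda>z. dbar_form g K z - v K z) \<le> E) \<and>
    (\<forall>L\<in>multi_indices p. n2 (\<lambda>z. dstar_form g L z - w L z) \<le> E)"
    using E by (rule test_forms_dense_aux) (simp add: u'_def)
  then show ?thesis by (simp add: u'_def)
qed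

end

section \<open>Coercivity and compactness on test forms\<close>

lemma dd_locally_const:
  assumes "open S" "z \<in> S" "\<And>x. x \<in> S \<Longrightarrow> f x = c" shows "dd b f z = 0"
proof (rule dd_eqI[of _ "\<lambda>_. 0"])
  show "(f has_derivative (\<lambda>_. 0)) (at z)"
    by (rule has_derivative_transform_within_open[OF has_derivative_const assms(1,2)]) (rule assms(3)[symmetric])
qed

lemma d_z_by_parts:
  assumes f: "C_k 1 f" and g: "C_k 1 g" and b: "bounded {x. f x \<noteq> 0} \<or> bounded {x. g x \<noteq> 0}"
  shows "(LINT x|lborel. d_z j f x * g x) = - (LINT x|lborel. f x * d_z j g x)"
proof -
  have e: "cnj (d_zbar j (\<lambda>x. cnj (h x)) x) = d_z j h x" if "C_k 1 h" for h x
    using d_zbar_cnj[OF C1_differentiable[OF that, of x], of j] by simp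
  have "(LINT x|lborel. d_z j f x * g x) = cnj (LINT x|lborel. d_zbar j (\<lambda>x. cnj (f x)) x * cnj (g x))"
    unfolding Bochner_Integration.integral_cnj[symmetric] by (simp add: e[OF f])
  also have "\<dots> = cnj (- (LINT x|lborel. cnj (f x) * d_zbar j (\<lambda>x. cnj (g x)) x))"
    using b by (subst d_zbar_by_parts[OF C_k_cnj[OF f] C_k_cnj[OF g]]) auto
  also have "\<dots> = - (LINT x|lborel. f x * d_z j g x)"
    unfolding complex_cnj_minus Bochner_Integration.integral_cnj[symmetric] by (simp add: e[OF g])
  finally show ?thesis .
qed

lemma nn2_eq_integral:
  assumes "continuous_on UNIV f" "bounded {x. f x \<noteq> 0}"
  shows "nn2 f = ennreal (LINT x|lborel. (cmod (f x))\<^sup>2)"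
  unfolding nn2_def using assms
  by (intro nn_integral_eq_integral integrable_compact_support continuous_intros) (auto elim: bounded_subset)

text \<open>Two integrations by parts, in between which the two derivatives commute. The identity of Kohn, Morrey
and Hoermander bounds the derivatives with respect to the conjugate variables only; this recovers the
others.\<close>
lemma nn2_d_z_eq:
  assumes t: "test_function f" shows "nn2 (d_z j f) = nn2 (d_zbar j f)"
proof -
  have C: "C_k k (d_z j f)" "C_k k (d_zbar j f)" "C_k 2 f" "C_k 1 f" for k
    using t test_function_d_z test_function_d_zbar test_function_C_k by blast+
  have b: "bounded {x. d_z j f x \<noteq> 0}" "bounded {x. d_zbar j f x \<noteq> 0}" "bounded {x. f x \<noteq> 0}"
    using t test_function_d_z test_function_d_zbar test_function_bounded by blast+
  have c1: "d_zbar j (\<lambda>x. cnj (d_zbar j f x)) x = cnj (d_z j (d_zbar j f) x)" for x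
    by (rule d_zbar_cnj[OF C1_differentiable[OF C(2)]])
  have c2: "d_z j (\<lambda>x. cnj (d_z j f x)) x = cnj (d_zbar j (d_z j f) x)" for x
    by (rule d_z_cnj[OF C1_differentiable[OF C(1)]])
  have "(LINT x|lborel. d_zbar j f x * cnj (d_zbar j f x)) = - (LINT x|lborel. f x * d_zbar j (\<lambda>x. cnj (d_zbar j f x)) x)"
    by (rule d_zbar_by_parts[OF C(4) C_k_cnj[OF C(2)]]) (use b in simp)
  also have "\<dots> = - (LINT x|lborel. f x * d_z j (\<lambda>x. cnj (d_z j f x)) x)"
    unfolding c1 c2 using d_z_d_zbar_commute[OF C(3)] by simp
  also have "\<dots> = (LINT x|lborel. d_z j f x * cnj (d_z j f x))"
    by (subst d_z_by_parts[OF C(4) C_k_cnj[OF C(1)]]) (use b in simp)+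
  finally have "complex_of_real (LINT x|lborel. (cmod (d_zbar j f x))\<^sup>2) = complex_of_real (LINT x|lborel. (cmod (d_z j f x))\<^sup>2)"
    unfolding integral_complex_of_real[symmetric] complex_norm_square .
  then have "(LINT x|lborel. (cmod (d_zbar j f x))\<^sup>2) = (LINT x|lborel. (cmod (d_z j f x))\<^sup>2)" by (simp only: of_real_eq_iff)
  then show ?thesis using nn2_eq_integral[OF C_k_continuous[OF C(1)] b(1)] nn2_eq_integral[OF C_k_continuous[OF C(2)] b(2)] by simp
qed

text \<open>Expand \<open>h\<close> in the real basis, each member of which gives a combination of the two complex derivatives.\<close>
lemma nn2_dd_le:
  fixes f :: "complex ^ 'n::finite \<Rightarrow> complex"
  assumes t: "test_function f"
  shows "nn2 (dd h f) \<le> ennreal (4 * real CARD('n) * (real (DIM(complex ^ 'n)))\<^sup>2 * (norm h)\<^sup>2) * (\<Sum>j\<in>UNIV. nn2 (d_zbar j f))"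
proof -
  define D where "D = real (DIM(complex ^ 'n))"
  define N where "N = real CARD('n)"
  have D: "D \<ge> 0" "N \<ge> 0" by (auto simp: D_def N_def)
  have d: "f differentiable at x" for x using C2_differentiable[OF test_function_C_k[OF t]] .
  have meas [measurable]: "d_z j f \<in> borel_measurable borel" "d_zbar j f \<in> borel_measurable borel" for j
    using borel_measurable_C_k[OF test_function_C_k[OF test_function_d_z[OF t]]] borel_measurable_C_k[OF test_function_C_k[OF test_function_d_zbar[OF t]]] by blast+
  have pt: "(cmod (dd h f x))\<^sup>2 \<le> D\<^sup>2 * (norm h)\<^sup>2 * (2 * N) * (\<Sum>j\<in>UNIV. (cmod (d_z j f x))\<^sup>2 + (cmod (d_zbar j f x))\<^sup>2)" for x
  proof -
    define S where "S = (\<Sum>j\<in>UNIV. cmod (d_z j f x) + cmod (d_zbar j f x))"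
    have "cmod (dd b f x) \<le> S" if bB: "b \<in> Basis" for b
    proof -
      obtain j where j: "b = axis j 1 \<or> b = axis j \<i>" using bB unfolding Basis_vec_def Basis_complex_def by blast
      have "dd (axis j 1) f x = d_z j f x + d_zbar j f x" "dd (axis j \<i>) f x = \<i> * (d_z j f x - d_zbar j f x)"
        by (simp_all add: d_z_dd d_zbar_dd field_simps)
      then have "cmod (dd b f x) \<le> cmod (d_z j f x) + cmod (d_zbar j f x)"
        using j norm_triangle_ineq[of "d_z j f x" "d_zbar j f x"] norm_triangle_ineq4[of "d_z j f x" "d_zbar j f x"] by (auto simp: norm_mult)
      also have "\<dots> \<le> S" unfolding S_def by (rule member_le_sum) auto
      finally show ?thesis .
    qed
    then have "(\<Sum>b\<in>Basis. cmod (dd b f x)) \<le> D * S" using sum_bounded_above[of Basis "\<lambda>b. cmod (dd b f x)" S] by (simp add: D_def)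
    then have "cmod (dd h f x) \<le> norm h * (D * S)" using norm_dd_le[OF d, of h x] by (meson mult_left_mono norm_ge_zero order_trans)
    then have "(cmod (dd h f x))\<^sup>2 \<le> (norm h * (D * S))\<^sup>2" by (intro power_mono) auto
    also have "\<dots> = D\<^sup>2 * (norm h)\<^sup>2 * S\<^sup>2" by (simp add: power_mult_distrib)
    also have "\<dots> \<le> D\<^sup>2 * (norm h)\<^sup>2 * ((\<Sum>j\<in>UNIV. (cmod (d_z j f x) + cmod (d_zbar j f x))\<^sup>2) * N)"
      unfolding S_def N_def by (intro mult_left_mono sum_squared_le_sum_of_squares) auto
    also have "\<dots> \<le> D\<^sup>2 * (norm h)\<^sup>2 * ((\<Sum>j\<in>UNIV. 2 * (cmod (d_z j f x))\<^sup>2 + 2 * (cmod (d_zbar j f x))\<^sup>2) * N)"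
    proof -
      have "(a + b)\<^sup>2 \<le> 2 * a\<^sup>2 + 2 * b\<^sup>2" for a b :: real using sum_squares_bound[of a b] by (simp add: power2_sum)
      then show ?thesis using D by (intro mult_left_mono mult_right_mono sum_mono) auto
    qed
    also have "\<dots> = D\<^sup>2 * (norm h)\<^sup>2 * (2 * N) * (\<Sum>j\<in>UNIV. (cmod (d_z j f x))\<^sup>2 + (cmod (d_zbar j f x))\<^sup>2)"
      by (simp add: sum_distrib_left[symmetric] sum.distrib distrib_left algebra_simps)
    finally show ?thesis .
  qed
  define c where "c = D\<^sup>2 * (norm h)\<^sup>2 * (2 * N)"
  have c: "c \<ge> 0" using D by (simp add: c_def)
  have "nn2 (dd h f) \<le> (\<integral>\<^sup>+x. ennreal c * (\<Sum>j\<in>UNIV. ennreal ((cmod (d_z j f x))\<^sup>2) + ennreal ((cmod (d_zbar j f x))\<^sup>2)) \<partial>lborel)"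
    unfolding nn2_def
  proof (intro nn_integral_mono)
    fix x
    have "ennreal c * (\<Sum>j\<in>UNIV. ennreal ((cmod (d_z j f x))\<^sup>2) + ennreal ((cmod (d_zbar j f x))\<^sup>2)) = ennreal (c * (\<Sum>j\<in>UNIV. (cmod (d_z j f x))\<^sup>2 + (cmod (d_zbar j f x))\<^sup>2))"
      using c by (simp add: ennreal_mult sum_nonneg sum_ennreal[symmetric] ennreal_plus)
    then show "ennreal ((cmod (dd h f x))\<^sup>2) \<le> ennreal c * (\<Sum>j\<in>UNIV. ennreal ((cmod (d_z j f x))\<^sup>2) + ennreal ((cmod (d_zbar j f x))\<^sup>2))"
      using pt[of x] by (simp add: c_def ennreal_leI)
  qed
  also have "\<dots> = ennreal c * (\<Sum>j\<in>UNIV. nn2 (d_z j f) + nn2 (d_zbar j f))"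
    unfolding nn2_def by (simp add: nn_integral_cmult nn_integral_sum nn_integral_add)
  also have "\<dots> = ennreal c * (2 * (\<Sum>j\<in>UNIV. nn2 (d_zbar j f)))"
    by (simp add: nn2_d_z_eq[OF t] sum.distrib mult_2)
  also have "\<dots> = ennreal (2 * c) * (\<Sum>j\<in>UNIV. nn2 (d_zbar j f))"
    using c by (simp add: ennreal_mult mult_ac)
  finally show ?thesis by (simp add: c_def D_def N_def mult_ac)
qed

context psh_weight
begin

text \<open>The part of a function outside the open ball of radius \<open>R\<close>.\<close>
definition tail :: "real \<Rightarrow> ((complex,'n) vec \<Rightarrow> complex) \<Rightarrow> (complex,'n) vec \<Rightarrow> complex" where
  "tail R g z = indicator {z. norm z \<ge> R} z * g z"

lemma tail_measurable [measurable]: "g \<in> borel_measurable borel \<Longrightarrow> tail R g \<in> borel_measurable borel"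
proof -
  assume [measurable]: "g \<in> borel_measurable borel"
  have "closed {z::(complex,'n) vec. norm z \<ge> R}" by (intro closed_Collect_le continuous_intros)
  then have "(\<lambda>z. indicator {z. norm z \<ge> R} z :: complex) \<in> borel_measurable borel" by (intro borel_measurable_indicator) auto
  then show ?thesis unfolding tail_def[abs_def] by measurable
qed

lemma tail_L2: "g \<in> L2 \<phi> \<Longrightarrow> tail R g \<in> L2 \<phi>" and n2_tail_le: "g \<in> L2 \<phi> \<Longrightarrow> n2 (tail R g) \<le> n2 g"
proof -
  assume g: "g \<in> L2 \<phi>"
  have le: "cmod (tail R g z) \<le> cmod (g z)" for z by (simp add: tail_def indicator_def)
  show "tail R g \<in> L2 \<phi>" "n2 (tail R g) \<le> n2 g"
    using n2_mono[OF tail_measurable[OF L2_measurable[OF g]] g le] by auto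
qed

text \<open>A cutoff \<open>ch\<close> that is \<open>1\<close> on the ball of radius \<open>R\<close> and \<open>0\<close> outside that of radius \<open>R'\<close>, together with a
constant \<open>M\<close> for which the unweighted gradient of \<open>ch g\<close> is bounded by quantities that \<open>Q\<close> controls.\<close>
definition plateau :: "real \<Rightarrow> ((complex,'n) vec \<Rightarrow> complex) \<Rightarrow> real \<Rightarrow> real \<Rightarrow> bool" where
  "plateau R ch R' M \<longleftrightarrow> test_function ch \<and> (\<forall>z. cmod (ch z) \<le> 1) \<and> (\<forall>z. cmod (1 - ch z) \<le> 1) \<and> (\<forall>z. norm z \<le> R \<longrightarrow> ch z = 1) \<and>
    (\<forall>z. norm z > R' \<longrightarrow> ch z = 0) \<and> R' > 0 \<and> M \<ge> 0 \<and>
    (\<forall>g h. test_function g \<longrightarrow> nn2 (dd h (\<lambda>z. ch z * g z)) \<le> ennreal (M * (norm h)\<^sup>2 * ((\<Sum>j\<in>UNIV. n2 (d_zbar j g)) + n2 (tail R g))))"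

text \<open>The cutoff is a mollified indicator function. Its gradient lives outside the ball of radius \<open>R\<close>, so that
the error term \<open>g \<partial>ch/\<partial>(cnj z\<^sub>j)\<close> involves the tail of \<open>g\<close> only. On the support of \<open>ch\<close> the weight is bounded
below, which permits the passage to the unweighted norm and the use of \<open>nn2_d_z_eq\<close>.\<close>
lemma plateau_exists:
  assumes R: "R > 0"
  shows "\<exists>ch R' M. plateau R ch R' M"
proof -
  obtain \<rho> :: "(complex,'n) vec \<Rightarrow> real" where m: "mollifier 1 \<rho>" using mollifier_exists[of 1] by auto
  define \<eta> where "\<eta> x = complex_of_real (\<rho> x)" for x
  have t: "test_function \<eta>" and r0: "\<And>x. \<rho> x \<ge> 0" and rz: "\<And>x. norm x \<ge> 1 \<Longrightarrow> \<rho> x = 0"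
    and ri: "integrable lborel \<rho>" and r1: "(LINT x|lborel. \<rho> x) = 1" using m by (auto simp: mollifier_def \<eta>_def[abs_def])
  have rm [measurable]: "\<rho> \<in> borel_measurable borel" using borel_measurable_integrable[OF ri] by simp
  define I where "I z = complex_of_real (indicator (cball 0 (R + 2)) z)" for z :: "(complex,'n) vec"
  have Ii: "integrable lborel I" unfolding I_def
    using emeasure_lborel_cball_finite[of "0::(complex,'n) vec" "R+2"]
    by (intro integrable_of_real integrable_real_indicator) (auto simp: less_top)
  define ch where "ch = conv I \<eta>"
  have chr: "ch z = complex_of_real (LINT w|lborel. indicator (cball 0 (R+2)) w * \<rho> (w - z))" for z
    unfolding ch_def conv_def I_def \<eta>_def of_real_mult[symmetric] integral_complex_of_real ..
  have sh: "(LINT w|lborel. \<rho> (w - z)) = 1" "integrable lborel (\<lambda>w. \<rho> (w - z))" for z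
    using integral_shift[OF rm, of "-z"] integrable_shift[OF ri, of "-z"] r1 by auto
  have ii: "integrable lborel (\<lambda>w. indicator (cball 0 (R+2)) w * \<rho> (w - z))" for z
    using integrable_mult_indicator[of "cball 0 (R+2)" lborel "\<lambda>w. \<rho> (w - z)"] sh(2)[of z] by simp
  have ch01: "0 \<le> Re (ch z) \<and> Re (ch z) \<le> 1 \<and> Im (ch z) = 0" for z
  proof -
    have "(LINT w|lborel. indicator (cball 0 (R+2)) w * \<rho> (w - z)) \<le> (LINT w|lborel. \<rho> (w - z))"
      by (rule integral_mono[OF ii sh(2)]) (simp add: indicator_def r0)
    moreover have "0 \<le> (LINT w|lborel. indicator (cball 0 (R+2)) w * \<rho> (w - z))" by (intro integral_nonneg_AE) (simp add: r0)
    ultimately show ?thesis by (simp add: chr sh)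
  qed
  have cht: "test_function ch" unfolding ch_def
    by (rule test_function_conv[OF Ii t]) (rule bounded_subset[OF bounded_cball[of 0 "R+2"]], auto simp: I_def indicator_def split: if_splits)
  have ch1: "ch z = 1" if "norm z \<le> R + 1" for z
  proof -
    have "indicator (cball 0 (R+2)) w * \<rho> (w - z) = \<rho> (w - z)" for w
    proof (cases "norm (w - z) \<ge> 1")
      case False
      have "norm w \<le> norm z + norm (w - z)" by (rule norm_triangle_sub)
      then show ?thesis using False that by (simp add: indicator_def)
    qed (simp add: rz)
    then have "(\<lambda>w. indicator (cball 0 (R+2)) w * \<rho> (w - z)) = (\<lambda>w. \<rho> (w - z))" by blast
    then show ?thesis by (simp add: chr sh)
  qed
  define R' where "R' = R + 3"
  have chz: "ch z = 0" if "norm z > R'" for z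
    unfolding ch_def by (rule conv_eq_0[where R="R+2" and \<delta>=1]) (use that in \<open>auto simp: R'_def I_def \<eta>_def rz indicator_def\<close>)
  have dch: "d_zbar j ch z = 0" if "norm z < R" for j z
  proof -
    have "dd b ch z = 0" for b
      by (rule dd_locally_const[OF open_ball[of 0 "R+1"]]) (use that ch1 in \<open>simp_all\<close>)
    then show ?thesis by (simp add: d_zbar_dd)
  qed
  have "\<exists>B. B \<ge> 0 \<and> (\<forall>z. cmod (d_zbar j ch z) \<le> B)" for j
    using test_function_bound[OF test_function_d_zbar[OF cht, of j]] by metis
  then obtain B where B: "\<And>j. B j \<ge> 0" "\<And>j z. cmod (d_zbar j ch z) \<le> B j" by metis
  obtain mm where mm: "mm > 0" "\<And>z. norm z \<le> R' \<Longrightarrow> mm \<le> exp (- \<phi> z)" using exp_phi_bounded_below[of R'] by blast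
  define BB where "BB = 2 + 2 * (\<Sum>j\<in>UNIV. (B j)\<^sup>2)"
  have BB0: "BB \<ge> 0" by (simp add: BB_def sum_nonneg)
  define c where "c = 4 * real CARD('n) * (real (DIM((complex,'n) vec)))\<^sup>2"
  define M where "M = c * (BB / mm)"
  have "c \<ge> 0" by (simp add: c_def)
  then have M: "M \<ge> 0" unfolding M_def using BB0 mm(1) by simp
  have "plateau R ch R' M" unfolding plateau_def
  proof (intro conjI allI impI)
    show "cmod (ch z) \<le> 1" "cmod (1 - ch z) \<le> 1" for z
      using ch01[of z] by (simp_all add: cmod_def)
    show "norm z \<le> R \<Longrightarrow> ch z = 1" for z using ch1 by simp
    show "R' > 0" using R by (simp add: R'_def)
    fix g h assume g: "test_function (g :: (complex,'n) vec \<Rightarrow> complex)"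
    have f: "test_function (\<lambda>z. ch z * g z)" by (rule test_function_mult[OF cht g])
    have gL: "g \<in> L2 \<phi>" "d_zbar j g \<in> L2 \<phi>" for j using L2_test[OF g] L2_test[OF test_function_d_zbar[OF g]] by auto
    define S where "S = (\<Sum>j\<in>UNIV. n2 (d_zbar j g)) + n2 (tail R g)"
    have S0: "S \<ge> 0" by (simp add: S_def sum_nonneg n2_nonneg)
    have each: "nn2 (d_zbar j (\<lambda>z. ch z * g z)) \<le> ennreal ((2 * n2 (d_zbar j g) + 2 * ((B j)\<^sup>2 * n2 (tail R g))) / mm)" for j
    proof -
      have e: "d_zbar j (\<lambda>z. ch z * g z) = (\<lambda>z. ch z * d_zbar j g z + d_zbar j ch z * tail R g z)"
      proof
        fix z
        have "d_zbar j (\<lambda>z. ch z * g z) z = ch z * d_zbar j g z + d_zbar j ch z * g z"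
          by (intro d_zbar_mult C2_differentiable test_function_C_k cht g)
        also have "d_zbar j ch z * g z = d_zbar j ch z * tail R g z" using dch[of z j] by (auto simp: tail_def indicator_def)
        finally show "d_zbar j (\<lambda>z. ch z * g z) z = ch z * d_zbar j g z + d_zbar j ch z * tail R g z" .
      qed
      have cm: "ch \<in> borel_measurable borel" "d_zbar j ch \<in> borel_measurable borel"
        using borel_measurable_C_k[OF test_function_C_k[OF cht]] borel_measurable_C_k[OF test_function_C_k[OF test_function_d_zbar[OF cht]]] by auto
      have L: "(\<lambda>z. ch z * d_zbar j g z) \<in> L2 \<phi>" "(\<lambda>z. d_zbar j ch z * tail R g z) \<in> L2 \<phi>"
        by (intro L2_test_mult cht test_function_d_zbar gL tail_L2)+
      have "n2 (\<lambda>z. ch z * d_zbar j g z) \<le> 1\<^sup>2 * n2 (d_zbar j g)"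
        by (rule n2_bounded_mult[OF gL(2) cm(1)]) (use ch01 in \<open>simp add: cmod_def\<close>)
      moreover have "n2 (\<lambda>z. d_zbar j ch z * tail R g z) \<le> (B j)\<^sup>2 * n2 (tail R g)"
        by (rule n2_bounded_mult[OF tail_L2[OF gL(1)] cm(2) B(2)])
      ultimately have "n2 (d_zbar j (\<lambda>z. ch z * g z)) \<le> 2 * n2 (d_zbar j g) + 2 * ((B j)\<^sup>2 * n2 (tail R g))"
        unfolding e using n2_add_le[OF L] by simp
      then have le: "n2 (d_zbar j (\<lambda>z. ch z * g z)) / mm \<le> (2 * n2 (d_zbar j g) + 2 * ((B j)\<^sup>2 * n2 (tail R g))) / mm"
        using mm(1) by (intro divide_right_mono) auto
      have "nn2 (d_zbar j (\<lambda>z. ch z * g z)) \<le> ennreal (n2 (d_zbar j (\<lambda>z. ch z * g z)) / mm)"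
      proof (rule nn2_le_n2[OF L2_test[OF test_function_d_zbar[OF f]] _ mm])
        show "d_zbar j (\<lambda>z. ch z * g z) z = 0" if "norm z > R'" for z
        proof -
          have "open {z::(complex,'n) vec. norm z > R'}" by (intro open_Collect_less continuous_intros)
          then have "dd b (\<lambda>z. ch z * g z) z = 0" for b
            by (rule dd_locally_const) (simp_all add: that chz)
          then show ?thesis by (simp add: d_zbar_dd)
        qed
      qed
      then show ?thesis using ennreal_leI[OF le] by (rule order_trans)
    qed
    have "(\<Sum>j\<in>UNIV. nn2 (d_zbar j (\<lambda>z. ch z * g z))) \<le> (\<Sum>j\<in>UNIV. ennreal ((2 * n2 (d_zbar j g) + 2 * ((B j)\<^sup>2 * n2 (tail R g))) / mm))"
      by (intro sum_mono each)
    also have "\<dots> = ennreal (\<Sum>j\<in>UNIV. (2 * n2 (d_zbar j g) + 2 * ((B j)\<^sup>2 * n2 (tail R g))) / mm)"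
      using mm(1) by (intro sum_ennreal) (simp add: n2_nonneg)
    also have "(\<Sum>j\<in>UNIV. (2 * n2 (d_zbar j g) + 2 * ((B j)\<^sup>2 * n2 (tail R g))) / mm) =
        (2 * (\<Sum>j\<in>UNIV. n2 (d_zbar j g)) + 2 * (\<Sum>j\<in>UNIV. (B j)\<^sup>2) * n2 (tail R g)) / mm"
      by (simp add: sum_divide_distrib[symmetric] sum.distrib sum_distrib_left sum_distrib_right mult.assoc)
    also have "ennreal \<dots> \<le> ennreal (BB / mm * S)"
    proof (rule ennreal_leI)
      have "2 * (\<Sum>j\<in>UNIV. n2 (d_zbar j g)) \<le> BB * (\<Sum>j\<in>UNIV. n2 (d_zbar j g))"
        by (intro mult_right_mono) (auto simp: BB_def sum_nonneg n2_nonneg)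
      moreover have "2 * (\<Sum>j\<in>UNIV. (B j)\<^sup>2) * n2 (tail R g) \<le> BB * n2 (tail R g)"
        by (intro mult_right_mono) (auto simp: BB_def n2_nonneg)
      ultimately have "2 * (\<Sum>j\<in>UNIV. n2 (d_zbar j g)) + 2 * (\<Sum>j\<in>UNIV. (B j)\<^sup>2) * n2 (tail R g) \<le> BB * S" by (simp add: S_def distrib_left)
      then show "(2 * (\<Sum>j\<in>UNIV. n2 (d_zbar j g)) + 2 * (\<Sum>j\<in>UNIV. (B j)\<^sup>2) * n2 (tail R g)) / mm \<le> BB / mm * S"
        using mm(1) by (simp add: divide_right_mono)
    qed
    finally have sum: "(\<Sum>j\<in>UNIV. nn2 (d_zbar j (\<lambda>z. ch z * g z))) \<le> ennreal (BB / mm * S)" .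
    have "nn2 (dd h (\<lambda>z. ch z * g z)) \<le> ennreal (c * (norm h)\<^sup>2) * ennreal (BB / mm * S)"
      using order_trans[OF nn2_dd_le[OF f, of h] mult_left_mono[OF sum]] by (simp add: c_def)
    also have "\<dots> = ennreal (M * (norm h)\<^sup>2 * S)"
      using \<open>c \<ge> 0\<close> BB0 mm(1) S0 by (simp add: ennreal_mult[symmetric] M_def mult_ac)
    finally show "nn2 (dd h (\<lambda>z. ch z * g z)) \<le> ennreal (M * (norm h)\<^sup>2 * ((\<Sum>j\<in>UNIV. n2 (d_zbar j g)) + n2 (tail R g)))"
      by (simp add: S_def)
  qed (use cht chz M in auto)
  then show ?thesis by blast
qed

lemma one_minus_plateau:
  assumes ch: "test_function ch" "\<And>z. cmod (1 - ch z) \<le> 1" "\<And>z. norm z \<le> R \<Longrightarrow> ch z = 1" and f: "f \<in> L2 \<phi>"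
  shows "(\<lambda>z. (1 - ch z) * f z) \<in> L2 \<phi>" "n2 (\<lambda>z. (1 - ch z) * f z) \<le> n2 (tail R f)"
proof -
  have m: "(\<lambda>z. (1 - ch z) * f z) \<in> borel_measurable borel"
    using borel_measurable_C_k[OF test_function_C_k[OF ch(1), where k=0]] L2_measurable[OF f] by (intro borel_measurable_times borel_measurable_diff) auto
  have "cmod ((1 - ch z) * f z) \<le> cmod (tail R f z)" for z
    using ch(2)[of z] ch(3)[of z] mult_right_mono[OF ch(2)[of z], of "cmod (f z)"] by (cases "norm z \<ge> R") (auto simp: tail_def norm_mult)
  from n2_mono[OF m tail_L2[OF f] this] show "(\<lambda>z. (1 - ch z) * f z) \<in> L2 \<phi>" "n2 (\<lambda>z. (1 - ch z) * f z) \<le> n2 (tail R f)" by auto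
qed

end

text \<open>The degree is \<open>p + 1\<close>, so that the degrees \<open>p\<close>, \<open>p + 1\<close> and \<open>p + 2\<close> of the three spaces involved can be
written without subtraction.\<close>
locale growing_weight = psh_weight \<phi> for \<phi> :: "(complex, 'n::{finite,linorder}) vec \<Rightarrow> real" +
  fixes p :: nat
  assumes p: "Suc p \<le> CARD('n)"
    and growth: "filterlim (\<lambda>z. sum_smallest_eigenvalues (Suc p) (levi_matrix \<phi> z)) at_top at_infinity"
begin

text \<open>The factor \<open>c\<close> can be taken arbitrarily large because the eigenvalue sums tend to infinity.\<close>
lemma tail_small:
  assumes "c > 0"
  obtains R where "R > 0" "\<And>g. test_form g \<Longrightarrow> c * (\<Sum>J\<in>multi_indices (Suc p). n2 (tail R (g J))) \<le> Q p g"
proof -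
  obtain R where R: "\<And>z. norm z \<ge> R \<Longrightarrow> c \<le> sum_smallest_eigenvalues (Suc p) (levi_matrix \<phi> z)"
    using growth unfolding filterlim_at_top eventually_at_infinity by blast
  have "c * (\<Sum>J\<in>multi_indices (Suc p). n2 (tail (max R 1) (g J))) \<le> Q p g" if "test_form g" for g
    unfolding tail_def[abs_def] by (rule tail_le_Q[OF that p]) (use R assms in auto)
  then show ?thesis using that[of "max R 1"] by simp
qed

text \<open>Split \<open>f = ch f + (1 - ch) f\<close> with a plateau function. The second part is bounded by the tail. For the first
part, translation by more than the diameter of the support gives a Poincare inequality.\<close>
lemma coercive_test:
  obtains C where "C \<ge> 0" "\<And>g. test_form g \<Longrightarrow> (\<Sum>J\<in>multi_indices (Suc p). n2 (g J)) \<le> C * Q p g"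
proof -
  obtain R where R: "R > 0" and tl: "\<And>g. test_form g \<Longrightarrow> (\<Sum>J\<in>multi_indices (Suc p). n2 (tail R (g J))) \<le> Q p g"
    using tail_small[of 1] by auto
  obtain ch R' M where pl: "plateau R ch R' M" using plateau_exists[OF R] by blast
  have cht: "test_function ch" and ch: "\<And>z. cmod (ch z) \<le> 1" "\<And>z. cmod (1 - ch z) \<le> 1" "\<And>z. norm z \<le> R \<Longrightarrow> ch z = 1"
    "\<And>z. norm z > R' \<Longrightarrow> ch z = 0" "R' > 0" "M \<ge> 0"
    and est: "\<And>g h. test_function g \<Longrightarrow> nn2 (dd h (\<lambda>z. ch z * g z)) \<le> ennreal (M * (norm h)\<^sup>2 * ((\<Sum>j\<in>UNIV. n2 (d_zbar j g)) + n2 (tail R g)))"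
    using pl unfolding plateau_def by blast+
  \<comment> \<open>longer than the diameter of the support, in the direction of an arbitrary coordinate\<close>
  define h :: "(complex,'n) vec" where "h = (2 * R' + 1) *\<^sub>R axis undefined 1"
  have nh: "norm h = 2 * R' + 1" using ch(5) by (simp add: h_def)
  define A where "A = M * (norm h)\<^sup>2"
  have A: "A \<ge> 0" using ch(6) by (simp add: A_def)
  have each: "n2 f \<le> (2 * A + 2) * ((\<Sum>j\<in>UNIV. n2 (d_zbar j f)) + n2 (tail R f))" if f: "test_function f" for f
  proof -
    define S where "S = (\<Sum>j\<in>UNIV. n2 (d_zbar j f)) + n2 (tail R f)"
    have S0: "S \<ge> 0" "n2 (tail R f) \<le> S" by (simp_all add: S_def sum_nonneg n2_nonneg)
    have t: "test_function (\<lambda>z. ch z * f z)" by (rule test_function_mult[OF cht f])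
    have "nn2 (\<lambda>z. ch z * f z) \<le> nn2 (\<lambda>x. ch (x + h) * f (x + h) - ch x * f x)"
      unfolding nn2_def
    proof (intro nn_integral_mono ennreal_leI power_mono norm_ge_zero)
      fix z
      show "cmod (ch z * f z) \<le> cmod (ch (z + h) * f (z + h) - ch z * f z)"
      proof (cases "norm z > R'")
        case False
        have "norm (z + h) \<ge> norm h - norm z" using norm_diff_ineq[of h z] by (simp add: add.commute)
        then have "norm (z + h) > R'" using False nh ch(5) by linarith
        then show ?thesis by (simp add: ch(4))
      qed (simp add: ch(4))
    qed
    also have "\<dots> \<le> nn2 (dd h (\<lambda>z. ch z * f z))"
      unfolding nn2_def by (rule translation_estimate[OF test_function_C_k[OF t]])
    also have "\<dots> \<le> ennreal (A * S)" using est[OF f, of h] by (simp add: A_def S_def)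
    finally have "n2 (\<lambda>z. ch z * f z) \<le> A * S"
      using A S0 by (intro n2_le_nn2(2)[OF L2_measurable[OF L2_test[OF t]] phi_nonneg]) auto
    moreover have "n2 f \<le> 2 * n2 (\<lambda>z. ch z * f z) + 2 * n2 (\<lambda>z. (1 - ch z) * f z)"
      using n2_add_le[OF L2_test[OF t] one_minus_plateau(1)[OF cht ch(2,3) L2_test[OF f]]] by (simp add: algebra_simps)
    moreover have "n2 (\<lambda>z. (1 - ch z) * f z) \<le> n2 (tail R f)" by (rule one_minus_plateau(2)[OF cht ch(2,3) L2_test[OF f]])
    ultimately have "n2 f \<le> 2 * (A * S) + 2 * S" using S0(2) by linarith
    then show ?thesis unfolding S_def[symmetric] by (simp add: algebra_simps)
  qed
  have "(\<Sum>J\<in>multi_indices (Suc p). n2 (g J)) \<le> (2 * (2 * A + 2)) * Q p g" if g: "test_form g" for g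
  proof -
    have "(\<Sum>J\<in>multi_indices (Suc p). n2 (g J)) \<le> (\<Sum>J\<in>multi_indices (Suc p). (2 * A + 2) * ((\<Sum>j\<in>UNIV. n2 (d_zbar j (g J))) + n2 (tail R (g J))))"
      by (intro sum_mono each test_form_J g)
    also have "\<dots> = (2 * A + 2) * ((\<Sum>J\<in>multi_indices (Suc p). \<Sum>j\<in>UNIV. n2 (d_zbar j (g J))) + (\<Sum>J\<in>multi_indices (Suc p). n2 (tail R (g J))))"
      by (simp only: sum_distrib_left[symmetric] sum.distrib)
    also have "\<dots> \<le> (2 * A + 2) * (Q p g + Q p g)"
      using A by (intro mult_left_mono add_mono sum_d_zbar_le_Q tl g) auto
    finally show ?thesis by (simp add: algebra_simps)
  qed
  then show ?thesis using that[of "2 * (2 * A + 2)"] A by auto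
qed

text \<open>Choose the radius so large that the tails of all members contribute at most a fraction of \<open>E\<close>, and
apply Rellich's theorem to the forms cut off by a plateau function.\<close>
lemma compact_test:
  fixes g :: "nat \<Rightarrow> 'n form"
  assumes g: "\<And>k. test_form (g k)" and C: "\<And>k. (\<Sum>J\<in>multi_indices (Suc p). n2 (g k J)) \<le> C" "\<And>k. Q p (g k) \<le> C" and E: "E > 0"
  shows "\<exists>r::nat \<Rightarrow> nat. strict_mono r \<and> (\<forall>k l. \<forall>J\<in>multi_indices (Suc p). n2 (\<lambda>z. g (r k) J z - g (r l) J z) \<le> E)"
proof -
  have C0: "C \<ge> 0" using C(1)[of 0] by (meson order_trans sum_nonneg n2_nonneg)
  \<comment> \<open>with this factor the bound \<open>C\<close> for the Dirichlet form leaves at most \<open>E / 16\<close> for the tails\<close>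
  define c where "c = 1 + 16 * C / E"
  have c: "c \<ge> 1" using C0 E by (simp add: c_def)
  obtain R where R: "R > 0" and tl: "\<And>g. test_form g \<Longrightarrow> c * (\<Sum>J\<in>multi_indices (Suc p). n2 (tail R (g J))) \<le> Q p g"
    using tail_small[of c] c by auto
  obtain ch R' M where pl: "plateau R ch R' M" using plateau_exists[OF R] by blast
  have cht: "test_function ch" and ch: "\<And>z. cmod (ch z) \<le> 1" "\<And>z. cmod (1 - ch z) \<le> 1" "\<And>z. norm z \<le> R \<Longrightarrow> ch z = 1"
    "\<And>z. norm z > R' \<Longrightarrow> ch z = 0" "R' > 0" "M \<ge> 0"
    and est: "\<And>g h. test_function g \<Longrightarrow> nn2 (dd h (\<lambda>z. ch z * g z)) \<le> ennreal (M * (norm h)\<^sup>2 * ((\<Sum>j\<in>UNIV. n2 (d_zbar j g)) + n2 (tail R g)))"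
    using pl unfolding plateau_def by blast+
  obtain mm where mm: "mm > 0" "\<And>z. norm z \<le> R' \<Longrightarrow> mm \<le> exp (- \<phi> z)" using exp_phi_bounded_below[of R'] by blast
  have tJ: "test_function (g k J)" for k J using g by (rule test_form_J)
  have LJ: "g k J \<in> L2 \<phi>" for k J by (rule L2_test[OF tJ])
  have nJ: "n2 (g k J) \<le> C" if "J \<in> multi_indices (Suc p)" for k J
    using member_le_sum[of J "multi_indices (Suc p)" "\<lambda>J. n2 (g k J)"] that n2_nonneg C(1)[of k] by fastforce
  have tJs: "n2 (tail R (g k J)) \<le> E / 16" if "J \<in> multi_indices (Suc p)" for k J
  proof -
    have "c * n2 (tail R (g k J)) \<le> c * (\<Sum>J\<in>multi_indices (Suc p). n2 (tail R (g k J)))"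
      using c that by (intro mult_left_mono member_le_sum) (auto simp: n2_nonneg)
    also have "\<dots> \<le> C" using tl[OF g] C(2) order_trans by blast
    also have "\<dots> \<le> c * (E / 16)" using E C0 by (simp add: c_def field_simps)
    finally show ?thesis using c by simp
  qed
  have tJC: "n2 (tail R (g k J)) \<le> C" if "J \<in> multi_indices (Suc p)" for k J
    using n2_tail_le[OF LJ] nJ[OF that] order_trans by blast
  have dJ: "(\<Sum>j\<in>UNIV. n2 (d_zbar j (g k J))) \<le> C" if "J \<in> multi_indices (Suc p)" for k J
  proof -
    have "(\<Sum>j\<in>UNIV. n2 (d_zbar j (g k J))) \<le> (\<Sum>J\<in>multi_indices (Suc p). \<Sum>j\<in>UNIV. n2 (d_zbar j (g k J)))"
      using that by (intro member_le_sum[of J _ "\<lambda>J. \<Sum>j\<in>UNIV. n2 (d_zbar j (g k J))"]) (auto simp: n2_nonneg sum_nonneg)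
    also have "\<dots> \<le> Q p (g k)" by (rule sum_d_zbar_le_Q[OF g])
    finally show ?thesis using C(2) order_trans by blast
  qed
  define f where "f k J = (if J \<in> multi_indices (Suc p) then (\<lambda>z. ch z * g k J z) else (\<lambda>z. 0))" for k J
  have ft: "test_function (\<lambda>z. ch z * g k J z)" for k J by (rule test_function_mult[OF cht tJ])
  have ftf: "test_function (f k J)" for k J using ft test_function_cmult[OF cht, of 0] by (simp add: f_def)
  have "\<exists>r::nat \<Rightarrow> nat. strict_mono r \<and> (\<forall>k l J. nn2 (\<lambda>x. f (r k) J x - f (r l) J x) \<le> ennreal (E/4))"
  proof (rule rellich)
    show "integrable lborel (f k J)" for k J
      using ftf by (intro integrable_compact_support test_function_bounded C_k_continuous[OF test_function_C_k[where k=0]])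
    show "norm x > R' \<Longrightarrow> f k J x = 0" for k J x by (simp add: f_def ch(4))
    show "nn2 (f k J) \<le> ennreal (C / mm)" for k J
    proof (cases "J \<in> multi_indices (Suc p)")
      case True
      have "n2 (\<lambda>z. ch z * g k J z) \<le> 1\<^sup>2 * n2 (g k J)"
        by (rule n2_bounded_mult[OF LJ borel_measurable_C_k[OF test_function_C_k[OF cht]] ch(1)])
      then have "n2 (f k J) \<le> C" using nJ[OF True, of k] True by (simp add: f_def)
      then have "n2 (f k J) / mm \<le> C / mm" using mm(1) by (intro divide_right_mono) auto
      moreover have "nn2 (f k J) \<le> ennreal (n2 (f k J) / mm)"
        by (rule nn2_le_n2[OF L2_test[OF ftf] _ mm]) (auto simp: f_def ch(4))
      ultimately show ?thesis using ennreal_leI order_trans by blast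
    qed (simp add: f_def nn2_def)
    show "nn2 (\<lambda>x. f k J (x + h) - f k J x) \<le> ennreal (M * (C + C) * (norm h)\<^sup>2)" for k J h
    proof (cases "J \<in> multi_indices (Suc p)")
      case True
      have "nn2 (\<lambda>x. f k J (x + h) - f k J x) \<le> nn2 (dd h (f k J))"
        unfolding nn2_def by (rule translation_estimate[OF test_function_C_k[OF ftf]])
      also have "\<dots> \<le> ennreal (M * (norm h)\<^sup>2 * ((\<Sum>j\<in>UNIV. n2 (d_zbar j (g k J))) + n2 (tail R (g k J))))"
        using est[OF tJ, of h k J] True by (simp add: f_def)
      also have "\<dots> \<le> ennreal (M * (norm h)\<^sup>2 * (C + C))"
        using ch(6) by (intro ennreal_leI mult_left_mono add_mono dJ tJC True) auto
      finally show ?thesis by (simp add: mult_ac)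
    qed (simp add: f_def nn2_def)
  qed (use ch mm C0 E in auto)
  then obtain r :: "nat \<Rightarrow> nat" where r: "strict_mono r" "\<And>k l J. nn2 (\<lambda>x. f (r k) J x - f (r l) J x) \<le> ennreal (E/4)" by blast
  have "n2 (\<lambda>z. g (r k) J z - g (r l) J z) \<le> E" if J: "J \<in> multi_indices (Suc p)" for k l J
  proof -
    define d where "d z = g (r k) J z - g (r l) J z" for z
    have dL: "d \<in> L2 \<phi>" unfolding d_def[abs_def] by (intro L2_diff LJ)
    have cd: "(\<lambda>z. ch z * d z) = (\<lambda>z. f (r k) J z - f (r l) J z)" using J by (auto simp: f_def d_def algebra_simps)
    have cdL: "(\<lambda>z. ch z * d z) \<in> L2 \<phi>" by (rule L2_test_mult[OF cht dL])
    have 1: "n2 (\<lambda>z. ch z * d z) \<le> E/4"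
      by (rule n2_le_nn2(2)[OF L2_measurable[OF cdL] phi_nonneg]) (use r(2)[of k J l] E in \<open>auto simp: cd\<close>)
    have td: "tail R d = (\<lambda>z. tail R (g (r k) J) z + (-1) * tail R (g (r l) J) z)" by (auto simp: tail_def d_def algebra_simps)
    have "n2 (tail R d) \<le> 2 * n2 (tail R (g (r k) J)) + 2 * n2 (\<lambda>z. (-1) * tail R (g (r l) J) z)"
      unfolding td by (intro n2_add_le L2_cmult tail_L2 LJ)
    then have 2: "n2 (tail R d) \<le> E/4" using tJs[OF J, of "r k"] tJs[OF J, of "r l"] n2_cmult[of "-1" "tail R (g (r l) J)"] by simp
    have "n2 d \<le> 2 * n2 (\<lambda>z. ch z * d z) + 2 * n2 (\<lambda>z. (1 - ch z) * d z)"
      using n2_add_le[OF cdL one_minus_plateau(1)[OF cht ch(2,3) dL]] by (simp add: algebra_simps)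
    also have "\<dots> \<le> 2 * (E/4) + 2 * (E/4)"
    proof -
      have "n2 (\<lambda>z. (1 - ch z) * d z) \<le> n2 (tail R d)" by (rule one_minus_plateau(2)[OF cht ch(2,3) dL])
      with 1 2 show ?thesis by linarith
    qed
    finally show ?thesis by (simp add: d_def[abs_def])
  qed
  with r(1) show ?thesis by blast
qed

end

section \<open>The Hilbert spaces of forms\<close>

text \<open>If every subsequence has, for each \<open>E\<close>, a further subsequence whose mutual distances are at most \<open>E\<close>,
then a diagonal subsequence is Cauchy.\<close>
lemma diagonal_cauchy:
  fixes d :: "nat \<Rightarrow> nat \<Rightarrow> real"
  assumes "\<And>s E. strict_mono (s :: nat \<Rightarrow> nat) \<Longrightarrow> E > 0 \<Longrightarrow> \<exists>r::nat \<Rightarrow> nat. strict_mono r \<and> (\<forall>k l. d (s (r k)) (s (r l)) \<le> E)"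
  shows "\<exists>r::nat \<Rightarrow> nat. strict_mono r \<and> (\<forall>E>0. \<exists>N. \<forall>k\<ge>N. \<forall>l\<ge>N. d (r k) (r l) \<le> E)"
proof -
  define P where "P n s \<longleftrightarrow> (\<forall>k l. d (s k) (s l) \<le> 1 / real (Suc n))" for n and s :: "nat \<Rightarrow> nat"
  interpret subseqs P
  proof
    fix n and s :: "nat \<Rightarrow> nat" assume "strict_mono s"
    then show "\<exists>r'. strict_mono r' \<and> P n (s \<circ> r')" using assms[of s "1 / real (Suc n)"] by (simp add: P_def)
  qed
  have h: "P n (diagseq \<circ> ((+) (Suc n)))" for n by (rule diagseq_holds) (simp add: P_def)
  have "\<exists>N. \<forall>k\<ge>N. \<forall>l\<ge>N. d (diagseq k) (diagseq l) \<le> E" if E: "E > 0" for E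
  proof -
    obtain n where n: "1 / real (Suc n) < E" using nat_approx_posE[OF E] by blast
    have "d (diagseq k) (diagseq l) \<le> E" if "k \<ge> Suc n" "l \<ge> Suc n" for k l
    proof -
      have "d (diagseq (Suc n + (k - Suc n))) (diagseq (Suc n + (l - Suc n))) \<le> 1 / real (Suc n)"
        using h[of n] unfolding P_def o_def by blast
      then show ?thesis using that n by simp
    qed
    then show ?thesis by blast
  qed
  then show ?thesis using subseq_diagseq by blast
qed

context weight
begin

definition NN :: "nat \<Rightarrow> 'n form \<Rightarrow> real" where "NN q u = (\<Sum>J\<in>multi_indices q. n2 (u J))"

text \<open>Linear combinations, with the coefficients next to the vectors as in the locale \<open>semi_inner\<close>.\<close>
definition fcomb :: "complex \<Rightarrow> 'n form \<Rightarrow> complex \<Rightarrow> 'n form \<Rightarrow> 'n form" where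
  "fcomb a u b v = (\<lambda>J z. a * u J z + b * v J z)"

abbreviation fdiff :: "'n form \<Rightarrow> 'n form \<Rightarrow> 'n form" where "fdiff u v \<equiv> (\<lambda>J z. u J z - v J z)"

lemma fcomb_diff: "fcomb 1 u (-1) v = fdiff u v" by (simp add: fcomb_def)

lemma NN_nonneg: "0 \<le> NN q u" by (simp add: NN_def sum_nonneg n2_nonneg)
lemma inner_forms_self: "inner_forms \<phi> q u u = of_real (NN q u)" by (simp add: inner_forms_def NN_def inner_self)
lemma norm_forms_NN: "norm_forms \<phi> q u = sqrt (NN q u)" by (simp add: norm_forms_def inner_forms_self)

lemma L2_formsD: "u \<in> L2_forms \<phi> q \<Longrightarrow> J \<in> multi_indices q \<Longrightarrow> u J \<in> L2 \<phi>" by (simp add: L2_forms_def)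

lemma L2_forms_comb: "u \<in> L2_forms \<phi> q \<Longrightarrow> v \<in> L2_forms \<phi> q \<Longrightarrow> fcomb a u b v \<in> L2_forms \<phi> q"
  by (auto simp: L2_forms_def fcomb_def intro!: L2_add L2_cmult)
lemma L2_forms_diff: "u \<in> L2_forms \<phi> q \<Longrightarrow> v \<in> L2_forms \<phi> q \<Longrightarrow> fdiff u v \<in> L2_forms \<phi> q"
  by (auto simp: L2_forms_def intro!: L2_diff)
lemma L2_forms_0: "(\<lambda>J z. 0) \<in> L2_forms \<phi> q" by (simp add: L2_forms_def)

lemma inner_forms_commute: "inner_forms \<phi> q v u = cnj (inner_forms \<phi> q u v)"
  by (simp add: inner_forms_def inner_commute[of "v _"])

lemma inner_forms_comb_left:
  assumes "u \<in> L2_forms \<phi> q" "v \<in> L2_forms \<phi> q" "w \<in> L2_forms \<phi> q"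
  shows "inner_forms \<phi> q (fcomb a u b v) w = a * inner_forms \<phi> q u w + b * inner_forms \<phi> q v w"
  unfolding inner_forms_def fcomb_def sum_distrib_left sum.distrib[symmetric] using assms
  by (intro sum.cong) (auto simp: inner_add_left L2_cmult inner_cmult_left L2_formsD)

lemma inner_forms_comb_right:
  assumes "u \<in> L2_forms \<phi> q" "v \<in> L2_forms \<phi> q" "w \<in> L2_forms \<phi> q"
  shows "inner_forms \<phi> q w (fcomb a u b v) = cnj a * inner_forms \<phi> q w u + cnj b * inner_forms \<phi> q w v"
  using arg_cong[OF inner_forms_comb_left[OF assms, of a b], of cnj] by (simp add: inner_forms_commute[of q _ w])

lemma inner_forms_diff_left:
  assumes "u \<in> L2_forms \<phi> q" "v \<in> L2_forms \<phi> q" "w \<in> L2_forms \<phi> q"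
  shows "inner_forms \<phi> q (fdiff u v) w = inner_forms \<phi> q u w - inner_forms \<phi> q v w"
  using inner_forms_comb_left[OF assms, of 1 "-1"] by (simp add: fcomb_diff)
lemma inner_forms_diff_right:
  assumes "u \<in> L2_forms \<phi> q" "v \<in> L2_forms \<phi> q" "w \<in> L2_forms \<phi> q"
  shows "inner_forms \<phi> q w (fdiff u v) = inner_forms \<phi> q w u - inner_forms \<phi> q w v"
  using inner_forms_comb_right[OF assms, of 1 "-1"] by (simp add: fcomb_diff)
lemma inner_forms_0: "inner_forms \<phi> q (\<lambda>J z. 0) w = 0" "inner_forms \<phi> q w (\<lambda>J z. 0) = 0"
  by (simp_all add: inner_forms_def inner_L2_def)

lemma fcomb_semi_inner: "semi_inner (L2_forms \<phi> q) (\<lambda>a u b v. fcomb (of_real a) u (of_real b) v) (\<lambda>u v. Re (inner_forms \<phi> q u v))"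
proof
  show "Re (inner_forms \<phi> q u v) = Re (inner_forms \<phi> q v u)" for u v by (subst inner_forms_commute) simp
qed (auto simp: L2_forms_comb inner_forms_comb_left inner_forms_self NN_nonneg)

lemma Re_inner_forms_le: "u \<in> L2_forms \<phi> q \<Longrightarrow> v \<in> L2_forms \<phi> q \<Longrightarrow> (Re (inner_forms \<phi> q u v))\<^sup>2 \<le> NN q u * NN q v"
  using semi_inner.cauchy_schwarz[OF fcomb_semi_inner, of u q v] by (simp add: inner_forms_self)

text \<open>The inequality for the real part suffices after the first argument has been multiplied by a phase.\<close>
lemma cmod_inner_forms_le:
  assumes u: "u \<in> L2_forms \<phi> q" and v: "v \<in> L2_forms \<phi> q"
  shows "(cmod (inner_forms \<phi> q u v))\<^sup>2 \<le> NN q u * NN q v"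
proof -
  define s where "s = inner_forms \<phi> q u v"
  \<comment> \<open>the phase that makes \<open>c s\<close> equal to the modulus of \<open>s\<close>\<close>
  define c where "c = cnj (sgn s)"
  have cs: "c * s = of_real (cmod s)" unfolding c_def sgn_eq
    by (cases "s = 0") (auto simp: complex_norm_square[symmetric] power2_eq_square mult.commute divide_simps simp flip: complex_norm_square)
  have c1: "cmod c \<le> 1" by (simp add: c_def norm_sgn)
  have uc: "fcomb c u 0 u \<in> L2_forms \<phi> q" by (rule L2_forms_comb[OF u u])
  have "Re (inner_forms \<phi> q (fcomb c u 0 u) v) = cmod s"
    using inner_forms_comb_left[OF u u v, of c 0] cs by (simp add: s_def)
  moreover have "NN q (fcomb c u 0 u) = (cmod c)\<^sup>2 * NN q u" by (simp add: NN_def fcomb_def n2_cmult sum_distrib_left)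
  ultimately have "(cmod s)\<^sup>2 \<le> (cmod c)\<^sup>2 * NN q u * NN q v" using Re_inner_forms_le[OF uc v] by simp
  also have "\<dots> \<le> 1 * NN q u * NN q v"
    using c1 by (intro mult_right_mono NN_nonneg) (simp add: power_le_one)
  finally show ?thesis by (simp add: s_def)
qed

lemma NN_add_le:
  assumes "u \<in> L2_forms \<phi> q" "v \<in> L2_forms \<phi> q" shows "NN q (\<lambda>J z. u J z + v J z) \<le> 2 * NN q u + 2 * NN q v"
  unfolding NN_def sum_distrib_left sum.distrib[symmetric] using assms by (intro sum_mono n2_add_le) (auto simp: L2_formsD)

lemma NN_diff_commute: "NN q (fdiff u v) = NN q (fdiff v u)"
  by (simp add: NN_def n2_def norm_minus_commute)

definition fconv :: "nat \<Rightarrow> (nat \<Rightarrow> 'n form) \<Rightarrow> 'n form \<Rightarrow> bool" where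
  "fconv q x l \<longleftrightarrow> (\<forall>n. x n \<in> L2_forms \<phi> q) \<and> l \<in> L2_forms \<phi> q \<and> (\<lambda>n. NN q (fdiff (x n) l)) \<longlonglongrightarrow> 0"

lemma inner_forms_tendsto:
  assumes c: "fconv q x l" and v: "v \<in> L2_forms \<phi> q"
  shows "(\<lambda>n. inner_forms \<phi> q (x n) v) \<longlonglongrightarrow> inner_forms \<phi> q l v"
proof -
  have x: "x n \<in> L2_forms \<phi> q" "l \<in> L2_forms \<phi> q" for n using c by (auto simp: fconv_def)
  have "(\<lambda>n. (cmod (inner_forms \<phi> q (x n) v - inner_forms \<phi> q l v))\<^sup>2) \<longlonglongrightarrow> 0"
  proof (rule tendsto_sandwich[of "\<lambda>_. 0"])
    show "\<forall>\<^sub>F n in sequentially. (cmod (inner_forms \<phi> q (x n) v - inner_forms \<phi> q l v))\<^sup>2 \<le> NN q (fdiff (x n) l) * NN q v"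
      using cmod_inner_forms_le[OF L2_forms_diff[OF x] v] inner_forms_diff_left[OF x v] by simp
    show "(\<lambda>n. NN q (fdiff (x n) l) * NN q v) \<longlonglongrightarrow> 0" using c by (auto simp: fconv_def intro!: tendsto_mult_left_zero)
  qed auto
  then have "(\<lambda>n. sqrt ((cmod (inner_forms \<phi> q (x n) v - inner_forms \<phi> q l v))\<^sup>2)) \<longlonglongrightarrow> sqrt 0" by (rule tendsto_real_sqrt)
  then have "(\<lambda>n. cmod (inner_forms \<phi> q (x n) v - inner_forms \<phi> q l v)) \<longlonglongrightarrow> 0" by simp
  then show ?thesis by (simp add: tendsto_norm_zero_iff LIM_zero_iff)
qed

lemma forms_complete:
  assumes x: "\<And>n. x n \<in> L2_forms \<phi> q" and C: "\<And>e. e > 0 \<Longrightarrow> \<exists>M. \<forall>m\<ge>M. \<forall>n\<ge>M. NN q (fdiff (x m) (x n)) < e"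
  shows "\<exists>l. fconv q x l"
proof -
  have "\<exists>l\<in>L2 \<phi>. (\<lambda>k. n2 (\<lambda>z. x k J z - l z)) \<longlonglongrightarrow> 0" if J: "J \<in> multi_indices q" for J
  proof (rule L2_complete)
    show "x k J \<in> L2 \<phi>" for k by (rule L2_formsD[OF x J])
    fix e :: real assume "e > 0"
    then obtain M where M: "\<And>m n. m \<ge> M \<Longrightarrow> n \<ge> M \<Longrightarrow> NN q (fdiff (x m) (x n)) < e" using C by blast
    have "n2 (\<lambda>z. x m J z - x n J z) \<le> NN q (fdiff (x m) (x n))" for m n
      unfolding NN_def using J by (intro member_le_sum[of J _ "\<lambda>J. n2 (\<lambda>z. x m J z - x n J z)"]) (auto simp: n2_nonneg)
    then show "\<exists>M. \<forall>k\<ge>M. \<forall>l\<ge>M. n2 (\<lambda>z. x k J z - x l J z) < e"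
      using M by (intro exI[of _ M] allI impI) (rule le_less_trans)
  qed
  then have "\<forall>J\<in>multi_indices q. \<exists>l. l \<in> L2 \<phi> \<and> (\<lambda>k. n2 (\<lambda>z. x k J z - l z)) \<longlonglongrightarrow> 0" by blast
  from bchoice[OF this] obtain l where l0: "\<forall>J\<in>multi_indices q. l J \<in> L2 \<phi> \<and> (\<lambda>k. n2 (\<lambda>z. x k J z - l J z)) \<longlonglongrightarrow> 0" ..
  then have l: "\<And>J. J \<in> multi_indices q \<Longrightarrow> l J \<in> L2 \<phi>" "\<And>J. J \<in> multi_indices q \<Longrightarrow> (\<lambda>k. n2 (\<lambda>z. x k J z - l J z)) \<longlonglongrightarrow> 0"
    by blast+
  have "(\<lambda>n. NN q (fdiff (x n) l)) \<longlonglongrightarrow> (\<Sum>J\<in>(multi_indices q :: 'n set set). 0)" unfolding NN_def by (intro tendsto_sum l(2))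
  then have "fconv q x l" using x l by (simp add: fconv_def L2_forms_def)
  then show ?thesis by blast
qed

lemma fconvI_eq: "fconv q x l \<Longrightarrow> (\<lambda>n. NN q (fdiff (x n) l)) \<longlonglongrightarrow> 0" by (simp add: fconv_def)

lemma NN_0_AE:
  assumes u: "u \<in> L2_forms \<phi> q" and 0: "NN q u \<le> 0" and J: "J \<in> multi_indices q" shows "AE z in lborel. u J z = 0"
proof -
  have "n2 (u J) \<le> NN q u" unfolding NN_def using J by (intro member_le_sum) (auto simp: n2_nonneg)
  then have "n2 (u J) = 0" using 0 n2_nonneg[of "u J"] by linarith
  moreover have "integrable lborel (\<lambda>z. (cmod (u J z))\<^sup>2 * exp (- \<phi> z))" using u J by (auto simp: L2_forms_def L2_def)
  ultimately have "AE z in lborel. (cmod (u J z))\<^sup>2 * exp (- \<phi> z) = 0"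
    unfolding n2_def by (subst (asm) integral_nonneg_eq_0_iff_AE) auto
  then show ?thesis by eventually_elim simp
qed

end

context psh_weight
begin

lemma has_dbar_L2: "has_dbar \<phi> q u v \<Longrightarrow> u \<in> L2_forms \<phi> q" "has_dbar \<phi> q u v \<Longrightarrow> v \<in> L2_forms \<phi> (Suc q)"
  by (auto simp: has_dbar_def)
lemma has_adj_L2: "has_dbar_adjoint \<phi> q u v \<Longrightarrow> u \<in> L2_forms \<phi> (Suc q)" "has_dbar_adjoint \<phi> q u v \<Longrightarrow> v \<in> L2_forms \<phi> q"
  by (auto simp: has_dbar_adjoint_def)

lemma has_adj_comb: "has_dbar_adjoint \<phi> q u v \<Longrightarrow> has_dbar_adjoint \<phi> q u' v' \<Longrightarrow> has_dbar_adjoint \<phi> q (fcomb a u b u') (fcomb a v b v')"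
  unfolding has_dbar_adjoint_def using has_dbar_L2 by (auto simp: L2_forms_comb inner_forms_comb_right)

text \<open>The form whose weighted inner product with \<open>b\<close> is the integral of \<open>b K \<eta>\<close>. With it, and with
\<open>dual_test_adjoint\<close> for the right-hand side, the distributional equation for \<open>\<partial>\<close>-bar becomes an identity
between inner products, and closedness of the operator becomes continuity of the inner product.\<close>
definition dual_test_form :: "'n set \<Rightarrow> ((complex,'n) vec \<Rightarrow> complex) \<Rightarrow> 'n form" where
  "dual_test_form K \<eta> J z = (if J = K then cnj (\<eta> z) * complex_of_real (exp (\<phi> z)) else 0)"

definition dual_test_adjoint :: "'n set \<Rightarrow> ((complex,'n) vec \<Rightarrow> complex) \<Rightarrow> 'n form" where
  "dual_test_adjoint K \<eta> L z = (\<Sum>j\<in>K. if L = K - {j} then - (wedge_sign j L * (cnj (d_zbar j \<eta> z) * complex_of_real (exp (\<phi> z)))) else 0)"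

lemma L2_test_exp: "test_function \<eta> \<Longrightarrow> (\<lambda>z. cnj (\<eta> z) * complex_of_real (exp (\<phi> z))) \<in> L2 \<phi>"
  by (intro L2_compact_support continuous_intros phi_cont C_k_continuous[OF test_function_C_k[where k=0]])
     (auto elim: bounded_subset dest: test_function_bounded)

lemma inner_test_exp: "inner_L2 \<phi> f (\<lambda>z. cnj (\<eta> z) * complex_of_real (exp (\<phi> z))) = (LINT z|lborel. f z * \<eta> z)"
proof -
  have "complex_of_real (exp (\<phi> z)) * complex_of_real (exp (- \<phi> z)) = 1" for z by (simp flip: of_real_mult exp_add)
  then have "f z * cnj (cnj (\<eta> z) * complex_of_real (exp (\<phi> z))) * complex_of_real (exp (- \<phi> z)) = f z * \<eta> z" for z
    by (simp add: mult.assoc)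
  then show ?thesis unfolding inner_L2_def by (simp only:)
qed

lemma dual_test_form_L2: assumes "test_function \<eta>" shows "dual_test_form K \<eta> \<in> L2_forms \<phi> q"
proof -
  have "dual_test_form K \<eta> J \<in> L2 \<phi>" for J using L2_test_exp[OF assms] by (cases "J = K") (simp_all add: dual_test_form_def[abs_def])
  then show ?thesis by (simp add: L2_forms_def)
qed

lemma dual_test_adjoint_L2: assumes "test_function \<eta>" shows "dual_test_adjoint K \<eta> \<in> L2_forms \<phi> q"
proof -
  have "(\<lambda>z. if L = K - {j} then - (wedge_sign j L * (cnj (d_zbar j \<eta> z) * complex_of_real (exp (\<phi> z)))) else 0) \<in> L2 \<phi>" for L j
    using L2_cmult[OF L2_test_exp[OF test_function_d_zbar[OF assms, of j]], of "- wedge_sign j L"] by (cases "L = K - {j}") auto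
  then show ?thesis unfolding L2_forms_def dual_test_adjoint_def[abs_def] by (auto intro!: L2_sum)
qed

lemma inner_dual_test_form: "K \<in> multi_indices q \<Longrightarrow> inner_forms \<phi> q b (dual_test_form K \<eta>) = (LINT z|lborel. b K z * \<eta> z)"
proof -
  assume K: "K \<in> multi_indices q"
  have "inner_forms \<phi> q b (dual_test_form K \<eta>) = (\<Sum>J\<in>multi_indices q. if J = K then (LINT z|lborel. b K z * \<eta> z) else 0)"
    unfolding inner_forms_def
  proof (intro sum.cong refl)
    fix J
    show "inner_L2 \<phi> (b J) (dual_test_form K \<eta> J) = (if J = K then (LINT z|lborel. b K z * \<eta> z) else 0)"
      by (cases "J = K") (simp_all add: dual_test_form_def[abs_def] inner_test_exp, simp add: inner_L2_def)
  qed
  then show ?thesis using K by simp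
qed

lemma inner_dual_test_adjoint:
  assumes K: "K \<in> multi_indices (Suc q)" and a: "a \<in> L2_forms \<phi> q" and t: "test_function \<eta>"
  shows "inner_forms \<phi> q a (dual_test_adjoint K \<eta>) = (\<Sum>j\<in>K. wedge_sign j (K - {j}) * - (LINT z|lborel. a (K - {j}) z * d_zbar j \<eta> z))"
proof -
  define X where "X j L z = (if L = K - {j} then - (wedge_sign j L * (cnj (d_zbar j \<eta> z) * complex_of_real (exp (\<phi> z)))) else 0)" for j L z
  have XL: "X j L \<in> L2 \<phi>" for j L
    using L2_cmult[OF L2_test_exp[OF test_function_d_zbar[OF t, of j]], of "- wedge_sign j L"] by (cases "L = K - {j}") (auto simp: X_def[abs_def])
  have 1: "inner_L2 \<phi> (a L) (X j L) = (if L = K - {j} then wedge_sign j (K - {j}) * - (LINT z|lborel. a (K - {j}) z * d_zbar j \<eta> z) else 0)" for j L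
  proof (cases "L = K - {j}")
    case True
    have eX: "X j L = (\<lambda>z. - wedge_sign j L * (cnj (d_zbar j \<eta> z) * complex_of_real (exp (\<phi> z))))" using True by (auto simp: X_def)
    have "inner_L2 \<phi> (a L) (X j L) = - wedge_sign j L * inner_L2 \<phi> (a L) (\<lambda>z. cnj (d_zbar j \<eta> z) * complex_of_real (exp (\<phi> z)))"
      unfolding eX inner_commute[of "a L"] inner_cmult_left by simp
    then show ?thesis using True by (simp add: inner_test_exp)
  next
    case False then show ?thesis by (simp add: X_def[abs_def] inner_L2_def)
  qed
  have "inner_L2 \<phi> (a L) (dual_test_adjoint K \<eta> L) = (\<Sum>j\<in>K. inner_L2 \<phi> (a L) (X j L))" if L: "L \<in> multi_indices q" for L
  proof -
    have e: "dual_test_adjoint K \<eta> L = (\<lambda>z. \<Sum>j\<in>K. X j L z)" by (auto simp: dual_test_adjoint_def X_def)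
    show ?thesis unfolding e inner_commute[of "a L"] inner_sum_left[OF finite XL L2_formsD[OF a L]] by simp
  qed
  then have "inner_forms \<phi> q a (dual_test_adjoint K \<eta>) = (\<Sum>L\<in>multi_indices q. \<Sum>j\<in>K. if L = K - {j} then wedge_sign j (K - {j}) * - (LINT z|lborel. a (K - {j}) z * d_zbar j \<eta> z) else 0)"
    unfolding inner_forms_def 1 by (intro sum.cong refl)
  also have "\<dots> = (\<Sum>j\<in>K. \<Sum>L\<in>multi_indices q. if L = K - {j} then wedge_sign j (K - {j}) * - (LINT z|lborel. a (K - {j}) z * d_zbar j \<eta> z) else 0)"
    by (rule sum.swap)
  also have "\<dots> = (\<Sum>j\<in>K. wedge_sign j (K - {j}) * - (LINT z|lborel. a (K - {j}) z * d_zbar j \<eta> z))"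
    using multi_indices_remove[OF _ K] by (intro sum.cong refl) simp
  finally show ?thesis .
qed

lemma has_dbar_iff: "has_dbar \<phi> q u v \<longleftrightarrow> u \<in> L2_forms \<phi> q \<and> v \<in> L2_forms \<phi> (Suc q) \<and>
   (\<forall>K\<in>multi_indices (Suc q). \<forall>\<eta>. test_function \<eta> \<longrightarrow> inner_forms \<phi> (Suc q) v (dual_test_form K \<eta>) = inner_forms \<phi> q u (dual_test_adjoint K \<eta>))"
  unfolding has_dbar_def by (auto simp: inner_dual_test_form inner_dual_test_adjoint)

lemma has_adj_dual_test_form: "K \<in> multi_indices (Suc q) \<Longrightarrow> test_function \<eta> \<Longrightarrow> has_dbar_adjoint \<phi> q (dual_test_form K \<eta>) (dual_test_adjoint K \<eta>)"
  unfolding has_dbar_adjoint_def has_dbar_iff by (auto simp: dual_test_form_L2 dual_test_adjoint_L2)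

lemma has_dbar_comb: "has_dbar \<phi> q u v \<Longrightarrow> has_dbar \<phi> q u' v' \<Longrightarrow> has_dbar \<phi> q (fcomb a u b u') (fcomb a v b v')"
  unfolding has_dbar_iff by (auto simp: L2_forms_comb inner_forms_comb_left dual_test_form_L2 dual_test_adjoint_L2)

lemma has_dbar_closed:
  assumes "\<And>n. has_dbar \<phi> q (x n) (y n)" "fconv q x u" "fconv (Suc q) y v" shows "has_dbar \<phi> q u v"
  unfolding has_dbar_iff
proof (intro conjI ballI allI impI)
  show "u \<in> L2_forms \<phi> q" "v \<in> L2_forms \<phi> (Suc q)" using assms by (auto simp: fconv_def)
  fix K :: "'n set" and \<eta> :: "(complex,'n) vec \<Rightarrow> complex" assume "K \<in> multi_indices (Suc q)" "test_function \<eta>"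
  then have "inner_forms \<phi> (Suc q) (y n) (dual_test_form K \<eta>) = inner_forms \<phi> q (x n) (dual_test_adjoint K \<eta>)" for n
    using assms(1)[of n] by (simp add: has_dbar_iff)
  moreover have "(\<lambda>n. inner_forms \<phi> (Suc q) (y n) (dual_test_form K \<eta>)) \<longlonglongrightarrow> inner_forms \<phi> (Suc q) v (dual_test_form K \<eta>)"
    by (intro inner_forms_tendsto assms dual_test_form_L2 \<open>test_function \<eta>\<close>)
  moreover have "(\<lambda>n. inner_forms \<phi> q (x n) (dual_test_adjoint K \<eta>)) \<longlonglongrightarrow> inner_forms \<phi> q u (dual_test_adjoint K \<eta>)"
    by (intro inner_forms_tendsto assms dual_test_adjoint_L2 \<open>test_function \<eta>\<close>)
  ultimately show "inner_forms \<phi> (Suc q) v (dual_test_form K \<eta>) = inner_forms \<phi> q u (dual_test_adjoint K \<eta>)"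
    using LIMSEQ_unique by simp
qed

lemma has_adj_closed:
  assumes "\<And>n. has_dbar_adjoint \<phi> q (x n) (y n)" "fconv (Suc q) x u" "fconv q y v" shows "has_dbar_adjoint \<phi> q u v"
  unfolding has_dbar_adjoint_def
proof (intro conjI allI impI)
  show "v \<in> L2_forms \<phi> q" "u \<in> L2_forms \<phi> (q + 1)" using assms by (auto simp: fconv_def)
  fix a b assume ab: "has_dbar \<phi> q a b"
  have "inner_forms \<phi> (Suc q) (x n) b = inner_forms \<phi> q (y n) a" for n
    using assms(1)[of n] ab by (subst (1 2) inner_forms_commute) (simp add: has_dbar_adjoint_def)
  moreover have "(\<lambda>n. inner_forms \<phi> (Suc q) (x n) b) \<longlonglongrightarrow> inner_forms \<phi> (Suc q) u b"
    by (intro inner_forms_tendsto assms has_dbar_L2(2)[OF ab])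
  moreover have "(\<lambda>n. inner_forms \<phi> q (y n) a) \<longlonglongrightarrow> inner_forms \<phi> q v a"
    by (intro inner_forms_tendsto assms has_dbar_L2(1)[OF ab])
  ultimately have "inner_forms \<phi> (Suc q) u b = inner_forms \<phi> q v a" using LIMSEQ_unique by simp
  then show "inner_forms \<phi> (q + 1) b u = inner_forms \<phi> q a v" by (subst (1 2) inner_forms_commute) simp
qed

text \<open>In \<open>\<partial>\<close>-bar of \<open>\<partial>\<close>-bar the second derivatives of the test function are symmetric in \<open>j\<close> and \<open>k\<close>, while the signs are
antisymmetric.\<close>
lemma dbar_dbar:
  assumes ab: "has_dbar \<phi> q a b" shows "has_dbar \<phi> (Suc q) b (\<lambda>J z. 0)"
  unfolding has_dbar_def
proof (intro conjI ballI allI impI)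
  show "b \<in> L2_forms \<phi> (Suc q)" using has_dbar_L2[OF ab] by simp
  show "(\<lambda>J z. 0) \<in> L2_forms \<phi> (Suc q + 1)" by (rule L2_forms_0)
  fix K :: "'n set" and \<eta> :: "(complex,'n) vec \<Rightarrow> complex" assume K: "K \<in> multi_indices (Suc q + 1)" and t: "test_function \<eta>"
  define c where "c j k = (if j = k then 0 else wedge_sign j (K - {j}) * wedge_sign k (K - {j} - {k}) * (LINT z|lborel. a (K - {j} - {k}) z * d_zbar k (d_zbar j \<eta>) z))" for j k
  have "(\<Sum>j\<in>K. wedge_sign j (K - {j}) * - (LINT z|lborel. b (K - {j}) z * d_zbar j \<eta> z)) = (\<Sum>j\<in>K. \<Sum>k\<in>K. c j k)"
  proof (rule sum.cong[OF refl])
    fix j assume j: "j \<in> K"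
    then have "K - {j} \<in> multi_indices (q + 1)" using multi_indices_remove[OF j, of "Suc q"] K by simp
    then have "(LINT z|lborel. b (K - {j}) z * d_zbar j \<eta> z) = (\<Sum>k\<in>K - {j}. wedge_sign k (K - {j} - {k}) * - (LINT z|lborel. a (K - {j} - {k}) z * d_zbar k (d_zbar j \<eta>) z))"
      using ab test_function_d_zbar[OF t] unfolding has_dbar_def by blast
    then have "wedge_sign j (K - {j}) * - (LINT z|lborel. b (K - {j}) z * d_zbar j \<eta> z) = (\<Sum>k\<in>K - {j}. c j k)"
      by (auto simp: sum_distrib_left sum_negf[symmetric] c_def mult.assoc intro!: sum.cong split: if_splits)
    also have "\<dots> = (\<Sum>k\<in>K. c j k)" by (rule sum.mono_neutral_left) (auto simp: c_def)
    finally show "wedge_sign j (K - {j}) * - (LINT z|lborel. b (K - {j}) z * d_zbar j \<eta> z) = (\<Sum>k\<in>K. c j k)" .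
  qed
  moreover have "(\<Sum>j\<in>K. \<Sum>k\<in>K. c j k) = - (\<Sum>j\<in>K. \<Sum>k\<in>K. c j k)"
  proof -
    have anti: "c k j = - c j k" if "j \<in> K" "k \<in> K" for j k
    proof (cases "j = k")
      case False
      define L where "L = K - {j} - {k}"
      have e: "K - {j} = insert k L" "K - {k} = insert j L" "K - {k} - {j} = L" "j \<notin> L" "k \<notin> L" using that False by (auto simp: L_def)
      have "d_zbar k (d_zbar j \<eta>) z = d_zbar j (d_zbar k \<eta>) z" for z by (rule d_zbar_commute[OF test_function_C_k[OF t]])
      then show ?thesis using False e(4,5) unfolding c_def e(3) L_def[symmetric] unfolding e(1,2)
        by (auto simp: wedge_sign_insert)
    qed (simp add: c_def)
    have "(\<Sum>j\<in>K. \<Sum>k\<in>K. c j k) = (\<Sum>k\<in>K. \<Sum>j\<in>K. c j k)" by (rule sum.swap)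
    also have "\<dots> = (\<Sum>k\<in>K. \<Sum>j\<in>K. - c k j)" by (intro sum.cong refl anti)
    finally show ?thesis by (simp add: sum_negf)
  qed
  ultimately show "(LINT z|lborel. 0 * \<eta> z) = (\<Sum>j\<in>K. wedge_sign j (K - {j}) * - (LINT z|lborel. b (K - {j}) z * d_zbar j \<eta> z))"
    by simp
qed

text \<open>The kernel of \<open>\<partial>\<close>-bar is complete because the operator is closed, so that Riesz representation on it gives the
orthogonal projection. The passage from real parts to complex inner products replaces \<open>y\<close> by \<open>\<i> y\<close>.\<close>
lemma kernel_projection:
  assumes f: "f \<in> L2_forms \<phi> q"
  obtains f1 where "has_dbar \<phi> q f1 (\<lambda>J z. 0)" "\<And>y. has_dbar \<phi> q y (\<lambda>J z. 0) \<Longrightarrow> inner_forms \<phi> q y f1 = inner_forms \<phi> q y f"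
proof -
  define V where "V = {y. has_dbar \<phi> q y (\<lambda>J z. 0)}"
  have VL: "y \<in> L2_forms \<phi> q" if "y \<in> V" for y using that has_dbar_L2 by (auto simp: V_def)
  have Vc: "fcomb a u b v \<in> V" if "u \<in> V" "v \<in> V" for a b u v
    using has_dbar_comb[of q u "\<lambda>J z. 0" v "\<lambda>J z. 0" a b] that by (simp add: V_def fcomb_def)
  interpret semi_inner V "\<lambda>a u b v. fcomb (of_real a) u (of_real b) v" "\<lambda>u v. Re (inner_forms \<phi> q u v)"
  proof
    show "Re (inner_forms \<phi> q u v) = Re (inner_forms \<phi> q v u)" for u v by (subst inner_forms_commute) simp
  qed (auto simp: Vc VL inner_forms_comb_left inner_forms_self NN_nonneg)
  have "\<exists>u\<in>V. \<forall>v\<in>V. Re (inner_forms \<phi> q u v) = Re (inner_forms \<phi> q f v)"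
  proof (rule riesz[where C="NN q f"])
    have "has_dbar \<phi> q (\<lambda>J z. 0) (\<lambda>J z. 0)" by (simp add: has_dbar_def L2_forms_0)
    then show "V \<noteq> {}" by (auto simp: V_def)
    show "(Re (inner_forms \<phi> q f u))\<^sup>2 \<le> NN q f * Re (inner_forms \<phi> q u u)" if "u \<in> V" for u
      using Re_inner_forms_le[OF f VL[OF that]] by (simp add: inner_forms_self)
    show "Re (inner_forms \<phi> q f (fcomb (of_real a) u (of_real b) v)) = a * Re (inner_forms \<phi> q f u) + b * Re (inner_forms \<phi> q f v)" if "u \<in> V" "v \<in> V" for a u b v
      using that by (simp add: inner_forms_comb_right VL f)
    fix x :: "nat \<Rightarrow> 'n form" assume x: "\<And>n. x n \<in> V" and C: "\<And>e. e > 0 \<Longrightarrow> \<exists>M. \<forall>m\<ge>M. \<forall>n\<ge>M. Re (inner_forms \<phi> q (fcomb (of_real 1) (x m) (of_real (-1)) (x n)) (fcomb (of_real 1) (x m) (of_real (-1)) (x n))) < e"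
    obtain l where l: "fconv q x l" using forms_complete[of x q, OF VL[OF x]] C by (auto simp: fcomb_diff inner_forms_self)
    have z: "fconv (Suc q) (\<lambda>n J z. 0) (\<lambda>J z. 0)" by (simp add: fconv_def L2_forms_0 NN_def n2_def)
    have xd: "has_dbar \<phi> q (x n) (\<lambda>J z. 0)" for n using x by (simp add: V_def)
    have "l \<in> V" unfolding V_def using has_dbar_closed[OF xd l z] by simp
    then show "\<exists>l\<in>V. (\<lambda>n. Re (inner_forms \<phi> q (fcomb (of_real 1) (x n) (of_real (-1)) l) (fcomb (of_real 1) (x n) (of_real (-1)) l))) \<longlonglongrightarrow> 0"
      using fconvI_eq[OF l] by (auto simp: fcomb_diff inner_forms_self)
  qed (simp add: NN_nonneg)
  then obtain u where u: "u \<in> V" "\<And>v. v \<in> V \<Longrightarrow> Re (inner_forms \<phi> q u v) = Re (inner_forms \<phi> q f v)" by blast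
  have "inner_forms \<phi> q y u = inner_forms \<phi> q y f" if y: "y \<in> V" for y
  proof -
    \<comment> \<open>the combination with a zero coefficient is \<open>\<i> y\<close>\<close>
    have "Re (inner_forms \<phi> q u (fcomb \<i> y 0 y)) = Re (inner_forms \<phi> q f (fcomb \<i> y 0 y))" by (rule u(2)[OF Vc[OF y y]])
    then have "Im (inner_forms \<phi> q u y) = Im (inner_forms \<phi> q f y)"
      by (simp add: inner_forms_comb_right VL[OF y] VL[OF u(1)] f)
    then have "inner_forms \<phi> q u y = inner_forms \<phi> q f y" using u(2)[OF y] by (simp add: complex_eq_iff)
    then show ?thesis by (subst (1 2) inner_forms_commute) simp
  qed
  then show ?thesis using that[of u] u(1) by (simp add: V_def)
qed

text \<open>The range of \<open>\<partial>\<close>-bar lies in the kernel of the next \<open>\<partial>\<close>-bar, so that the orthogonal complement of that kernel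
is annihilated by the adjoint.\<close>
lemma kernel_complement:
  assumes x: "x \<in> L2_forms \<phi> (Suc q)" and x1: "has_dbar \<phi> (Suc q) x1 (\<lambda>J z. 0)"
    and o: "\<And>y. has_dbar \<phi> (Suc q) y (\<lambda>J z. 0) \<Longrightarrow> inner_forms \<phi> (Suc q) y x1 = inner_forms \<phi> (Suc q) y x"
  shows "has_dbar_adjoint \<phi> q (fdiff x x1) (\<lambda>J z. 0)"
  unfolding has_dbar_adjoint_def
proof (intro conjI allI impI)
  have L: "x1 \<in> L2_forms \<phi> (Suc q)" using has_dbar_L2[OF x1] by simp
  show "fdiff x x1 \<in> L2_forms \<phi> (q + 1)" using L2_forms_diff[OF x L] by simp
  fix a b assume ab: "has_dbar \<phi> q a b"
  show "inner_forms \<phi> (q + 1) b (fdiff x x1) = inner_forms \<phi> q a (\<lambda>J z. 0)"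
    using o[OF dbar_dbar[OF ab]] inner_forms_diff_right[OF x L has_dbar_L2(2)[OF ab]] by (simp add: inner_forms_0)
qed (rule L2_forms_0)

end

section \<open>Passing from test forms to the maximal domains\<close>

context growing_weight
begin

text \<open>Density in the form needed below: approximation of \<open>u\<close> with control of norm and Dirichlet form.\<close>
lemma NN_test_dense:
  assumes hd: "has_dbar \<phi> (Suc p) u v" and ad: "has_dbar_adjoint \<phi> p u w" and E: "E > 0"
  obtains g where "test_form g" "\<forall>J\<in>multi_indices (Suc p). n2 (\<lambda>z. g J z - u J z) \<le> E"
    "NN (Suc p) g \<le> 2 * NN (Suc p) u + 2 * real (card (UNIV :: 'n set set)) * E"
    "NN (Suc p) u \<le> 2 * NN (Suc p) g + 2 * real (card (UNIV :: 'n set set)) * E"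
    "Q p g \<le> 2 * (NN (Suc (Suc p)) v + NN p w) + 4 * real (card (UNIV :: 'n set set)) * E"
proof -
  define c where "c = real (card (UNIV :: 'n set set))"
  obtain g where g: "test_form g" and 1: "\<And>J. J \<in> multi_indices (Suc p) \<Longrightarrow> n2 (\<lambda>z. g J z - u J z) \<le> E"
    and 2: "\<And>K. K \<in> multi_indices (Suc (Suc p)) \<Longrightarrow> n2 (\<lambda>z. dbar_form g K z - v K z) \<le> E"
    and 3: "\<And>L. L \<in> multi_indices p \<Longrightarrow> n2 (\<lambda>z. dstar_form g L z - w L z) \<le> E"
    using test_forms_dense[OF hd ad E] by blast
  have s: "(\<Sum>J\<in>multi_indices q. n2 (a J)) \<le> 2 * (\<Sum>J\<in>multi_indices q. n2 (b J)) + 2 * c * E"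
    if ab: "\<And>J. J \<in> multi_indices q \<Longrightarrow> n2 (\<lambda>z. a J z - b J z) \<le> E" and L: "\<And>J. J \<in> multi_indices q \<Longrightarrow> a J \<in> L2 \<phi>" "\<And>J. J \<in> multi_indices q \<Longrightarrow> b J \<in> L2 \<phi>"
    for a b :: "'n form" and q
  proof -
    have "n2 (a J) \<le> 2 * n2 (b J) + 2 * E" if J: "J \<in> multi_indices q" for J
      using n2_add_le[OF L2_diff[OF L(1)[OF J] L(2)[OF J]] L(2)[OF J]] ab[OF J] by simp
    then have "(\<Sum>J\<in>multi_indices q. n2 (a J)) \<le> (\<Sum>J\<in>multi_indices q. 2 * n2 (b J) + 2 * E)" by (rule sum_mono)
    also have "\<dots> = 2 * (\<Sum>J\<in>multi_indices q. n2 (b J)) + 2 * real (card (multi_indices q :: 'n set set)) * E"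
      by (simp add: sum.distrib sum_distrib_left)
    also have "\<dots> \<le> 2 * (\<Sum>J\<in>multi_indices q. n2 (b J)) + 2 * c * E"
    proof -
      have "real (card (multi_indices q :: 'n set set)) \<le> c" unfolding c_def of_nat_le_iff by (rule card_mono) auto
      then have "real (card (multi_indices q :: 'n set set)) * E \<le> c * E" using E by (intro mult_right_mono) auto
      then show ?thesis by simp
    qed
    finally show ?thesis .
  qed
  have gL: "g J \<in> L2 \<phi>" for J by (rule L2_test[OF test_form_J[OF g]])
  have uL: "u J \<in> L2 \<phi>" if "J \<in> multi_indices (Suc p)" for J by (rule L2_formsD[OF has_dbar_L2(1)[OF hd] that])
  have vL: "v J \<in> L2 \<phi>" if "J \<in> multi_indices (Suc (Suc p))" for J by (rule L2_formsD[OF has_dbar_L2(2)[OF hd] that])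
  have wL: "w J \<in> L2 \<phi>" if "J \<in> multi_indices p" for J by (rule L2_formsD[OF has_adj_L2(2)[OF ad] that])
  have dL: "dbar_form g K \<in> L2 \<phi>" for K unfolding dbar_form_def[abs_def]
    by (intro L2_sum L2_cmult L2_test test_function_d_zbar test_form_J[OF g])
  have sL: "dstar_form g L \<in> L2 \<phi>" for L
  proof -
    have "dstar_form g L = (\<lambda>z. (-1) * (\<Sum>j\<in>-L. wedge_sign j L * delta j (g (insert j L)) z))" by (auto simp: dstar_form_def)
    then show ?thesis by (simp only:) (intro L2_sum L2_cmult L2_delta test_form_J[OF g])
  qed
  show ?thesis
  proof (rule that[OF g])
    show "\<forall>J\<in>multi_indices (Suc p). n2 (\<lambda>z. g J z - u J z) \<le> E" using 1 by blast
    show "NN (Suc p) g \<le> 2 * NN (Suc p) u + 2 * real (card (UNIV :: 'n set set)) * E"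
      unfolding NN_def c_def[symmetric] by (rule s[OF 1 gL uL])
    show "NN (Suc p) u \<le> 2 * NN (Suc p) g + 2 * real (card (UNIV :: 'n set set)) * E"
      unfolding NN_def c_def[symmetric]
    proof (rule s[OF _ uL gL])
      show "n2 (\<lambda>z. u J z - g J z) \<le> E" if "J \<in> multi_indices (Suc p)" for J using 1[OF that] by (simp add: n2_def norm_minus_commute)
    qed
    have "(\<Sum>K\<in>multi_indices (Suc (Suc p)). n2 (dbar_form g K)) \<le> 2 * NN (Suc (Suc p)) v + 2 * c * E"
      unfolding NN_def by (rule s[OF 2 dL vL])
    moreover have "(\<Sum>L\<in>multi_indices p. n2 (dstar_form g L)) \<le> 2 * NN p w + 2 * c * E"
      unfolding NN_def by (rule s[OF 3 sL wL])
    ultimately show "Q p g \<le> 2 * (NN (Suc (Suc p)) v + NN p w) + 4 * real (card (UNIV :: 'n set set)) * E"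
      unfolding Q_def c_def[symmetric] by (simp add: algebra_simps)
  qed
qed

lemma coercive:
  obtains C where "C \<ge> 0" "\<And>u v w. has_dbar \<phi> (Suc p) u v \<Longrightarrow> has_dbar_adjoint \<phi> p u w \<Longrightarrow> NN (Suc p) u \<le> C * (NN (Suc (Suc p)) v + NN p w)"
proof -
  obtain C where C: "C \<ge> 0" "\<And>g. test_form g \<Longrightarrow> (\<Sum>J\<in>multi_indices (Suc p). n2 (g J)) \<le> C * Q p g" using coercive_test by blast
  define c where "c = real (card (UNIV :: 'n set set))"
  have "NN (Suc p) u \<le> 4 * C * (NN (Suc (Suc p)) v + NN p w)" if hd: "has_dbar \<phi> (Suc p) u v" and ad: "has_dbar_adjoint \<phi> p u w" for u v w
  proof (rule field_le_epsilon)
    fix e :: real assume e: "e > 0"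
    define K where "K = 8 * C * c + 2 * c + 1"
    have K: "K > 0" using C(1) by (simp add: K_def c_def add_nonneg_pos)
    define E where "E = e / K"
    have E: "E > 0" using e K by (simp add: E_def)
    obtain g where gt: "test_form g" and "\<forall>J\<in>multi_indices (Suc p). n2 (\<lambda>z. g J z - u J z) \<le> E"
      "NN (Suc p) g \<le> 2 * NN (Suc p) u + 2 * c * E"
      and gu: "NN (Suc p) u \<le> 2 * NN (Suc p) g + 2 * c * E"
      and gQ: "Q p g \<le> 2 * (NN (Suc (Suc p)) v + NN p w) + 4 * c * E"
      by (rule NN_test_dense[OF hd ad E, folded c_def])
    note g = gt gu gQ
    have "NN (Suc p) g \<le> C * Q p g" using C(2)[OF g(1)] by (simp add: NN_def)
    also have "\<dots> \<le> C * (2 * (NN (Suc (Suc p)) v + NN p w) + 4 * c * E)" by (rule mult_left_mono[OF g(3) C(1)])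
    finally have "NN (Suc p) u \<le> 4 * C * (NN (Suc (Suc p)) v + NN p w) + (8 * C * c + 2 * c) * E" using g(2) by (simp add: algebra_simps)
    also have "(8 * C * c + 2 * c) * E \<le> K * E" using E by (intro mult_right_mono) (auto simp: K_def)
    also have "K * E = e" using K by (simp add: E_def)
    finally show "NN (Suc p) u \<le> 4 * C * (NN (Suc (Suc p)) v + NN p w) + e" by simp
  qed
  then show ?thesis using that[of "4 * C"] C(1) by simp
qed

text \<open>Replace the sequence by test forms at distances tending to zero, and take a diagonal subsequence of
those provided by \<open>compact_test\<close> for decreasing \<open>E\<close>.\<close>
lemma compact_embedding:
  assumes hd: "\<And>k. has_dbar \<phi> (Suc p) (u k) (v k)" and ad: "\<And>k. has_dbar_adjoint \<phi> p (u k) (w k)"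
    and A: "\<And>k. NN (Suc p) (u k) \<le> A" "\<And>k. NN (Suc (Suc p)) (v k) + NN p (w k) \<le> A"
  shows "\<exists>r l. strict_mono (r :: nat \<Rightarrow> nat) \<and> fconv (Suc p) (\<lambda>k. u (r k)) l"
proof -
  define c where "c = real (card (UNIV :: 'n set set))"
  have c0: "c \<ge> 0" by (simp add: c_def)
  have uL: "u k \<in> L2_forms \<phi> (Suc p)" for k by (rule has_dbar_L2(1)[OF hd])
  have "\<exists>g. test_form g \<and> (\<forall>J\<in>multi_indices (Suc p). n2 (\<lambda>z. g J z - u k J z) \<le> 1 / real (Suc k)) \<and> NN (Suc p) g \<le> 2 * A + 2 * c \<and> Q p g \<le> 2 * A + 4 * c" for k
  proof -
    have E: "1 / real (Suc k) > 0" "1 / real (Suc k) \<le> 1" by auto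
    obtain g where g: "test_form g" "\<forall>J\<in>multi_indices (Suc p). n2 (\<lambda>z. g J z - u k J z) \<le> 1 / real (Suc k)"
      "NN (Suc p) g \<le> 2 * NN (Suc p) (u k) + 2 * c * (1 / real (Suc k))"
      "NN (Suc p) (u k) \<le> 2 * NN (Suc p) g + 2 * c * (1 / real (Suc k))"
      "Q p g \<le> 2 * (NN (Suc (Suc p)) (v k) + NN p (w k)) + 4 * c * (1 / real (Suc k))"
      by (rule NN_test_dense[OF hd[of k] ad[of k] E(1), folded c_def])
    have cE': "2 * c * (1 / real (Suc k)) \<le> 2 * c" "4 * c * (1 / real (Suc k)) \<le> 4 * c"
      using mult_left_mono[OF E(2), of "2 * c"] mult_left_mono[OF E(2), of "4 * c"] c0 by auto
    have "NN (Suc p) g \<le> 2 * A + 2 * c" using g(3) A(1)[of k] cE'(1) by linarith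
    moreover have "2 * (NN (Suc (Suc p)) (v k) + NN p (w k)) \<le> 2 * A" using A(2)[of k] by simp
    then have "Q p g \<le> 2 * A + 4 * c" using order_trans[OF g(5) add_mono[OF _ cE'(2)]] by blast
    ultimately have "NN (Suc p) g \<le> 2 * A + 2 * c" "Q p g \<le> 2 * A + 4 * c" by simp_all
    with g(1,2) show ?thesis by (intro exI[of _ g] conjI)
  qed
  from choice[OF allI[OF this]] obtain g where g0: "\<forall>k. test_form (g k) \<and> (\<forall>J\<in>multi_indices (Suc p). n2 (\<lambda>z. g k J z - u k J z) \<le> 1 / real (Suc k)) \<and> NN (Suc p) (g k) \<le> 2 * A + 2 * c \<and> Q p (g k) \<le> 2 * A + 4 * c" ..
  then have g: "\<And>k. test_form (g k)" "\<And>k J. J \<in> multi_indices (Suc p) \<Longrightarrow> n2 (\<lambda>z. g k J z - u k J z) \<le> 1 / real (Suc k)"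
    "\<And>k. NN (Suc p) (g k) \<le> 2 * A + 2 * c" "\<And>k. Q p (g k) \<le> 2 * A + 4 * c" by blast+
  have gL: "g k J \<in> L2 \<phi>" for k J by (rule L2_test[OF test_form_J[OF g(1)]])
  have "\<exists>r::nat \<Rightarrow> nat. strict_mono r \<and> (\<forall>E>0. \<exists>N. \<forall>k\<ge>N. \<forall>l\<ge>N. NN (Suc p) (fdiff (g (r k)) (g (r l))) \<le> E)"
  proof (rule diagonal_cauchy)
    fix s :: "nat \<Rightarrow> nat" and E :: real assume s: "strict_mono s" and E: "E > 0"
    have E': "E / (c + 1) > 0" using E c0 by simp
    have "\<exists>r::nat \<Rightarrow> nat. strict_mono r \<and> (\<forall>k l. \<forall>J\<in>multi_indices (Suc p). n2 (\<lambda>z. g (s (r k)) J z - g (s (r l)) J z) \<le> E / (c + 1))"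
    proof (rule compact_test[where C="2 * A + 4 * c", OF _ _ _ E'])
      show "test_form (g (s k))" for k by (rule g(1))
      show "(\<Sum>J\<in>multi_indices (Suc p). n2 (g (s k) J)) \<le> 2 * A + 4 * c" for k using g(3)[of "s k"] c0 by (simp add: NN_def)
      show "Q p (g (s k)) \<le> 2 * A + 4 * c" for k by (rule g(4))
    qed
    then obtain r :: "nat \<Rightarrow> nat" where r: "strict_mono r" "\<And>k l J. J \<in> multi_indices (Suc p) \<Longrightarrow> n2 (\<lambda>z. g (s (r k)) J z - g (s (r l)) J z) \<le> E / (c + 1)" by blast
    have "NN (Suc p) (fdiff (g (s (r k))) (g (s (r l)))) \<le> E" for k l
    proof -
      have "NN (Suc p) (fdiff (g (s (r k))) (g (s (r l)))) \<le> (\<Sum>J\<in>(multi_indices (Suc p) :: 'n set set). E / (c + 1))"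
        unfolding NN_def by (intro sum_mono r(2))
      also have "\<dots> = real (card (multi_indices (Suc p) :: 'n set set)) * (E / (c + 1))" by simp
      also have "\<dots> \<le> (c + 1) * (E / (c + 1))"
      proof (rule mult_right_mono)
        have "real (card (multi_indices (Suc p) :: 'n set set)) \<le> c" unfolding c_def of_nat_le_iff by (intro card_mono) auto
        then show "real (card (multi_indices (Suc p) :: 'n set set)) \<le> c + 1" by simp
      qed (use E' in simp)
      also have "\<dots> = E" using c0 by simp
      finally show ?thesis .
    qed
    with r(1) show "\<exists>r::nat \<Rightarrow> nat. strict_mono r \<and> (\<forall>k l. NN (Suc p) (fdiff (g (s (r k))) (g (s (r l)))) \<le> E)" by blast
  qed
  then obtain r :: "nat \<Rightarrow> nat" where r: "strict_mono r" "\<And>E. E > 0 \<Longrightarrow> \<exists>N. \<forall>k\<ge>N. \<forall>l\<ge>N. NN (Suc p) (fdiff (g (r k)) (g (r l))) \<le> E" by blast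
  have gu: "NN (Suc p) (fdiff (g k) (u k)) \<le> c * (1 / real (Suc k))" for k
  proof -
    have "NN (Suc p) (fdiff (g k) (u k)) \<le> (\<Sum>J\<in>(multi_indices (Suc p) :: 'n set set). 1 / real (Suc k))"
      unfolding NN_def by (intro sum_mono g(2))
    also have "\<dots> = real (card (multi_indices (Suc p) :: 'n set set)) * (1 / real (Suc k))" by simp
    also have "\<dots> \<le> c * (1 / real (Suc k))"
    proof (rule mult_right_mono)
      show "real (card (multi_indices (Suc p) :: 'n set set)) \<le> c" unfolding c_def of_nat_le_iff by (intro card_mono) auto
    qed simp
    finally show ?thesis .
  qed
  have gF: "g k \<in> L2_forms \<phi> (Suc p)" for k using gL by (simp add: L2_forms_def)
  have cau: "\<exists>M. \<forall>m\<ge>M. \<forall>n\<ge>M. NN (Suc p) (fdiff (u (r m)) (u (r n))) < e" if e: "e > 0" for e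
  proof -
    obtain N1 where N1: "\<And>k l. k \<ge> N1 \<Longrightarrow> l \<ge> N1 \<Longrightarrow> NN (Suc p) (fdiff (g (r k)) (g (r l))) \<le> e / 16" using r(2)[of "e/16"] e by auto
    obtain N2 where N2: "1 / real (Suc N2) < e / (16 * (c + 1))" using nat_approx_posE[of "e / (16 * (c + 1))"] e c0 by auto
    have small: "NN (Suc p) (fdiff (g (r k)) (u (r k))) \<le> e / 16" if "k \<ge> N2" for k
    proof -
      have "N2 \<le> r k" using that seq_suble[OF r(1), of k] by simp
      then have "1 / real (Suc (r k)) \<le> 1 / real (Suc N2)" by (intro frac_le) auto
      then have "1 / real (Suc (r k)) \<le> e / (16 * (c + 1))" using N2 by linarith
      then have "c * (1 / real (Suc (r k))) \<le> (c + 1) * (e / (16 * (c + 1)))" using c0 by (intro mult_mono) auto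
      also have "\<dots> = e / 16"
      proof -
        have "d * (e / (16 * d)) = e / 16" if "d \<noteq> 0" for d :: real using that by simp
        from this[of "c + 1"] show ?thesis using c0 by simp
      qed
      finally show ?thesis using gu[of "r k"] by linarith
    qed
    have "NN (Suc p) (fdiff (u (r m)) (u (r n))) < e" if "m \<ge> max N1 N2" "n \<ge> max N1 N2" for m n
    proof -
      have 1: "NN (Suc p) (fdiff (u (r m)) (g (r m))) \<le> e / 16" "NN (Suc p) (fdiff (g (r n)) (u (r n))) \<le> e / 16"
        using small[of m] small[of n] that NN_diff_commute[of "Suc p" "u (r m)" "g (r m)"] by simp_all
      have 2: "NN (Suc p) (fdiff (g (r m)) (g (r n))) \<le> e / 16" using N1 that by simp
      have L: "fdiff (u (r m)) (g (r m)) \<in> L2_forms \<phi> (Suc p)" "fdiff (g (r m)) (g (r n)) \<in> L2_forms \<phi> (Suc p)" "fdiff (g (r n)) (u (r n)) \<in> L2_forms \<phi> (Suc p)"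
        by (intro L2_forms_diff uL gF)+
      have L': "(\<lambda>J z. (g (r m) J z - g (r n) J z) + (g (r n) J z - u (r n) J z)) \<in> L2_forms \<phi> (Suc p)"
        using L2_forms_diff[OF gF[of "r m"] uL[of "r n"]] by simp
      have "NN (Suc p) (fdiff (u (r m)) (u (r n))) \<le> 2 * NN (Suc p) (fdiff (u (r m)) (g (r m))) + 2 * NN (Suc p) (fdiff (g (r m)) (u (r n)))"
        using NN_add_le[OF L(1) L'] by simp
      moreover have "NN (Suc p) (fdiff (g (r m)) (u (r n))) \<le> 2 * NN (Suc p) (fdiff (g (r m)) (g (r n))) + 2 * NN (Suc p) (fdiff (g (r n)) (u (r n)))"
        using NN_add_le[OF L(2,3)] by simp
      moreover have "x \<le> 2 * a + 2 * y \<Longrightarrow> y \<le> 2 * b + 2 * d \<Longrightarrow> a \<le> t \<Longrightarrow> b \<le> t \<Longrightarrow> d \<le> t \<Longrightarrow> x \<le> 10 * t" for x y a b d t :: real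
        by linarith
      ultimately have "NN (Suc p) (fdiff (u (r m)) (u (r n))) \<le> 10 * (e / 16)" using 1 2 by blast
      also have "\<dots> < e" using e by simp
      finally show ?thesis .
    qed
    then show ?thesis by blast
  qed
  have "\<exists>l. fconv (Suc p) (\<lambda>k. u (r k)) l" by (rule forms_complete[OF uL cau])
  with r(1) show ?thesis by blast
qed

section \<open>Existence and compactness of the Neumann operator\<close>

text \<open>The form domain, as the set of triples of a form, its \<open>\<partial>\<close>-bar and its \<open>\<partial>\<close>-bar*. Keeping the images as
components avoids choosing representatives of classes modulo equality almost everywhere.\<close>
definition graph :: "('n form \<times> 'n form \<times> 'n form) set" where
  "graph = {(u, v, w). has_dbar \<phi> (Suc p) u v \<and> has_dbar_adjoint \<phi> p u w}"

definition tcomb :: "complex \<Rightarrow> ('n form \<times> 'n form \<times> 'n form) \<Rightarrow> complex \<Rightarrow> ('n form \<times> 'n form \<times> 'n form) \<Rightarrow> ('n form \<times> 'n form \<times> 'n form)" where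
  "tcomb a s b t = (fcomb a (fst s) b (fst t), fcomb a (fst (snd s)) b (fst (snd t)), fcomb a (snd (snd s)) b (snd (snd t)))"

text \<open>The Dirichlet form \<open>Q\<^sub>\<phi>\<close>.\<close>
definition dir :: "('n form \<times> 'n form \<times> 'n form) \<Rightarrow> ('n form \<times> 'n form \<times> 'n form) \<Rightarrow> complex" where
  "dir s t = inner_forms \<phi> (Suc (Suc p)) (fst (snd s)) (fst (snd t)) + inner_forms \<phi> p (snd (snd s)) (snd (snd t))"

lemma graph_L2:
  assumes "s \<in> graph"
  shows "fst s \<in> L2_forms \<phi> (Suc p)" "fst (snd s) \<in> L2_forms \<phi> (Suc (Suc p))" "snd (snd s) \<in> L2_forms \<phi> p"
  using assms has_dbar_L2 has_adj_L2 by (auto simp: graph_def)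

lemma graph_comb: "s \<in> graph \<Longrightarrow> t \<in> graph \<Longrightarrow> tcomb a s b t \<in> graph"
  by (auto simp: graph_def tcomb_def has_dbar_comb has_adj_comb)

lemma dir_comb_left: "s \<in> graph \<Longrightarrow> t \<in> graph \<Longrightarrow> r \<in> graph \<Longrightarrow> dir (tcomb a s b t) r = a * dir s r + b * dir t r"
  by (simp add: dir_def tcomb_def inner_forms_comb_left graph_L2 algebra_simps)
lemma dir_commute: "dir t s = cnj (dir s t)" by (simp add: dir_def inner_forms_commute[of _ "fst (snd t)"] inner_forms_commute[of _ "snd (snd t)"])
lemma dir_self: "dir s s = of_real (NN (Suc (Suc p)) (fst (snd s)) + NN p (snd (snd s)))" by (simp add: dir_def inner_forms_self)

lemma graph_semi_inner: "semi_inner graph (\<lambda>a s b t. tcomb (of_real a) s (of_real b) t) (\<lambda>s t. Re (dir s t))"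
proof
  show "Re (dir s t) = Re (dir t s)" for s t by (subst dir_commute) simp
qed (auto simp: graph_comb dir_comb_left dir_self NN_nonneg)

definition weak_solution :: "'n form \<Rightarrow> ('n form \<times> 'n form \<times> 'n form) \<Rightarrow> bool" where
  "weak_solution f s \<longleftrightarrow> s \<in> graph \<and> (\<forall>t\<in>graph. dir s t = inner_forms \<phi> (Suc p) f (fst t))"

text \<open>By coercivity the right-hand side is a bounded functional for the Dirichlet form, and a Cauchy sequence
for the Dirichlet form converges in all three components, as both operators are closed.\<close>
lemma weak_solution_exists:
  assumes f: "f \<in> L2_forms \<phi> (Suc p)" shows "\<exists>s. weak_solution f s"
proof -
  obtain C where C: "C \<ge> 0" "\<And>u v w. has_dbar \<phi> (Suc p) u v \<Longrightarrow> has_dbar_adjoint \<phi> p u w \<Longrightarrow> NN (Suc p) u \<le> C * (NN (Suc (Suc p)) v + NN p w)"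
    using coercive by blast
  have Cg: "NN (Suc p) (fst s) \<le> C * Re (dir s s)" if "s \<in> graph" for s
    using that C(2) by (auto simp: graph_def dir_self)
  interpret semi_inner graph "\<lambda>a s b t. tcomb (of_real a) s (of_real b) t" "\<lambda>s t. Re (dir s t)" by (rule graph_semi_inner)
  have td: "tcomb 1 s (-1) t = (fdiff (fst s) (fst t), fdiff (fst (snd s)) (fst (snd t)), fdiff (snd (snd s)) (snd (snd t)))" for s t
    by (simp add: tcomb_def fcomb_diff)
  have "\<exists>s\<in>graph. \<forall>t\<in>graph. Re (dir s t) = Re (inner_forms \<phi> (Suc p) f (fst t))"
  proof (rule riesz[where C="NN (Suc p) f * C"])
    have "has_dbar \<phi> (Suc p) (\<lambda>J z. 0) (\<lambda>J z. 0)" by (simp add: has_dbar_def L2_forms_0)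
    moreover have "has_dbar_adjoint \<phi> p (\<lambda>J z. 0) (\<lambda>J z. 0)" by (simp add: has_dbar_adjoint_def L2_forms_0 inner_forms_0)
    ultimately show "graph \<noteq> {}" by (auto simp: graph_def)
    show "(Re (inner_forms \<phi> (Suc p) f (fst s)))\<^sup>2 \<le> NN (Suc p) f * C * Re (dir s s)" if s: "s \<in> graph" for s
      using Re_inner_forms_le[OF f graph_L2(1)[OF s]] mult_left_mono[OF Cg[OF s] NN_nonneg[of "Suc p" f]] by (simp add: mult.assoc)
    show "Re (inner_forms \<phi> (Suc p) f (fst (tcomb (of_real a) s (of_real b) t))) = a * Re (inner_forms \<phi> (Suc p) f (fst s)) + b * Re (inner_forms \<phi> (Suc p) f (fst t))"
      if "s \<in> graph" "t \<in> graph" for a s b t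
      using that by (simp add: tcomb_def inner_forms_comb_right graph_L2 f)
    show "0 \<le> NN (Suc p) f * C" using C(1) NN_nonneg by simp
    fix x :: "nat \<Rightarrow> 'n form \<times> 'n form \<times> 'n form" assume x: "\<And>n. x n \<in> graph"
      and Ca: "\<And>e. e > 0 \<Longrightarrow> \<exists>M. \<forall>m\<ge>M. \<forall>n\<ge>M. Re (dir (tcomb (of_real 1) (x m) (of_real (-1)) (x n)) (tcomb (of_real 1) (x m) (of_real (-1)) (x n))) < e"
    define q where "q m n = tcomb 1 (x m) (-1) (x n)" for m n
    have qg: "q m n \<in> graph" for m n unfolding q_def by (intro graph_comb x)
    have Ca': "\<exists>M. \<forall>m\<ge>M. \<forall>n\<ge>M. Re (dir (q m n) (q m n)) < e" if "e > 0" for e using Ca[OF that] by (simp add: q_def)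
    have dq: "Re (dir (q m n) (q m n)) = NN (Suc (Suc p)) (fdiff (fst (snd (x m))) (fst (snd (x n)))) + NN p (fdiff (snd (snd (x m))) (snd (snd (x n))))" for m n
      by (simp add: dir_self) (simp add: q_def td)
    have "\<exists>l. fconv (Suc (Suc p)) (\<lambda>n. fst (snd (x n))) l"
    proof (rule forms_complete[OF graph_L2(2)[OF x]])
      fix e :: real assume "e > 0"
      then obtain M where M: "\<forall>m\<ge>M. \<forall>n\<ge>M. Re (dir (q m n) (q m n)) < e" using Ca' by blast
      have "NN (Suc (Suc p)) (fdiff (fst (snd (x m))) (fst (snd (x n)))) < e" if "m \<ge> M" "n \<ge> M" for m n
      proof -
        have "Re (dir (q m n) (q m n)) < e" using M that by blast
        with NN_nonneg[of p "fdiff (snd (snd (x m))) (snd (snd (x n)))"] show ?thesis unfolding dq by linarith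
      qed
      then show "\<exists>M. \<forall>m\<ge>M. \<forall>n\<ge>M. NN (Suc (Suc p)) (fdiff (fst (snd (x m))) (fst (snd (x n)))) < e" by blast
    qed
    then obtain v where v: "fconv (Suc (Suc p)) (\<lambda>n. fst (snd (x n))) v" by blast
    have "\<exists>l. fconv p (\<lambda>n. snd (snd (x n))) l"
    proof (rule forms_complete[OF graph_L2(3)[OF x]])
      fix e :: real assume "e > 0"
      then obtain M where M: "\<forall>m\<ge>M. \<forall>n\<ge>M. Re (dir (q m n) (q m n)) < e" using Ca' by blast
      have "NN p (fdiff (snd (snd (x m))) (snd (snd (x n)))) < e" if "m \<ge> M" "n \<ge> M" for m n
      proof -
        have "Re (dir (q m n) (q m n)) < e" using M that by blast
        with NN_nonneg[of "Suc (Suc p)" "fdiff (fst (snd (x m))) (fst (snd (x n)))"] show ?thesis unfolding dq by linarith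
      qed
      then show "\<exists>M. \<forall>m\<ge>M. \<forall>n\<ge>M. NN p (fdiff (snd (snd (x m))) (snd (snd (x n)))) < e" by blast
    qed
    then obtain w where w: "fconv p (\<lambda>n. snd (snd (x n))) w" by blast
    have "\<exists>l. fconv (Suc p) (\<lambda>n. fst (x n)) l"
    proof (rule forms_complete[OF graph_L2(1)[OF x]])
      fix e :: real assume e: "e > 0"
      have "e / (C + 1) > 0" using e C(1) by simp
      then obtain M where M0: "\<forall>m\<ge>M. \<forall>n\<ge>M. Re (dir (q m n) (q m n)) < e / (C + 1)" using Ca' by blast
      have M: "Re (dir (q m n) (q m n)) < e / (C + 1)" if "m \<ge> M" "n \<ge> M" for m n using M0 that by blast
      have "NN (Suc p) (fdiff (fst (x m)) (fst (x n))) < e" if "m \<ge> M" "n \<ge> M" for m n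
      proof -
        have "NN (Suc p) (fdiff (fst (x m)) (fst (x n))) = NN (Suc p) (fst (q m n))" by (simp add: q_def td)
        also have "\<dots> \<le> C * Re (dir (q m n) (q m n))" by (rule Cg[OF qg])
        also have "\<dots> \<le> (C + 1) * Re (dir (q m n) (q m n))" by (intro mult_right_mono pos qg) simp
        also have "\<dots> < (C + 1) * (e / (C + 1))" using M[OF that] C(1) by (intro mult_strict_left_mono) auto
        also have "\<dots> = e" using C(1) by simp
        finally show ?thesis .
      qed
      then show "\<exists>M. \<forall>m\<ge>M. \<forall>n\<ge>M. NN (Suc p) (fdiff (fst (x m)) (fst (x n))) < e" by blast
    qed
    then obtain u where u: "fconv (Suc p) (\<lambda>n. fst (x n)) u" by blast
    have x': "has_dbar \<phi> (Suc p) (fst (x n)) (fst (snd (x n)))" "has_dbar_adjoint \<phi> p (fst (x n)) (snd (snd (x n)))" for n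
      using x[of n] by (auto simp: graph_def)
    have "has_dbar \<phi> (Suc p) u v" by (rule has_dbar_closed[OF x'(1) u v])
    moreover have "has_dbar_adjoint \<phi> p u w" by (rule has_adj_closed[OF x'(2) u w])
    ultimately have l: "(u, v, w) \<in> graph" by (simp add: graph_def)
    have "(\<lambda>n. NN (Suc (Suc p)) (fdiff (fst (snd (x n))) v) + NN p (fdiff (snd (snd (x n))) w)) \<longlonglongrightarrow> 0"
      by (intro tendsto_add_zero fconvI_eq v w)
    then have "(\<lambda>n. Re (dir (tcomb (of_real 1) (x n) (of_real (-1)) (u, v, w)) (tcomb (of_real 1) (x n) (of_real (-1)) (u, v, w)))) \<longlonglongrightarrow> 0"
      by (simp add: dir_self td)
    with l show "\<exists>l\<in>graph. (\<lambda>n. Re (dir (tcomb (of_real 1) (x n) (of_real (-1)) l) (tcomb (of_real 1) (x n) (of_real (-1)) l))) \<longlonglongrightarrow> 0" by blast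
  qed
  then obtain s where s: "s \<in> graph" "\<And>t. t \<in> graph \<Longrightarrow> Re (dir s t) = Re (inner_forms \<phi> (Suc p) f (fst t))" by blast
  have "dir s t = inner_forms \<phi> (Suc p) f (fst t)" if t: "t \<in> graph" for t
  proof -
    \<comment> \<open>replacing \<open>t\<close> by \<open>\<i> t\<close> recovers the imaginary part\<close>
    have "Re (dir s (tcomb \<i> t 0 t)) = Re (inner_forms \<phi> (Suc p) f (fst (tcomb \<i> t 0 t)))" by (rule s(2)[OF graph_comb[OF t t]])
    moreover have "dir s (tcomb \<i> t 0 t) = - \<i> * dir s t"
    proof -
      have "dir s (tcomb \<i> t 0 t) = cnj (dir (tcomb \<i> t 0 t) s)" by (rule dir_commute)
      also have "\<dots> = - \<i> * cnj (dir t s)" by (simp add: dir_comb_left t s(1))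
      finally show ?thesis by (simp add: dir_commute[of s t])
    qed
    moreover have "inner_forms \<phi> (Suc p) f (fst (tcomb \<i> t 0 t)) = - \<i> * inner_forms \<phi> (Suc p) f (fst t)"
      by (simp add: tcomb_def inner_forms_comb_right graph_L2 t f)
    ultimately have "Im (dir s t) = Im (inner_forms \<phi> (Suc p) f (fst t))" by simp
    then show ?thesis using s(2)[OF t] by (simp add: complex_eq_iff)
  qed
  then have "weak_solution f s" using s(1) by (simp add: weak_solution_def)
  then show ?thesis ..
qed

text \<open>Let \<open>f1\<close> be the projection of \<open>f\<close> to the kernel of \<open>\<partial>\<close>-bar. Then \<open>\<partial>-bar \<partial>-bar* u = f1\<close> and
\<open>\<partial>-bar* \<partial>-bar u = f - f1\<close>. To see the first equation, test with the projection \<open>x1\<close> of an arbitrary \<open>x\<close>: this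
has the same \<open>\<partial>\<close>-bar* as \<open>x\<close>, and \<open>\<partial>\<close>-bar \<open>x1\<close> vanishes. For the second, test with \<open>x - x1\<close>, which has the
same \<open>\<partial>\<close>-bar as \<open>x\<close> and is annihilated by \<open>\<partial>\<close>-bar*.\<close>
lemma weak_solution_has_box:
  assumes f: "f \<in> L2_forms \<phi> (Suc p)" and s: "weak_solution f s" shows "has_box \<phi> (Suc p) (fst s) f"
proof -
  obtain u v w where suvw: "s = (u, v, w)" by (cases s)
  have g: "has_dbar \<phi> (Suc p) u v" "has_dbar_adjoint \<phi> p u w" using s by (auto simp: weak_solution_def graph_def suvw)
  have eq: "inner_forms \<phi> (Suc (Suc p)) v y + inner_forms \<phi> p w t = inner_forms \<phi> (Suc p) f x"
    if "has_dbar \<phi> (Suc p) x y" "has_dbar_adjoint \<phi> p x t" for x y t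
  proof -
    have "(x, y, t) \<in> graph" using that by (simp add: graph_def)
    then have "dir s (x, y, t) = inner_forms \<phi> (Suc p) f (fst (x, y, t))" using s unfolding weak_solution_def by blast
    then show ?thesis by (simp add: dir_def suvw)
  qed
  obtain f1 where f1: "has_dbar \<phi> (Suc p) f1 (\<lambda>J z. 0)" and o: "\<And>y. has_dbar \<phi> (Suc p) y (\<lambda>J z. 0) \<Longrightarrow> inner_forms \<phi> (Suc p) y f1 = inner_forms \<phi> (Suc p) y f"
    using kernel_projection[OF f] by blast
  have f1L: "f1 \<in> L2_forms \<phi> (Suc p)" by (rule has_dbar_L2(1)[OF f1])
  have vL: "v \<in> L2_forms \<phi> (Suc (Suc p))" and wL: "w \<in> L2_forms \<phi> p" using has_dbar_L2[OF g(1)] has_adj_L2[OF g(2)] by auto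
  have "has_dbar \<phi> p w f1" unfolding has_dbar_iff
  proof (intro conjI ballI allI impI wL f1L)
    fix K :: "'n set" and \<eta> :: "(complex,'n) vec \<Rightarrow> complex" assume K: "K \<in> multi_indices (Suc p)" and t: "test_function \<eta>"
    define x where "x = dual_test_form K \<eta>"
    define t' where "t' = dual_test_adjoint K \<eta>"
    have ad: "has_dbar_adjoint \<phi> p x t'" unfolding x_def t'_def by (rule has_adj_dual_test_form[OF K t])
    have xL: "x \<in> L2_forms \<phi> (Suc p)" by (rule has_adj_L2(1)[OF ad])
    obtain x1 where x1: "has_dbar \<phi> (Suc p) x1 (\<lambda>J z. 0)" and ox: "\<And>y. has_dbar \<phi> (Suc p) y (\<lambda>J z. 0) \<Longrightarrow> inner_forms \<phi> (Suc p) y x1 = inner_forms \<phi> (Suc p) y x"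
      using kernel_projection[OF xL] by blast
    have "has_dbar_adjoint \<phi> p (fdiff x x1) (\<lambda>J z. 0)" by (rule kernel_complement[OF xL x1 ox])
    from has_adj_comb[OF ad this, of 1 "-1"] have "has_dbar_adjoint \<phi> p x1 t'" by (simp add: fcomb_def)
    from eq[OF x1 this] have "inner_forms \<phi> p w t' = inner_forms \<phi> (Suc p) f x1" by (simp add: inner_forms_0)
    also have "\<dots> = inner_forms \<phi> (Suc p) f1 x1" using o[OF x1] by (subst (1 2) inner_forms_commute) simp
    also have "\<dots> = inner_forms \<phi> (Suc p) f1 x" by (rule ox[OF f1])
    finally show "inner_forms \<phi> (Suc p) f1 (dual_test_form K \<eta>) = inner_forms \<phi> p w (dual_test_adjoint K \<eta>)" by (simp add: x_def t'_def)
  qed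
  moreover have "has_dbar_adjoint \<phi> (Suc p) v (fdiff f f1)" unfolding has_dbar_adjoint_def
  proof (intro conjI allI impI)
    show "v \<in> L2_forms \<phi> (Suc p + 1)" "fdiff f f1 \<in> L2_forms \<phi> (Suc p)" using vL L2_forms_diff[OF f f1L] by simp_all
    fix x y assume xy: "has_dbar \<phi> (Suc p) x y"
    have xL: "x \<in> L2_forms \<phi> (Suc p)" by (rule has_dbar_L2(1)[OF xy])
    obtain x1 where x1: "has_dbar \<phi> (Suc p) x1 (\<lambda>J z. 0)" and ox: "\<And>y. has_dbar \<phi> (Suc p) y (\<lambda>J z. 0) \<Longrightarrow> inner_forms \<phi> (Suc p) y x1 = inner_forms \<phi> (Suc p) y x"
      using kernel_projection[OF xL] by blast
    have x1L: "x1 \<in> L2_forms \<phi> (Suc p)" by (rule has_dbar_L2(1)[OF x1])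
    have ad: "has_dbar_adjoint \<phi> p (fdiff x x1) (\<lambda>J z. 0)" by (rule kernel_complement[OF xL x1 ox])
    have "has_dbar \<phi> (Suc p) (fdiff x x1) y" using has_dbar_comb[OF xy x1, of 1 "-1"] by (simp add: fcomb_def)
    from eq[OF this ad] have "inner_forms \<phi> (Suc (Suc p)) v y = inner_forms \<phi> (Suc p) f (fdiff x x1)" by (simp add: inner_forms_0)
    then have "inner_forms \<phi> (Suc (Suc p)) y v = inner_forms \<phi> (Suc p) (fdiff x x1) f" by (subst (1 2) inner_forms_commute) simp
    also have "\<dots> = inner_forms \<phi> (Suc p) x f - inner_forms \<phi> (Suc p) x1 f" by (rule inner_forms_diff_left[OF xL x1L f])
    also have "inner_forms \<phi> (Suc p) x1 f = inner_forms \<phi> (Suc p) x f1"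
    proof -
      have "inner_forms \<phi> (Suc p) x1 f = inner_forms \<phi> (Suc p) x1 f1" by (rule o[OF x1, symmetric])
      also have "\<dots> = inner_forms \<phi> (Suc p) x f1" using ox[OF f1] by (subst (1 2) inner_forms_commute) simp
      finally show ?thesis .
    qed
    also have "inner_forms \<phi> (Suc p) x f - inner_forms \<phi> (Suc p) x f1 = inner_forms \<phi> (Suc p) x (fdiff f f1)"
      by (rule inner_forms_diff_right[OF f f1L xL, symmetric])
    finally show "inner_forms \<phi> (Suc p + 1) y v = inner_forms \<phi> (Suc p) x (fdiff f f1)" by simp
  qed
  moreover have "forms_eq (Suc p) f (\<lambda>J z. f1 J z + fdiff f f1 J z)" by (simp add: forms_eq_def)
  ultimately show ?thesis unfolding has_box_def suvw fst_conv diff_Suc_1 using g f by blast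
qed

lemma weak_solution_bound:
  assumes f: "f \<in> L2_forms \<phi> (Suc p)" and s: "weak_solution f s"
    and C: "C \<ge> 0" "\<And>u v w. has_dbar \<phi> (Suc p) u v \<Longrightarrow> has_dbar_adjoint \<phi> p u w \<Longrightarrow> NN (Suc p) u \<le> C * (NN (Suc (Suc p)) v + NN p w)"
  shows "NN (Suc p) (fst s) \<le> C\<^sup>2 * NN (Suc p) f"
proof -
  have sg: "s \<in> graph" using s by (simp add: weak_solution_def)
  define U where "U = NN (Suc p) (fst s)"
  define F where "F = NN (Suc p) f"
  have nn: "U \<ge> 0" "F \<ge> 0" by (simp_all add: U_def F_def NN_nonneg)
  have "dir s s = inner_forms \<phi> (Suc p) f (fst s)" using s sg by (simp add: weak_solution_def)
  then have e: "Re (dir s s) = Re (inner_forms \<phi> (Suc p) f (fst s))" by simp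
  have "U \<le> C * Re (dir s s)" using sg C(2) by (auto simp: graph_def dir_self U_def)
  then have "U \<le> C * Re (inner_forms \<phi> (Suc p) f (fst s))" by (simp only: e)
  then have "U\<^sup>2 \<le> (C * Re (inner_forms \<phi> (Suc p) f (fst s)))\<^sup>2" using nn by (intro power_mono)
  also have "\<dots> \<le> C\<^sup>2 * (F * U)"
    unfolding power_mult_distrib U_def F_def by (intro mult_left_mono Re_inner_forms_le f graph_L2(1)[OF sg]) simp
  finally have "U * U \<le> (C\<^sup>2 * F) * U" by (simp add: power2_eq_square mult.assoc)
  then have "U \<le> C\<^sup>2 * F" using nn by (cases "U = 0") (auto simp: mult_le_cancel_right)
  then show ?thesis by (simp add: U_def F_def)
qed

text \<open>Uniqueness makes the choice of weak solutions linear up to equality almost everywhere.\<close>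
lemma weak_solution_unique:
  assumes s: "s \<in> graph" and 0: "\<And>t. t \<in> graph \<Longrightarrow> dir s t = 0" and J: "J \<in> multi_indices (Suc p)"
  shows "AE z in lborel. fst s J z = 0"
proof -
  obtain C where C: "C \<ge> 0" "\<And>u v w. has_dbar \<phi> (Suc p) u v \<Longrightarrow> has_dbar_adjoint \<phi> p u w \<Longrightarrow> NN (Suc p) u \<le> C * (NN (Suc (Suc p)) v + NN p w)"
    using coercive by blast
  have "weak_solution (\<lambda>J z. 0) s" using s 0 by (simp add: weak_solution_def inner_forms_0)
  then have "NN (Suc p) (fst s) \<le> C\<^sup>2 * NN (Suc p) (\<lambda>J z. 0)" by (rule weak_solution_bound[OF L2_forms_0 _ C])
  then have "NN (Suc p) (fst s) \<le> 0" by (simp add: NN_def n2_def)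
  then show ?thesis by (rule NN_0_AE[OF graph_L2(1)[OF s] _ J])
qed

lemma dbar_neumann_exists: "\<exists>N. dbar_neumann_operator \<phi> (Suc p) N"
proof -
  define S where "S f = (SOME s. weak_solution f s)" for f
  have S: "weak_solution f (S f)" if "f \<in> L2_forms \<phi> (Suc p)" for f
    unfolding S_def using weak_solution_exists[OF that] by (rule someI_ex)
  define N where "N f = fst (S f)" for f
  obtain C where C: "C \<ge> 0" "\<And>u v w. has_dbar \<phi> (Suc p) u v \<Longrightarrow> has_dbar_adjoint \<phi> p u w \<Longrightarrow> NN (Suc p) u \<le> C * (NN (Suc (Suc p)) v + NN p w)"
    using coercive by blast
  have Sg: "S f \<in> graph" "\<And>t. t \<in> graph \<Longrightarrow> dir (S f) t = inner_forms \<phi> (Suc p) f (fst t)" if "f \<in> L2_forms \<phi> (Suc p)" for f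
    using S[OF that] by (auto simp: weak_solution_def)
  have comb: "forms_eq (Suc p) (N (fcomb a f b g)) (fcomb a (N f) b (N g))"
    if f: "f \<in> L2_forms \<phi> (Suc p)" and g: "g \<in> L2_forms \<phi> (Suc p)" for a b f g
    unfolding forms_eq_def
  proof
    fix J :: "'n set" assume J: "J \<in> multi_indices (Suc p)"
    have fg: "fcomb a f b g \<in> L2_forms \<phi> (Suc p)" by (rule L2_forms_comb[OF f g])
    define s where "s = tcomb a (S f) b (S g)"
    have sg: "s \<in> graph" unfolding s_def by (intro graph_comb Sg f g)
    define d where "d = tcomb 1 (S (fcomb a f b g)) (-1) s"
    have dg: "d \<in> graph" unfolding d_def by (intro graph_comb Sg fg sg)
    have "dir d t = 0" if t: "t \<in> graph" for t
    proof -
      have "dir s t = inner_forms \<phi> (Suc p) (fcomb a f b g) (fst t)"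
        unfolding s_def by (simp add: dir_comb_left Sg f g t inner_forms_comb_left graph_L2)
      then show ?thesis unfolding d_def by (simp add: dir_comb_left Sg fg sg t)
    qed
    from weak_solution_unique[OF dg this J] have "AE z in lborel. fst d J z = 0" .
    then show "AE z in lborel. N (fcomb a f b g) J z = fcomb a (N f) b (N g) J z"
      by eventually_elim (simp add: d_def s_def tcomb_def fcomb_def N_def algebra_simps add_eq_0_iff)
  qed
  have "bounded_operator \<phi> (Suc p) N" unfolding bounded_operator_def
  proof (intro conjI ballI allI exI[of _ C])
    show "N u \<in> L2_forms \<phi> (Suc p)" if "u \<in> L2_forms \<phi> (Suc p)" for u unfolding N_def by (rule graph_L2(1)[OF Sg(1)[OF that]])
    show "forms_eq (Suc p) (N (\<lambda>J z. u J z + v J z)) (\<lambda>J z. N u J z + N v J z)" if "u \<in> L2_forms \<phi> (Suc p)" "v \<in> L2_forms \<phi> (Suc p)" for u v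
      using comb[OF that, of 1 1] by (simp add: fcomb_def)
    show "forms_eq (Suc p) (N (\<lambda>J z. c * u J z)) (\<lambda>J z. c * N u J z)" if "u \<in> L2_forms \<phi> (Suc p)" for u c
      using comb[OF that that, of c 0] by (simp add: fcomb_def)
    show "norm_forms \<phi> (Suc p) (N u) \<le> C * norm_forms \<phi> (Suc p) u" if u: "u \<in> L2_forms \<phi> (Suc p)" for u
    proof -
      have "sqrt (NN (Suc p) (N u)) \<le> sqrt (C\<^sup>2 * NN (Suc p) u)"
        unfolding N_def by (intro real_sqrt_le_mono weak_solution_bound[OF u S[OF u] C])
      then show ?thesis using C(1) by (simp add: norm_forms_NN real_sqrt_mult)
    qed
  qed
  moreover have "has_box \<phi> (Suc p) (N u) u" if "u \<in> L2_forms \<phi> (Suc p)" for u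
    unfolding N_def by (rule weak_solution_has_box[OF that S[OF that]])
  ultimately show ?thesis unfolding dbar_neumann_operator_def by blast
qed

lemma inner_forms_eq_cong: "forms_eq q f g \<Longrightarrow> g \<in> L2_forms \<phi> q \<Longrightarrow> f \<in> L2_forms \<phi> q \<Longrightarrow> h \<in> L2_forms \<phi> q \<Longrightarrow> inner_forms \<phi> q h f = inner_forms \<phi> q h g"
  unfolding inner_forms_def
proof (intro sum.cong refl)
  fix J :: "'n set" assume a: "forms_eq q f g" "g \<in> L2_forms \<phi> q" "f \<in> L2_forms \<phi> q" "h \<in> L2_forms \<phi> q" "J \<in> multi_indices q"
  then have ae: "AE z in lborel. f J z = g J z" by (simp add: forms_eq_def)
  have L: "f J \<in> L2 \<phi>" "g J \<in> L2 \<phi>" "h J \<in> L2 \<phi>" using a by (auto simp: L2_forms_def)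
  show "inner_L2 \<phi> (h J) (f J) = inner_L2 \<phi> (h J) (g J)"
    unfolding inner_L2_def
    by (rule integral_cong_AE) (use borel_measurable_integrable[OF inner_integrable[OF L(3,1)]] borel_measurable_integrable[OF inner_integrable[OF L(3,2)]] ae in auto)
qed

text \<open>Pairing the equation \<open>f = \<partial>-bar \<partial>-bar* N f + \<partial>-bar* \<partial>-bar N f\<close> with \<open>N f\<close> bounds the Dirichlet form of
\<open>N f\<close> by the norms of \<open>f\<close> and \<open>N f\<close>, after which \<open>compact_embedding\<close> applies.\<close>
lemma dbar_neumann_compact:
  assumes N: "dbar_neumann_operator \<phi> (Suc p) N" shows "compact_operator \<phi> (Suc p) N"
  unfolding compact_operator_def
proof (intro conjI allI impI)
  show bo: "bounded_operator \<phi> (Suc p) N" using N by (simp add: dbar_neumann_operator_def)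
  fix f :: "nat \<Rightarrow> 'n form" assume a: "(\<forall>k. f k \<in> L2_forms \<phi> (Suc p)) \<and> (\<exists>C. \<forall>k. norm_forms \<phi> (Suc p) (f k) \<le> C)"
  then have fL: "\<And>k. f k \<in> L2_forms \<phi> (Suc p)" by blast
  obtain B where B: "\<And>k. norm_forms \<phi> (Suc p) (f k) \<le> B" using a by blast
  obtain D where D: "\<And>u. u \<in> L2_forms \<phi> (Suc p) \<Longrightarrow> norm_forms \<phi> (Suc p) (N u) \<le> D * norm_forms \<phi> (Suc p) u"
    using bo unfolding bounded_operator_def by blast
  \<comment> \<open>a common bound for the norms of \<open>f k\<close> and \<open>N (f k)\<close>\<close>
  define M where "M = max 1 \<bar>D\<bar> * \<bar>B\<bar>"
  have nf: "NN (Suc p) (f k) \<le> M\<^sup>2" and nN: "NN (Suc p) (N (f k)) \<le> M\<^sup>2" for k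
  proof -
    have 1: "0 \<le> sqrt (NN (Suc p) (f k))" "sqrt (NN (Suc p) (f k)) \<le> \<bar>B\<bar>" using B[of k] NN_nonneg by (auto simp: norm_forms_NN)
    have "1 * \<bar>B\<bar> \<le> M" unfolding M_def by (intro mult_right_mono) auto
    with 1 show "NN (Suc p) (f k) \<le> M\<^sup>2" by (intro sqrt_le_D) simp
    have "sqrt (NN (Suc p) (N (f k))) \<le> D * sqrt (NN (Suc p) (f k))" using D[OF fL] by (simp add: norm_forms_NN)
    also have "\<dots> \<le> \<bar>D\<bar> * \<bar>B\<bar>" using 1 by (intro mult_mono) auto
    also have "\<dots> \<le> M" unfolding M_def by (intro mult_right_mono) auto
    finally show "NN (Suc p) (N (f k)) \<le> M\<^sup>2" by (rule sqrt_le_D)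
  qed
  have "\<exists>v w. has_dbar \<phi> (Suc p) (N (f k)) v \<and> has_dbar_adjoint \<phi> p (N (f k)) w \<and> NN (Suc (Suc p)) v + NN p w \<le> M\<^sup>2" for k
  proof -
    have "has_box \<phi> (Suc p) (N (f k)) (f k)" using N fL by (simp add: dbar_neumann_operator_def)
    then obtain a b c d where box: "has_dbar_adjoint \<phi> p (N (f k)) a" "has_dbar \<phi> p a b" "has_dbar \<phi> (Suc p) (N (f k)) c" "has_dbar_adjoint \<phi> (Suc p) c d"
      "forms_eq (Suc p) (f k) (\<lambda>J z. b J z + d J z)" by (auto simp: has_box_def)
    define x where "x = N (f k)"
    have L: "x \<in> L2_forms \<phi> (Suc p)" "b \<in> L2_forms \<phi> (Suc p)" "d \<in> L2_forms \<phi> (Suc p)"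
      using has_dbar_L2[OF box(3)] has_dbar_L2[OF box(2)] has_adj_L2[OF box(4)] by (auto simp: x_def)
    have bd: "(\<lambda>J z. b J z + d J z) = fcomb 1 b 1 d" by (simp add: fcomb_def)
    have "inner_forms \<phi> (Suc p) x (f k) = inner_forms \<phi> (Suc p) x (fcomb 1 b 1 d)"
      using box(5) unfolding bd by (rule inner_forms_eq_cong[OF _ L2_forms_comb[OF L(2,3)] fL L(1)])
    also have "\<dots> = inner_forms \<phi> (Suc p) x b + inner_forms \<phi> (Suc p) x d" by (simp add: inner_forms_comb_right L)
    also have "inner_forms \<phi> (Suc p) x d = inner_forms \<phi> (Suc (Suc p)) c c"
      using box(3,4) by (simp add: has_dbar_adjoint_def x_def)
    also have "inner_forms \<phi> (Suc p) x b = inner_forms \<phi> p a a"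
      using box(1,2) by (subst (1 2) inner_forms_commute) (simp add: has_dbar_adjoint_def x_def)
    finally have e: "Re (inner_forms \<phi> (Suc p) x (f k)) = NN (Suc (Suc p)) c + NN p a" by (simp add: inner_forms_self)
    have "(Re (inner_forms \<phi> (Suc p) x (f k)))\<^sup>2 \<le> NN (Suc p) x * NN (Suc p) (f k)" by (rule Re_inner_forms_le[OF L(1) fL])
    also have "\<dots> \<le> M\<^sup>2 * M\<^sup>2" using nf[of k] nN[of k] by (intro mult_mono) (auto simp: x_def NN_nonneg)
    finally have "(Re (inner_forms \<phi> (Suc p) x (f k)))\<^sup>2 \<le> (M\<^sup>2)\<^sup>2" by (simp add: power2_eq_square)
    then have "Re (inner_forms \<phi> (Suc p) x (f k)) \<le> M\<^sup>2" by (rule power2_le_imp_le) simp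
    with e box(1,3) show ?thesis by auto
  qed
  from choice[OF allI[OF this]] obtain v where "\<forall>k. \<exists>w. has_dbar \<phi> (Suc p) (N (f k)) (v k) \<and> has_dbar_adjoint \<phi> p (N (f k)) w \<and> NN (Suc (Suc p)) (v k) + NN p w \<le> M\<^sup>2" ..
  from choice[OF this] obtain w where "\<forall>k. has_dbar \<phi> (Suc p) (N (f k)) (v k) \<and> has_dbar_adjoint \<phi> p (N (f k)) (w k) \<and> NN (Suc (Suc p)) (v k) + NN p (w k) \<le> M\<^sup>2" ..
  then have vw: "\<And>k. has_dbar \<phi> (Suc p) (N (f k)) (v k)" "\<And>k. has_dbar_adjoint \<phi> p (N (f k)) (w k)" "\<And>k. NN (Suc (Suc p)) (v k) + NN p (w k) \<le> M\<^sup>2"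
    by blast+
  obtain r l where r: "strict_mono (r :: nat \<Rightarrow> nat)" "fconv (Suc p) (\<lambda>k. N (f (r k))) l"
    using compact_embedding[where u="\<lambda>k. N (f k)" and v=v and w=w, OF vw(1,2) nN vw(3)] by blast
  have "(\<lambda>k. sqrt (NN (Suc p) (fdiff (N (f (r k))) l))) \<longlonglongrightarrow> sqrt 0" by (intro tendsto_real_sqrt fconvI_eq r(2))
  then have "(\<lambda>k. norm_forms \<phi> (Suc p) (\<lambda>J z. N (f (r k)) J z - l J z)) \<longlonglongrightarrow> 0" by (simp add: norm_forms_NN)
  moreover have "l \<in> L2_forms \<phi> (Suc p)" using r(2) by (simp add: fconv_def)
  ultimately show "\<exists>r l. strict_mono r \<and> l \<in> L2_forms \<phi> (Suc p) \<and> (\<lambda>k. norm_forms \<phi> (Suc p) (\<lambda>J z. N (f (r k)) J z - l J z)) \<longlonglongrightarrow> 0"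
    using r(1) by blast
qed

end

theorem proposition3p2:
  fixes \<phi> :: "complex ^ 'n::{finite,linorder} \<Rightarrow> real" and q :: nat
  assumes "\<And>z. 0 \<le> \<phi> z"
    and "C_k 2 \<phi>"
    and "plurisubharmonic \<phi>"
    and "1 \<le> q" and "q \<le> CARD('n)"
    and "filterlim (\<lambda>z. sum_smallest_eigenvalues q (levi_matrix \<phi> z)) at_top at_infinity"
  shows "(\<exists>N. dbar_neumann_operator \<phi> q N) \<and>
         (\<forall>N. dbar_neumann_operator \<phi> q N \<longrightarrow> compact_operator \<phi> q N)"
proof -
  obtain p where q: "q = Suc p" using assms(4) by (cases q) auto
  interpret growing_weight \<phi> p
    by unfold_locales (use assms C_k_continuous[OF assms(2)] in \<open>auto simp: q\<close>)
  show ?thesis unfolding q using dbar_neumann_exists dbar_neumann_compact by blast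
qed

end
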